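(* Let $0<q<1$ and $$a=q^{l_1/2+\alpha},\quad b=-q^{l_2/2+\beta},\quad c=-q^{l_2/2},\quad d=q^{l_1/2},$$ where $\alpha,\beta,l_1,l_2$ are positive integers. Define $$J=\big\{q^{l_1/2+k}+q^{-l_1/2-k}:\ 0\le k\le\alpha-1\big\},\qquad K=\big\{-(q^{l_2/2+k}+q^{-l_2/2-k}):\ 0\le k\le\beta-1\big\},$$ and let $X=\{x_{j_1},\dots,x_{j_m}\}$ be a subset of $J\cup K$. Let $\hat L$ be the second-order difference operator obtained by iteration of the Darboux transformation, starting with the associated Askey-Wilson operator $L_0=L_{a,b,c,d}(\gamma,E)$ and adding bound states at the points of $X$, and let $\mathcal Q$ be the corresponding intertwining operator, $\hat L\mathcal Q=\mathcal QL_0$. Then $\hat L$ possesses a two-dimensional space of eigenfunctions which are also eigenfunctions of a $q$-difference operator in the spectral variable $z$. Namely, there exist a $q$-difference operator $\hat B(z,D_z)$ in $z$ and some function $\hat\Lambda_\gamma$ of $\gamma$ such that every $\hat\Psi(\gamma,z)=\mathcal Q\Psi(\gamma,z)$, with $\Psi$ a linear combination of $R_\gamma(a,b,c,d;z)$ and $S_\gamma(a,b,c,d;z)$, satisfies $$\hat L\hat\Psi(\gamma,z)=(z+z^{-1})\hat\Psi(\gamma,z),\qquad\hat B(z,D_z)\hat\Psi(\gamma,z)=\hat\Lambda_\gamma\hat\Psi(\gamma,z).$$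
   Context: Notation: $(x;q)_\infty=\prod_{i\ge0}(1-xq^i)$, $(x;q)_k=(x;q)_\infty/(xq^k;q)_\infty$, $(x_1,\dots,x_r;q)_k=\prod_i(x_i;q)_k$, and $${}_8W_7(\sigma;a_1,\dots,a_5;q,x)=\sum_{k\ge0}\frac{(\sigma,q\sigma^{1/2},-q\sigma^{1/2},a_1,\dots,a_5;q)_k}{(q,\sigma^{1/2},-\sigma^{1/2},q\sigma/a_1,\dots,q\sigma/a_5;q)_k}x^k.$$ $E^{\pm1}h_\gamma=h_{\gamma\pm1}$, $D_z^{\pm1}h(z)=h(q^{\pm1}z)$. The variable $\gamma$ stands for $n+\varepsilon$, $n\in\mathbb Z$, with $\varepsilon$ an arbitrary shift. A $q$-difference operator in $z$ is a finite sum $\sum_{i\in\mathbb Z}D_i(z)D_z^i$, with coefficients depending only on $z$. The (associated) Askey-Wilson operator is $L_{a,b,c,d}(\gamma,E)=A_\gamma E+B_\gamma\,\mathrm{Id}+C_\gamma E^{-1}$ with $$A_\gamma=\frac{(1-abq^\gamma)(1-acq^\gamma)(1-adq^\gamma)(1-abcdq^{\gamma-1})}{a(1-abcdq^{2\gamma-1})(1-abcdq^{2\gamma})},\quad C_\gamma=\frac{a(1-q^\gamma)(1-bcq^{\gamma-1})(1-bdq^{\gamma-1})(1-cdq^{\gamma-1})}{(1-abcdq^{2\gamma-2})(1-abcdq^{2\gamma-1})},$$ $B_\gamma=a+a^{-1}-(A_\gamma+C_\gamma)$. The functions $R_\gamma,S_\gamma$, which satisfy $L_{a,b,c,d}(\gamma,E)\Psi=(z+z^{-1})\Psi$,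 are $$R_\gamma(a,b,c,d;z)=\frac{(az;q)_\infty}{(bcd/z;q)_\infty}r_\gamma(a,b,c,d;z),\quad S_\gamma(a,b,c,d;z)=\frac{z^{-1+\log(abcd)/\log q}(az;q)_\infty}{(zq/a,zq/b,zq/c,zq/d;q)_\infty}s_\gamma(a,b,c,d;z),$$ $$r_\gamma(a,b,c,d;z)=\frac{(abq^\gamma,acq^\gamma,adq^\gamma,bcdq^\gamma/z;q)_\infty}{(bcq^\gamma,bdq^\gamma,cdq^\gamma,azq^\gamma;q)_\infty}\Big(\frac az\Big)^\gamma{}_8W_7\big(bcd/qz;b/z,c/z,d/z,abcdq^{\gamma-1},q^{-\gamma};q,qz/a\big),$$ $$s_\gamma(a,b,c,d;z)=\frac{(abcdq^{2\gamma},bzq^{\gamma+1},czq^{\gamma+1},dzq^{\gamma+1},bcdzq^\gamma;q)_\infty}{(bcq^\gamma,bdq^\gamma,cdq^\gamma,q^{\gamma+1},bcdzq^{2\gamma+1};q)_\infty}(az)^\gamma{}_8W_7\big(bcdzq^{2\gamma};bcq^\gamma,bdq^\gamma,cdq^\gamma,q^{\gamma+1},zq/a;q,az\big).$$ Darboux transformation: given a difference operator $L$ and a nonzero eigenfunction $\psi(\gamma)$ with $L\psi=x\psi$, take a first-order difference operator $Q$ whose kernel is spanned by $\psi$; then $L=x\,\mathrm{Id}+PQ$ for some difference operator $P$, and $x\,\mathrm{Id}+QP$ is a Darboux transformation of $L$ at $x$ ("adding a bound state at $x$"). Iterating at $x_{j_1},\dots,x_{j_m}$: $$L_0=x_{j_1}\mathrm{Id}+P_0Q_0\to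 L_1=x_{j_1}\mathrm{Id}+Q_0P_0=x_{j_2}\mathrm{Id}+P_1Q_1\to\cdots\to\hat L=L_m=x_{j_m}\mathrm{Id}+Q_{m-1}P_{m-1}.$$ With $\mathcal Q=Q_{m-1}\cdots Q_0$ one has $\hat L\mathcal Q=\mathcal QL_0$, and $\ker\mathcal Q$ is spanned by eigenfunctions $\psi_1,\dots,\psi_m$ of $L_0$ with $L_0\psi_k=x_{j_k}\psi_k$. *)

theory Defs
  imports "HOL-Complex_Analysis.Complex_Analysis"
begin

section \<open>Basic hypergeometric notation\<close>

definition qpoch :: "complex list \<Rightarrow> complex \<Rightarrow> nat \<Rightarrow> complex" where
  "qpoch xs q k = (\<Prod>x\<leftarrow>xs. \<Prod>i<k. 1 - x * q ^ i)"

definition qpoch_inf :: "complex list \<Rightarrow> complex \<Rightarrow> complex" where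
  "qpoch_inf xs q = (\<Prod>x\<leftarrow>xs. prodinf (\<lambda>i. 1 - x * q ^ i))"

text \<open>
  The very-well-poised series with parameters \<open>as = [a1, ..., a5]\<close>: denominator parameters
  and coefficient of \<open>x ^ k\<close>. The choice of the square root of \<open>\<sigma>\<close> does not matter, since only
  the two roots together occur.
\<close>

definition W87_den :: "complex \<Rightarrow> complex list \<Rightarrow> complex \<Rightarrow> complex list" where
  "W87_den \<sigma> as q = [q, csqrt \<sigma>, - csqrt \<sigma>] @ map (\<lambda>a. q * \<sigma> / a) as"

definition W87_coeff :: "complex \<Rightarrow> complex list \<Rightarrow> complex \<Rightarrow> nat \<Rightarrow> complex" where
  "W87_coeff \<sigma> as q k =
     qpoch ([\<sigma>, q * csqrt \<sigma>, - q * csqrt \<sigma>] @ as) q k / qpoch (W87_den \<sigma> as q) q k"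

text \<open>
  For \<open>0 < \<bar>q\<bar> < 1\<close> the series \<open>\<Sum>k. W87_coeff \<sigma> as q k * x ^ k\<close> converges for \<open>\<bar>x\<bar> < 1\<close> only, but
  its sum continues analytically in \<open>x\<close> to the plane without the points \<open>q ^ (-j)\<close>, \<open>j \<ge> 0\<close>,
  because the coefficients are, for large \<open>k\<close>, the values at \<open>q ^ k\<close> of a function holomorphic
  near \<open>0\<close>. As the operators \<open>D\<^sub>z\<close> and \<open>D\<^sub>z\<close> inverse move \<open>x\<close> across the unit circle, \<open>W87\<close> denotes
  this continuation, which is unique because the complement of a countable set is connected.
\<close>

definition W87_poles :: "complex \<Rightarrow> complex set" where
  "W87_poles q = {x. \<exists>j::nat. x * q ^ j = 1}"

definition W87 :: "complex \<Rightarrow> complex list \<Rightarrow> complex \<Rightarrow> complex \<Rightarrow> complex" where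
  "W87 \<sigma> as q x =
     (THE w. \<exists>f. f holomorphic_on (- W87_poles q) \<and>
                 (\<forall>y. norm y < 1 \<longrightarrow> (\<lambda>k. W87_coeff \<sigma> as q k * y ^ k) sums f y) \<and>
                 w = f x)"

definition W87_regular :: "complex \<Rightarrow> complex list \<Rightarrow> complex \<Rightarrow> complex \<Rightarrow> bool" where
  "W87_regular \<sigma> as q x \<longleftrightarrow> (\<forall>k. qpoch (W87_den \<sigma> as q) q k \<noteq> 0) \<and> x \<notin> W87_poles q"


section \<open>The associated Askey-Wilson operator and its eigenfunctions\<close>

definition AW_A :: "complex \<Rightarrow> complex \<Rightarrow> complex \<Rightarrow> complex \<Rightarrow> complex \<Rightarrow> complex \<Rightarrow> complex" where
  "AW_A q a b c d \<gamma> =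
     (1 - a*b * q powr \<gamma>) * (1 - a*c * q powr \<gamma>) * (1 - a*d * q powr \<gamma>) *
       (1 - a*b*c*d * q powr (\<gamma> - 1)) /
     (a * (1 - a*b*c*d * q powr (2*\<gamma> - 1)) * (1 - a*b*c*d * q powr (2*\<gamma>)))"

definition AW_C :: "complex \<Rightarrow> complex \<Rightarrow> complex \<Rightarrow> complex \<Rightarrow> complex \<Rightarrow> complex \<Rightarrow> complex" where
  "AW_C q a b c d \<gamma> =
     a * (1 - q powr \<gamma>) * (1 - b*c * q powr (\<gamma> - 1)) * (1 - b*d * q powr (\<gamma> - 1)) *
       (1 - c*d * q powr (\<gamma> - 1)) /
     ((1 - a*b*c*d * q powr (2*\<gamma> - 2)) * (1 - a*b*c*d * q powr (2*\<gamma> - 1)))"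

definition AW_B :: "complex \<Rightarrow> complex \<Rightarrow> complex \<Rightarrow> complex \<Rightarrow> complex \<Rightarrow> complex \<Rightarrow> complex" where
  "AW_B q a b c d \<gamma> = a + 1 / a - (AW_A q a b c d \<gamma> + AW_C q a b c d \<gamma>)"

text \<open>
  The variable \<open>\<gamma>\<close> runs through the lattice of all \<open>n + \<epsilon>\<close> with \<open>n\<close> an integer. A function \<open>h\<close>
  of \<open>\<gamma>\<close> is represented by \<open>\<lambda>n. h (n + \<epsilon>)\<close>, and a difference operator by its action on such
  functions.
\<close>

type_synonym lfun = "int \<Rightarrow> complex"
type_synonym lop = "lfun \<Rightarrow> lfun"

definition AW_op ::
  "complex \<Rightarrow> complex \<Rightarrow> complex \<Rightarrow> complex \<Rightarrow> complex \<Rightarrow> complex \<Rightarrow> lop" where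
  "AW_op q a b c d \<epsilon> h n =
     AW_A q a b c d (of_int n + \<epsilon>) * h (n + 1) +
     AW_B q a b c d (of_int n + \<epsilon>) * h n +
     AW_C q a b c d (of_int n + \<epsilon>) * h (n - 1)"

text \<open>
  All powers below are principal. Multiplying \<open>z\<close> by a positive number does not
  change the branch, so this is compatible with \<open>D\<^sub>z\<close> for \<open>0 < q < 1\<close>; it is also compatible with
  integer shifts of \<open>\<gamma>\<close>.
\<close>

definition r_fun ::
  "complex \<Rightarrow> complex \<Rightarrow> complex \<Rightarrow> complex \<Rightarrow> complex \<Rightarrow> complex \<Rightarrow> complex \<Rightarrow> complex" where
  "r_fun q a b c d \<gamma> z =
     qpoch_inf [a*b * q powr \<gamma>, a*c * q powr \<gamma>, a*d * q powr \<gamma>, b*c*d * q powr \<gamma> / z] q /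
     qpoch_inf [b*c * q powr \<gamma>, b*d * q powr \<gamma>, c*d * q powr \<gamma>, a*z * q powr \<gamma>] q *
     (a / z) powr \<gamma> *
     W87 (b*c*d / (q*z)) [b/z, c/z, d/z, a*b*c*d * q powr (\<gamma> - 1), q powr (- \<gamma>)] q (q*z / a)"

definition s_fun ::
  "complex \<Rightarrow> complex \<Rightarrow> complex \<Rightarrow> complex \<Rightarrow> complex \<Rightarrow> complex \<Rightarrow> complex \<Rightarrow> complex" where
  "s_fun q a b c d \<gamma> z =
     qpoch_inf [a*b*c*d * q powr (2*\<gamma>), b*z * q powr (\<gamma> + 1), c*z * q powr (\<gamma> + 1),
                d*z * q powr (\<gamma> + 1), b*c*d*z * q powr \<gamma>] q /
     qpoch_inf [b*c * q powr \<gamma>, b*d * q powr \<gamma>, c*d * q powr \<gamma>, q powr (\<gamma> + 1),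
                b*c*d*z * q powr (2*\<gamma> + 1)] q *
     (a * z) powr \<gamma> *
     W87 (b*c*d*z * q powr (2*\<gamma>))
         [b*c * q powr \<gamma>, b*d * q powr \<gamma>, c*d * q powr \<gamma>, q powr (\<gamma> + 1), z*q / a] q (a*z)"

definition R_fun ::
  "complex \<Rightarrow> complex \<Rightarrow> complex \<Rightarrow> complex \<Rightarrow> complex \<Rightarrow> complex \<Rightarrow> complex \<Rightarrow> complex" where
  "R_fun q a b c d \<gamma> z =
     qpoch_inf [a*z] q / qpoch_inf [b*c*d / z] q * r_fun q a b c d \<gamma> z"

definition S_fun ::
  "complex \<Rightarrow> complex \<Rightarrow> complex \<Rightarrow> complex \<Rightarrow> complex \<Rightarrow> complex \<Rightarrow> complex \<Rightarrow> complex" where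
  "S_fun q a b c d \<gamma> z =
     z powr (- 1 + ln (a*b*c*d) / ln q) * qpoch_inf [a*z] q /
     qpoch_inf [z*q / a, z*q / b, z*q / c, z*q / d] q * s_fun q a b c d \<gamma> z"

text \<open>
  The points \<open>z\<close> at which none of the denominators in the formulas for \<open>R_fun\<close> and \<open>S_fun\<close>
  vanishes. Elsewhere these formulas have no meaning because of the convention \<open>x / 0 = 0\<close>.
\<close>

definition R_regular ::
  "complex \<Rightarrow> complex \<Rightarrow> complex \<Rightarrow> complex \<Rightarrow> complex \<Rightarrow> complex \<Rightarrow> complex \<Rightarrow> bool" where
  "R_regular q a b c d \<gamma> z \<longleftrightarrow> z \<noteq> 0 \<and>
     qpoch_inf [b*c*d / z] q \<noteq> 0 \<and>
     qpoch_inf [b*c * q powr \<gamma>, b*d * q powr \<gamma>, c*d * q powr \<gamma>, a*z * q powr \<gamma>] q \<noteq> 0 \<and>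
     W87_regular (b*c*d / (q*z))
       [b/z, c/z, d/z, a*b*c*d * q powr (\<gamma> - 1), q powr (- \<gamma>)] q (q*z / a)"

definition S_regular ::
  "complex \<Rightarrow> complex \<Rightarrow> complex \<Rightarrow> complex \<Rightarrow> complex \<Rightarrow> complex \<Rightarrow> complex \<Rightarrow> bool" where
  "S_regular q a b c d \<gamma> z \<longleftrightarrow> z \<noteq> 0 \<and>
     qpoch_inf [z*q / a, z*q / b, z*q / c, z*q / d] q \<noteq> 0 \<and>
     qpoch_inf [b*c * q powr \<gamma>, b*d * q powr \<gamma>, c*d * q powr \<gamma>, q powr (\<gamma> + 1),
                b*c*d*z * q powr (2*\<gamma> + 1)] q \<noteq> 0 \<and>
     W87_regular (b*c*d*z * q powr (2*\<gamma>))
       [b*c * q powr \<gamma>, b*d * q powr \<gamma>, c*d * q powr \<gamma>, q powr (\<gamma> + 1), z*q / a] q (a*z)"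

definition regular_point ::
  "complex \<Rightarrow> complex \<Rightarrow> complex \<Rightarrow> complex \<Rightarrow> complex \<Rightarrow> complex \<Rightarrow> complex \<Rightarrow> bool" where
  "regular_point q a b c d \<epsilon> z \<longleftrightarrow>
     (\<forall>n::int. R_regular q a b c d (of_int n + \<epsilon>) z \<and> S_regular q a b c d (of_int n + \<epsilon>) z)"


section \<open>Darboux transformations of difference operators\<close>

definition difference_operator :: "lop \<Rightarrow> bool" where
  "difference_operator T \<longleftrightarrow>
     (\<exists>(I :: int set) (u :: int \<Rightarrow> lfun). finite I \<and> (\<forall>h n. T h n = (\<Sum>i\<in>I. u i n * h (n + i))))"

text \<open>No normalisation is imposed: the two adjacent shifts may be any powers of \<open>E\<close>.\<close>

definition first_order_operator :: "lop \<Rightarrow> bool" where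
  "first_order_operator T \<longleftrightarrow>
     (\<exists>(i :: int) (u :: lfun) (v :: lfun). (\<forall>n. u n \<noteq> 0 \<and> v n \<noteq> 0) \<and>
        (\<forall>h n. T h n = u n * h (n + i + 1) + v n * h (n + i)))"

definition darboux_step :: "complex \<Rightarrow> lop \<Rightarrow> lop \<Rightarrow> lop \<Rightarrow> bool" where
  "darboux_step x L Q L' \<longleftrightarrow>
     (\<exists>\<psi> P. (\<exists>n. \<psi> n \<noteq> 0) \<and> (\<forall>n. L \<psi> n = x * \<psi> n) \<and>
        first_order_operator Q \<and> {h. \<forall>n. Q h n = 0} = {h. \<exists>k. \<forall>n. h n = k * \<psi> n} \<and>
        difference_operator P \<and>
        (\<forall>h n. L h n = x * h n + P (Q h) n) \<and>
        (\<forall>h n. L' h n = x * h n + Q (P h) n))"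

text \<open>
  \<open>darboux_chain xs L \<Q> L'\<close>: successive Darboux transformations at the points of \<open>xs\<close>
  lead from \<open>L\<close> to \<open>L'\<close>, and \<open>\<Q>\<close> is the product of the first-order operators, the
  first one rightmost.
\<close>

inductive darboux_chain :: "complex list \<Rightarrow> lop \<Rightarrow> lop \<Rightarrow> lop \<Rightarrow> bool" where
  Nil: "darboux_chain [] L (\<lambda>h. h) L"
| Cons: "darboux_step x L Q L1 \<Longrightarrow> darboux_chain xs L1 \<Q> L2 \<Longrightarrow>
           darboux_chain (x # xs) L (\<lambda>h. \<Q> (Q h)) L2"


section \<open>q-difference operators in the spectral variable\<close>

text \<open>
  A \<open>q\<close>-difference operator is given by its family of coefficients, meromorphic functions
  of \<open>z\<close> of which only finitely many do not vanish identically.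
\<close>

definition qdiff_supp :: "(int \<Rightarrow> complex \<Rightarrow> complex) \<Rightarrow> int set" where
  "qdiff_supp B = {i. \<exists>z. B i z \<noteq> 0}"

definition qdiff_operator :: "(int \<Rightarrow> complex \<Rightarrow> complex) \<Rightarrow> bool" where
  "qdiff_operator B \<longleftrightarrow> finite (qdiff_supp B) \<and> (\<forall>i. B i meromorphic_on UNIV)"

definition qdiff_apply ::
  "complex \<Rightarrow> (int \<Rightarrow> complex \<Rightarrow> complex) \<Rightarrow> (complex \<Rightarrow> complex) \<Rightarrow> complex \<Rightarrow> complex" where
  "qdiff_apply q B f z = (\<Sum>i\<in>qdiff_supp B. B i z * f (q powi i * z))"

end

theory Submission
 imports Defs
begin

text \<open>
 Put \<open>t = q\<close> to the power \<open>\<gamma>\<close>. The functions \<open>R\<close> and \<open>S\<close> satisfy the three-term relation in \<open>t\<close> and a second-order \<open>q\<close>-difference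
 equation in \<open>z\<close> with eigenvalue affine in \<open>t + w / t\<close>, \<open>w = q / (abcd)\<close>; both follow from telescoping certificates on
 the terms of the series for small arguments, and then by analytic continuation in \<open>z\<close>. At the points of \<open>J\<close> and \<open>K\<close> all
 eigenfunctions of \<open>L\<close> are, up to a gauge factor, rational in \<open>t\<close> and symmetric under \<open>t \<mapsto> w / t\<close>.
 This symmetry survives a Darboux step with \<open>w\<close> replaced by \<open>q w\<close>. At each stage every operator coming from a polynomial in
 \<open>t + w / t\<close> divisible by a fixed one is realised by an operator in \<open>z\<close>; composing with the two factors of the Darboux step and
 dividing by \<open>z + 1 / z - x\<close> gives such operators for the next stage, because a solution of a first-order rational recurrence
 in the span of \<open>R\<close> and \<open>S\<close> vanishes for generic \<open>z\<close>, that is, for all but countably many \<open>z\<close>.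
\<close>

text \<open>The obstacle: a Darboux step lives in \<open>n\<close> and its coefficients contain an
  eigenfunction at \<open>x\<close>, while operators in \<open>z\<close> only give multipliers in
  \<open>t + w / t\<close>. Once that eigenfunction is symmetric up to sign and rational up to a
  gauge factor, \<open>P mu Q\<close> with a symmetric \<open>mu\<close> has reflection-invariant
  coefficients; after denominators are cleared it lies in the algebra generated by \<open>L\<close>,
  which is multiplication by \<open>z + 1 / z\<close>, and the multipliers at hand. Operators in
  \<open>z\<close> commute with operators in \<open>n\<close>, so \<open>P Q = L - x\<close> turns a
  realisation of \<open>P mu Q\<close> on the old family into one of \<open>mu\<close> on the new
  family, up to the kernel of \<open>P\<close>. Two rational solutions exist at a point of
  \<open>J\<close> because \<open>a / d\<close> and \<open>a d\<close> are both powers of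
  \<open>q\<close>: exchanging \<open>a\<close> with \<open>d\<close>, and passing to
  \<open>q / a\<close> and \<open>q / d\<close>, are then rational gauge transformations, and each
  of them makes a series terminate there. For \<open>K\<close> the pair \<open>b\<close>,
  \<open>c\<close> takes this role, after a further gauge that is known only through its rational
  ratio.\<close>

lemmas sqr_eq = power2_eq_square

section \<open>Properties that hold off a countable set\<close>

definition generic :: "(complex => bool) => bool" where
 "generic P \<longleftrightarrow> countable {z. ~ P z}"

lemma generic_mono: "generic P ==> (!!z. P z ==> Q z) ==> generic Q"
 unfolding generic_def by (rule countable_subset[rotated]) auto

lemma generic_True: "(!!z. P z) ==> generic P"
 by (simp add: generic_def)

lemma generic_conj: "generic P ==> generic Q ==> generic (%z. P z & Q z)"
proof -
 assume "generic P" "generic Q"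
 then have "countable ({z. ~ P z} \<union> {z. ~ Q z})" by (simp add: generic_def)
 moreover have "{z. ~ (P z & Q z)} = {z. ~ P z} \<union> {z. ~ Q z}" by auto
 ultimately show ?thesis by (simp add: generic_def)
qed

lemma generic_all:
 fixes P :: "'i::countable => complex => bool"
 assumes "!!i. generic (P i)" shows "generic (%z. ALL i. P i z)"
proof -
 have "{z. ~ (ALL i. P i z)} = (\<Union>i. {z. ~ P i z})" by auto
 with assms show ?thesis by (auto simp: generic_def)
qed

lemma generic_scale:
 assumes "c ~= 0" "generic P" shows "generic (%z. P (c * z))"
proof -
 have "{z. ~ P (c * z)} \<subseteq> (%z. z / c) ` {z. ~ P z}"
 using assms(1) by (auto simp: image_iff intro!: exI[of _ "c * _"])
 with assms(2) show ?thesis unfolding generic_def by (meson countable_image countable_subset)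
qed

text \<open>The reason for countable rather than finite exceptional sets: conditions are needed
  along whole \<open>q\<close>-orbits and for all \<open>n\<close> at once.\<close>

lemma generic_orbit:
 assumes "q ~= 0" "generic P" shows "generic (%z. \<forall>i::int. P (q powi i * z))"
 by (rule generic_all) (use assms in \<open>auto intro!: generic_scale\<close>)

lemma generic_neq: "generic (%z. z ~= c)"
 by (simp add: generic_def)

lemma generic_finite: "finite {z. ~ P z} ==> generic P"
 by (simp add: generic_def countable_finite)

text \<open>A ball is uncountable, so it cannot consist of exceptional points alone.\<close>

lemma generic_dense:
 assumes "generic P" "open U" "x \<in> U" shows "\<exists>z\<in>U. P z"
proof (rule ccontr)
 assume "~ ?thesis"
 then have "U \<subseteq> {z. ~ P z}" by auto
 with assms(1) have "countable U" unfolding generic_def by (rule countable_subset[rotated])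
 moreover from assms obtain e where "e > 0" "ball x e \<subseteq> U" by (meson openE)
 ultimately show False using uncountable_ball countable_subset by blast
qed

lemma generic_at:
 assumes "generic P" shows "frequently P (at x)"
 unfolding frequently_def
proof
 assume "\<forall>\<^sub>F y in at x. ~ P y"
 then have "EX S. open S & x \<in> S & (\<forall>y\<in>S. y ~= x --> ~ P y)"
 by (simp add: eventually_at_topological)
 then obtain S where S: "open S" "x \<in> S" "\<forall>y\<in>S. y ~= x --> ~ P y" by auto
 have "generic (%z. P z & z ~= x)" using assms generic_neq by (rule generic_conj)
 from generic_dense[OF this S(1,2)] S(3) show False by auto
qed

section \<open>Operators in z acting on families indexed by n\<close>

lemma qdiff_apply_superset:
 assumes "finite I" "qdiff_supp B \<subseteq> I"
 shows "qdiff_apply q B f z = (\<Sum>i\<in>I. B i z * f (q powi i * z))"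
 unfolding qdiff_apply_def
 by (rule sum.mono_neutral_left) (use assms in \<open>auto simp: qdiff_supp_def\<close>)

text \<open>The boolean index distinguishes the two solutions. One operator has to serve both of
  them and every \<open>n\<close>, because its coefficients may depend on \<open>z\<close>
  only.\<close>

definition zrel ::
 "complex => (int => complex => complex) => (bool => int => complex => complex) =>
 (bool => int => complex => complex) => bool" where
 "zrel q B Ps Ph \<longleftrightarrow> qdiff_operator B &
 generic (%z. ALL j n. qdiff_apply q B (Ps j n) z = Ph j n z)"

definition zact ::
 "complex => (bool => int => complex => complex) => (bool => int => complex => complex) => bool" where
 "zact q Ps Ph \<longleftrightarrow> (EX B. zrel q B Ps Ph)"

lemma zrelI:
 assumes "qdiff_operator B" "generic P" "!!z j n. P z ==> qdiff_apply q B (Ps j n) z = Ph j n z"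
 shows "zrel q B Ps Ph"
 unfolding zrel_def using assms by (auto elim: generic_mono)

text \<open>The operator samples its source at the points \<open>q powi i * z\<close>, so a change
  of the source family needs equality along the whole orbit; \<open>generic_orbit\<close> supplies
  it.\<close>

lemma zrel_cong:
 assumes q: "q ~= 0" and "zrel q B Ps Ph" "generic (%z. ALL j n. Ps j n z = Ps' j n z)"
 "generic (%z. ALL j n. Ph j n z = Ph' j n z)"
 shows "zrel q B Ps' Ph'"
proof -
 have g: "generic (%z. ((ALL j n. qdiff_apply q B (Ps j n) z = Ph j n z) & (ALL j n. Ph j n z = Ph' j n z)) &
 (\<forall>i::int. ALL j n. Ps j n (q powi i * z) = Ps' j n (q powi i * z)))"
 using assms by (intro generic_conj generic_orbit[OF q]) (auto simp: zrel_def)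
 show ?thesis
 proof (rule zrelI[OF _ g])
 show "qdiff_operator B" using assms by (simp add: zrel_def)
 fix z j n
 assume 1: "((ALL j n. qdiff_apply q B (Ps j n) z = Ph j n z) & (ALL j n. Ph j n z = Ph' j n z)) &
 (\<forall>i::int. ALL j n. Ps j n (q powi i * z) = Ps' j n (q powi i * z))"
 have "qdiff_apply q B (Ps' j n) z = qdiff_apply q B (Ps j n) z"
 unfolding qdiff_apply_def using 1 by simp
 with 1 show "qdiff_apply q B (Ps' j n) z = Ph' j n z" by simp
 qed
qed

lemma zrel_cong_right:
 "zrel q B Ps Ph ==> generic (%z. ALL j n. Ph j n z = Ph' j n z) ==> q ~= 0 ==> zrel q B Ps Ph'"
 by (rule zrel_cong) (auto intro: generic_True)

lemma zact_cong_right: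
 "zact q Ps Ph ==> generic (%z. ALL j n. Ph j n z = Ph' j n z) ==> q ~= 0 ==> zact q Ps Ph'"
 unfolding zact_def using zrel_cong_right by blast

text \<open>Factors depending on \<open>n\<close> are constants for an operator in \<open>z\<close>.
  Together with \<open>zrel_shift\<close> this says that operators in \<open>z\<close> commute with
  difference operators in \<open>n\<close>.\<close>

lemma zrel_lincomb:
 assumes "zrel q B Ps Ph" "zrel q B Ps' Ph'"
 shows "zrel q B (%j n z. u n * Ps j n z + v n * Ps' j n z) (%j n z. u n * Ph j n z + v n * Ph' j n z)"
proof -
 from assms have g: "generic (%z. (ALL j n. qdiff_apply q B (Ps j n) z = Ph j n z) &
 (ALL j n. qdiff_apply q B (Ps' j n) z = Ph' j n z))"
 unfolding zrel_def by (intro generic_conj) auto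
 have "qdiff_operator B" using assms by (simp add: zrel_def)
 from this g show ?thesis
 proof (rule zrelI)
 fix z j n assume "(ALL j n. qdiff_apply q B (Ps j n) z = Ph j n z) &
 (ALL j n. qdiff_apply q B (Ps' j n) z = Ph' j n z)"
 then have e: "Ph j n z = qdiff_apply q B (Ps j n) z" "Ph' j n z = qdiff_apply q B (Ps' j n) z"
 by auto
 show "qdiff_apply q B (%z. u n * Ps j n z + v n * Ps' j n z) z = u n * Ph j n z + v n * Ph' j n z"
 unfolding e qdiff_apply_def sum_distrib_left sum.distrib[symmetric]
 by (intro sum.cong) (auto simp: algebra_simps)
 qed
qed

lemma zrel_shift: "zrel q B Ps Ph ==> zrel q B (%j n. Ps j (n + s)) (%j n. Ph j (n + s))"
 unfolding zrel_def by (auto elim: generic_mono)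

lemma zact_mult:
 assumes "m meromorphic_on UNIV" shows "zact q Ps (%j n z. m z * Ps j n z)"
proof -
 define B where "B = (%i::int. %z::complex. if i = 0 then m z else 0)"
 have "qdiff_operator B" unfolding qdiff_operator_def
 proof
 show "finite (qdiff_supp B)" by (rule finite_subset[of _ "{0}"]) (auto simp: qdiff_supp_def B_def)
 have "B i = (if i = 0 then m else (%_. 0))" for i by (auto simp: B_def)
 then show "ALL i. B i meromorphic_on UNIV" using assms by (auto intro: meromorphic_intros)
 qed
 moreover have "qdiff_apply q B f z = m z * f z" for f z
 by (subst qdiff_apply_superset[of "{0}"]) (auto simp: qdiff_supp_def B_def)
 ultimately show ?thesis unfolding zact_def zrel_def by (auto intro!: exI[of _ B] generic_True)
qed

lemma zact_add:
 assumes "zact q Ps Ph" "zact q Ps Ph'"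
 shows "zact q Ps (%j n z. Ph j n z + Ph' j n z)"
proof -
 from assms obtain B B' where B: "zrel q B Ps Ph" "zrel q B' Ps Ph'" by (auto simp: zact_def)
 define I where "I = qdiff_supp B \<union> qdiff_supp B'"
 define C where "C = (%i z. B i z + B' i z)"
 have I: "finite I" "qdiff_supp B \<subseteq> I" "qdiff_supp B' \<subseteq> I" "qdiff_supp C \<subseteq> I"
 unfolding C_def using B by (auto simp: I_def zrel_def qdiff_operator_def qdiff_supp_def)
 have op: "qdiff_operator C"
 using B finite_subset[OF I(4) I(1)]
 by (auto simp: C_def zrel_def qdiff_operator_def intro!: meromorphic_intros)
 have ap: "qdiff_apply q C f z = qdiff_apply q B f z + qdiff_apply q B' f z" for f z
 unfolding qdiff_apply_superset[OF I(1,2)] qdiff_apply_superset[OF I(1,3)]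
 qdiff_apply_superset[OF I(1,4)] sum.distrib[symmetric]
 by (simp add: C_def algebra_simps)
 have g: "generic (%z. (ALL j n. qdiff_apply q B (Ps j n) z = Ph j n z) &
 (ALL j n. qdiff_apply q B' (Ps j n) z = Ph' j n z))"
 using B unfolding zrel_def by (intro generic_conj) auto
 have "zrel q C Ps (%j n z. Ph j n z + Ph' j n z)"
 by (rule zrelI[OF op g]) (simp add: ap)
 then show ?thesis by (auto simp: zact_def)
qed

text \<open>Coefficient of the \<open>k\<close>-th shift in a product of two operators: moving a
  shift past a coefficient dilates the argument of that coefficient.\<close>

definition zcomp ::
 "complex => (int => complex => complex) => (int => complex => complex) => int => complex => complex" where
 "zcomp q B C k z = (\<Sum>i\<in>qdiff_supp B. B i z * C (k - i) (q powi i * z))"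

lemma zcomp_supp: "qdiff_supp (zcomp q B C) \<subseteq> (%(i, j). i + j) ` (qdiff_supp B \<times> qdiff_supp C)"
proof
 fix k assume "k \<in> qdiff_supp (zcomp q B C)"
 then obtain z where "zcomp q B C k z ~= 0" by (auto simp: qdiff_supp_def)
 then obtain i where "i \<in> qdiff_supp B" "B i z * C (k - i) (q powi i * z) ~= 0"
 unfolding zcomp_def using sum.neutral by meson
 then have "i \<in> qdiff_supp B" "k - i \<in> qdiff_supp C" by (auto simp: qdiff_supp_def)
 then show "k \<in> (%(i, j). i + j) ` (qdiff_supp B \<times> qdiff_supp C)"
 by (auto intro!: image_eqI[of _ _ "(i, k - i)"])
qed

lemma meromorphic_scale:
 assumes "f meromorphic_on UNIV" "c ~= 0" shows "(%z. f (c * z)) meromorphic_on UNIV"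
 by (rule meromorphic_on_compose[OF assms(1)]) (auto intro!: analytic_intros)

lemma zcomp_operator:
 assumes "q ~= 0" "qdiff_operator B" "qdiff_operator C" shows "qdiff_operator (zcomp q B C)"
 unfolding qdiff_operator_def
proof
 show "finite (qdiff_supp (zcomp q B C))"
 by (rule finite_subset[OF zcomp_supp]) (use assms in \<open>auto simp: qdiff_operator_def\<close>)
 show "ALL i. zcomp q B C i meromorphic_on UNIV"
 unfolding zcomp_def using assms
 by (auto simp: qdiff_operator_def intro!: meromorphic_intros meromorphic_scale)
qed

lemma zcomp_apply:
 assumes "q ~= 0" "qdiff_operator B" "qdiff_operator C"
 shows "qdiff_apply q (zcomp q B C) f z = qdiff_apply q B (qdiff_apply q C f) z"
proof -
 define I where "I = qdiff_supp B"
 define J where "J = qdiff_supp C"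
 define K where "K = (%(i, j). i + j) ` (I \<times> J)"
 have fin: "finite I" "finite J" "finite K" using assms by (auto simp: qdiff_operator_def I_def J_def K_def)
 have "qdiff_apply q (zcomp q B C) f z = (\<Sum>k\<in>K. zcomp q B C k z * f (q powi k * z))"
 by (rule qdiff_apply_superset[OF fin(3)]) (use zcomp_supp in \<open>auto simp: K_def I_def J_def\<close>)
 also have "... = (\<Sum>k\<in>K. \<Sum>i\<in>I. B i z * C (k - i) (q powi i * z) * f (q powi k * z))"
 by (simp add: zcomp_def I_def sum_distrib_right)
 also have "... = (\<Sum>i\<in>I. \<Sum>k\<in>K. B i z * C (k - i) (q powi i * z) * f (q powi k * z))"
 by (rule sum.swap)
 also have "... = (\<Sum>i\<in>I. B i z * (\<Sum>j\<in>J. C j (q powi i * z) * f (q powi j * (q powi i * z))))"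
 proof (rule sum.cong[OF refl])
 fix i assume i: "i \<in> I"
 have "(\<Sum>k\<in>K. B i z * C (k - i) (q powi i * z) * f (q powi k * z)) =
 (\<Sum>k\<in>(%j. i + j) ` J. B i z * C (k - i) (q powi i * z) * f (q powi k * z))"
 proof (rule sum.mono_neutral_right)
 show "finite K" by (rule fin)
 show "(+) i ` J \<subseteq> K" using i by (auto simp: K_def)
 show "\<forall>k\<in>K - (+) i ` J. B i z * C (k - i) (q powi i * z) * f (q powi k * z) = 0"
 proof
 fix k assume "k \<in> K - (+) i ` J"
 then have "k - i \<notin> J" by (auto simp: image_iff)
 then show "B i z * C (k - i) (q powi i * z) * f (q powi k * z) = 0"
 by (auto simp: J_def qdiff_supp_def)
 qed
 qed
 also have "... = (\<Sum>j\<in>J. B i z * C j (q powi i * z) * f (q powi (i + j) * z))"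
 by (subst sum.reindex) (auto simp: inj_on_def)
 also have "... = B i z * (\<Sum>j\<in>J. C j (q powi i * z) * f (q powi j * (q powi i * z)))"
 using assms(1) by (simp add: sum_distrib_left power_int_add mult_ac)
 finally show "(\<Sum>k\<in>K. B i z * C (k - i) (q powi i * z) * f (q powi k * z)) =
 B i z * (\<Sum>j\<in>J. C j (q powi i * z) * f (q powi j * (q powi i * z)))" .
 qed
 also have "... = qdiff_apply q B (qdiff_apply q C f) z"
 by (simp add: qdiff_apply_def I_def J_def)
 finally show ?thesis .
qed

lemma zrel_comp:
 assumes q: "q ~= 0" and "zrel q C Ps Ph" "zrel q B Ph \<Omega>"
 shows "zrel q (zcomp q B C) Ps \<Omega>"
proof -
 have op: "qdiff_operator B" "qdiff_operator C" using assms by (auto simp: zrel_def)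
 have g: "generic (%z. (\<forall>i::int. ALL j n. qdiff_apply q C (Ps j n) (q powi i * z) = Ph j n (q powi i * z)) &
 (ALL j n. qdiff_apply q B (Ph j n) z = \<Omega> j n z))"
 using assms by (intro generic_conj generic_orbit[OF q]) (auto simp: zrel_def)
 show ?thesis
 proof (rule zrelI[OF zcomp_operator[OF q op] g], elim conjE)
 fix z j n
 assume 1: "\<forall>i::int. ALL j n. qdiff_apply q C (Ps j n) (q powi i * z) = Ph j n (q powi i * z)"
 and 2: "ALL j n. qdiff_apply q B (Ph j n) z = \<Omega> j n z"
 have "qdiff_apply q (zcomp q B C) (Ps j n) z = qdiff_apply q B (Ph j n) z"
 unfolding zcomp_apply[OF q op] by (simp add: qdiff_apply_def[of q B] 1)
 with 2 show "qdiff_apply q (zcomp q B C) (Ps j n) z = \<Omega> j n z" by simp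
 qed
qed

lemma zact_comp: "q ~= 0 ==> zact q Ps Ph ==> zact q Ph \<Omega> ==> zact q Ps \<Omega>"
 unfolding zact_def using zrel_comp by blast

section \<open>Rational functions and Laurent polynomials on a set of points\<close>

definition rfun :: "complex set => (complex => complex) => bool" where
 "rfun T f \<longleftrightarrow> (EX p r. \<forall>t\<in>T. poly r t ~= 0 & f t = poly p t / poly r t)"

text \<open>Both classes consist of restrictions to \<open>T\<close>, since the functions met later
  are known only on a lattice and its reflection.\<close>

definition lau :: "complex set => (complex => complex) => bool" where
 "lau T f \<longleftrightarrow> (EX p N. \<forall>t\<in>T. f t = poly p t / t ^ N)"

lemma rfunI: "(!!t. t \<in> T ==> poly r t ~= 0 & f t = poly p t / poly r t) ==> rfun T f"
 unfolding rfun_def by blast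

lemma rfun_cong: "rfun T f ==> (!!t. t \<in> T ==> f t = g t) ==> rfun T g"
 unfolding rfun_def by metis

lemma rfun_poly [intro]: "rfun T (poly p)"
 by (rule rfunI[of T 1 _ p]) auto

lemma rfun_const [intro, simp]: "rfun T (%t. c)"
 by (rule rfunI[of T 1 _ "[:c:]"]) auto

lemma rfun_id [intro, simp]: "rfun T (%t. t)"
 by (rule rfunI[of T 1 _ "[:0, 1:]"]) auto

lemma rfun_add [intro]:
 assumes "rfun T f" "rfun T g" shows "rfun T (%t. f t + g t)"
proof -
 from assms obtain p r p' r' where
 *: "!!t. t \<in> T ==> poly r t ~= 0 & f t = poly p t / poly r t"
 "!!t. t \<in> T ==> poly r' t ~= 0 & g t = poly p' t / poly r' t" unfolding rfun_def by metis
 show ?thesis by (rule rfunI[of _ "r * r'" _ "p * r' + p' * r"]) (use * in \<open>auto simp: field_simps\<close>)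
qed

lemma rfun_mult [intro]:
 assumes "rfun T f" "rfun T g" shows "rfun T (%t. f t * g t)"
proof -
 from assms obtain p r p' r' where
 *: "!!t. t \<in> T ==> poly r t ~= 0 & f t = poly p t / poly r t"
 "!!t. t \<in> T ==> poly r' t ~= 0 & g t = poly p' t / poly r' t" unfolding rfun_def by metis
 show ?thesis by (rule rfunI[of _ "r * r'" _ "p * p'"]) (use * in \<open>auto simp: field_simps\<close>)
qed

lemma rfun_uminus [intro]: "rfun T f ==> rfun T (%t. - f t)"
 using rfun_mult[of T "%_. - 1" f] by simp

lemma rfun_diff [intro]: "rfun T f ==> rfun T g ==> rfun T (%t. f t - g t)"
 using rfun_add[of T f "%t. - g t"] by auto

lemma rfun_power [intro]: "rfun T f ==> rfun T (%t. f t ^ n)"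
 by (induction n) auto

lemma rfun_prod [intro]: "(!!i. i \<in> I ==> rfun T (f i)) ==> rfun T (%t. \<Prod>i\<in>I. f i t)"
 by (induction I rule: infinite_finite_induct) auto

lemma rfun_inverse:
 assumes "rfun T f" "!!t. t \<in> T ==> f t ~= 0" shows "rfun T (%t. 1 / f t)"
proof -
 from assms(1) obtain p r where
 *: "!!t. t \<in> T ==> poly r t ~= 0 & f t = poly p t / poly r t" unfolding rfun_def by metis
 show ?thesis by (rule rfunI[of _ p _ r]) (use * assms(2) in fastforce)
qed

lemma rfun_divide:
 assumes "rfun T f" "rfun T g" "!!t. t \<in> T ==> g t ~= 0" shows "rfun T (%t. f t / g t)"
 using rfun_mult[OF assms(1) rfun_inverse[OF assms(2,3)]] by simp

lemma rfun_scale: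
 assumes "rfun T f" "!!t. t \<in> T ==> c * t \<in> T" shows "rfun T (%t. f (c * t))"
proof -
 from assms(1) obtain p r where
 *: "!!t. t \<in> T ==> poly r t ~= 0 & f t = poly p t / poly r t" unfolding rfun_def by metis
 show ?thesis
 by (rule rfunI[of _ "pcompose r [:0, c:]" _ "pcompose p [:0, c:]"])
 (use * assms(2) in \<open>auto simp: poly_pcompose mult.commute\<close>)
qed

lemma lauI: "(!!t. t \<in> T ==> f t = poly p t / t ^ N) ==> lau T f"
 unfolding lau_def by blast

lemma lau_cong: "lau T f ==> (!!t. t \<in> T ==> f t = g t) ==> lau T g"
 unfolding lau_def by metis

lemma lau_poly [intro]: "lau T (poly p)"
 by (rule lauI[of _ _ p 0]) auto

lemma lau_const [intro, simp]: "lau T (%t. c)"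
 by (rule lauI[of _ _ "[:c:]" 0]) auto

lemma lau_id [intro, simp]: "lau T (%t. t)"
 by (rule lauI[of _ _ "[:0, 1:]" 0]) auto

lemma lau_inverse_id [intro, simp]: "lau T (%t. c / t)"
 by (rule lauI[of _ _ "[:c:]" 1]) auto

lemma lau_add [intro]:
 assumes "0 \<notin> T" "lau T f" "lau T g" shows "lau T (%t. f t + g t)"
proof -
 from assms obtain p N p' N' where
 *: "!!t. t \<in> T ==> f t = poly p t / t ^ N" "!!t. t \<in> T ==> g t = poly p' t / t ^ N'"
 unfolding lau_def by metis
 show ?thesis
 proof (rule lauI[of _ _ "p * monom 1 N' + p' * monom 1 N" "N + N'"])
 fix t assume t: "t \<in> T"
 with assms have "t ~= 0" by auto
 with *[OF t] show "f t + g t = poly (p * monom 1 N' + p' * monom 1 N) t / t ^ (N + N')"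
 by (simp add: poly_monom power_add field_simps)
 qed
qed

lemma lau_mult [intro]:
 assumes "lau T f" "lau T g" shows "lau T (%t. f t * g t)"
proof -
 from assms obtain p N p' N' where
 *: "!!t. t \<in> T ==> f t = poly p t / t ^ N" "!!t. t \<in> T ==> g t = poly p' t / t ^ N'"
 unfolding lau_def by metis
 show ?thesis by (rule lauI[of _ _ "p * p'" "N + N'"]) (simp add: * power_add)
qed

lemma lau_uminus [intro]: "lau T f ==> lau T (%t. - f t)"
 using lau_mult[of T "%_. - 1" f] by simp

lemma lau_diff [intro]: "0 \<notin> T ==> lau T f ==> lau T g ==> lau T (%t. f t - g t)"
 using lau_add[of T f "%t. - g t"] by auto

lemma lau_poly_comp [intro]:
 assumes "0 \<notin> T" "lau T f" shows "lau T (%t. poly m (f t))"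
 by (induction m) (use assms in \<open>auto intro!: lau_add lau_mult\<close>)

lemma lau_scale:
 assumes "lau T f" "!!t. t \<in> T ==> c * t \<in> T" "c ~= 0" shows "lau T (%t. f (c * t))"
proof -
 from assms(1) obtain p N where *: "!!t. t \<in> T ==> f t = poly p t / t ^ N"
 unfolding lau_def by metis
 show ?thesis
 by (rule lauI[of _ _ "smult (1 / c ^ N) (pcompose p [:0, c:])" N])
 (use * assms(2,3) in \<open>auto simp: poly_pcompose mult.commute power_mult_distrib\<close>)
qed

lemma lau_poly_reflect:
 assumes "0 \<notin> T" shows "lau T (%t. poly p (w / t))"
 using lau_poly_comp[OF assms lau_inverse_id] .

lemma lau_reflect:
 assumes "0 \<notin> T" "w ~= 0" "!!t. t \<in> T ==> w / t \<in> T" "lau T f"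
 shows "lau T (%t. f (w / t))"
proof -
 from assms(4) obtain p N where *: "!!t. t \<in> T ==> f t = poly p t / t ^ N"
 unfolding lau_def by metis
 have "lau T (%t. poly p (w / t) * poly (monom (1 / w ^ N) N) t)"
 using assms by (intro lau_mult lau_poly_reflect) auto
 then show ?thesis
 by (rule lau_cong) (use * assms in \<open>auto simp: poly_monom power_divide\<close>)
qed

lemma lau_rfun:
 assumes "0 \<notin> T" "lau T f" shows "rfun T f"
proof -
 from assms(2) obtain p N where *: "!!t. t \<in> T ==> f t = poly p t / t ^ N"
 unfolding lau_def by metis
 show ?thesis by (rule rfunI[of _ "monom 1 N" _ p]) (use * assms in \<open>auto simp: poly_monom\<close>)
qed

lemma rfun_reflect:
 assumes "0 \<notin> T" "w ~= 0" "!!t. t \<in> T ==> w / t \<in> T" "rfun T f"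
 shows "rfun T (%t. f (w / t))"
proof -
 from assms(4) obtain p r where
 *: "!!t. t \<in> T ==> poly r t ~= 0 & f t = poly p t / poly r t" unfolding rfun_def by metis
 have "rfun T (%t. poly p (w / t) / poly r (w / t))"
 using assms * by (intro rfun_divide lau_rfun lau_poly_reflect) auto
 then show ?thesis by (rule rfun_cong) (use * assms in auto)
qed

lemma rfun_clear_denominator:
 assumes "rfun T f"
 obtains r where "!!t. t \<in> T ==> poly r t ~= 0" "lau T (%t. poly r t * f t)"
proof -
 from assms obtain p r where
 *: "!!t. t \<in> T ==> poly r t ~= 0 & f t = poly p t / poly r t" unfolding rfun_def by metis
 have "lau T (%t. poly r t * f t)" by (rule lau_cong[OF lau_poly[of _ p]]) (simp add: *)
 with * show ?thesis by (intro that[of r]) auto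
qed

text \<open>Chebyshev-type recursion: \<open>s j = t ^ j + (w / t) ^ j\<close> satisfies
  \<open>s (j + 2) = (t + w / t) * s (j + 1) - w * s j\<close>.\<close>

lemma power_plus_reflected:
 fixes w :: complex
 shows "EX m. ALL t. t ~= 0 --> t ^ j + (w / t) ^ j = poly m (t + w / t)"
proof (induction j rule: induct_nat_012)
 case 0
 show ?case by (rule exI[of _ "[:2:]"]) auto
next
 case 1
 show ?case by (rule exI[of _ "[:0, 1:]"]) auto
next
 case (ge2 j)
 from ge2 obtain m m' where m: "!!t. t ~= 0 ==> t ^ j + (w / t) ^ j = poly m (t + w / t)"
 "!!t. t ~= 0 ==> t ^ Suc j + (w / t) ^ Suc j = poly m' (t + w / t)" by metis
 show ?case
 proof (rule exI[of _ "[:0, 1:] * m' - smult w m"], intro allI impI)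
 fix t :: complex assume t: "t ~= 0"
 have "poly ([:0, 1:] * m' - smult w m) (t + w / t) =
 (t + w / t) * poly m' (t + w / t) - t * (w / t) * poly m (t + w / t)"
 using t by simp
 also have "... = (t + w / t) * (t ^ Suc j + (w / t) ^ Suc j) - t * (w / t) * (t ^ j + (w / t) ^ j)"
 by (simp only: m[OF t])
 also have "... = t ^ Suc (Suc j) + (w / t) ^ Suc (Suc j)"
 by (simp add: algebra_simps del: times_divide_eq_right times_divide_eq_left)
 finally show "t ^ Suc (Suc j) + (w / t) ^ Suc (Suc j) = poly ([:0, 1:] * m' - smult w m) (t + w / t)" ..
 qed
qed

lemma laurent_monomial_plus_reflected:
 fixes w :: complex assumes w: "w ~= 0"
 shows "EX m. ALL t. t ~= 0 --> t ^ i / t ^ N + (w / t) ^ i / (w / t) ^ N = poly m (t + w / t)"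
proof (cases "i >= N")
 case True
 then obtain j where j: "i = N + j" using le_Suc_ex by blast
 obtain m where "!!t. t ~= 0 ==> t ^ j + (w / t) ^ j = poly m (t + w / t)"
 using power_plus_reflected by blast
 with w show ?thesis by (intro exI[of _ m]) (auto simp: j power_add)
next
 case False
 then obtain j where j: "N = i + j" using le_Suc_ex by (metis nat_le_linear)
 obtain m where m: "!!t. t ~= 0 ==> t ^ j + (w / t) ^ j = poly m (t + w / t)"
 using power_plus_reflected by blast
 \<comment> \<open>Negative powers: up to the factor \<open>1 / w ^ j\<close>, the pair
   \<open>t ^ (-j)\<close>, \<open>(w / t) ^ (-j)\<close> is the pair of positive powers in reverse
   order.\<close>
 show ?thesis
 proof (rule exI[of _ "smult (1 / w ^ j) m"], intro allI impI)
 fix t :: complex assume t: "t ~= 0"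
 show "t ^ i / t ^ N + (w / t) ^ i / (w / t) ^ N = poly (smult (1 / w ^ j) m) (t + w / t)"
 unfolding poly_smult m[OF t, symmetric] using t w
 by (simp add: j power_add power_divide field_simps)
 qed
qed

text \<open>Averaging \<open>f\<close> with its reflection leaves sums of monomials and their mirror
  images. This converts every symmetry found later into a multiplier that operators in
  \<open>z\<close> can realise.\<close>

lemma lau_symmetric:
 assumes T: "0 \<notin> T" "w ~= 0" "!!t. t \<in> T ==> w / t \<in> T" and "lau T f"
 "!!t. t \<in> T ==> f (w / t) = f t"
 obtains m where "!!t. t \<in> T ==> f t = poly m (t + w / t)"
proof -
 from assms(4) obtain p N where *: "!!t. t \<in> T ==> f t = poly p t / t ^ N"
 unfolding lau_def by metis
 from laurent_monomial_plus_reflected[OF T(2), of _ N] obtain M where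
 M: "!!i t. t ~= 0 ==> t ^ i / t ^ N + (w / t) ^ i / (w / t) ^ N = poly (M i) (t + w / t)" by metis
 show ?thesis
 proof (rule that[of "\<Sum>i\<le>degree p. smult (coeff p i / 2) (M i)"])
 fix t assume t: "t \<in> T"
 with T have t0: "t ~= 0" by auto
 have "f t = (f t + f (w / t)) / 2" using assms(5)[OF t] by simp
 also have "... = (poly p t / t ^ N + poly p (w / t) / (w / t) ^ N) / 2"
 using *[OF t] *[OF T(3)[OF t]] by simp
 also have "... = (\<Sum>i\<le>degree p. coeff p i / 2 * (t ^ i / t ^ N + (w / t) ^ i / (w / t) ^ N))"
 unfolding poly_altdef sum_divide_distrib sum.distrib[symmetric]
 by (intro sum.cong refl) (simp add: field_simps)
 also have "... = poly (\<Sum>i\<le>degree p. smult (coeff p i / 2) (M i)) (t + w / t)"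
 using M[OF t0] by (simp add: poly_sum)
 finally show "f t = poly (\<Sum>i\<le>degree p. smult (coeff p i / 2) (M i)) (t + w / t)" .
 qed
qed

text \<open>The points \<open>t0 * q ^ n\<close> tend to \<open>0\<close>, where a rational function
  behaves like its lowest power of \<open>t\<close>: \<open>k\<close> is the order of the numerator
  at \<open>0\<close> minus that of the denominator.\<close>

lemma rfun_leading_behaviour:
 fixes q t0 :: complex
 assumes q: "q ~= 0" "norm q < 1" and t: "t0 ~= 0" "!!n::nat. t0 * q ^ n \<in> T" and f: "rfun T f"
 obtains "!!t. t \<in> T ==> f t = 0"
 | k :: int and c where "c ~= 0" "(%n. f (t0 * q ^ n) / (t0 * q ^ n) powi k) \<longlonglongrightarrow> c"
proof -
 from f obtain p r where
 *: "!!t. t \<in> T ==> poly r t ~= 0 & f t = poly p t / poly r t" unfolding rfun_def by metis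
 have r0: "r ~= 0" using *[OF t(2)[of 0]] by auto
 show ?thesis
 proof (cases "p = 0")
 case True
 show ?thesis by (rule that(1)) (use * True in auto)
 next
 case False
 obtain p' where p': "p = [:- 0, 1:] ^ order 0 p * p'" "~ [:- 0, 1:] dvd p'"
 using order_decomp[OF False] by blast
 obtain r' where r': "r = [:- 0, 1:] ^ order 0 r * r'" "~ [:- 0, 1:] dvd r'"
 using order_decomp[OF r0] by blast
 have nz: "poly p' 0 ~= 0" "poly r' 0 ~= 0" using p' r' poly_eq_0_iff_dvd by blast+
 define x where "x n = t0 * q ^ n" for n :: nat
 have x0: "x n ~= 0" for n using q t by (simp add: x_def)
 have lim: "x \<longlonglongrightarrow> 0" unfolding x_def using LIMSEQ_power_zero[OF q(2)] by (rule tendsto_mult_right_zero)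
 have "(%n. poly p' (x n) / poly r' (x n)) \<longlonglongrightarrow> poly p' 0 / poly r' 0"
 using nz lim by (intro tendsto_intros isCont_tendsto_compose[OF poly_isCont]) auto
 moreover have "poly p' (x n) / poly r' (x n) = f (x n) / x n powi (int (order 0 p) - int (order 0 r))" for n
 proof -
 have "poly p (x n) = x n ^ order 0 p * poly p' (x n)" by (subst p'(1)) simp
 moreover have "poly r (x n) = x n ^ order 0 r * poly r' (x n)" by (subst r'(1)) simp
 moreover have "f (x n) = poly p (x n) / poly r (x n)" using *[OF t(2)[of n]] by (simp add: x_def)
 ultimately show ?thesis using x0[of n] by (simp add: power_int_diff)
 qed
 ultimately show ?thesis
 by (intro that(2)[of "poly p' 0 / poly r' 0" "int (order 0 p) - int (order 0 r)"])
 (use nz in \<open>auto simp: x_def\<close>)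
 qed
qed

text \<open>Since \<open>q ^ 2 ~= 1\<close>, both \<open>t\<close> and \<open>1 / t\<close> are
  linear combinations of \<open>t + w / t\<close> and \<open>q * t + w / (q * t)\<close>, so
  products of polynomials in these two span all Laurent polynomials. In the application they are
  multipliers to the left and to the right of \<open>L\<close>, the second seen through a shift of
  \<open>n\<close>.\<close>

lemma lau_induct_sym:
 fixes q w :: complex
 assumes T: "0 \<notin> T" and q: "q ~= 0" "q ^ 2 ~= 1" and w: "w ~= 0" and f: "lau T f"
 and cong: "!!f g. P f ==> (!!t. t \<in> T ==> f t = g t) ==> P g"
 and add: "!!f g. P f ==> P g ==> P (%t. f t + g t)"
 and gen: "!!a b. P (%t. poly a (t + w / t) * poly b (q * t + w / (q * t)))"
 shows "P f"
proof -
 let ?L = "%t. t + w / t" and ?M = "%t. q * t + w / (q * t)"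
 have q2: "1 - q ^ 2 ~= 0" using q by auto
 have up: "P (%t. t ^ j * (poly a (?L t) * poly b (?M t)))" for j a b
 proof (induction j arbitrary: a b)
 case 0
 then show ?case using gen by simp
 next
 case (Suc j)
 have "P (%t. t ^ j * (poly ([:0, 1 / (1 - q^2):] * a) (?L t) * poly b (?M t)) +
 t ^ j * (poly a (?L t) * poly ([:0, - q / (1 - q^2):] * b) (?M t)))"
 by (intro add Suc)
 then show ?case
 proof (rule cong)
 fix t assume "t \<in> T"
 with T have t: "t ~= 0" by auto
 have "t * (1 - q^2) = ?L t - q * ?M t" using t q by (simp add: field_simps sqr_eq)
 then have "t = (?L t - q * ?M t) / (1 - q^2)" using q2 by (metis nonzero_eq_divide_eq)
 then have e: "t = ?L t * (1 / (1 - q^2)) + ?M t * (- q / (1 - q^2))"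
 by (simp add: diff_divide_distrib mult.commute)
 have "t ^ j * (poly ([:0, 1 / (1 - q^2):] * a) (?L t) * poly b (?M t)) +
 t ^ j * (poly a (?L t) * poly ([:0, - q / (1 - q^2):] * b) (?M t)) =
 t ^ j * (?L t * (1 / (1 - q^2)) + ?M t * (- q / (1 - q^2))) * (poly a (?L t) * poly b (?M t))"
 by (simp add: algebra_simps)
 also have "... = t ^ Suc j * (poly a (?L t) * poly b (?M t))"
 unfolding e[symmetric] by simp
 finally show "t ^ j * (poly ([:0, 1 / (1 - q^2):] * a) (?L t) * poly b (?M t)) +
 t ^ j * (poly a (?L t) * poly ([:0, - q / (1 - q^2):] * b) (?M t)) =
 t ^ Suc j * (poly a (?L t) * poly b (?M t))" .
 qed
 qed
 have down: "P (%t. (1 / t ^ N) * (t ^ j * (poly a (?L t) * poly b (?M t))))" for N j a b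
 proof (induction N arbitrary: a b)
 case 0
 then show ?case using up by simp
 next
 case (Suc N)
 have "P (%t. (1 / t ^ N) * (t ^ j * (poly ([:0, - (q^2) / (w * (1 - q^2)):] * a) (?L t) * poly b (?M t))) +
 (1 / t ^ N) * (t ^ j * (poly a (?L t) * poly ([:0, q / (w * (1 - q^2)):] * b) (?M t))))"
 by (intro add Suc)
 then show ?case
 proof (rule cong)
 fix t assume "t \<in> T"
 with T have t: "t ~= 0" by auto
 have "w * (1 - q^2) = t * (- (q^2) * ?L t + q * ?M t)"
 using t q by (simp add: field_simps sqr_eq)
 then have "1 / t = (- (q^2) * ?L t + q * ?M t) / (w * (1 - q^2))"
 using q2 w t by (metis (no_types, lifting) divide_divide_eq_left frac_eq_eq mult.commute mult_eq_0_iff nonzero_eq_divide_eq mult_1)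
 also have "... = ?L t * (- (q^2) / (w * (1 - q^2))) + ?M t * (q / (w * (1 - q^2)))"
 unfolding add_divide_distrib by (simp add: mult.commute)
 finally have e: "1 / t = ?L t * (- (q^2) / (w * (1 - q^2))) + ?M t * (q / (w * (1 - q^2)))" .
 have "(1 / t ^ N) * (t ^ j * (poly ([:0, - (q^2) / (w * (1 - q^2)):] * a) (?L t) * poly b (?M t))) +
 (1 / t ^ N) * (t ^ j * (poly a (?L t) * poly ([:0, q / (w * (1 - q^2)):] * b) (?M t))) =
 (1 / t ^ N) * (?L t * (- (q^2) / (w * (1 - q^2))) + ?M t * (q / (w * (1 - q^2)))) *
 (t ^ j * (poly a (?L t) * poly b (?M t)))"
 by (simp add: algebra_simps)
 also have "... = (1 / t ^ Suc N) * (t ^ j * (poly a (?L t) * poly b (?M t)))"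
 unfolding e[symmetric] by simp
 finally show "(1 / t ^ N) * (t ^ j * (poly ([:0, - (q^2) / (w * (1 - q^2)):] * a) (?L t) * poly b (?M t))) +
 (1 / t ^ N) * (t ^ j * (poly a (?L t) * poly ([:0, q / (w * (1 - q^2)):] * b) (?M t))) =
 (1 / t ^ Suc N) * (t ^ j * (poly a (?L t) * poly b (?M t)))" .
 qed
 qed
 obtain p N where f: "!!t. t \<in> T ==> f t = poly p t / t ^ N" using f unfolding lau_def by metis
 have "P (%t. \<Sum>i\<in>I. (1 / t ^ N) * (t ^ i * (poly [:coeff p i:] (?L t) * poly 1 (?M t))))" if "finite I" for I
 using that
 proof (induction I rule: finite_induct)
 case empty
 show ?case by (rule cong[OF gen[of 0 0]]) simp
 next
 case (insert i I)
 show ?case by (rule cong[OF add[OF down[of N i "[:coeff p i:]" 1] insert.IH]])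
 (use insert in simp)
 qed
 then have "P (%t. \<Sum>i\<le>degree p. (1 / t ^ N) * (t ^ i * (poly [:coeff p i:] (?L t) * poly 1 (?M t))))"
 by simp
 then show ?thesis
 by (rule cong) (simp add: f poly_altdef sum_divide_distrib mult_ac)
qed

section \<open>A pair of solutions with shifts in n and in z\<close>

lemma solve_three_term:
 fixes A :: complex
 assumes "A ~= 0" "A * x + B * y + C * u = X * y" shows "x = (X - B) / A * y - C / A * u"
proof -
 have "A * x = (X - B) * y - C * u" using assms(2) by (simp add: algebra_simps)
 with assms(1) show ?thesis by (metis diff_divide_distrib nonzero_mult_div_cancel_left times_divide_eq_left)
qed

text \<open>\<open>Ps True\<close> and \<open>Ps False\<close> are two solutions of one difference equation in \<open>n\<close>; a shift of \<open>z\<close>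
 acts on them like a difference operator in \<open>n\<close> with rational coefficients.\<close>

locale bispectral_pair =
 fixes q t0 w0 a :: complex and Ps :: "bool => int => complex => complex"
 and A0 B0 C0 :: "complex => complex" and T :: "complex set"
 assumes q: "q ~= 0" "norm q < 1"
 and t0: "t0 ~= 0" and w0: "w0 ~= 0" and a: "a ~= 0"
 and T: "T = {t0 * q powi n |n. True} \<union> {w0 / (t0 * q powi n) |n. True}"
 and coeffs: "rfun T A0" "rfun T B0" "rfun T C0"
 "!!t. t \<in> T ==> A0 t ~= 0" "!!t. t \<in> T ==> C0 t ~= 0"
 and limits: "(%n. A0 (t0 * q ^ n)) \<longlonglongrightarrow> 1 / a" "(%n. B0 (t0 * q ^ n)) \<longlonglongrightarrow> 0"
 "(%n. C0 (t0 * q ^ n)) \<longlonglongrightarrow> a"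
 and eigen: "generic (%z. ALL j n. A0 (t0 * q powi n) * Ps j (n + 1) z + B0 (t0 * q powi n) * Ps j n z
 + C0 (t0 * q powi n) * Ps j (n - 1) z = (z + 1 / z) * Ps j n z)"
 and zshift: "generic (%z. EX u v. rfun T u & rfun T v &
 (ALL j n. Ps j n (q * z) = u (t0 * q powi n) * Ps j n z + v (t0 * q powi n) * Ps j (n + 1) z))"
 "generic (%z. EX u v. rfun T u & rfun T v &
 (ALL j n. Ps j n (z / q) = u (t0 * q powi n) * Ps j n z + v (t0 * q powi n) * Ps j (n + 1) z))"
 and indep: "generic (%z. ALL n. Ps True n z * Ps False (n + 1) z ~= Ps True (n + 1) z * Ps False n z)"
begin

definition tn :: "int => complex" where "tn n = t0 * q powi n"

lemma tn_T [simp, intro]: "tn n \<in> T"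
 by (auto simp: T tn_def)

lemma tn_add1: "tn (n + 1) = q * tn n" and tn_diff1: "tn (n - 1) = tn n / q"
 using q by (auto simp: tn_def power_int_add power_int_diff)

lemma T_0: "0 \<notin> T"
 using q t0 w0 by (auto simp: T)

lemma T_nz: "t \<in> T ==> t ~= 0" using T_0 by auto

lemma T_mult: assumes "t \<in> T" shows "q * t \<in> T"
proof -
 from assms obtain n where "t = t0 * q powi n | t = w0 / (t0 * q powi n)" by (auto simp: T)
 then have "q * t = t0 * q powi (n + 1) | q * t = w0 / (t0 * q powi (n - 1))"
 using q by (auto simp: power_int_add power_int_diff)
 then show ?thesis by (auto simp: T)
qed

lemma T_div: assumes "t \<in> T" shows "t / q \<in> T"
proof -
 from assms obtain n where "t = t0 * q powi n | t = w0 / (t0 * q powi n)" by (auto simp: T)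
 then have "t / q = t0 * q powi (n - 1) | t / q = w0 / (t0 * q powi (n + 1))"
 using q by (auto simp: power_int_add power_int_diff)
 then show ?thesis by (auto simp: T)
qed

lemma T_div': "t \<in> T ==> inverse q * t \<in> T"
 using T_div by (simp add: field_simps)

text \<open>The \<open>i\<close>-th transformed operator reflects with constant
  \<open>q ^ i * w0\<close>. One set \<open>T\<close> serves all stages because it is stable under
  multiplication by \<open>q\<close> and by \<open>1 / q\<close>.\<close>

lemma T_reflect:
 assumes "t \<in> T" "w = q ^ i * w0" shows "w / t \<in> T"
proof -
 from assms obtain n where "t = t0 * q powi n | t = w0 / (t0 * q powi n)" by (auto simp: T)
 then have "w / t = w0 / (t0 * q powi (n - i)) | w / t = t0 * q powi (n + i)"
 using q t0 w0 by (auto simp: power_int_add power_int_diff assms(2))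
 then show ?thesis by (auto simp: T)
qed

lemma T_cases:
 assumes "t \<in> T" "w = q ^ i * w0" obtains n where "t = tn n | t = w / tn n"
proof -
 from assms obtain n where "t = t0 * q powi n | t = w0 / (t0 * q powi n)" by (auto simp: T)
 then have "t = tn n | t = w / tn (n + i)"
 using q t0 w0 by (auto simp: power_int_add assms(2) tn_def)
 then show ?thesis using that by blast
qed

lemma rfun_up: "rfun T f ==> rfun T (%t. f (q * t))"
 by (rule rfun_scale) (auto intro: T_mult)

lemma rfun_down: "rfun T f ==> rfun T (%t. f (t / q))"
 using rfun_scale[of T f "inverse q"] T_div' by (simp add: field_simps)

lemma q_sq: "q ^ 2 ~= 1"
proof
 assume "q ^ 2 = 1"
 then have "norm q ^ 2 = 1" by (metis norm_one norm_power)
 moreover have "norm q ^ 2 < 1" using q(2) by (simp add: power_less_one_iff)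
 ultimately show False by simp
qed

text \<open>A module over the rational functions of \<open>t\<close>, stable under shifts of
  \<open>n\<close> by the recurrence and under shifts of \<open>z\<close> on good orbits. The
  uniqueness of the operators constructed later is decided inside it.\<close>

definition inspan :: "complex => (bool => int => complex) => bool" where
 "inspan z X \<longleftrightarrow> (EX u v. rfun T u & rfun T v &
 (ALL j n. X j n = u (tn n) * Ps j n z + v (tn n) * Ps j (n + 1) z))"

definition eig :: "complex => bool" where
 "eig z \<longleftrightarrow> (ALL j n. A0 (tn n) * Ps j (n + 1) z + B0 (tn n) * Ps j n z
 + C0 (tn n) * Ps j (n - 1) z = (z + 1 / z) * Ps j n z)"

definition shiftable :: "complex => bool" where
 "shiftable z \<longleftrightarrow> inspan z (%j n. Ps j n (q * z)) & inspan z (%j n. Ps j n (z / q))"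

lemma generic_eig: "generic eig"
 using eigen by (simp add: eig_def[abs_def] tn_def)

lemma generic_shiftable: "generic shiftable"
 unfolding shiftable_def[abs_def] inspan_def tn_def using zshift by (rule generic_conj)

lemma inspan_lin:
 assumes "inspan z X" "inspan z Y" "rfun T f" "rfun T g"
 shows "inspan z (%j n. f (tn n) * X j n + g (tn n) * Y j n)"
proof -
 from assms obtain u v u' v' where r: "rfun T u" "rfun T v" "rfun T u'" "rfun T v'"
 and e: "!!j n. X j n = u (tn n) * Ps j n z + v (tn n) * Ps j (n + 1) z"
 "!!j n. Y j n = u' (tn n) * Ps j n z + v' (tn n) * Ps j (n + 1) z"
 unfolding inspan_def by metis
 show ?thesis unfolding inspan_def
 by (rule exI[of _ "%t. f t * u t + g t * u' t"], rule exI[of _ "%t. f t * v t + g t * v' t"])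
 (use r assms in \<open>auto simp: e algebra_simps intro!: rfun_add rfun_mult\<close>)
qed

lemma inspan_sum:
 assumes "!!i. i \<in> I ==> inspan z (X i)" shows "inspan z (%j n. \<Sum>i\<in>I. c i * X i j n)"
 using assms
proof (induction I rule: infinite_finite_induct)
 case (insert i I)
 then have "inspan z (%j n. c i * X i j n + 1 * (\<Sum>i\<in>I. c i * X i j n))"
 by (intro inspan_lin[where f = "%_. c i" and g = "%_. 1"]) auto
 with insert show ?case by simp
qed (auto simp: inspan_def intro!: exI[of _ "%_. 0"])

lemma inspan_Ps: "inspan z (%j n. Ps j n z)" "inspan z (%j n. Ps j (n + 1) z)"
 unfolding inspan_def
 by (rule exI[of _ "%_. 1"], rule exI[of _ "%_. 0"], simp,
 rule exI[of _ "%_. 0"], rule exI[of _ "%_. 1"], simp)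

lemma eig_up:
 assumes "eig z"
 shows "Ps j (n + 2) z = (z + 1 / z - B0 (tn (n + 1))) / A0 (tn (n + 1)) * Ps j (n + 1) z
 - C0 (tn (n + 1)) / A0 (tn (n + 1)) * Ps j n z"
proof -
 have "A0 (tn (n + 1)) * Ps j (n + 2) z + B0 (tn (n + 1)) * Ps j (n + 1) z
 + C0 (tn (n + 1)) * Ps j n z = (z + 1 / z) * Ps j (n + 1) z"
 using assms[unfolded eig_def, rule_format, of "n + 1" j] by (simp add: add.assoc)
 moreover have "A0 (tn (n + 1)) ~= 0" using coeffs(4) by auto
 ultimately show ?thesis by (intro solve_three_term)
qed

lemma inspan_up:
 assumes "eig z" "inspan z X" shows "inspan z (%j n. X j (n + 1))"
proof -
 from assms obtain u v where r: "rfun T u" "rfun T v"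
 and e: "!!j n. X j n = u (tn n) * Ps j n z + v (tn n) * Ps j (n + 1) z"
 unfolding inspan_def by metis
 have nz: "A0 (q * t) ~= 0" if "t \<in> T" for t using coeffs(4) T_mult[OF that] by blast
 have "rfun T (%t. - (C0 (q * t) / A0 (q * t)))"
 by (intro rfun_uminus rfun_divide rfun_up[OF coeffs(3)] rfun_up[OF coeffs(1)]) (rule nz)
 moreover have "rfun T (%t. (z + 1 / z - B0 (q * t)) / A0 (q * t))"
 by (intro rfun_divide rfun_diff rfun_up[OF coeffs(2)] rfun_up[OF coeffs(1)] rfun_const) (rule nz)
 moreover have "Ps j (n + 2) z = - (C0 (q * tn n) / A0 (q * tn n)) * Ps j n z +
 (z + 1 / z - B0 (q * tn n)) / A0 (q * tn n) * Ps j (n + 1) z" for j n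
 using eig_up[OF assms(1), of j n] by (simp only: tn_add1) (simp add: algebra_simps)
 ultimately have "inspan z (%j n. Ps j (n + 2) z)" unfolding inspan_def
 by (intro exI[of _ "%t. - (C0 (q * t) / A0 (q * t))"]
 exI[of _ "%t. (z + 1 / z - B0 (q * t)) / A0 (q * t)"] conjI allI)
 from inspan_lin[OF inspan_Ps(2) this rfun_up[OF r(1)] rfun_up[OF r(2)]] show ?thesis
 by (simp add: e tn_add1 add.assoc)
qed

lemma inspan_down:
 assumes "eig z" "inspan z X" shows "inspan z (%j n. X j (n - 1))"
proof -
 from assms obtain u v where r: "rfun T u" "rfun T v"
 and e: "!!j n. X j n = u (tn n) * Ps j n z + v (tn n) * Ps j (n + 1) z"
 unfolding inspan_def by metis
 have "Ps j (n - 1) z = (z + 1 / z - B0 (tn n)) / C0 (tn n) * Ps j n z - A0 (tn n) / C0 (tn n) * Ps j (n + 1) z"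
 for j n
 proof -
 have "C0 (tn n) ~= 0" using coeffs(5) by auto
 with assms(1)[unfolded eig_def, rule_format, of n j] show ?thesis
 by (intro solve_three_term) (simp_all add: add_ac)
 qed
 then have "inspan z (%j n. Ps j (n - 1) z)" unfolding inspan_def
 by (intro exI[of _ "%t. (z + 1 / z - B0 t) / C0 t"] exI[of _ "%t. - (A0 t / C0 t)"])
 (use coeffs in \<open>auto intro!: rfun_diff[OF rfun_const] rfun_divide rfun_uminus\<close>)
 from inspan_lin[OF this inspan_Ps(1) rfun_down[OF r(1)] rfun_down[OF r(2)]] show ?thesis
 by (simp add: e tn_diff1)
qed

lemma inspan_subst:
 assumes z: "eig z" "inspan z (%j n. Ps j n y)" and X: "inspan y X"
 shows "inspan z X"
proof -
 from X obtain u v where r: "rfun T u" "rfun T v"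
 and e: "!!j n. X j n = u (tn n) * Ps j n y + v (tn n) * Ps j (n + 1) y"
 unfolding inspan_def by metis
 from inspan_lin[OF z(2) inspan_up[OF z] r] show ?thesis by (simp add: e[abs_def])
qed

definition good :: "complex => bool" where
 "good z \<longleftrightarrow> (\<forall>i::int. eig (q powi i * z) & shiftable (q powi i * z))"

lemma generic_good: "generic good"
 unfolding good_def[abs_def] using q generic_eig generic_shiftable by (intro generic_orbit generic_conj)

text \<open>Each unit shift of \<open>z\<close> is a rational combination of two consecutive values,
  and the recurrence in \<open>n\<close> reduces iterated combinations to two consecutive values
  again.\<close>

lemma good_inspan:
 assumes "good z" shows "inspan z (%j n. Ps j n (q powi i * z))"
proof -
 have z: "eig z" using assms[unfolded good_def, rule_format, of 0] by simp
 show ?thesis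
 proof (induction i rule: int_induct[where k = 0])
 case base
 then show ?case using inspan_Ps by simp
 next
 case (step1 i)
 have "inspan (q powi i * z) (%j n. Ps j n (q * (q powi i * z)))"
 using assms by (auto simp: good_def shiftable_def)
 from inspan_subst[OF z step1(2) this] show ?case using q by (simp add: power_int_add mult_ac)
 next
 case (step2 i)
 have "inspan (q powi i * z) (%j n. Ps j n ((q powi i * z) / q))"
 using assms by (auto simp: good_def shiftable_def)
 from inspan_subst[OF z step2(2) this] show ?case using q by (simp add: power_int_diff mult_ac)
 qed
qed

lemma good_inspan': "good z ==> inspan (q powi i * z) X ==> inspan z X"
 using inspan_subst[OF _ good_inspan] unfolding good_def by (metis mult_1 power_int_0_right)

lemma tn_nat: "tn (int n) = t0 * q ^ n" by (simp add: tn_def)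

lemma rfun_tn_behaviour:
 assumes "rfun T f"
 obtains "!!t. t \<in> T ==> f t = 0"
 | k :: int and c where "c ~= 0" "(%n. f (tn (int n)) / tn (int n) powi k) \<longlonglongrightarrow> c"
proof -
 have "t0 * q ^ n \<in> T" for n using tn_T[of "int n"] by (simp add: tn_def)
 from rfun_leading_behaviour[OF q t0 this assms] show ?thesis using that by (simp add: tn_nat) blast
qed

lemma leading_shift:
 assumes "(%n. f (tn (int n)) / tn (int n) powi k) \<longlonglongrightarrow> c"
 shows "(%n. f (tn (int n + int m)) / tn (int n) powi k) \<longlonglongrightarrow> c * q powi (k * int m)"
proof -
 have "(%n. f (tn (int (n + m))) / tn (int (n + m)) powi k * q powi (k * int m)) \<longlonglongrightarrow> c * q powi (k * int m)"
 by (intro tendsto_mult_right LIMSEQ_ignore_initial_segment[OF assms, of m])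
 moreover have "tn (int (n + m)) powi k = tn (int n) powi k * q powi (k * int m)" for n
 proof -
 have "q powi (k * int m) = (q ^ m) powi k" by (metis mult.commute power_int_mult power_int_of_nat)
 then show ?thesis using q by (simp add: tn_def power_int_add power_int_mult_distrib)
 qed
 ultimately show ?thesis using q by (simp add: divide_simps)
qed

lemma coeff_limits:
 "(%n. 1 / A0 (tn (int n + int m))) \<longlonglongrightarrow> a" "(%n. B0 (tn (int n + int m))) \<longlonglongrightarrow> 0"
 "(%n. C0 (tn (int n + int m))) \<longlonglongrightarrow> a"
proof -
 note * = limits[folded tn_nat, THEN LIMSEQ_ignore_initial_segment, of m]
 have "(%n. 1 / A0 (tn (int (n + m)))) \<longlonglongrightarrow> 1 / (1 / a)"
 by (intro tendsto_intros *) (use a in auto)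
 then show "(%n. 1 / A0 (tn (int n + int m))) \<longlonglongrightarrow> a" by simp
 show "(%n. B0 (tn (int n + int m))) \<longlonglongrightarrow> 0" "(%n. C0 (tn (int n + int m))) \<longlonglongrightarrow> a"
 using *(2,3) by simp_all
qed

lemma quadratic_root:
 fixes z s :: complex
 assumes "z ~= 0" "s ^ 2 - s * (z + 1 / z) + 1 = 0" shows "z = s | z = 1 / s"
proof -
 have "z * (s ^ 2 - s * (z + 1 / z) + 1) = (z - s) * (1 - s * z)"
 using assms(1) by (simp add: field_simps sqr_eq)
 then have "z = s | s * z = 1" using assms by simp
 moreover have "s * z = 1 ==> z = 1 / s" by (metis mult_zero_left nonzero_mult_div_cancel_left zero_neq_one)
 ultimately show ?thesis by blast
qed

lemma powi_tendsto_0: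
 assumes "k > 0" shows "(%n. tn (int n) powi k) \<longlonglongrightarrow> 0"
proof -
 have "(%n. t0 * q ^ n) \<longlonglongrightarrow> 0" using LIMSEQ_power_zero[OF q(2)] by (rule tendsto_mult_right_zero)
 then have "(%n. (t0 * q ^ n) ^ nat k) \<longlonglongrightarrow> 0 ^ nat k" by (rule tendsto_power)
 then show ?thesis using assms by (simp add: tn_nat power_int_def zero_power)
qed

text \<open>Comparing leading powers of \<open>t\<close> as \<open>t\<close> tends to \<open>0\<close>: a nonzero solution would force \<open>z\<close> to be
 one of the exponents of the difference equation, a countable exceptional set.\<close>

lemma span_recurrence_trivial:
 assumes rho: "rfun T rho" "!!t. t \<in> T ==> rho t ~= 0"
 shows "generic (%z. ALL X. inspan z X --> (ALL j n. X j (n + 1) = rho (tn n) * X j n) --> (ALL j n. X j n = 0))"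
proof -
 obtain r :: int and d where d: "d ~= 0" and rlim: "(%n. rho (tn (int n)) / tn (int n) powi r) \<longlonglongrightarrow> d"
 using rfun_tn_behaviour[OF rho(1)] rho(2)[OF tn_T] tn_T by metis
 have nz: "tn (int n) ~= 0" for n using T_nz by blast
 \<comment> \<open>These numbers are the only candidates for \<open>z\<close> in the balanced case
   \<open>r = 0\<close> below; there are countably many because \<open>k\<close> is an
   integer.\<close>
 have exc: "generic (%z. \<forall>k::int. z ~= q powi k * a / d & z ~= 1 / (q powi k * a / d))"
 by (intro generic_all generic_conj generic_neq)
 have g: "generic (%z. eig z & (ALL n. Ps True n z * Ps False (n + 1) z ~= Ps True (n + 1) z * Ps False n z) & z ~= 0 &
 (\<forall>k::int. z ~= q powi k * a / d & z ~= 1 / (q powi k * a / d)))"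
 by (intro generic_conj generic_eig indep exc generic_neq)
 show ?thesis
 proof (rule generic_mono[OF g], elim conjE, intro allI impI)
 fix z X j n
 assume z: "eig z" "z ~= 0"
 and ind: "ALL n. Ps True n z * Ps False (n + 1) z ~= Ps True (n + 1) z * Ps False n z"
 and zex: "\<forall>k::int. z ~= q powi k * a / d & z ~= 1 / (q powi k * a / d)"
 and X: "inspan z X" "ALL j n. X j (n + 1) = rho (tn n) * X j n"
 from X(1) obtain u v where r: "rfun T u" "rfun T v"
 and e: "!!j n. X j n = u (tn n) * Ps j n z + v (tn n) * Ps j (n + 1) z"
 unfolding inspan_def by metis
 define x where "x = z + 1 / z"
 \<comment> \<open>Independence of the two solutions allows the coefficients of
   \<open>Ps j n z\<close> and \<open>Ps j (n + 1) z\<close> to be compared.\<close>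
 have rec: "u (tn (n + 1)) + v (tn (n + 1)) * ((x - B0 (tn (n + 1))) / A0 (tn (n + 1))) = rho (tn n) * v (tn n) &
 - v (tn (n + 1)) * (C0 (tn (n + 1)) / A0 (tn (n + 1))) = rho (tn n) * u (tn n)" for n
 proof -
 define p where "p = u (tn (n + 1)) + v (tn (n + 1)) * ((x - B0 (tn (n + 1))) / A0 (tn (n + 1))) - rho (tn n) * v (tn n)"
 define p' where "p' = - v (tn (n + 1)) * (C0 (tn (n + 1)) / A0 (tn (n + 1))) - rho (tn n) * u (tn n)"
 have "p' * Ps j n z + p * Ps j (n + 1) z = 0" for j
 proof -
 have "u (tn (n + 1)) * Ps j (n + 1) z + v (tn (n + 1)) * Ps j (n + 2) z =
 rho (tn n) * (u (tn n) * Ps j n z + v (tn n) * Ps j (n + 1) z)"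
 using X(2)[rule_format, of j n] by (simp add: e add.assoc)
 then show ?thesis unfolding eig_up[OF z(1)] p_def p'_def x_def by (simp add: algebra_simps)
 qed
 from this[of True] this[of False] have
 "p * (Ps True n z * Ps False (n + 1) z - Ps True (n + 1) z * Ps False n z) = 0"
 "p' * (Ps True n z * Ps False (n + 1) z - Ps True (n + 1) z * Ps False n z) = 0"
 by algebra+
 with ind have "p = 0" "p' = 0" by auto
 then show ?thesis by (simp add: p_def p'_def)
 qed
 have rho0: "rho (tn n) ~= 0" for n using rho(2) by auto
 \<comment> \<open>Eliminating \<open>u\<close> leaves a scalar second-order recurrence for the
   rational function \<open>v\<close>; its leading power decides everything.\<close>
 have main: "- (v (tn (n + 2)) * (C0 (tn (n + 2)) / A0 (tn (n + 2))))
 + rho (tn (n + 1)) * (v (tn (n + 1)) * ((x - B0 (tn (n + 1))) / A0 (tn (n + 1))))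
 = rho (tn (n + 1)) * rho (tn n) * v (tn n)" for n
 proof -
 have "- (v (tn (n + 2)) * (C0 (tn (n + 2)) / A0 (tn (n + 2)))) = rho (tn (n + 1)) * u (tn (n + 1))"
 using rec[of "n + 1"] by (simp add: add.assoc)
 moreover have "u (tn (n + 1)) + v (tn (n + 1)) * ((x - B0 (tn (n + 1))) / A0 (tn (n + 1))) = rho (tn n) * v (tn n)"
 using rec[of n] by blast
 ultimately show ?thesis by (metis distrib_left mult.assoc)
 qed
 show "X j n = 0" using r(2)
 proof (cases rule: rfun_tn_behaviour)
 case 1
 then have "v (tn n) = 0" for n by auto
 moreover from this have "u (tn n) = 0" for n using rec[of n] rho0[of n] by simp
 ultimately show ?thesis by (simp add: e)
 next
 case (2 k c)
 define V where "V m n = v (tn (int n + int m)) / tn (int n) powi k" for m n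
 define D where "D m n = rho (tn (int n + int m)) / tn (int n) powi r" for m n
 have Vl: "V m \<longlonglongrightarrow> c * q powi (k * int m)" for m
 unfolding V_def[abs_def] by (rule leading_shift[OF 2(2)])
 have Dl: "D m \<longlonglongrightarrow> d * q powi (r * int m)" for m
 unfolding D_def[abs_def] by (rule leading_shift[OF rlim])
 define A where "A m n = 1 / A0 (tn (int n + int m))" for m n
 define C where "C m n = C0 (tn (int n + int m))" for m n
 define B where "B m n = B0 (tn (int n + int m))" for m n
 define y where "y n = tn (int n) powi r" for n
 have y0: "y n ~= 0" for n using nz by (simp add: y_def)
 note lims = coeff_limits(1)[folded A_def[abs_def]] coeff_limits(2)[folded B_def[abs_def]]
 coeff_limits(3)[folded C_def[abs_def]]
 have ABC: "A m \<longlonglongrightarrow> a" "B m \<longlonglongrightarrow> 0" "C m \<longlonglongrightarrow> a" for m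
 using coeff_limits by (auto simp: A_def[abs_def] B_def[abs_def] C_def[abs_def])
 have eq: "- (V 2 n * (C 2 n * A 2 n)) + D 1 n * y n * (V 1 n * ((x - B 1 n) * A 1 n)) =
 D 1 n * y n * (D 0 n * y n) * V 0 n" for n
 proof -
 have "v (tn (int n + int m)) = V m n * tn (int n) powi k" "rho (tn (int n + int m)) = D m n * y n" for m
 using nz[of n] by (simp_all add: V_def D_def y_def)
 note this[of 0] this[of 1] this[of 2]
 with main[of "int n"] have "tn (int n) powi k * (- (V 2 n * (C 2 n * A 2 n)) + D 1 n * y n * (V 1 n * ((x - B 1 n) * A 1 n))) =
 tn (int n) powi k * (D 1 n * y n * (D 0 n * y n) * V 0 n)"
 by (simp add: A_def B_def C_def algebra_simps)
 then show ?thesis using nz[of n] by simp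
 qed
 \<comment> \<open>For \<open>r = 0\<close> the limit is the characteristic equation with root
   \<open>q powi k * a / d\<close>. For \<open>r > 0\<close> the first term of \<open>eq\<close>
   dominates, for \<open>r < 0\<close> its right-hand side, and a nonzero leading coefficient would
   have to vanish.\<close>
 have False
 proof (cases "r = 0")
 case True
 then have y1: "y n = 1" for n by (simp add: y_def)
 have "(%n. - (V 2 n * (C 2 n * A 2 n)) + D 1 n * (V 1 n * ((x - B 1 n) * A 1 n))) \<longlonglongrightarrow>
 - (c * q powi (k * 2) * (a * a)) + d * q powi (r * 1) * (c * q powi (k * 1) * ((x - 0) * a))"
 using Vl[of 2] Vl[of 1] Dl[of 1] by (intro tendsto_intros ABC) simp_all
 moreover have "(%n. D 1 n * D 0 n * V 0 n) \<longlonglongrightarrow> d * q powi (r * 1) * (d * q powi (r * 0)) * (c * q powi (k * 0))"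
 using Vl[of 0] Dl[of 1] Dl[of 0] by (intro tendsto_intros) simp_all
 ultimately have "- (c * q powi (k * 2) * (a * a)) + d * (c * q powi k * (x * a)) = d * d * c"
 using eq LIMSEQ_unique by (fastforce simp: y1 True)
 moreover have "q powi (k * 2) = (q powi k)\<^sup>2" by (simp add: power_int_mult)
 ultimately have "c * d^2 * ((q powi k * a / d)\<^sup>2 - (q powi k * a / d) * x + 1) = 0"
 proof -
 have "d^2 * ((q powi k * a / d)\<^sup>2 - (q powi k * a / d) * x + 1) = (q powi k * a)\<^sup>2 - d * (q powi k * a) * x + d^2"
 using d by (simp add: field_simps sqr_eq)
 moreover assume "- (c * q powi (k * 2) * (a * a)) + d * (c * q powi k * (x * a)) = d * d * c"
 "q powi (k * 2) = (q powi k)\<^sup>2"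
 ultimately show ?thesis by algebra
 qed
 then have "(q powi k * a / d)\<^sup>2 - (q powi k * a / d) * (z + 1 / z) + 1 = 0"
 using d \<open>c ~= 0\<close> by (simp add: x_def)
 from quadratic_root[OF z(2) this] zex show False by blast
 next
 case False
 show False
 proof (cases "r > 0")
 case True
 have yl: "y \<longlonglongrightarrow> 0" unfolding y_def[abs_def] using powi_tendsto_0[OF True] .
 have "(%n. V 2 n * (C 2 n * A 2 n)) \<longlonglongrightarrow> c * q powi (k * 2) * (a * a)"
 using Vl[of 2] by (intro tendsto_intros ABC) simp_all
 moreover have "(%n. D 1 n * y n * (V 1 n * ((x - B 1 n) * A 1 n)) - D 1 n * y n * (D 0 n * y n) * V 0 n) \<longlonglongrightarrow>
 d * q powi (r * 1) * 0 * (c * q powi (k * 1) * ((x - 0) * a)) - d * q powi (r * 1) * 0 * (d * q powi (r * 0) * 0) * (c * q powi (k * 0))"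
 using Vl[of 1] Vl[of 0] Dl[of 1] Dl[of 0] by (intro tendsto_intros ABC yl) simp_all
 moreover have "V 2 n * (C 2 n * A 2 n) = D 1 n * y n * (V 1 n * ((x - B 1 n) * A 1 n)) - D 1 n * y n * (D 0 n * y n) * V 0 n" for n
 using eq[of n] by algebra
 ultimately have "c * q powi (k * 2) * (a * a) = 0" using LIMSEQ_unique by fastforce
 then show False using \<open>c ~= 0\<close> a q by simp
 next
 case neg: False
 define y' where "y' n = tn (int n) powi (- r)" for n
 have yy: "y' n * y n = 1" for n using nz[of n] by (simp add: y_def y'_def power_int_minus)
 have yl: "y' \<longlonglongrightarrow> 0" unfolding y'_def[abs_def] using powi_tendsto_0[of "- r"] neg False by simp
 have "(%n. D 1 n * D 0 n * V 0 n) \<longlonglongrightarrow> d * q powi (r * 1) * (d * q powi (r * 0)) * (c * q powi (k * 0))"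
 using Vl[of 0] Dl[of 1] Dl[of 0] by (intro tendsto_intros) simp_all
 moreover have "(%n. - (V 2 n * (C 2 n * A 2 n)) * y' n * y' n + D 1 n * (V 1 n * ((x - B 1 n) * A 1 n)) * y' n) \<longlonglongrightarrow>
 - (c * q powi (k * 2) * (a * a)) * 0 * 0 + d * q powi (r * 1) * (c * q powi (k * 1) * ((x - 0) * a)) * 0"
 using Vl[of 2] Vl[of 1] Dl[of 1] by (intro tendsto_intros ABC yl) simp_all
 moreover have "- (V 2 n * (C 2 n * A 2 n)) * y' n * y' n + D 1 n * (V 1 n * ((x - B 1 n) * A 1 n)) * y' n = D 1 n * D 0 n * V 0 n" for n
 proof -
 have "- (V 2 n * (C 2 n * A 2 n)) * y' n * y' n + D 1 n * (V 1 n * ((x - B 1 n) * A 1 n)) * y' n =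
 y' n * y' n * (- (V 2 n * (C 2 n * A 2 n)) + D 1 n * y n * (V 1 n * ((x - B 1 n) * A 1 n)))"
 using yy[of n] by algebra
 also have "... = (y' n * y n) * (y' n * y n) * (D 1 n * D 0 n * V 0 n)" unfolding eq by (simp add: mult_ac)
 finally show ?thesis by (simp add: yy)
 qed
 ultimately have "d * q powi (r * 1) * (d * q powi (r * 0)) * (c * q powi (k * 0)) = 0" using LIMSEQ_unique by fastforce
 then show False using \<open>c ~= 0\<close> d q by simp
 qed
 qed
 then show ?thesis ..
 qed
 qed
qed

section \<open>What is carried through a Darboux step\<close>

definition extends :: "complex => (int => complex) => (complex => complex) => bool" where
 "extends w ps pst \<longleftrightarrow> (ALL n. pst (tn n) = ps n) & (EX s. (s = 1 | s = - 1) & (\<forall>t\<in>T. pst (w / t) = s * pst t)) &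
 (EX g p r. rfun T p & rfun T r &
 (\<forall>t\<in>T. r t ~= 0 & g t ~= 0 & g t = r t * g (t / q) & pst t = g t * p t))"

text \<open>The coefficient of \<open>h (n - 1)\<close> is the reflection of that of
  \<open>h (n + 1)\<close>. With a symmetric \<open>B\<close> the whole operator is invariant under
  \<open>t \<mapsto> w / t\<close>.\<close>

definition second_order :: "complex => (complex => complex) => (complex => complex) => lop" where
 "second_order w A B h n = A (tn n) * h (n + 1) + B (tn n) * h n + A (w / tn n) * h (n - 1)"

definition sym_op :: "complex => (complex => complex) => (complex => complex) => bool" where
 "sym_op w A B \<longleftrightarrow> (EX i. w = q ^ i * w0) & rfun T A & rfun T B & (\<forall>t\<in>T. A t ~= 0) &
 (\<forall>t\<in>T. B (w / t) = B t)"

definition eigenfamily ::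
 "complex => (complex => complex) => (complex => complex) => (bool => int => complex => complex) => bool" where
 "eigenfamily w A B Ph \<longleftrightarrow>
 generic (%z. ALL j n. second_order w A B (%n. Ph j n z) n = (z + 1 / z) * Ph j n z)"

text \<open>A Darboux step can lose multipliers, so only the multiples of some \<open>G\<close> are
  claimed. As \<open>G\<close> has no zeros on \<open>T\<close>, the ideal is nontrivial and a
  nonconstant eigenvalue can be found at the end.\<close>

definition has_zops :: "complex => (bool => int => complex => complex) => bool" where
 "has_zops w Ph \<longleftrightarrow> (EX G. (\<forall>t\<in>T. poly G (t + w / t) ~= 0) &
 (ALL m. EX B. zrel q B Ph (%j n z. poly (G * m) (tn n + w / tn n) * Ph j n z)))"

text \<open>After removal of a gauge factor in \<open>n\<close>, each transformed family stays
  inside the module of the original pair, where \<open>span_recurrence_trivial\<close>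
  applies.\<close>

definition gauge_span :: "(bool => int => complex => complex) => bool" where
 "gauge_span Ph \<longleftrightarrow> (EX g r. rfun T r & (\<forall>t\<in>T. r t ~= 0) & (ALL n. g n ~= 0 & g n = r (tn n) * g (n - 1)) &
 generic (%z. inspan z (%j n. Ph j n z / g n)))"

text \<open>All eigenfunctions at \<open>x\<close> have to extend because a Darboux step may start
  from any of them. In \<open>extends\<close> a sign is allowed since the Casoratian of symmetric
  functions is antisymmetric, and a gauge with rational ratio since at the points of
  \<open>K\<close> the solutions are obtained only up to such a factor.\<close>

definition eigen_ext ::
 "complex => (complex => complex) => (complex => complex) => complex => bool" where
 "eigen_ext w A B x \<longleftrightarrow>
 (\<forall>ps. (ALL n. second_order w A B ps n = x * ps n) --> (\<exists>pst. extends w ps pst))"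

definition stage ::
 "complex => (complex => complex) => (complex => complex) => (bool => int => complex => complex) =>
 complex set => bool" where
 "stage w A B Ph X \<longleftrightarrow> sym_op w A B & eigenfamily w A B Ph & has_zops w Ph & gauge_span Ph &
 (\<forall>x\<in>X. eigen_ext w A B x)"

text \<open>A Casorati determinant with \<open>ps\<close>, which therefore lies in the kernel.
  \<open>Pop\<close> is the complementary factor, with \<open>Pop Qop = L - x\<close>.\<close>

definition Qop :: "(int => complex) => lop" where
 "Qop ps h n = ps n * h (n - 1) - ps (n - 1) * h n"

definition Pop :: "complex => (complex => complex) => (int => complex) => lop" where
 "Pop w A ps h n = (A (w / tn n) * h n - A (tn n) * h (n + 1)) / ps n"

lemma Pop_Qop:
 assumes "second_order w A B ps n = x * ps n" "ps n ~= 0"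
 shows "Pop w A ps (Qop ps h) n = second_order w A B h n - x * h n"
proof -
 have "A (w / tn n) * Qop ps h n - A (tn n) * Qop ps h (n + 1) = ps n * (second_order w A B h n - x * h n)"
 using assms(1) by (simp add: second_order_def Qop_def) algebra
 then show ?thesis using assms(2) by (simp add: Pop_def)
qed

end

section \<open>One Darboux step\<close>

locale darboux_data = bispectral_pair +
 fixes w x :: complex and A B :: "complex => complex" and ps :: "int => complex" and pst :: "complex => complex"
 assumes sym: "sym_op w A B"
 and ps: "!!n. ps n ~= 0" "!!n. second_order w A B ps n = x * ps n" "extends w ps pst"
begin

definition rho :: "complex => complex" where "rho t = pst t / pst (t / q)"
text \<open>With \<open>rho (tn n) = ps n / ps (n - 1)\<close>, these are the coefficients of
  \<open>x + Qop Pop\<close>, as \<open>second_order'\<close> confirms.\<close>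

definition A' :: "complex => complex" where "A' t = A t / rho t"
definition B' :: "complex => complex" where "B' t = x - A (t / q) * rho t - A (w / t) / rho t"

lemma w: obtains i where "w = q ^ i * w0"
 using sym by (auto simp: sym_op_def)

lemma w_nz: "w ~= 0" using w w0 q by fastforce

lemma reflect: "t \<in> T ==> w / t \<in> T" using T_reflect w by metis

lemma reflect': assumes "t \<in> T" shows "q * w / t \<in> T"
 using reflect[OF T_div[OF assms]] by (simp add: mult.commute)

lemma reflect_reflect: "t \<in> T ==> w / (w / t) = t"
 using w_nz T_nz by auto

lemma pst_tn: "pst (tn n) = ps n" using ps(3) by (simp add: extends_def)

lemma pst_sym: obtains s where "s = 1 | s = - 1" "!!t. t \<in> T ==> pst (w / t) = s * pst t"
 using ps(3) unfolding extends_def by metis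

lemma pst_nz: assumes "t \<in> T" shows "pst t ~= 0"
proof -
 obtain s where s: "s = 1 | s = - 1" "!!t. t \<in> T ==> pst (w / t) = s * pst t" using pst_sym by blast
 from assms w obtain n where "t = tn n | t = w / tn n" by (metis T_cases)
 then show ?thesis using s(2)[OF tn_T[of n]] ps(1)[of n] s(1) by (auto simp: pst_tn)
qed

lemma rho_nz: "t \<in> T ==> rho t ~= 0" using pst_nz T_div by (simp add: rho_def)

text \<open>The gauge enters a quotient of consecutive values only through its own ratio, which is
  rational.\<close>

lemma rho_rfun: "rfun T rho"
proof -
 from ps(3) obtain g p r where p: "rfun T p" "rfun T r"
 and *: "!!t. t \<in> T ==> r t ~= 0 & g t ~= 0 & g t = r t * g (t / q) & pst t = g t * p t"
 unfolding extends_def by metis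
 have nz: "p t ~= 0" if "t \<in> T" for t using *[OF that] pst_nz[OF that] by auto
 have "rfun T (%t. r t * p t / p (t / q))"
 by (intro rfun_divide rfun_mult p rfun_down[OF p(1)]) (use nz T_div in blast)
 then show ?thesis
 proof (rule rfun_cong)
 fix t assume t: "t \<in> T"
 have 1: "pst t = r t * g (t / q) * p t" "pst (t / q) = g (t / q) * p (t / q)" "g (t / q) ~= 0"
 using *[OF t] *[OF T_div[OF t]] by metis+
 show "r t * p t / p (t / q) = rho t"
 unfolding rho_def 1(1,2) using 1(3) by simp
 qed
qed

text \<open>The origin of the new constant \<open>q * w\<close>: \<open>rho\<close> compares
  \<open>pst\<close> at \<open>t\<close> and \<open>t / q\<close>, and the reflection with constant
  \<open>w\<close> carries this pair to \<open>w / t\<close> and \<open>q * w / t\<close>, again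
  neighbours but in the opposite order. The sign of \<open>pst\<close> cancels.\<close>

lemma rho_reflect: assumes "t \<in> T" shows "rho (q * w / t) = 1 / rho t"
proof -
 obtain s where s: "s = 1 | s = - 1" "!!t. t \<in> T ==> pst (w / t) = s * pst t" using pst_sym by blast
 have "pst (q * w / t) = s * pst (t / q)" using s(2)[OF T_div[OF assms]] by (simp add: mult.commute)
 moreover have "pst (q * w / t / q) = s * pst t" using s(2)[OF assms] q by simp
 ultimately show ?thesis using s(1) pst_nz[OF assms] by (auto simp: rho_def)
qed

lemma rho_tn: "rho (tn n) = ps n / ps (n - 1)"
 by (simp add: rho_def pst_tn flip: tn_diff1)

lemma A_props: "rfun T A" "rfun T B" "t \<in> T ==> A t ~= 0" "t \<in> T ==> B (w / t) = B t"
 using sym by (auto simp: sym_op_def)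

lemma A_reflect: "rfun T (%t. A (w / t))"
 by (rule rfun_reflect[OF T_0 w_nz reflect A_props(1)])

lemma A'_tn: "A' (tn n) = A (tn n) * ps (n - 1) / ps n"
 by (simp add: A'_def rho_tn)

lemma A'_reflect: assumes "t \<in> T" shows "A' (q * w / t) = A (q * w / t) * rho t"
 by (simp add: A'_def rho_reflect[OF assms])

lemma A'_reflect_tn: "A' (q * w / tn n) = A (w / tn (n - 1)) * ps n / ps (n - 1)"
 by (simp add: A'_reflect rho_tn tn_diff1 mult.commute)

lemma B'_tn: "B' (tn n) = x - A (tn (n - 1)) * ps n / ps (n - 1) - A (w / tn n) * ps (n - 1) / ps n"
 by (simp add: B'_def rho_tn tn_diff1)

lemma sym_op': "sym_op (q * w) A' B'"
 unfolding sym_op_def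
proof (intro conjI ballI)
 obtain i where "w = q ^ i * w0" by (rule w)
 then show "EX i. q * w = q ^ i * w0" by (intro exI[of _ "Suc i"]) simp
 show "rfun T A'" unfolding A'_def[abs_def] by (intro rfun_divide A_props rho_rfun rho_nz)
 show "rfun T B'" unfolding B'_def[abs_def]
 by (intro rfun_diff[OF rfun_diff[OF rfun_const rfun_mult] rfun_divide] rfun_down A_props rho_rfun A_reflect rho_nz)
 fix t assume t: "t \<in> T"
 show "A' t ~= 0" using A_props(3) rho_nz t by (simp add: A'_def)
 have "w / (q * w / t) = t / q" "q * w / t / q = w / t" using w_nz q T_nz[OF t] by simp_all
 then show "B' (q * w / t) = B' t" by (simp add: B'_def rho_reflect[OF t])
qed

lemma second_order': "second_order (q * w) A' B' h n = x * h n + Qop ps (Pop w A ps h) n"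
 using ps(1)[of n] ps(1)[of "n - 1"]
 by (simp add: second_order_def A'_tn B'_tn A'_reflect_tn Qop_def Pop_def field_simps)

lemma Pop_Qop': "Pop w A ps (Qop ps h) n = second_order w A B h n - x * h n"
 by (rule Pop_Qop) (rule ps)+

lemma Qop_diff: "Qop ps (%n. c * h n - d * k n) n = c * Qop ps h n - d * Qop ps k n"
 by (simp add: Qop_def algebra_simps)

lemma Qop_scale: "Qop ps (%n. c * h n) n = c * Qop ps h n"
 by (simp add: Qop_def algebra_simps)

lemma Qop_intertwines:
 assumes "!!n. second_order w A B h n = y * h n"
 shows "second_order (q * w) A' B' (Qop ps h) n = y * Qop ps h n"
proof -
 have "Pop w A ps (Qop ps h) = (%n. y * h n - x * h n)"
 by (rule ext) (simp add: Pop_Qop' assms)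
 then show ?thesis unfolding second_order' by (simp add: Qop_diff)
qed

text \<open>For \<open>y ~= x\<close> the step is invertible on eigenfunctions:
  \<open>\<phi>\<close> is \<open>Qop\<close> applied to \<open>Pop \<phi> / (y - x)\<close>, an
  eigenfunction of the old operator, and the extension of the latter gives one of
  \<open>\<phi>\<close>. At \<open>y = x\<close> this breaks down, which is why a point is removed
  from the set once it has been added.\<close>

lemma eigen_ext':
 assumes ext: "eigen_ext w A B y" and "y ~= x"
 shows "eigen_ext (q * w) A' B' y"
 unfolding eigen_ext_def
proof (intro allI impI)
 fix \<phi> assume \<phi>: "ALL n. second_order (q * w) A' B' \<phi> n = y * \<phi> n"
 define h where "h n = Pop w A ps \<phi> n / (y - x)" for n
 have QP: "Qop ps (Pop w A ps \<phi>) = (%n. (y - x) * \<phi> n)"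
 proof
 fix n
 have "x * \<phi> n + Qop ps (Pop w A ps \<phi>) n = y * \<phi> n" using \<phi> unfolding second_order' by blast
 then show "Qop ps (Pop w A ps \<phi>) n = (y - x) * \<phi> n" by (simp add: algebra_simps)
 qed
 have h: "h = (%n. (1 / (y - x)) * Pop w A ps \<phi> n)" by (simp add: h_def[abs_def])
 have Qh: "Qop ps h = \<phi>"
 proof
 fix n
 have "Qop ps h n = 1 / (y - x) * Qop ps (Pop w A ps \<phi>) n" unfolding h by (rule Qop_scale)
 then show "Qop ps h n = \<phi> n" using assms(2) by (simp add: QP)
 qed
 have "second_order w A B h n = y * h n" for n
 proof -
 have "second_order w A B h n = x * h n + Pop w A ps \<phi> n" using Pop_Qop'[of h n] Qh by simp
 then show ?thesis using assms(2) by (simp add: h_def field_simps)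
 qed
 with ext obtain ht where ht: "extends w h ht" unfolding eigen_ext_def by metis
 then obtain s g p r where s: "s = 1 | s = - 1" "!!t. t \<in> T ==> ht (w / t) = s * ht t"
 and p: "rfun T p" "rfun T r"
 and *: "!!t. t \<in> T ==> r t ~= 0 & g t ~= 0 & g t = r t * g (t / q) & ht t = g t * p t"
 and htn: "!!n. ht (tn n) = h n"
 unfolding extends_def by metis
 obtain s' where s': "s' = 1 | s' = - 1" "!!t. t \<in> T ==> pst (w / t) = s' * pst t" using pst_sym by blast
 \<comment> \<open>The Casoratian of the two extensions at \<open>t\<close> and
   \<open>t / q\<close>. Under \<open>t \<mapsto> q * w / t\<close> these points change places,
   which gives the minus sign in \<open>- (s * s')\<close>; the new gauge is
   \<open>pst (t / q) * g (t / q)\<close>.\<close>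
 define \<phi>t where "\<phi>t t = pst t * ht (t / q) - pst (t / q) * ht t" for t
 have "extends (q * w) \<phi> \<phi>t" unfolding extends_def
 proof (intro conjI allI exI ballI)
 fix n
 have "\<phi>t (tn n) = Qop ps h n"
 by (simp add: \<phi>t_def pst_tn htn Qop_def flip: tn_diff1)
 then show "\<phi>t (tn n) = \<phi> n" by (simp add: Qh)
 next
 show "- (s * s') = 1 | - (s * s') = - 1" using s s' by auto
 fix t assume t: "t \<in> T"
 have e: "q * w / t = w / (t / q)" "q * w / t / q = w / t" using q by simp_all
 show "\<phi>t (q * w / t) = - (s * s') * \<phi>t t"
 unfolding \<phi>t_def e(2) unfolding e(1) s(2)[OF t] s'(2)[OF t] s(2)[OF T_div[OF t]] s'(2)[OF T_div[OF t]]
 by (simp add: algebra_simps)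
 next
 show "rfun T (%t. rho t * p (t / q) - r t * p t)"
 by (intro rfun_diff rfun_mult rho_rfun rfun_down[OF p(1)] p)
 show "rfun T (%t. rho (t / q) * r (t / q))"
 by (intro rfun_mult rfun_down[OF rho_rfun] rfun_down[OF p(2)])
 fix t assume t: "t \<in> T"
 note t' = T_div[OF t] T_div[OF T_div[OF t]]
 have "r (t / q) ~= 0" "g (t / q) ~= 0" using *[OF t'(1)] by blast+
 then show "rho (t / q) * r (t / q) ~= 0" "pst (t / q) * g (t / q) ~= 0"
 using rho_nz[OF t'(1)] pst_nz[OF t'(1)] by simp_all
 show "pst (t / q) * g (t / q) = rho (t / q) * r (t / q) * (pst (t / q / q) * g (t / q / q))"
 proof -
 have "g (t / q) = r (t / q) * g (t / q / q)" using *[OF t'(1)] by blast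
 moreover have "pst (t / q) = rho (t / q) * pst (t / q / q)" using pst_nz[OF t'(2)] by (simp add: rho_def)
 ultimately have "pst (t / q) * g (t / q) = (rho (t / q) * pst (t / q / q)) * (r (t / q) * g (t / q / q))"
 by (simp only:)
 then show ?thesis by (simp only: mult_ac)
 qed
 have "ht t = r t * g (t / q) * p t" "ht (t / q) = g (t / q) * p (t / q)"
 using *[OF t] *[OF t'(1)] by metis+
 then have "\<phi>t t = pst t * (g (t / q) * p (t / q)) - pst (t / q) * (r t * g (t / q) * p t)"
 by (simp add: \<phi>t_def)
 also have "pst t = rho t * pst (t / q)" using pst_nz[OF t'(1)] by (simp add: rho_def)
 finally show "\<phi>t t = pst (t / q) * g (t / q) * (rho t * p (t / q) - r t * p t)"
 by (simp add: algebra_simps)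
 qed
 then show "\<exists>pst. extends (q * w) \<phi> pst" by blast
qed

text \<open>Dividing by \<open>ps (n - 1) * g (n - 1)\<close> leaves the rational ratios
  \<open>rho\<close> and \<open>r\<close> as the coefficients of the two shifted terms.\<close>

lemma gauge_span':
 assumes "gauge_span Ph" shows "gauge_span (%j n z. Qop ps (%n. Ph j n z) n)"
proof -
 from assms obtain g r where *: "rfun T r" "\<forall>t\<in>T. r t ~= 0" "ALL n. g n ~= 0 & g n = r (tn n) * g (n - 1)"
 and span: "generic (%z. inspan z (%j n. Ph j n z / g n))" unfolding gauge_span_def by blast
 note r = *(1) bspec[OF *(2)]
 have g: "g n ~= 0" "g n = r (tn n) * g (n - 1)" for n using *(3) by blast+
 show ?thesis unfolding gauge_span_def
 proof (intro exI conjI ballI allI)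
 show "rfun T (%t. rho (t / q) * r (t / q))"
 by (intro rfun_mult rfun_down[OF rho_rfun] rfun_down[OF r(1)])
 show "rho (t / q) * r (t / q) ~= 0" if "t \<in> T" for t
 using r(2) rho_nz T_div[OF that] by simp
 show "ps (n - 1) * g (n - 1) ~= 0" for n using ps(1) g(1) by simp
 show "ps (n - 1) * g (n - 1) = rho (tn n / q) * r (tn n / q) * (ps (n - 1 - 1) * g (n - 1 - 1))" for n
 proof -
 have "rho (tn n / q) = ps (n - 1) / ps (n - 1 - 1)" "r (tn n / q) = r (tn (n - 1))"
 unfolding tn_diff1[symmetric] by (rule rho_tn, rule refl)
 moreover define k where "k = n - 1 - 1"
 ultimately have "rho (tn n / q) * r (tn n / q) * (ps k * g k) = ps (n - 1) * (r (tn (n - 1)) * g k)"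
 using ps(1)[of k] by simp
 then show ?thesis using g(2)[of "n - 1"] by (simp only: k_def)
 qed
 show "generic (%z. inspan z (%j n. Qop ps (%n. Ph j n z) n / (ps (n - 1) * g (n - 1))))"
 proof (rule generic_mono[OF generic_conj[OF span generic_eig]], elim conjE)
 fix z assume z: "inspan z (%j n. Ph j n z / g n)" "eig z"
 have "inspan z (%j n. rho (tn n) * (Ph j (n - 1) z / g (n - 1)) + (- r (tn n)) * (Ph j n z / g n))"
 by (intro inspan_lin[where f = rho and g = "%t. - r t"] inspan_down[OF z(2) z(1)] z rho_rfun rfun_uminus r)
 moreover have "rho (tn n) * (Ph j (n - 1) z / g (n - 1)) + (- r (tn n)) * (Ph j n z / g n) =
 Qop ps (%n. Ph j n z) n / (ps (n - 1) * g (n - 1))" for j n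
 proof -
 have "r (tn n) * (Ph j n z / g n) = Ph j n z / g (n - 1)"
 unfolding g(2)[of n] using r(2)[OF tn_T[of n]] by simp
 then have "(- r (tn n)) * (Ph j n z / g n) = - (Ph j n z / g (n - 1))" by simp
 then show ?thesis using ps(1)[of "n - 1"] ps(1)[of n] g(1)[of "n - 1"]
 by (simp only:) (simp add: Qop_def rho_tn field_simps)
 qed
 ultimately show "inspan z (%j n. Qop ps (%n. Ph j n z) n / (ps (n - 1) * g (n - 1)))" by simp
 qed
 qed
qed

lemma eigenfamily':
 assumes "eigenfamily w A B Ph" shows "eigenfamily (q * w) A' B' (%j n z. Qop ps (%n. Ph j n z) n)"
 using assms unfolding eigenfamily_def by (rule generic_mono) (auto intro: Qop_intertwines)

text \<open>A denominator times its reflection is a symmetric Laurent polynomial without zeros on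
  \<open>T\<close>, hence a polynomial in \<open>t + w / t\<close> by
  \<open>lau_symmetric\<close>.\<close>

lemma clear_denominators:
 assumes "rfun T F1" "rfun T F2"
 obtains D where "!!t. t \<in> T ==> poly D (t + w / t) ~= 0"
 "lau T (%t. poly D (t + w / t) * F1 t)" "lau T (%t. poly D (t + w / t) * F2 t)"
proof -
 obtain r1 where r1: "!!t. t \<in> T ==> poly r1 t ~= 0" "lau T (%t. poly r1 t * F1 t)"
 using rfun_clear_denominator[OF assms(1)] by blast
 obtain r2 where r2: "!!t. t \<in> T ==> poly r2 t ~= 0" "lau T (%t. poly r2 t * F2 t)"
 using rfun_clear_denominator[OF assms(2)] by blast
 define D where "D t = (poly r1 t * poly r1 (w / t)) * (poly r2 t * poly r2 (w / t))" for t
 have refl: "lau T (%t. poly r (w / t))" for r by (rule lau_poly_reflect[OF T_0])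
 have "lau T D" unfolding D_def[abs_def] by (intro lau_mult refl lau_poly)
 moreover have "D (w / t) = D t" if "t \<in> T" for t
 unfolding D_def reflect_reflect[OF that] by (simp only: mult_ac)
 ultimately obtain m where m: "!!t. t \<in> T ==> D t = poly m (t + w / t)"
 using lau_symmetric[OF T_0 w_nz reflect] by blast
 show ?thesis
 proof (rule that[of m])
 show "poly m (t + w / t) ~= 0" if "t \<in> T" for t
 using r1(1) r2(1) reflect that by (simp add: m[symmetric] D_def)
 have "lau T (%t. (poly r1 t * F1 t) * (poly r1 (w / t) * (poly r2 t * poly r2 (w / t))))"
 by (intro lau_mult r1(2) refl lau_poly)
 then show "lau T (%t. poly m (t + w / t) * F1 t)"
 by (rule lau_cong) (simp add: m[symmetric] D_def)
 have "lau T (%t. (poly r2 t * F2 t) * (poly r2 (w / t) * (poly r1 t * poly r1 (w / t))))"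
 by (intro lau_mult r2(2) refl lau_poly)
 then show "lau T (%t. poly m (t + w / t) * F2 t)"
 by (rule lau_cong) (simp add: m[symmetric] D_def)
 qed
qed

lemma zrel_second_order:
 assumes "zrel q Z Ph Ph'"
 shows "zrel q Z (%j n z. k n * second_order w A B (%n. Ph j n z) n)
 (%j n z. k n * second_order w A B (%n. Ph' j n z) n)"
proof -
 have 1: "zrel q Z (%j n z. A (tn n) * Ph j (n + 1) z + B (tn n) * Ph j n z)
 (%j n z. A (tn n) * Ph' j (n + 1) z + B (tn n) * Ph' j n z)"
 by (rule zrel_lincomb[OF zrel_shift[OF assms] assms])
 have 2: "zrel q Z (%j n z. k n * (A (tn n) * Ph j (n + 1) z + B (tn n) * Ph j n z)
 + (k n * A (w / tn n)) * Ph j (n + - 1) z)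
 (%j n z. k n * (A (tn n) * Ph' j (n + 1) z + B (tn n) * Ph' j n z)
 + (k n * A (w / tn n)) * Ph' j (n + - 1) z)"
 by (rule zrel_lincomb[OF 1 zrel_shift[OF assms]])
 then show ?thesis by (simp add: second_order_def algebra_simps)
qed

lemma zrel_Pop: "zrel q Z Ph Ph' ==>
 zrel q Z (%j n z. Pop w A ps (%n. Ph j n z) n) (%j n z. Pop w A ps (%n. Ph' j n z) n)"
 using zrel_lincomb[OF _ zrel_shift[of q Z Ph Ph' 1], of Ph Ph' "%n. A (w / tn n) / ps n" "%n. - A (tn n) / ps n"]
 by (simp add: Pop_def diff_divide_distrib)

text \<open>For polynomials \<open>a\<close>, \<open>b\<close> the operator \<open>G D a L G b\<close> is realised in \<open>z\<close>; by
 \<open>lau_induct_sym\<close> these products produce every Laurent coefficient in front of \<open>Ph (n + 1)\<close>.\<close>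

lemma zact_leading_coefficient:
 assumes eig: "eigenfamily w A B Ph"
 and G: "!!m. zact q Ph (%j n z. poly (G * m) (tn n + w / tn n) * Ph j n z)"
 and h: "lau T h"
 shows "EX S. zact q Ph (%j n z.
 poly (G * D) (tn n + w / tn n) * poly G (tn (n + 1) + w / tn (n + 1)) * h (tn n) * A (tn n) * Ph j (n + 1) z
 + poly (G * D) (tn n + w / tn n) * poly G (tn (n - 1) + w / tn (n - 1)) * h (w / tn n) * A (w / tn n) * Ph j (n - 1) z
 + poly (G * G * D) (tn n + w / tn n) * B (tn n) * poly S (tn n + w / tn n) * Ph j n z)" (is "?P h")
proof (rule lau_induct_sym[where P = ?P, OF T_0 q(1) q_sq w_nz h])
 fix f g assume f: "?P f" and eq: "!!t. t \<in> T ==> f t = g t"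
 have "f (tn n) = g (tn n)" "f (w / tn n) = g (w / tn n)" for n
 using eq reflect tn_T by blast+
 with f show "?P g" by simp
next
 fix f g assume "?P f" "?P g"
 then obtain S1 S2 where S: "zact q Ph (%j n z.
 poly (G * D) (tn n + w / tn n) * poly G (tn (n + 1) + w / tn (n + 1)) * f (tn n) * A (tn n) * Ph j (n + 1) z
 + poly (G * D) (tn n + w / tn n) * poly G (tn (n - 1) + w / tn (n - 1)) * f (w / tn n) * A (w / tn n) * Ph j (n - 1) z
 + poly (G * G * D) (tn n + w / tn n) * B (tn n) * poly S1 (tn n + w / tn n) * Ph j n z)"
 "zact q Ph (%j n z.
 poly (G * D) (tn n + w / tn n) * poly G (tn (n + 1) + w / tn (n + 1)) * g (tn n) * A (tn n) * Ph j (n + 1) z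
 + poly (G * D) (tn n + w / tn n) * poly G (tn (n - 1) + w / tn (n - 1)) * g (w / tn n) * A (w / tn n) * Ph j (n - 1) z
 + poly (G * G * D) (tn n + w / tn n) * B (tn n) * poly S2 (tn n + w / tn n) * Ph j n z)" by blast
 show "?P (%t. f t + g t)"
 by (rule exI[of _ "S1 + S2"], rule zact_cong_right[OF zact_add[OF S] generic_True q(1)])
 (simp add: algebra_simps)
next
 fix a b :: "complex poly"
 define X where "X j n z = (z + 1 / z) * (poly (G * (D * a)) (tn n + w / tn n) * Ph j n z)" for j n z
 have mer: "(%z::complex. z + 1 / z) meromorphic_on UNIV" by (intro meromorphic_intros)
 have 1: "zact q Ph X" unfolding X_def[abs_def] by (rule zact_comp[OF q(1) G zact_mult[OF mer]])
 have 2: "zact q Ph (%j n z. poly (G * (D * a)) (tn n + w / tn n) * second_order w A B (%n. Ph j n z) n)"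
 by (rule zact_cong_right[OF 1 generic_mono[OF eig[unfolded eigenfamily_def]] q(1)])
 (simp add: X_def)
 obtain Z where Z: "zrel q Z Ph (%j n z. poly (G * b) (tn n + w / tn n) * Ph j n z)"
 using G[of b] unfolding zact_def by blast
 have "zact q
 (%j n z. poly (G * (D * a)) (tn n + w / tn n) * second_order w A B (%n. Ph j n z) n)
 (%j n z. poly (G * (D * a)) (tn n + w / tn n) *
 second_order w A B (%n. poly (G * b) (tn n + w / tn n) * Ph j n z) n)"
 unfolding zact_def by (rule exI[of _ Z], rule zrel_second_order[OF Z])
 from zact_comp[OF q(1) 2 this] have 3: "zact q Ph (%j n z. poly (G * (D * a)) (tn n + w / tn n) *
 second_order w A B (%n. poly (G * b) (tn n + w / tn n) * Ph j n z) n)" .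
 have e: "q * (w / tn n) = w / tn (n - 1)" "w / (w / tn n) = tn n" "w / (w / tn (n - 1)) = tn (n - 1)" for n
 using q w_nz T_nz[OF tn_T[of n]] by (simp_all add: tn_diff1)
 show "?P (%t. poly a (t + w / t) * poly b (q * t + w / (q * t)))"
 by (rule exI[of _ "a * b"], rule zact_cong_right[OF 3 generic_True q(1)], intro allI)
 (simp only: second_order_def poly_mult e tn_add1[symmetric] add.commute[of "w / tn _" "tn _"],
 simp only: algebra_simps)
qed

text \<open>The multiplier \<open>\<mu>\<close> on the new family is reached through the old one:
  \<open>Pop \<mu> Qop\<close> is realised on \<open>Ph\<close>, where \<open>Pop Qop\<close> is
  multiplication by \<open>z + 1 / z - x\<close> and can be divided out. What remains is to cancel
  \<open>Pop\<close> on the left.\<close>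

lemma has_zops':
 assumes eig: "eigenfamily w A B Ph" and zops: "has_zops w Ph" and span: "gauge_span Ph"
 shows "has_zops (q * w) (%j n z. Qop ps (%n. Ph j n z) n)"
proof -
 define Ph' where "Ph' = (%j n z. Qop ps (%n. Ph j n z) n)"
 from zops obtain G where G0: "\<forall>t\<in>T. poly G (t + w / t) ~= 0"
 and G1: "ALL m. EX B. zrel q B Ph (%j n z. poly (G * m) (tn n + w / tn n) * Ph j n z)"
 unfolding has_zops_def by blast
 have Gz: "zact q Ph (%j n z. poly (G * m) (tn n + w / tn n) * Ph j n z)" for m
 unfolding zact_def using G1 by blast
 \<comment> \<open>Up to the multiplier and a sign, half of the diagonal coefficient of
   \<open>Pop \<mu> Qop\<close>: on the lattice \<open>F\<close> is
   \<open>A (tn n) * ps (n + 1) / ps n\<close>, and its reflection is the other half.\<close>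
 define F where "F t = A t * rho (q * t)" for t
 have F: "rfun T F" unfolding F_def[abs_def] by (intro rfun_mult A_props rfun_up rho_rfun)
 obtain D where D0: "!!t. t \<in> T ==> poly D (t + w / t) ~= 0"
 and D: "lau T (%t. poly D (t + w / t) * F t)" "lau T (%t. poly D (t + w / t) * B t)"
 using clear_denominators[OF F A_props(2)] by blast
 define g where "g t = poly G (t + w / t)" for t
 define d where "d t = poly D (t + w / t)" for t
 note D = D[folded d_def]
 have lau_refl: "lau T (%t. f (w / t))" if "lau T f" for f
 by (rule lau_reflect[OF T_0 w_nz reflect that])
 have inv: "lau T (%t. t + w / t)" by (intro lau_add T_0 lau_id lau_inverse_id)
 have lau_g: "lau T g" and lau_d: "lau T d"
 unfolding g_def[abs_def] d_def[abs_def] by (intro lau_poly_comp T_0 inv)+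
 have lau_up: "lau T (%t. f (q * t))" if "lau T f" for f
 by (rule lau_scale[OF that T_mult q(1)])
 have lau_down: "lau T (%t. f (t / q))" if "lau T f" for f
 using lau_scale[OF that T_div'] q(1) by (simp add: field_simps)
 have gd_sym: "g (w / t) = g t" "d (w / t) = d t" if "t \<in> T" for t
 using reflect_reflect[OF that] by (simp_all add: g_def d_def add.commute)
 have gd_nz: "g t ~= 0" "d t ~= 0" if "t \<in> T" for t using G0 D0 that by (simp_all add: g_def d_def)
 have refl': "q * w / t = w / (t / q)" "q * w / t / q = w / t" for t using q by simp_all
 \<comment> \<open>\<open>G'\<close> must be symmetric for the constant \<open>q * w\<close>. That
   reflection exchanges \<open>t\<close> and \<open>t / q\<close> up to the old reflection, so the
   product of the values of a symmetric function at both points qualifies.\<close>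
 have "EX G'. \<forall>t\<in>T. g (t / q) * g t * (d (t / q) * d t) = poly G' (t + q * w / t)"
 proof -
 have "lau T (%t. g (t / q) * g t * (d (t / q) * d t))"
 by (rule lau_mult[OF lau_mult[OF lau_down[OF lau_g] lau_g] lau_mult[OF lau_down[OF lau_d] lau_d]])
 moreover have "g (q * w / t / q) * g (q * w / t) * (d (q * w / t / q) * d (q * w / t)) =
 g (t / q) * g t * (d (t / q) * d t)" if "t \<in> T" for t
 unfolding refl'(2) unfolding refl'(1)
 using gd_sym[OF that] gd_sym[OF T_div[OF that]] by (simp add: mult_ac)
 moreover have "q * w ~= 0" using q w_nz by simp
 ultimately obtain m where "!!t. t \<in> T ==> g (t / q) * g t * (d (t / q) * d t) = poly m (t + q * w / t)"
 using lau_symmetric[OF T_0 _ reflect'] by blast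
 then show ?thesis by blast
 qed
 then obtain G' where G': "!!t. t \<in> T ==> poly G' (t + q * w / t) = g (t / q) * g t * (d (t / q) * d t)"
 by metis
 show ?thesis unfolding has_zops_def
 proof (intro exI[of _ G'] conjI ballI allI)
 show "poly G' (t + q * w / t) ~= 0" if "t \<in> T" for t
 using that T_div[OF that] gd_nz by (simp add: G')
 fix m
 define \<mu> where "\<mu> t = poly (G' * m) (t + q * w / t)" for t
 \<comment> \<open>Chosen so that \<open>\<mu> (q * t)\<close>, the multiplier in front of the term
   with \<open>n + 1\<close>, becomes \<open>g t * d t * g (q * t) * h t\<close>, the shape
   delivered by \<open>zact_leading_coefficient\<close>.\<close>
 define h where "h t = d (q * t) * poly m (q * t + w / t)" for t
 have h: "lau T h" unfolding h_def[abs_def]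
 by (rule lau_mult[OF lau_up[OF lau_d]
 lau_poly_comp[OF T_0 lau_add[OF T_0 lau_mult[OF lau_const lau_id] lau_inverse_id]]])
 have mu_up: "\<mu> (q * t) = g t * d t * g (q * t) * h t" if "t \<in> T" for t
 using G'[OF T_mult[OF that]] q by (simp add: \<mu>_def h_def mult_ac)
 have mu_refl: "\<mu> t = g t * d t * g (t / q) * h (w / t)" if "t \<in> T" for t
 proof -
 have "q * (w / t) = w / (t / q)" by simp
 then have "d (q * (w / t)) = d (t / q)" using gd_sym(2)[OF T_div[OF that]] by (simp add: mult.commute)
 then have "h (w / t) = d (t / q) * poly m (t + q * w / t)"
 using reflect_reflect[OF that] by (simp add: h_def add.commute)
 then show ?thesis using G'[OF that] by (simp add: \<mu>_def mult_ac)
 qed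
 obtain S where S: "zact q Ph (%j n z.
 poly (G * D) (tn n + w / tn n) * poly G (tn (n + 1) + w / tn (n + 1)) * h (tn n) * A (tn n) * Ph j (n + 1) z
 + poly (G * D) (tn n + w / tn n) * poly G (tn (n - 1) + w / tn (n - 1)) * h (w / tn n) * A (w / tn n) * Ph j (n - 1) z
 + poly (G * G * D) (tn n + w / tn n) * B (tn n) * poly S (tn n + w / tn n) * Ph j n z)"
 using zact_leading_coefficient[OF eig Gz h] by blast
 \<comment> \<open>What is still missing on the diagonal, divided by \<open>g t\<close>. It is
   Laurent because \<open>d\<close> clears the denominators, and symmetric, so one of the available
   multipliers provides it.\<close>
 define M where "M t = - (g (q * t) * h t * (d t * F t) + g (t / q) * h (w / t) * (d (w / t) * F (w / t)))
 - g t * (d t * B t) * poly S (t + w / t)" for t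
 have lauM: "lau T M" unfolding M_def[abs_def]
 by (rule lau_diff[OF T_0 lau_uminus[OF lau_add[OF T_0 lau_mult[OF lau_mult[OF lau_up[OF lau_g] h] D(1)]
 lau_mult[OF lau_mult[OF lau_down[OF lau_g] lau_refl[OF h]] lau_refl[OF D(1)]]]]
 lau_mult[OF lau_mult[OF lau_g D(2)] lau_poly_comp[OF T_0 inv]]])
 have symM: "M (w / t) = M t" if "t \<in> T" for t
 proof -
 have "g (q * (w / t)) = g (t / q)" using gd_sym(1)[OF T_div[OF that]] by (simp add: mult.commute)
 moreover have "g (w / t / q) = g (q * t)"
 using gd_sym(1)[OF T_mult[OF that]] q by (simp add: mult.commute)
 ultimately show ?thesis unfolding M_def
 using gd_sym[OF that] reflect_reflect[OF that] A_props(4)[OF that]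
 by (simp add: add.commute)
 qed
 obtain m' where m': "!!t. t \<in> T ==> M t = poly m' (t + w / t)"
 using lau_symmetric[OF T_0 w_nz reflect lauM symM] by blast
 \<comment> \<open>\<open>Pop \<mu> Qop Ph\<close> written out; the first summand is zero.\<close>
 define V where "V j n z = - Pop w A ps (%n. 0) n +
 (A (tn n) * \<mu> (tn (n + 1)) * Ph j (n + 1) z + A (w / tn n) * \<mu> (tn n) * Ph j (n - 1) z
 - (A (tn n) * \<mu> (tn (n + 1)) * ps (n + 1) + A (w / tn n) * \<mu> (tn n) * ps (n - 1)) / ps n * Ph j n z)" for j n z
 have Mval: "g (tn n) * M (tn n) + poly (G * G * D) (tn n + w / tn n) * B (tn n) * poly S (tn n + w / tn n)
 = - ((A (tn n) * \<mu> (tn (n + 1)) * ps (n + 1) + A (w / tn n) * \<mu> (tn n) * ps (n - 1)) / ps n)" for n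
 proof -
 have F1: "F (tn n) = A (tn n) * ps (n + 1) / ps n"
 by (simp add: F_def rho_tn flip: tn_add1)
 have "rho (q * (w / tn n)) = 1 / rho (tn n)" using rho_reflect[OF tn_T[of n]] by simp
 then have F2: "F (w / tn n) = A (w / tn n) * ps (n - 1) / ps n"
 by (simp add: F_def rho_tn)
 have mu: "\<mu> (tn (n + 1)) = g (tn n) * d (tn n) * g (q * tn n) * h (tn n)"
 "\<mu> (tn n) = g (tn n) * d (tn n) * g (tn n / q) * h (w / tn n)"
 using mu_up[OF tn_T] mu_refl[OF tn_T] by (simp_all add: tn_add1)
 have "poly (G * G * D) (tn n + w / tn n) = g (tn n) * g (tn n) * d (tn n)"
 by (simp add: g_def d_def)
 then show ?thesis unfolding M_def F1 F2 mu gd_sym(2)[OF tn_T]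
 by (simp add: algebra_simps add_divide_distrib)
 qed
 have "zact q Ph V"
 proof (rule zact_cong_right[OF zact_add[OF S Gz[of m']] generic_True q(1)], intro allI)
 fix z j n
 have mu: "\<mu> (tn (n + 1)) = g (tn n) * d (tn n) * g (tn (n + 1)) * h (tn n)"
 "\<mu> (tn n) = g (tn n) * d (tn n) * g (tn (n - 1)) * h (w / tn n)"
 using mu_up[OF tn_T] mu_refl[OF tn_T] by (simp_all add: tn_add1 tn_diff1)
 have "V j n z = A (tn n) * \<mu> (tn (n + 1)) * Ph j (n + 1) z + A (w / tn n) * \<mu> (tn n) * Ph j (n - 1) z
 + (g (tn n) * M (tn n) + poly (G * G * D) (tn n + w / tn n) * B (tn n) * poly S (tn n + w / tn n)) * Ph j n z"
 unfolding Mval by (simp add: V_def Pop_def)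
 then show "poly (G * D) (tn n + w / tn n) * poly G (tn (n + 1) + w / tn (n + 1)) * h (tn n) * A (tn n) * Ph j (n + 1) z
 + poly (G * D) (tn n + w / tn n) * poly G (tn (n - 1) + w / tn (n - 1)) * h (w / tn n) * A (w / tn n) * Ph j (n - 1) z
 + poly (G * G * D) (tn n + w / tn n) * B (tn n) * poly S (tn n + w / tn n) * Ph j n z
 + poly (G * m') (tn n + w / tn n) * Ph j n z = V j n z"
 unfolding mu by (simp add: m' g_def d_def algebra_simps)
 qed
 then obtain Z0 where Z0: "zrel q Z0 Ph V" by (auto simp: zact_def)
 have PV: "V j n z = Pop w A ps (%n. \<mu> (tn n) * Ph' j n z) n" for j n z
 using ps(1)[of n] by (simp add: V_def Pop_def Ph'_def Qop_def field_simps)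
 have mer: "(%z::complex. 1 / (z + 1 / z - x)) meromorphic_on UNIV" by (intro meromorphic_intros)
 define Y where "Y j n z = (z + 1 / z - x) * Ph j n z" for j n z
 obtain Z1 where Z1: "zrel q Z1 Y (%j n z. 1 / (z + 1 / z - x) * Y j n z)"
 using zact_mult[OF mer] by (auto simp: zact_def)
 have gx: "generic (%z. z + 1 / z - x ~= 0)"
 proof (rule generic_finite)
 have "{z. ~ z + 1 / z - x ~= 0} \<subseteq> insert 0 {z. poly [:1, - x, 1:] z = 0}"
 by (auto simp: field_simps)
 then show "finite {z. ~ z + 1 / z - x ~= 0}"
 by (rule finite_subset) (simp only: finite_insert, rule poly_roots_finite, simp)
 qed
 have Z1': "zrel q Z1 Y Ph"
 by (rule zrel_cong_right[OF Z1 generic_mono[OF gx] q(1)]) (auto simp: Y_def)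
 \<comment> \<open>\<open>Z\<close> divides by \<open>z + 1 / z - x\<close> and then applies
   \<open>Pop \<mu> Qop\<close>. As \<open>Y\<close> equals \<open>Pop Ph'\<close> for generic
   \<open>z\<close>, it carries \<open>Pop Ph'\<close> to \<open>Pop (\<mu> Ph')\<close>; and it
   commutes with \<open>Pop\<close>.\<close>
 define Z where "Z = zcomp q Z0 Z1"
 have ZY: "zrel q Z Y V" unfolding Z_def by (rule zrel_comp[OF q(1) Z1' Z0])
 have PQY: "generic (%z. ALL j n. Y j n z = Pop w A ps (%n. Ph' j n z) n)"
 by (rule generic_mono[OF eig[unfolded eigenfamily_def]])
 (simp add: Ph'_def Pop_Qop' Y_def algebra_simps)
 define U where "U j n z = qdiff_apply q Z (Ph' j n) z" for j n z
 have ZU: "zrel q Z Ph' U"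
 using ZY by (auto simp: zrel_def U_def intro: generic_True)
 have "generic (%z. (ALL j n. qdiff_apply q Z (Y j n) z = V j n z) &
 (ALL j n. qdiff_apply q Z (%z. Pop w A ps (%n. Ph' j n z) n) z = Pop w A ps (%n. U j n z) n) &
 (\<forall>i::int. ALL j n. Y j n (q powi i * z) = Pop w A ps (%n. Ph' j n (q powi i * z)) n))"
 using ZY zrel_Pop[OF ZU] PQY unfolding zrel_def by (intro generic_conj generic_orbit[OF q(1)]) auto
 then have PP: "generic (%z. ALL j n. Pop w A ps (%n. U j n z) n = Pop w A ps (%n. \<mu> (tn n) * Ph' j n z) n)"
 proof (rule generic_mono, intro allI, elim conjE)
 fix z j n
 assume 1: "ALL j n. qdiff_apply q Z (Y j n) z = V j n z"
 "ALL j n. qdiff_apply q Z (%z. Pop w A ps (%n. Ph' j n z) n) z = Pop w A ps (%n. U j n z) n"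
 "\<forall>i::int. ALL j n. Y j n (q powi i * z) = Pop w A ps (%n. Ph' j n (q powi i * z)) n"
 have "qdiff_apply q Z (Y j n) z = qdiff_apply q Z (%z. Pop w A ps (%n. Ph' j n z) n) z"
 by (simp add: qdiff_apply_def 1(3))
 then show "Pop w A ps (%n. U j n z) n = Pop w A ps (%n. \<mu> (tn n) * Ph' j n z) n"
 using 1(1,2) PV by simp
 qed
 from gauge_span'[OF span, folded Ph'_def] obtain gg r where
 *: "rfun T r" "\<forall>t\<in>T. r t ~= 0" "ALL n. gg n ~= 0 & gg n = r (tn n) * gg (n - 1)"
 "generic (%z. inspan z (%j n. Ph' j n z / gg n))" unfolding gauge_span_def by blast
 have gg: "gg n ~= 0" "gg (n + 1) = r (tn (n + 1)) * gg n" for n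
 using *(3)[rule_format, of n] *(3)[rule_format, of "n + 1"] by auto
 \<comment> \<open>The ratio of consecutive values of an element of the kernel of
   \<open>Pop\<close>, with the gauge removed.\<close>
 define R where "R t = A (w / t) / A t / r (q * t)" for t
 have R: "rfun T R" "!!t. t \<in> T ==> R t ~= 0"
 unfolding R_def using *(1,2) A_props(3) reflect T_mult
 by (intro rfun_divide A_reflect A_props rfun_up, auto)
 have mu_rfun: "rfun T \<mu>" unfolding \<mu>_def[abs_def]
 by (rule lau_rfun[OF T_0 lau_poly_comp[OF T_0 lau_add[OF T_0 lau_id lau_inverse_id]]])
 have "generic (%z. (ALL X. inspan z X --> (ALL j n. X j (n + 1) = R (tn n) * X j n) --> (ALL j n. X j n = 0)) &
 (ALL j n. Pop w A ps (%n. U j n z) n = Pop w A ps (%n. \<mu> (tn n) * Ph' j n z) n) & good z &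
 (\<forall>i::int. inspan (q powi i * z) (%j n. Ph' j n (q powi i * z) / gg n)))"
 by (intro generic_conj span_recurrence_trivial R PP generic_good generic_orbit[OF q(1)] *(4))
 then have "generic (%z. ALL j n. U j n z = \<mu> (tn n) * Ph' j n z)"
 proof (rule generic_mono, intro allI, elim conjE)
 fix z j n
 assume triv: "ALL X. inspan z X --> (ALL j n. X j (n + 1) = R (tn n) * X j n) --> (ALL j n. X j n = 0)"
 and P: "ALL j n. Pop w A ps (%n. U j n z) n = Pop w A ps (%n. \<mu> (tn n) * Ph' j n z) n"
 and z: "good z" and sp: "\<forall>i::int. inspan (q powi i * z) (%j n. Ph' j n (q powi i * z) / gg n)"
 have sp': "inspan z (%j n. Ph' j n (q powi i * z) / gg n)" for i
 using good_inspan'[OF z] sp by blast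
 \<comment> \<open>The defect lies in the kernel of \<open>Pop\<close>. It also lies in the span at
   \<open>z\<close>, since \<open>good_inspan'\<close> brings the values of \<open>Ph'\<close> at
   the shifted points back to \<open>z\<close>. So \<open>span_recurrence_trivial\<close> makes it
   vanish.\<close>
 define X where "X j n = (U j n z - \<mu> (tn n) * Ph' j n z) / gg n" for j n
 have "inspan z (%j n. 1 * (\<Sum>i\<in>qdiff_supp Z. Z i z * (Ph' j n (q powi i * z) / gg n)) +
 - \<mu> (tn n) * (Ph' j n z / gg n))"
 using sp'[of 0]
 by (intro inspan_lin[where f = "%_. 1" and g = "%t. - \<mu> t"] inspan_sum sp' rfun_uminus mu_rfun rfun_const)
 simp_all
 moreover have "1 * (\<Sum>i\<in>qdiff_supp Z. Z i z * (Ph' j n (q powi i * z) / gg n)) +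
 - \<mu> (tn n) * (Ph' j n z / gg n) = X j n" for j n
 by (simp add: X_def U_def qdiff_apply_def diff_divide_distrib sum_divide_distrib)
 ultimately have "inspan z X" by (simp add: X_def[abs_def])
 moreover have "X j (n + 1) = R (tn n) * X j n" for j n
 proof -
 have nz: "A (tn n) ~= 0" "r (tn (n + 1)) ~= 0" using A_props(3) *(2) by auto
 have "A (w / tn n) * (U j n z - \<mu> (tn n) * Ph' j n z) =
 A (tn n) * (U j (n + 1) z - \<mu> (tn (n + 1)) * Ph' j (n + 1) z)"
 using P[rule_format, of j n] ps(1)[of n] by (simp add: Pop_def algebra_simps)
 then have "U j (n + 1) z - \<mu> (tn (n + 1)) * Ph' j (n + 1) z =
 A (w / tn n) * (U j n z - \<mu> (tn n) * Ph' j n z) / A (tn n)"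
 using nz(1) by (metis nonzero_mult_div_cancel_left)
 then have "X j (n + 1) = A (w / tn n) * (U j n z - \<mu> (tn n) * Ph' j n z) / A (tn n) / (r (tn (n + 1)) * gg n)"
 unfolding X_def gg(2) by simp
 then show ?thesis by (simp add: X_def R_def tn_add1)
 qed
 ultimately have "X j n = 0" using triv by blast
 then show "U j n z = \<mu> (tn n) * Ph' j n z" using gg(1)[of n] by (simp add: X_def)
 qed
 from zrel_cong_right[OF ZU this q(1)] show "EX B. zrel q B (%j n z. Qop ps (%n. Ph j n z) n)
 (%j n z. poly (G' * m) (tn n + q * w / tn n) * Qop ps (%n. Ph j n z) n)"
 unfolding Ph'_def \<mu>_def by blast
 qed
qed

lemma stage_step:
 assumes "stage w A B Ph X"
 shows "stage (q * w) A' B' (%j n z. Qop ps (%n. Ph j n z) n) (X - {x})"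
 using assms unfolding stage_def
 by (auto intro!: sym_op' eigenfamily' has_zops' gauge_span' eigen_ext')

end

section \<open>Chains of Darboux transformations\<close>

lemma int_antidifference:
 fixes g :: "int => complex" obtains F where "!!n. F n - F (n - 1) = g n"
proof
 fix n :: int
 define F where "F n = (\<Sum>i\<in>{1..n}. g i) - (\<Sum>i\<in>{n + 1..0}. g i)" for n :: int
 show "F n - F (n - 1) = g n"
 proof (cases "n >= 1")
 case True
 then have "{1..n} = insert n {1..n - 1}" by auto
 with True show ?thesis by (simp add: F_def)
 next
 case False
 then have "{n..0} = insert n {n + 1..0}" by auto
 with False show ?thesis by (simp add: F_def)
 qed
qed

lemma first_order_lincomb:
 assumes "first_order_operator Q"
 shows "Q (%n. c * h n + d * k n) n = c * Q h n + d * Q k n"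
 using assms by (auto simp: first_order_operator_def algebra_simps)

lemma first_order_tendsto:
 assumes "first_order_operator Q" "!!m. ((%z. h z m) \<longlongrightarrow> l m) F"
 shows "((%z. Q (h z) n) \<longlongrightarrow> Q l n) F"
proof -
 from assms(1) obtain i u v where Q: "ALL h n. Q h n = u n * h (n + i + 1) + v n * h (n + i)"
 unfolding first_order_operator_def by blast
 show ?thesis unfolding Q[rule_format] by (intro tendsto_intros assms(2))
qed

lemma chain_lincomb:
 assumes "darboux_chain xs L \<Q> L'"
 shows "\<Q> (%n. c * h n + d * k n) n = c * \<Q> h n + d * \<Q> k n"
 using assms
proof (induction arbitrary: h k n rule: darboux_chain.induct)
 case (Cons x L Q L1 xs \<Q> L2)
 then have "first_order_operator Q" by (auto simp: darboux_step_def)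
 from first_order_lincomb[OF this, of c h d k]
 have "Q (%n. c * h n + d * k n) = (%n. c * Q h n + d * Q k n)" by (intro ext)
 then show ?case by (simp add: Cons.IH)
qed simp

text \<open>A value of the image involves only finitely many values of the argument, so pointwise
  limits pass through.\<close>

lemma chain_tendsto:
 assumes "darboux_chain xs L \<Q> L'" "!!m. ((%z. h z m) \<longlongrightarrow> l m) F"
 shows "((%z. \<Q> (h z) n) \<longlongrightarrow> \<Q> l n) F"
 using assms
proof (induction arbitrary: h l n rule: darboux_chain.induct)
 case (Cons x L Q L1 xs \<Q> L2)
 then have "first_order_operator Q" by (auto simp: darboux_step_def)
 from first_order_tendsto[OF this Cons.prems] show ?case by (intro Cons.IH)
qed simp

lemma darboux_step_intertwines:
 assumes "darboux_step x L Q L'" "!!n. L h n = y * h n"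
 shows "L' (Q h) n = y * Q h n" "(!!n. Q h n = 0) ==> y ~= x ==> h n = 0"
proof -
 from assms(1) obtain P where Q: "first_order_operator Q" and P: "difference_operator P"
 and L: "ALL h n. L h n = x * h n + P (Q h) n" "ALL h n. L' h n = x * h n + Q (P h) n"
 unfolding darboux_step_def by blast
 have PQ: "P (Q h) = (%n. (y - x) * h n + 0 * h n)"
 using assms(2) L(1) by (intro ext) (simp add: algebra_simps)
 show "L' (Q h) n = y * Q h n"
 unfolding L(2)[rule_format] PQ first_order_lincomb[OF Q] by (simp add: algebra_simps)
 assume "!!n. Q h n = 0" "y ~= x"
 then have "Q h = (%_. 0)" by (intro ext)
 moreover have "P (%_. 0) n = 0" using P by (auto simp: difference_operator_def)
 ultimately have "(y - x) * h n = 0" using PQ by (metis (no_types, lifting) add.right_neutral mult_zero_left)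
 with \<open>y ~= x\<close> show "h n = 0" by simp
qed

lemma chain_intertwines:
 assumes "darboux_chain xs L \<Q> L'" "!!n. L h n = y * h n"
 shows "L' (\<Q> h) n = y * \<Q> h n"
 using assms
proof (induction arbitrary: h n rule: darboux_chain.induct)
 case (Cons x L Q L1 xs \<Q> L2)
 from darboux_step_intertwines(1)[OF Cons.hyps(1) Cons.prems] show ?case by (intro Cons.IH)
qed simp

text \<open>By \<open>L = x + P Q\<close>, a nonzero eigenfunction killed by \<open>Q\<close> has
  eigenvalue \<open>x\<close>. This keeps the transformed solutions independent at the end.\<close>

lemma chain_injective:
 assumes "darboux_chain xs L \<Q> L'" "!!n. L h n = y * h n" "y \<notin> set xs" "!!n. \<Q> h n = 0"
 shows "h n = 0"
 using assms
proof (induction arbitrary: h n rule: darboux_chain.induct)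
 case (Cons x L Q L1 xs \<Q> L2)
 have "Q h n = 0" for n
 by (rule Cons.IH[OF darboux_step_intertwines(1)[OF Cons.hyps(1) Cons.prems(1)]]) (use Cons.prems in auto)
 then show ?case using darboux_step_intertwines(2)[OF Cons.hyps(1) Cons.prems(1)] Cons.prems(2) by auto
qed simp

text \<open>Neither coefficient has a zero, so a kernel element that vanishes once vanishes at both
  neighbours.\<close>

lemma first_order_kernel_nonzero:
 assumes "first_order_operator Q" "!!n. Q ps n = 0" "ps m ~= 0" shows "ps n ~= 0"
proof -
 from assms(1) obtain i u v where uv: "ALL n. u n ~= 0 & v n ~= 0"
 and Q: "ALL h n. Q h n = u n * h (n + i + 1) + v n * h (n + i)"
 unfolding first_order_operator_def by blast
 have iff: "ps (n + 1) ~= 0 \<longleftrightarrow> ps n ~= 0" for n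
 using assms(2)[of "n - i"] uv[rule_format, of "n - i"] unfolding Q[rule_format]
 by (auto simp: add.commute)
 show ?thesis
 proof (induction n rule: int_induct[where k = m])
 case base show ?case by (rule assms)
 next
 case (step1 i) then show ?case using iff by blast
 next
 case (step2 i) then show ?case using iff[of "i - 1"] by simp
 qed
qed

text \<open>The operators \<open>Q\<close> of a chain are not normalised and agree with
  \<open>Qop\<close> only up to a factor and a shift in \<open>n\<close>. \<open>gtrans\<close>
  collects both, and the chain is compared with its normal form through it.\<close>

definition gtrans :: "(int => complex) => int => lop" where
 "gtrans k s h n = k n * h (n + s)"

context bispectral_pair
begin

text \<open>Up to factor and shift a first-order operator is determined by its kernel, so
  \<open>Q\<close> is \<open>Qop\<close> for the transported eigenfunction \<open>ps\<close>. The
  operator \<open>P\<close> is only assumed to exist; surjectivity of \<open>Qop\<close> identifies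
  it.\<close>

lemma stage_darboux_step:
 assumes step: "darboux_step x L Q L1" and st: "stage w A B Ph X" and x: "x \<in> X"
 and k: "!!n. k n ~= 0" and L: "!!h n. L (gtrans k s h) n = gtrans k s (second_order w A B h) n"
 obtains w' A' B' Ph' k' s' where "stage w' A' B' Ph' (X - {x})" "!!n. k' n ~= 0"
 "!!h n. L1 (gtrans k' s' h) n = gtrans k' s' (second_order w' A' B' h) n"
 "!!j z. Q (gtrans k s (%n. Ph j n z)) = gtrans k' s' (%n. Ph' j n z)"
proof -
 from step obtain ps0 P where ps0: "EX n. ps0 n ~= 0" "ALL n. L ps0 n = x * ps0 n"
 and Q: "first_order_operator Q" and ker: "{h. ALL n. Q h n = 0} = {h. EX k. ALL n. h n = k * ps0 n}"
 and LPQ: "ALL h n. L h n = x * h n + P (Q h) n" "ALL h n. L1 h n = x * h n + Q (P h) n"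
 unfolding darboux_step_def by blast
 from Q obtain i u v where uv: "ALL n. u n ~= 0 & v n ~= 0"
 and Q': "ALL h n. Q h n = u n * h (n + i + 1) + v n * h (n + i)"
 unfolding first_order_operator_def by blast
 have "ps0 \<in> {h. EX k. ALL n. h n = k * ps0 n}" by (auto intro: exI[of _ 1])
 then have Q0: "Q ps0 n = 0" for n using ker by blast
 then have nz0: "ps0 n ~= 0" for n using first_order_kernel_nonzero[OF Q] ps0(1) by blast
 define ps where "ps n = ps0 (n - s) / k (n - s)" for n
 have gps: "gtrans k s ps = ps0" using k by (intro ext) (simp add: gtrans_def ps_def)
 have nz: "ps n ~= 0" for n using nz0 k by (simp add: ps_def)
 have ev: "second_order w A B ps n = x * ps n" for n
 proof -
 have "gtrans k s (second_order w A B ps) (n - s) = x * gtrans k s ps (n - s)"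
 using L[of ps "n - s"] ps0(2) by (simp add: gps)
 then show ?thesis using k by (simp add: gtrans_def)
 qed
 from st x have "eigen_ext w A B x" by (simp add: stage_def)
 with ev obtain pst where pst: "extends w ps pst" unfolding eigen_ext_def by blast
 interpret darboux_data q t0 w0 a Ps A0 B0 C0 T w x A B ps pst
 by unfold_locales (use st nz ev pst in \<open>auto simp: stage_def\<close>)
 \<comment> \<open>Read off from the higher shift in \<open>Q\<close>; the lower coefficient then
   agrees because \<open>Q\<close> kills \<open>ps0\<close>.\<close>
 define k' where "k' n = - (u n * k (n + i + 1) / ps (n + i + s))" for n
 define s' where "s' = i + 1 + s"
 have k': "k' n ~= 0" for n using uv k nz by (simp add: k'_def)
 have Qg: "Q (gtrans k s h) = gtrans k' s' (Qop ps h)" for h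
 proof
 fix n
 have "u n * (k (n + i + 1) * ps (n + i + 1 + s)) + v n * (k (n + i) * ps (n + i + s)) = 0"
 using Q0[of n] unfolding gps[symmetric] Q'[rule_format] by (simp add: gtrans_def)
 then have "u n * (k (n + i + 1) * ps (n + i + 1 + s)) = - (v n * (k (n + i) * ps (n + i + s)))"
 by (simp add: add_eq_0_iff2)
 then have e: "u n * k (n + i + 1) / ps (n + i + s) * ps (n + i + 1 + s) = - (v n * k (n + i))"
 using nz[of "n + i + s"] by (simp add: field_simps)
 have "gtrans k' s' (Qop ps h) n = - (u n * k (n + i + 1) / ps (n + i + s) * ps (n + i + 1 + s)) * h (n + i + s)
 + u n * k (n + i + 1) / ps (n + i + s) * ps (n + i + s) * h (n + i + 1 + s)"
 by (simp add: gtrans_def Qop_def k'_def s'_def algebra_simps)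
 also have "... = v n * k (n + i) * h (n + i + s) + u n * k (n + i + 1) * h (n + i + 1 + s)"
 unfolding e using nz[of "n + i + s"] by simp
 also have "... = Q (gtrans k s h) n" unfolding Q'[rule_format] by (simp add: gtrans_def)
 finally show "Q (gtrans k s h) n = gtrans k' s' (Qop ps h) n" ..
 qed
 have L1: "L1 (gtrans k' s' h) n = gtrans k' s' (second_order (q * w) A' B' h) n" for h n
 proof -
 \<comment> \<open>Surjectivity of \<open>Qop\<close>: on \<open>ps * F\<close> the Casoratian is a
   multiple of the difference of \<open>F\<close>, which can be prescribed.\<close>
 obtain F where F: "!!n. F n - F (n - 1) = - h n / (ps n * ps (n - 1))"
 using int_antidifference[of "%n. - h n / (ps n * ps (n - 1))"] by blast
 have h: "h = Qop ps (%n. ps n * F n)"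
 proof
 fix n
 have "Qop ps (%n. ps n * F n) n = - (ps n * ps (n - 1)) * (F n - F (n - 1))"
 by (simp add: Qop_def algebra_simps)
 also have "... = h n" unfolding F using nz[of n] nz[of "n - 1"] by simp
 finally show "h n = Qop ps (%n. ps n * F n) n" ..
 qed
 define f where "f n = ps n * F n" for n
 have hf: "gtrans k' s' h = Q (gtrans k s f)" unfolding Qg h f_def[abs_def] ..
 have "P (Q (gtrans k s f)) = gtrans k s (Pop w A ps h)"
 proof
 fix n
 have "P (Q (gtrans k s f)) n = L (gtrans k s f) n - x * gtrans k s f n" using LPQ(1) by simp
 also have "... = k n * (second_order w A B f (n + s) - x * f (n + s))"
 unfolding L by (simp add: gtrans_def algebra_simps)
 also have "... = k n * Pop w A ps (Qop ps f) (n + s)" unfolding Pop_Qop' ..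
 also have "Qop ps f = h" unfolding h f_def[abs_def] ..
 finally show "P (Q (gtrans k s f)) n = gtrans k s (Pop w A ps h) n" unfolding gtrans_def[of k s "Pop w A ps h" n] .
 qed
 then have "L1 (gtrans k' s' h) n = x * gtrans k' s' h n + gtrans k' s' (Qop ps (Pop w A ps h)) n"
 unfolding LPQ(2)[rule_format] by (simp add: hf flip: Qg)
 then show ?thesis by (simp add: gtrans_def second_order' algebra_simps)
 qed
 show ?thesis
 by (rule that[OF stage_step[OF st] k' L1 Qg])
qed

lemma stage_darboux_chain:
 assumes "darboux_chain xs L \<Q> L'" "stage w A B Ph X" "set xs \<subseteq> X" "distinct xs"
 "!!n. k n ~= 0" "!!h n. L (gtrans k s h) n = gtrans k s (second_order w A B h) n"
 shows "\<exists>w' A' B' Ph' X' k' s'. stage w' A' B' Ph' X' &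
 (ALL j z. \<Q> (gtrans k s (%n. Ph j n z)) = gtrans k' s' (%n. Ph' j n z))"
 using assms
proof (induction arbitrary: w A B Ph X k s rule: darboux_chain.induct)
 case (Nil L)
 then show ?case by blast
next
 case (Cons x L Q L1 xs \<Q> L2)
 have "x \<in> X" using Cons.prems by auto
 from stage_darboux_step[OF Cons.hyps(1) Cons.prems(1) this Cons.prems(4,5)]
 obtain w' A' B' Ph' k' s' where *: "stage w' A' B' Ph' (X - {x})" "!!n. k' n ~= 0"
 "!!h n. L1 (gtrans k' s' h) n = gtrans k' s' (second_order w' A' B' h) n"
 "!!j z. Q (gtrans k s (%n. Ph j n z)) = gtrans k' s' (%n. Ph' j n z)" by metis
 have "set xs \<subseteq> X - {x}" "distinct xs" using Cons.prems by auto
 from Cons.IH[OF *(1) this *(2,3)] show ?case unfolding *(4) .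
qed

text \<open>\<open>\<Lambda>\<close> is not constant: of the two eigenvalues \<open>G\<close> and \<open>G (t + w / t)\<close> at least one is not.\<close>

lemma stage_bispectral:
 assumes "stage w A B Ph X"
 obtains Z \<Lambda> where "zrel q Z Ph (%j n z. \<Lambda> n * Ph j n z)" "EX n n'. \<Lambda> n ~= \<Lambda> n'"
proof -
 from assms obtain G i where G: "\<forall>t\<in>T. poly G (t + w / t) ~= 0"
 and Z: "ALL m. EX B. zrel q B Ph (%j n z. poly (G * m) (tn n + w / tn n) * Ph j n z)"
 and w: "w = q ^ i * w0"
 unfolding stage_def has_zops_def sym_op_def by blast
 define ev where "ev n = tn n + w / tn n" for n
 \<comment> \<open>Otherwise infinitely many lattice points would be roots of one quadratic
   polynomial.\<close>
 have "EX n. ev n ~= ev 0"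
 proof (rule ccontr)
 assume "~ ?thesis"
 then have all: "ev n = ev 0" for n by blast
 have "poly [:w, - ev 0, 1:] (tn n) = 0" for n
 using all[of n] T_nz[OF tn_T[of n]] unfolding ev_def[of n] by (simp add: field_simps)
 then have "range tn \<subseteq> {t. poly [:w, - ev 0, 1:] t = 0}" by auto
 then have "finite (range tn)" by (rule finite_subset) (rule poly_roots_finite, simp)
 moreover have "inj tn"
 proof (rule injI)
 fix n m assume "tn n = tn m"
 then have "norm (q powi n) = norm (q powi m)" using t0 by (simp add: tn_def)
 then have "norm q powi n = norm q powi m" by (simp add: norm_power_int)
 then show "n = m" using q
 by (smt (verit, best) power_int_strict_decreasing zero_less_norm_iff)
 qed
 ultimately show False using infinite_UNIV_int finite_imageD by blast
 qed
 then obtain n where n: "ev n ~= ev 0" ..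
 show ?thesis
 proof (cases "poly G (ev n) = poly G (ev 0)")
 case False
 obtain B where "zrel q B Ph (%j n z. poly (G * 1) (tn n + w / tn n) * Ph j n z)" using Z by blast
 with False show ?thesis by (intro that[of B "%n. poly (G * 1) (tn n + w / tn n)"]) (auto simp: ev_def)
 next
 case True
 obtain B where "zrel q B Ph (%j n z. poly (G * [:0, 1:]) (tn n + w / tn n) * Ph j n z)" using Z by blast
 moreover have "poly (G * [:0, 1:]) (ev n) ~= poly (G * [:0, 1:]) (ev 0)"
 using True n G by (simp add: ev_def)
 ultimately show ?thesis by (intro that[of B "%n. poly (G * [:0, 1:]) (tn n + w / tn n)"]) (auto simp: ev_def)
 qed
qed

lemma chain_bispectral:
 assumes "darboux_chain xs L \<Q> L'" "stage w A B Ps X" "set xs \<subseteq> X" "distinct xs"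
 "!!h n. L h n = second_order w A B h n"
 obtains Z \<Lambda> where "zrel q Z (%j n z. \<Q> (%k. Ps j k z) n) (%j n z. \<Lambda> n * \<Q> (%k. Ps j k z) n)"
 "EX n n'. \<Lambda> n ~= \<Lambda> n'"
proof -
 have id: "gtrans (%_. 1) 0 h = h" for h by (simp add: gtrans_def fun_eq_iff)
 obtain w' A' B' Ph' X' k' s' where st: "stage w' A' B' Ph' X'"
 and Q: "!!j z. \<Q> (%n. Ps j n z) = gtrans k' s' (%n. Ph' j n z)"
 using stage_darboux_chain[OF assms(1-4), of "%_. 1" 0] assms(5) unfolding id by auto
 from stage_bispectral[OF st] obtain Z \<Lambda> where Z: "zrel q Z Ph' (%j n z. \<Lambda> n * Ph' j n z)"
 and nc: "EX n n'. \<Lambda> n ~= \<Lambda> n'" by blast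
 have "zrel q Z (%j n z. k' n * Ph' j (n + s') z + 0 * Ph' j (n + s') z)
 (%j n z. k' n * (\<Lambda> (n + s') * Ph' j (n + s') z) + 0 * (\<Lambda> (n + s') * Ph' j (n + s') z))"
 by (rule zrel_lincomb[OF zrel_shift[OF Z, of s'] zrel_shift[OF Z, of s']])
 then have "zrel q Z (%j n z. \<Q> (%k. Ps j k z) n) (%j n z. \<Lambda> (n + s') * \<Q> (%k. Ps j k z) n)"
 unfolding Q by (simp add: gtrans_def mult_ac)
 moreover from nc obtain n n' where "\<Lambda> (n - s' + s') ~= \<Lambda> (n' - s' + s')" by auto
 ultimately show ?thesis by (intro that[of Z "%n. \<Lambda> (n + s')"]) blast+
qed

end

section \<open>The Askey-Wilson coefficients as rational functions of t\<close>

definition AWA :: "complex => complex => complex => complex => complex => complex => complex" where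
 "AWA q a b c d t = (1 - a*b*t) * (1 - a*c*t) * (1 - a*d*t) * (q - a*b*c*d*t) /
 (a * (q - a*b*c*d*t^2) * (1 - a*b*c*d*t^2))"

definition AWC :: "complex => complex => complex => complex => complex => complex => complex" where
 "AWC q a b c d t = a * (1 - t) * (q - b*c*t) * (q - b*d*t) * (q - c*d*t) /
 ((q^2 - a*b*c*d*t^2) * (q - a*b*c*d*t^2))"

definition AWB :: "complex => complex => complex => complex => complex => complex => complex" where
 "AWB q a b c d t = a + 1 / a - (AWA q a b c d t + AWC q a b c d t)"

text \<open>\<open>b\<close>, \<open>c\<close>, \<open>d\<close> enter \<open>AWB\<close>
  symmetrically anyway, so this makes it symmetric in all four parameters. An exchange of parameters
  can then be effected by a gauge factor, which leaves the diagonal coefficient alone.\<close>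

lemma AWB_swap:
 assumes "a ~= 0" "b ~= 0" "q - a*b*c*d*t^2 ~= 0" "1 - a*b*c*d*t^2 ~= 0" "q^2 - a*b*c*d*t^2 ~= 0"
 shows "AWB q b a c d t = AWB q a b c d t"
proof -
 define P where "P = a*b*c*d"
 define Da where "Da = (1 - a*b*t) * (1 - a*c*t) * (1 - a*d*t) * (q - P*t) * (q^2-P*t^2) +
 a^2 * (1 - t) * (q - b*c*t) * (q - b*d*t) * (q - c*d*t) * (1 - P*t^2)"
 define Db where "Db = (1 - a*b*t) * (1 - b*c*t) * (1 - b*d*t) * (q - P*t) * (q^2-P*t^2) +
 b^2 * (1 - t) * (q - a*c*t) * (q - a*d*t) * (q - c*d*t) * (1 - P*t^2)"
 define E where "E = (q - P*t^2) * (1 - P*t^2) * (q^2 - P*t^2)"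
 have nz: "q - P*t^2 ~= 0" "1 - P*t^2 ~= 0" "q^2 - P*t^2 ~= 0" using assms by (simp_all add: P_def)
 then have E0: "E ~= 0" by (simp add: E_def)
 have P': "b*a*c*d = P" by (simp add: P_def)
 have a: "AWA q a b c d t + AWC q a b c d t = Da / (a * E)"
 unfolding AWA_def AWC_def P_def[symmetric] Da_def E_def using nz assms(1,2)
 by (simp add: divide_simps sqr_eq)
 have "AWA q b a c d t + AWC q b a c d t = Db / (b * E)"
 unfolding AWA_def AWC_def P' Db_def E_def using nz assms(1,2)
 by (simp add: divide_simps sqr_eq mult_ac)
 moreover have "a + 1 / a - Da / (a * E) = b + 1 / b - Db / (b * E)"
 proof -
 have "(a^2*b + b - a * b^2 - a) * E = b * Da - a * Db"
 unfolding Da_def Db_def E_def P_def by algebra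
 moreover have "(a + 1 / a - Da / (a * E)) - (b + 1 / b - Db / (b * E)) =
 ((a^2*b + b - a * b^2 - a) * E - (b * Da - a * Db)) / (a * b * E)"
 using E0 assms(1,2) by (simp add: divide_simps sqr_eq) (simp add: algebra_simps)
 ultimately show ?thesis by simp
 qed
 ultimately show ?thesis by (simp add: AWB_def a)
qed

lemma AWB_swap4:
 assumes "a ~= 0" "d ~= 0" "q - a*b*c*d*t^2 ~= 0" "1 - a*b*c*d*t^2 ~= 0" "q^2 - a*b*c*d*t^2 ~= 0"
 shows "AWB q d b c a t = AWB q a b c d t"
proof -
 have e: "a*b*c*d = a*d*b*c" by (simp add: mult_ac)
 have "AWB q d b c a t = AWB q d a b c t" "AWB q a b c d t = AWB q a d b c t"
 by (simp_all add: AWB_def AWA_def AWC_def mult_ac)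
 then show ?thesis using AWB_swap[of a d q b c t] assms unfolding e by simp
qed

text \<open>A second symmetry, combined with a rescaling of \<open>t\<close> that preserves
  \<open>a * b * c * d * t ^ 2\<close>. It is the source of the second rational solution.\<close>

lemma AWB_dual:
 assumes "q ~= 0" "a ~= 0" "d ~= 0" "q - a*b*c*d*t^2 ~= 0" "1 - a*b*c*d*t^2 ~= 0" "q^2 - a*b*c*d*t^2 ~= 0"
 shows "AWB q (q/a) b c (q/d) (a*d*t/q) = AWB q a b c d t"
proof -
 define P where "P = a*b*c*d"
 define Da where "Da = (1 - a*b*t) * (1 - a*c*t) * (1 - a*d*t) * (q - P*t) * (q^2-P*t^2) +
 a^2 * (1 - t) * (q - b*c*t) * (q - b*d*t) * (q - c*d*t) * (1 - P*t^2)"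
 define N1 where "N1 = (1 - d*b*t) * (1 - d*c*t) * (1 - q*t) * (1 - b*c*t)"
 define N2 where "N2 = (q - a*d*t) * (q^2 - P*t) * (q - a*b*t) * (q - a*c*t)"
 define D1 where "D1 = q - P*t^2"
 define D2 where "D2 = q^2 - P*t^2"
 define D0 where "D0 = 1 - P*t^2"
 define Db where "Db = a^2 * N1 * D2 * q + N2 * D0"
 define E where "E = D1 * D0 * D2"
 have nz: "D1 ~= 0" "D0 ~= 0" "D2 ~= 0" using assms by (simp_all add: P_def D1_def D0_def D2_def)
 then have E0: "E ~= 0" by (simp add: E_def)
 have a: "AWA q a b c d t + AWC q a b c d t = Da / (a * E)"
 unfolding AWA_def AWC_def P_def[symmetric] Da_def E_def D1_def[symmetric] D2_def[symmetric] D0_def[symmetric]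
 using nz assms(1,2) by (simp add: divide_simps sqr_eq)
 have e: "q/a*b*c*(q/d)*(a*d*t/q)^2 = P*t^2" "q/a*b*c*(q/d)*(a*d*t/q) = q*b*c*t" "q/a*b*(a*d*t/q) = d*b*t"
 "q/a*c*(a*d*t/q) = d*c*t" "q/a*(q/d)*(a*d*t/q) = q*t" "b*c*(a*d*t/q) = P*t/q" "b*(q/d)*(a*d*t/q) = a*b*t"
 "c*(q/d)*(a*d*t/q) = a*c*t"
 using assms(1-3) by (simp_all add: P_def sqr_eq)
 have "1 - a*d*t/q = (q - a*d*t)/q" "q - P*t/q = (q^2 - P*t)/q" "q - q*b*c*t = q * (1 - b*c*t)"
 using assms(1) by (simp_all add: field_simps sqr_eq)
 note e' = this
 have "AWA q (q/a) b c (q/d) (a*d*t/q) = a * N1 / (D1 * D0)"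
 unfolding AWA_def e e' D1_def[symmetric] D0_def[symmetric] N1_def using assms(1-3) by simp
 moreover have "AWC q (q/a) b c (q/d) (a*d*t/q) = N2 / (a * q * (D2 * D1))"
 unfolding AWC_def e e' D1_def[symmetric] D2_def[symmetric] N2_def using assms(1-3) by simp
 ultimately have b: "AWA q (q/a) b c (q/d) (a*d*t/q) + AWC q (q/a) b c (q/d) (a*d*t/q) = Db / (a * q * E)"
 unfolding Db_def E_def using nz assms(1,2) by (simp add: divide_simps sqr_eq) algebra
 have "(q*a^2 + q - q^2 - a^2) * E = q * Da - Db"
 unfolding Da_def Db_def E_def N1_def N2_def D1_def D2_def D0_def P_def by algebra
 moreover have "(a + 1 / a - Da / (a * E)) - (q / a + 1 / (q / a) - Db / (a * q * E)) =
 ((q*a^2 + q - q^2 - a^2) * E - (q * Da - Db)) / (a * q * E)"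
 using E0 assms(1,2) by (simp add: divide_simps sqr_eq) (simp add: algebra_simps)
 ultimately have "a + 1 / a - Da / (a * E) = q / a + 1 / (q / a) - Db / (a * q * E)" by simp
 then show ?thesis by (simp add: AWB_def a b)
qed

lemma AWA_reflect:
 assumes "q ~= 0" "a ~= 0" "b ~= 0" "c ~= 0" "d ~= 0" "t ~= 0" "q - a*b*c*d*t^2 ~= 0" "q^2 - a*b*c*d*t^2 ~= 0"
 shows "AWA q a b c d (q / (a*b*c*d) / t) = AWC q a b c d t"
proof -
 define P where "P = a*b*c*d"
 have P0: "P ~= 0" using assms by (simp add: P_def)
 have e: "a*b*(q/P/t) = q/(c*d*t)" "a*c*(q/P/t) = q/(b*d*t)" "a*d*(q/P/t) = q/(b*c*t)" "P*(q/P/t) = q/t"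
 "P*(q/P/t)^2 = q^2/(P*t^2)"
 using assms P0 by (auto simp: P_def sqr_eq)
 define X where "X u = (q - u*t)" for u
 define Y where "Y = 1 - t"
 define D1 where "D1 = q - P*t^2"
 define D2 where "D2 = q^2 - P*t^2"
 have D: "D1 ~= 0" "D2 ~= 0" using assms by (simp_all add: D1_def D2_def P_def)
 have f: "1 - q/(u*t) = - (X u/(u*t))" if "u ~= 0" for u
 using that assms by (simp add: X_def field_simps)
 have f4: "q - q/t = - (q*Y/t)" using assms by (simp add: Y_def field_simps)
 have f5: "q - q^2/(P*t^2) = - (q*D1/(P*t^2))" "1 - q^2/(P*t^2) = - (D2/(P*t^2))"
 using assms P0 by (simp_all add: D1_def D2_def field_simps sqr_eq)
 have "AWA q a b c d (q/P/t) = (1 - q/(c*d*t)) * (1 - q/(b*d*t)) * (1 - q/(b*c*t)) * (q - q/t) /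
 (a * (q - q^2/(P*t^2)) * (1 - q^2/(P*t^2)))"
 unfolding AWA_def P_def[symmetric] e ..
 also have "... = (- (X (c*d)/(c*d*t))) * (- (X (b*d)/(b*d*t))) * (- (X (b*c)/(b*c*t))) * (- (q*Y/t)) /
 (a * (- (q*D1/(P*t^2))) * (- (D2/(P*t^2))))"
 unfolding f4 f5 using f[of "c*d"] f[of "b*d"] f[of "b*c"] assms by simp
 also have "... = a * Y * X (b*c) * X (b*d) * X (c*d) / (D2 * D1)"
 unfolding P_def using assms D by (simp add: divide_simps sqr_eq)
 also have "... = AWC q a b c d t"
 unfolding AWC_def P_def[symmetric] by (simp add: X_def Y_def D1_def D2_def)
 finally show ?thesis unfolding P_def .
qed

section \<open>Solutions that are rational in t\<close>

definition awphi :: "complex => complex => nat => complex => complex" where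
 "awphi q P j t = (\<Prod>i<j. (1 - q^i / t) * (1 - P * q^i * t / q))"

lemma awphi_Suc: "awphi q P (Suc j) t = awphi q P j t * ((1 - q^j / t) * (1 - P * q^j * t / q))"
 by (simp add: awphi_def)

text \<open>A shift of \<open>t\<close> moves the two products by one factor each, in opposite
  directions. The prefactor here and \<open>1 - 1 / t\<close> in \<open>awphi_down\<close> are
  factors of \<open>AWA\<close> and, up to \<open>- t\<close>, of \<open>AWC\<close>.\<close>

lemma awphi_up:
 assumes "q ~= 0"
 shows "(1 - P*t/q) * awphi q P (Suc j) (q*t) = (1-1/(q*t))*(1-P*q^j*t/q)*(1-P*q^j*t) * awphi q P j t"
proof (induction j)
 case (Suc j)
 have "(1 - P*t/q) * awphi q P (Suc (Suc j)) (q*t) =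
 ((1 - P*t/q) * awphi q P (Suc j) (q*t)) * ((1 - q^j/t) * (1 - P * q^Suc j * t))"
 unfolding awphi_Suc[of q P "Suc j"] using assms by (simp add: mult_ac)
 also have "... = (1-1/(q*t))*(1-P*q^Suc j*t/q)*(1-P*q^Suc j*t) * awphi q P (Suc j) t"
 unfolding Suc unfolding awphi_Suc using assms by (simp add: mult_ac)
 finally show ?case .
qed (use assms in \<open>simp add: awphi_def field_simps\<close>)

lemma awphi_down:
 assumes "q ~= 0" "t ~= 0"
 shows "(1 - 1/t) * awphi q P (Suc j) (t/q) = (1-P*t/q^2)*(1-q^j/t)*(1-q*q^j/t) * awphi q P j t"
proof (induction j)
 case (Suc j)
 have "(1 - 1/t) * awphi q P (Suc (Suc j)) (t/q) =
 ((1 - 1/t) * awphi q P (Suc j) (t/q)) * ((1 - q*q^Suc j/t) * (1 - P * q^j * t/q))"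
 unfolding awphi_Suc[of q P "Suc j"] using assms by (simp add: mult_ac sqr_eq)
 also have "... = (1-P*t/q^2)*(1-q^Suc j/t)*(1-q*q^Suc j/t) * awphi q P (Suc j) t"
 unfolding Suc unfolding awphi_Suc using assms by (simp add: mult_ac)
 finally show ?case .
qed (use assms in \<open>simp add: awphi_def field_simps sqr_eq\<close>)

text \<open>Here \<open>s\<close> stands for \<open>q ^ j\<close>, which leaves an identity of
  rational functions.\<close>

lemma awphi_triangular_identity:
 fixes u b c d t q s :: complex
 defines "P \<equiv> u*b*c*d"
 assumes nz: "q ~= 0" "t ~= 0" "u ~= 0" "s ~= 0"
 "q - P*t^2 ~= 0" "1-P*t^2 ~= 0" "q^2-P*t^2 ~= 0"
 shows "(1-u*b*t)*(1-u*c*t)*(1-u*d*t)*q/(u*(q-P*t^2)*(1-P*t^2)) * ((1-1/(q*t))*(1-P * s*t/q)*(1-P * s*t) - (1 - P*t/q)*(1-s/t)*(1-P * s*t/q))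
 - u*t*(q-b*c*t)*(q-b*d*t)*(q-c*d*t)/((q^2-P*t^2)*(q-P*t^2)) * ((1-P*t/q^2)*(1-s/t)*(1-q * s/t) - (1-1/t)*(1-s/t)*(1-P * s*t/q))
 = (u*q * s+1/(u*q * s) - u - 1/u) * (1-s/t)*(1-P * s*t/q) - (1-q * s)*(1-u*b * s)*(1-u*c * s)*(1-u*d * s)/(q * s * u)"
proof -
 have 1: "((1-1/(q*t))*(1-P * s*t/q)*(1-P * s*t) - (1 - P*t/q)*(1-s/t)*(1-P * s*t/q)) = (1 - P * s*t/q) * (1-q * s)*(P*t^2-1)/(q*t)"
 using nz(1,2) by (simp add: field_simps) algebra
 have 2: "((1-P*t/q^2)*(1-s/t)*(1-q * s/t) - (1-1/t)*(1-s/t)*(1-P * s*t/q)) = (1-s/t)*(1-q * s)*(q^2-P*t^2)/(q^2*t)"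
 using nz(1,2) by (simp add: field_simps) algebra
 have 3: "(1-u*b*t)*(1-u*c*t)*(1-u*d*t)*q/(u*(q-P*t^2)*(1-P*t^2)) * ((1 - P * s*t/q) * (1-q * s)*(P*t^2-1)/(q*t)) =
 - ((1-u*b*t)*(1-u*c*t)*(1-u*d*t)* (q - P * s*t) * (1-q * s)) / (u*q*t*(q-P*t^2))"
 using nz by (simp add: divide_simps) algebra
 have 4: "u*t*(q-b*c*t)*(q-b*d*t)*(q-c*d*t)/((q^2-P*t^2)*(q-P*t^2)) * ((1-s/t)*(1-q * s)*(q^2-P*t^2)/(q^2*t)) =
 u*(q-b*c*t)*(q-b*d*t)*(q-c*d*t)*(t-s)*(1-q * s)/(q^2*t*(q-P*t^2))"
 using nz by (simp add: divide_simps)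
 show ?thesis unfolding 1 2 3 4 using nz unfolding P_def
 by (simp add: divide_simps) algebra
qed

definition AWL ::
 "complex => complex => complex => complex => complex => (complex => complex) => complex => complex" where
 "AWL q a b c d h t = AWA q a b c d t * h (q * t) + AWB q a b c d t * h t + AWC q a b c d t * h (t / q)"

text \<open>\<open>awphi q P j t\<close> is the product of the \<open>q\<close>-shifted factorials
  of \<open>1 / t\<close> and \<open>P * t / q\<close>, the part of the \<open>j\<close>-th term of
  the Askey-Wilson series that depends on \<open>t\<close>. On these functions the operator is
  bidiagonal, with diagonal entry \<open>z + 1 / z\<close> at \<open>z = u * q ^ j\<close>.\<close>

lemma AWL_awphi:
 fixes u b c d t q :: complex
 assumes nz: "q ~= 0" "t ~= 0" "u ~= 0"
 "q - u*b*c*d*t^2 ~= 0" "1-u*b*c*d*t^2 ~= 0" "q^2-u*b*c*d*t^2 ~= 0"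
 shows "AWL q u b c d (awphi q (u*b*c*d) (Suc j)) t =
 (u*q^Suc j + 1/(u*q^Suc j)) * awphi q (u*b*c*d) (Suc j) t
 - (1-q^Suc j)*(1-u*b*q^j)*(1-u*c*q^j)*(1-u*d*q^j)/(q^Suc j*u) * awphi q (u*b*c*d) j t"
proof -
 define P where "P = u*b*c*d"
 define s where "s = q^j"
 define f where "f = awphi q P"
 have s0: "s ~= 0" using nz by (simp add: s_def)
 define KA where "KA = (1-u*b*t)*(1-u*c*t)*(1-u*d*t)*q/(u*(q-P*t^2)*(1-P*t^2))"
 define KC where "KC = u*t*(q-b*c*t)*(q-b*d*t)*(q-c*d*t)/((q^2-P*t^2)*(q-P*t^2))"
 have A: "AWA q u b c d t = KA * (1 - P*t/q)"
 proof -
 have "1 - P*t/q = (q - P*t)/q" using nz by (simp add: field_simps)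
 then show ?thesis unfolding AWA_def KA_def P_def[symmetric] using nz by (simp add: mult.assoc)
 qed
 have C: "AWC q u b c d t = - KC * (1 - 1/t)"
 proof -
 have "1 - t = - (t * (1 - 1/t))" using nz(2) by (simp add: field_simps)
 then show ?thesis unfolding AWC_def KC_def P_def[symmetric] by (simp add: mult_ac)
 qed
 have up: "(1 - P*t/q) * f (Suc j) (q*t) = (1-1/(q*t))*(1-P * s*t/q)*(1-P * s*t) * f j t"
 unfolding f_def s_def by (rule awphi_up[OF nz(1)])
 have down: "(1 - 1/t) * f (Suc j) (t/q) = (1-P*t/q^2)*(1-s/t)*(1-q * s/t) * f j t"
 unfolding f_def s_def by (rule awphi_down[OF nz(1,2)])
 have here: "f (Suc j) t = (1-s/t)*(1-P * s*t/q) * f j t"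
 by (simp add: f_def s_def awphi_Suc)
 have "AWL q u b c d (f (Suc j)) t = KA * ((1 - P*t/q) * f (Suc j) (q*t) - (1 - P*t/q) * f (Suc j) t)
 - KC * ((1 - 1/t) * f (Suc j) (t/q) - (1 - 1/t) * f (Suc j) t) + (u + 1/u) * f (Suc j) t"
 unfolding AWL_def AWB_def A C by (simp add: algebra_simps)
 also have "... = (KA * ((1-1/(q*t))*(1-P * s*t/q)*(1-P * s*t) - (1 - P*t/q)*(1-s/t)*(1-P * s*t/q))
 - KC * ((1-P*t/q^2)*(1-s/t)*(1-q * s/t) - (1-1/t)*(1-s/t)*(1-P * s*t/q)) + (u + 1/u)*(1-s/t)*(1-P * s*t/q)) * f j t"
 unfolding up down here by (simp only: algebra_simps)
 also have "... = ((u*q * s+1/(u*q * s) - u - 1/u) * (1-s/t)*(1-P * s*t/q) - (1-q * s)*(1-u*b * s)*(1-u*c * s)*(1-u*d * s)/(q * s * u)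
 + (u + 1/u)*(1-s/t)*(1-P * s*t/q)) * f j t"
 using awphi_triangular_identity[OF nz(1-3) s0 nz(4-6)] unfolding KA_def KC_def P_def by simp
 also have "... = (u*q^Suc j + 1/(u*q^Suc j)) * f (Suc j) t - (1-q^Suc j)*(1-u*b*q^j)*(1-u*c*q^j)*(1-u*d*q^j)/(q^Suc j*u) * f j t"
 proof -
 have gen: "((X - u' - v) * m * m' - N + (u' + v) * m * m') * F = X * (m * m' * F) - N * F"
 for X u' v m m' N F :: complex by (simp add: algebra_simps)
 have "1/(u*q * s) = 1/(u*q^Suc j)" "u*q * s = u*q^Suc j" "q * s * u = q^Suc j * u" "q * s = q^Suc j"
 by (simp_all add: s_def)
 then show ?thesis unfolding here gen by (simp only: s_def)
 qed
 finally show ?thesis unfolding f_def P_def .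
qed

text \<open>A bidiagonal operator with distinct diagonal entries is solved downward from the top
  coefficient \<open>e k = 1\<close>. The induction carries one remainder term of index
  \<open>k - i - 1\<close>, which disappears at the bottom because \<open>g 0 = 0\<close>.\<close>

lemma AWL_polynomial_eigenfunction:
 fixes q u b c d :: complex
 assumes q: "q ~= 0" "u ~= 0" and u: "!!j. j < k ==> u * q^j + 1 / (u * q^j) ~= u * q^k + 1 / (u * q^k)"
 defines "P \<equiv> u*b*c*d"
 shows "EX e. e k = 1 & (ALL t. t ~= 0 --> q - P*t^2 ~= 0 --> 1 - P*t^2 ~= 0 --> q^2 - P*t^2 ~= 0 -->
 AWL q u b c d (%t. \<Sum>j\<le>k. e j * awphi q P j t) t =
 (u * q^k + 1 / (u * q^k)) * (\<Sum>j\<le>k. e j * awphi q P j t))"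
proof -
 define x where "x j = u * q^j + 1 / (u * q^j)" for j :: nat
 define g where "g j = (case j of 0 => 0 | Suc i => - ((1-q^Suc i)*(1-u*b*q^i)*(1-u*c*q^i)*(1-u*d*q^i)/(q^Suc i*u)))" for j :: nat
 define R where "R t \<longleftrightarrow> t ~= 0 & q - P*t^2 ~= 0 & 1 - P*t^2 ~= 0 & q^2 - P*t^2 ~= 0" for t
 have L: "AWL q u b c d (awphi q P j) t = x j * awphi q P j t + g j * awphi q P (j - 1) t" if "R t" for j t
 proof (cases j)
 case 0
 then show ?thesis by (simp add: g_def x_def AWL_def awphi_def AWB_def)
 next
 case (Suc i)
 show ?thesis using AWL_awphi[of q t u b c d i] that q
 by (simp add: Suc g_def x_def R_def P_def)
 qed
 have lin: "AWL q u b c d (%t. h t + k * f t) t = AWL q u b c d h t + k * AWL q u b c d f t" for h k f t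
 by (simp add: AWL_def algebra_simps)
 have "EX e. e k = 1 & (ALL t. R t -->
 AWL q u b c d (%t. \<Sum>j\<in>{k - i..k}. e j * awphi q P j t) t =
 x k * (\<Sum>j\<in>{k - i..k}. e j * awphi q P j t) + g (k - i) * e (k - i) * awphi q P (k - i - 1) t)" if "i <= k" for i
 using that
 proof (induction i)
 case 0
 show ?case by (rule exI[of _ "%_. 1"]) (simp add: L)
 next
 case (Suc i)
 then obtain e where e: "e k = 1" "!!t. R t ==>
 AWL q u b c d (%t. \<Sum>j\<in>{k - i..k}. e j * awphi q P j t) t =
 x k * (\<Sum>j\<in>{k - i..k}. e j * awphi q P j t) + g (k - i) * e (k - i) * awphi q P (k - i - 1) t"
 by auto
 define l where "l = k - Suc i"
 have l: "k - i - 1 = l" "k - i = Suc l" "l < k" using Suc.prems by (auto simp: l_def)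
 define v where "v = g (k - i) * e (k - i) / (x k - x l)"
 have "x k - x l ~= 0" using u[OF l(3)] by (simp add: x_def)
 then have v: "x l * v + g (k - i) * e (k - i) = x k * v" by (simp add: v_def field_simps)
 define e' where "e' = e(l := v)"
 have sum: "(\<Sum>j\<in>{l..k}. e' j * awphi q P j t) = (\<Sum>j\<in>{k - i..k}. e j * awphi q P j t) + v * awphi q P l t" for t
 proof -
 have "{l..k} = insert l {k - i..k}" using l by auto
 moreover have "l \<notin> {k - i..k}" using l by auto
 ultimately have "(\<Sum>j\<in>{l..k}. e' j * awphi q P j t) = e' l * awphi q P l t + (\<Sum>j\<in>{k - i..k}. e' j * awphi q P j t)"
 by simp
 also have "(\<Sum>j\<in>{k - i..k}. e' j * awphi q P j t) = (\<Sum>j\<in>{k - i..k}. e j * awphi q P j t)"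
 by (intro sum.cong) (use l in \<open>auto simp: e'_def\<close>)
 finally show ?thesis by (simp add: e'_def)
 qed
 show ?case
 proof (rule exI[of _ e'], intro conjI allI impI)
 show "e' k = 1" using e(1) l by (simp add: e'_def)
 fix t assume "R t"
 then have "AWL q u b c d (%t. (\<Sum>j\<in>{k - i..k}. e j * awphi q P j t) + v * awphi q P l t) t =
 x k * (\<Sum>j\<in>{k - i..k}. e j * awphi q P j t) + (x l * v + g (k - i) * e (k - i)) * awphi q P l t
 + v * g l * awphi q P (l - 1) t"
 unfolding lin e(2)[OF \<open>R t\<close>] L[OF \<open>R t\<close>] l(1) by (simp add: algebra_simps)
 then show "AWL q u b c d (%t. \<Sum>j\<in>{k - Suc i..k}. e' j * awphi q P j t) t =
 x k * (\<Sum>j\<in>{k - Suc i..k}. e' j * awphi q P j t) + g (k - Suc i) * e' (k - Suc i) * awphi q P (k - Suc i - 1) t"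
 unfolding l_def[symmetric] sum v by (simp add: e'_def algebra_simps)
 qed
 qed
 from this[of k] obtain e where e: "e k = 1" "!!t. R t ==>
 AWL q u b c d (%t. \<Sum>j\<in>{k - k..k}. e j * awphi q P j t) t =
 x k * (\<Sum>j\<in>{k - k..k}. e j * awphi q P j t) + g (k - k) * e (k - k) * awphi q P (k - k - 1) t"
 by auto
 then show ?thesis
 by (intro exI[of _ e]) (auto simp: R_def x_def g_def atLeast0AtMost)
qed

lemma awphi_reflect:
 assumes "q ~= 0" "P ~= 0" "t ~= 0" shows "awphi q P j (q / P / t) = awphi q P j t"
 unfolding awphi_def by (intro prod.cong refl) (use assms in \<open>simp add: mult_ac\<close>)

lemma awphi_leading:
 assumes "t ~= 0" shows "t ^ j * awphi q P j t = (\<Prod>i<j. (t - q^i) * (1 - P * q^i * t / q))"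
proof -
 have "t ^ j * awphi q P j t = (\<Prod>i<j. t * ((1 - q^i / t) * (1 - P * q^i * t / q)))"
 by (simp add: awphi_def prod.distrib)
 also have "... = (\<Prod>i<j. (t - q^i) * (1 - P * q^i * t / q))"
 by (intro prod.cong refl) (use assms in \<open>simp add: algebra_simps\<close>)
 finally show ?thesis .
qed

lemma awphi_rfun: "0 \<notin> T ==> rfun T (awphi q P j)"
 unfolding awphi_def[abs_def]
 by (intro rfun_prod rfun_mult lau_rfun lau_diff lau_const lau_inverse_id)
 (auto intro!: lau_rfun lau_diff lau_mult[of _ "%t. P * q ^ _ / q" "%t. t", simplified])

text \<open>A product that is invariant under the reflection \<open>t \<mapsto> w / t\<close> as soon as \<open>w y1 y2 q^(N-1) = 1\<close>.\<close>

definition gblock :: "complex => complex => complex => nat => complex => complex" where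
 "gblock q y1 y2 N t = (\<Prod>i<N. t / ((1 - y1 * t * q^i) * (1 - y2 * t * q^i)))"

text \<open>Telescoping: under \<open>t \<mapsto> q * t\<close> all inner denominators
  cancel.\<close>

lemma gblock_shift:
 assumes "!!i. i <= N ==> 1 - y1 * t * q^i ~= 0" "!!i. i <= N ==> 1 - y2 * t * q^i ~= 0"
 shows "gblock q y1 y2 N (q * t) * ((1 - y1*t*q^N) * (1 - y2*t*q^N)) =
 q^N * ((1 - y1*t) * (1 - y2*t)) * gblock q y1 y2 N t"
 using assms
proof (induction N)
 case (Suc N)
 have nz: "1 - y1 * t * q^i ~= 0" "1 - y2 * t * q^i ~= 0" if "i <= Suc N" for i using Suc.prems that by auto
 have IH: "gblock q y1 y2 N (q * t) * ((1 - y1*t*q^N) * (1 - y2*t*q^N)) =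
 q^N * ((1 - y1*t) * (1 - y2*t)) * gblock q y1 y2 N t" by (rule Suc.IH) (use Suc.prems in auto)
 have "gblock q y1 y2 (Suc N) (q * t) * ((1 - y1*t*q^Suc N) * (1 - y2*t*q^Suc N)) =
 gblock q y1 y2 N (q * t) * (q * t)"
 using nz[of "Suc N"] by (simp add: gblock_def mult_ac)
 also have "... = gblock q y1 y2 N (q * t) * ((1 - y1*t*q^N) * (1 - y2*t*q^N)) * (q * (t / ((1 - y1*t*q^N) * (1 - y2*t*q^N))))"
 using nz[of N] by simp
 also have "... = q^Suc N * ((1 - y1*t) * (1 - y2*t)) * gblock q y1 y2 (Suc N) t"
 unfolding IH by (simp add: gblock_def mult_ac)
 finally show ?case .
qed (simp add: gblock_def)

text \<open>By the condition on \<open>w\<close>, reflection turns the factor with \<open>y1\<close>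
  and index \<open>N - 1 - i\<close> into a multiple of the factor with \<open>y2\<close> and index
  \<open>i\<close>.\<close>

lemma gblock_reflect:
 assumes "q ~= 0" "t ~= 0" "y1 ~= 0" "y2 ~= 0" "w * y1 * y2 * q ^ (N - 1) = 1"
 "!!i. 1 - y1 * t * q^i ~= 0" "!!i. 1 - y2 * t * q^i ~= 0"
 shows "gblock q y1 y2 N (w / t) = gblock q y1 y2 N t"
proof -
 have w0: "w ~= 0" using assms(5) by auto
 have "gblock q y1 y2 N (w / t) = (\<Prod>i<N. w / t / ((1 - y1 * (w / t) * q^(N - Suc i)) * (1 - y2 * (w / t) * q^(N - Suc i))))"
 unfolding gblock_def by (rule prod.nat_diff_reindex[symmetric])
 also have "... = (\<Prod>i<N. (q^i / q^(N - Suc i)) * (t / ((1 - y1 * t * q^i) * (1 - y2 * t * q^i))))"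
 proof (rule prod.cong[OF refl])
 fix i assume "i \<in> {..<N}"
 then have "q ^ (N - 1) = q ^ (N - Suc i) * q ^ i" by (simp flip: power_add)
 then have e: "w * y1 * y2 * (q ^ (N - Suc i) * q ^ i) = 1" using assms(5) by simp
 define r where "r = q ^ (N - Suc i)"
 define s where "s = q ^ i"
 have nz: "r ~= 0" "s ~= 0" using assms(1) by (auto simp: r_def s_def)
 have e: "w * y1 * y2 * (r * s) = 1" using e by (simp add: r_def s_def)
 have w: "w = 1 / (y1 * y2 * (r * s))" using e by (metis eq_divide_imp mult.assoc mult_zero_right zero_neq_one)
 have 1: "1 - y1 * (w / t) * r = - ((1 - y2 * t * s) / (y2 * t * s))" "1 - y2 * (w / t) * r = - ((1 - y1 * t * s) / (y1 * t * s))"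
 using assms nz by (simp_all add: w field_simps)
 show "w / t / ((1 - y1 * (w / t) * q^(N - Suc i)) * (1 - y2 * (w / t) * q^(N - Suc i))) =
 (q^i / q^(N - Suc i)) * (t / ((1 - y1 * t * q^i) * (1 - y2 * t * q^i)))"
 unfolding r_def[symmetric] s_def[symmetric] 1 using assms(6)[of i] assms(7)[of i] assms(2-4) nz
 by (simp add: w s_def[symmetric] field_simps)
 qed
 also have "... = (\<Prod>i<N. q^i / q^(N - Suc i)) * gblock q y1 y2 N t"
 unfolding gblock_def by (rule prod.distrib)
 also have "(\<Prod>i<N. q^i / q^(N - Suc i)) = (\<Prod>i<N. q^i) / (\<Prod>i<N. q^(N - Suc i))" by (rule prod_dividef)
 also have "(\<Prod>i<N. q^(N - Suc i)) = (\<Prod>i<N. q^i)" by (rule prod.nat_diff_reindex)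
 finally show ?thesis using assms(1) by (simp add: prod_zero_iff)
qed

lemma gblock_rfun:
 assumes "!!t i. t \<in> T ==> 1 - y1 * t * q^i ~= 0" "!!t i. t \<in> T ==> 1 - y2 * t * q^i ~= 0"
 shows "rfun T (gblock q y1 y2 N)"
 unfolding gblock_def[abs_def]
 by (intro rfun_prod rfun_divide rfun_mult rfun_diff rfun_const rfun_id) (use assms in auto)

lemma gblock_leading: assumes "t ~= 0" shows "gblock q y1 y2 N t / t ^ N = (\<Prod>i<N. 1 / ((1 - y1 * t * q^i) * (1 - y2 * t * q^i)))"
 using assms by (simp add: gblock_def prod_dividef prod.distrib)

lemma AWA_dual:
 assumes "q ~= 0" "a ~= 0" "d ~= 0"
 shows "AWA q (q/a) b c (q/d) (a*d*t/q) =
 a * ((1 - d*b*t) * (1 - d*c*t) * (1 - q*t) * (1 - b*c*t)) / ((q - a*b*c*d*t^2) * (1 - a*b*c*d*t^2))"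
proof -
 have e: "q/a*b*c*(q/d)*(a*d*t/q)^2 = a*b*c*d*t^2" "q/a*b*c*(q/d)*(a*d*t/q) = q*b*c*t" "q/a*b*(a*d*t/q) = d*b*t"
 "q/a*c*(a*d*t/q) = d*c*t" "q/a*(q/d)*(a*d*t/q) = q*t"
 using assms by (simp_all add: sqr_eq)
 have "q - q*b*c*t = q * (1 - b*c*t)" by (simp add: algebra_simps)
 then show ?thesis unfolding AWA_def e using assms by simp
qed

text \<open>The lower order dominates as \<open>x n\<close> tends to \<open>0\<close>, which removes
  \<open>c1\<close> and then \<open>c2\<close>.\<close>

lemma leading_powers_independent:
 fixes x :: "nat => complex"
 assumes x: "x \<longlonglongrightarrow> 0" "!!n. x n ~= 0"
 and H: "isCont H1 0" "isCont H2 0" "H1 0 ~= 0" "H2 0 ~= 0" and e: "e1 < (e2::nat)"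
 and eq: "!!n. c1 * (x n ^ e1 * H1 (x n)) + c2 * (x n ^ e2 * H2 (x n)) = 0"
 shows "c1 = 0 & c2 = 0"
proof
 have lim: "(%n. H1 (x n)) \<longlonglongrightarrow> H1 0" "(%n. H2 (x n)) \<longlonglongrightarrow> H2 0"
 using H x(1) isCont_tendsto_compose by blast+
 have z: "c1 * H1 (x n) + c2 * (x n ^ (e2 - e1) * H2 (x n)) = 0" for n
 proof -
 have "x n ^ e2 = x n ^ e1 * x n ^ (e2 - e1)" using e by (simp flip: power_add)
 then have "x n ^ e1 * (c1 * H1 (x n) + c2 * (x n ^ (e2 - e1) * H2 (x n))) = 0"
 using eq[of n] by (simp add: algebra_simps)
 then show ?thesis using x(2)[of n] by simp
 qed
 have "(%n. c1 * H1 (x n) + c2 * (x n ^ (e2 - e1) * H2 (x n))) \<longlonglongrightarrow> c1 * H1 0 + c2 * (0 ^ (e2 - e1) * H2 0)"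
 by (intro tendsto_intros lim x)
 then have "c1 * H1 0 = 0" using e LIMSEQ_unique by (fastforce simp: z zero_power)
 then show c1: "c1 = 0" using H by simp
 have "\<forall>\<^sub>F n in sequentially. H2 (x n) ~= 0" using tendsto_imp_eventually_ne[OF lim(2) H(4)] .
 then obtain n where "H2 (x n) ~= 0" by (meson eventually_sequentially order_refl)
 then show "c2 = 0" using z[of n] c1 x(2)[of n] by simp
qed

context bispectral_pair
begin

lemma second_order_unique:
 assumes A: "!!t. t \<in> T ==> A t ~= 0" and w: "w = q ^ i * w0"
 and ps: "!!n. second_order w A B ps n = x * ps n" "ps 0 = 0" "ps 1 = 0"
 shows "ps n = 0"
proof -
 have C: "A (w / tn n) ~= 0" for n using A T_reflect[OF tn_T w] by blast
 have "ps n = 0 & ps (n + 1) = 0"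
 proof (induction n rule: int_induct[where k = 0])
 case base then show ?case using ps by simp
 next
 case (step1 i)
 then have "A (tn (i + 1)) * ps (i + 1 + 1) = 0" using ps(1)[of "i + 1"] by (simp add: second_order_def)
 with step1 show ?case using A[OF tn_T] by simp
 next
 case (step2 i)
 then have "A (w / tn i) * ps (i - 1) = 0" using ps(1)[of i] by (simp add: second_order_def)
 with step2 show ?case using C by simp
 qed
 then show ?thesis ..
qed

text \<open>\<open>A\<close> has no zeros on \<open>T\<close>, so the solution space is
  two-dimensional, and two independent solutions with a common gauge and the right symmetry
  suffice.\<close>

lemma eigen_extI:
 assumes A: "!!t. t \<in> T ==> A t ~= 0" and w: "w = q ^ i * w0"
 and g: "rfun T r" "!!t. t \<in> T ==> r t ~= 0 & g t ~= 0 & g t = r t * g (t / q)"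
 "!!t. t \<in> T ==> g (w / t) = g t"
 and p: "rfun T p1" "rfun T p2" "!!t. t \<in> T ==> p1 (w / t) = p1 t" "!!t. t \<in> T ==> p2 (w / t) = p2 t"
 and ev: "!!n. second_order w A B (%n. g (tn n) * p1 (tn n)) n = x * (g (tn n) * p1 (tn n))"
 "!!n. second_order w A B (%n. g (tn n) * p2 (tn n)) n = x * (g (tn n) * p2 (tn n))"
 and ind: "!!c1 c2. (!!n. c1 * p1 (tn n) + c2 * p2 (tn n) = 0) ==> c1 = 0 & c2 = 0"
 shows "eigen_ext w A B x"
 unfolding eigen_ext_def
proof (intro allI impI)
 fix ps assume ps: "ALL n. second_order w A B ps n = x * ps n"
 define y1 where "y1 n = g (tn n) * p1 (tn n)" for n
 define y2 where "y2 n = g (tn n) * p2 (tn n)" for n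
 note ev = ev[folded y1_def y2_def]
 have gn: "g (tn n) ~= 0" for n using g(2) by blast
 have lin: "second_order w A B (%n. a * h n + b * k n) n = a * second_order w A B h n + b * second_order w A B k n"
 for a b h k n by (simp add: second_order_def algebra_simps)
 \<comment> \<open>If this Casoratian vanished, uniqueness would spread a linear relation between
   the initial values over the whole lattice.\<close>
 define D where "D = y1 0 * y2 1 - y1 1 * y2 0"
 have D: "D ~= 0"
 proof
 assume D: "D = 0"
 have z: "c1 = 0 & c2 = 0" if "c1 * y1 0 + c2 * y2 0 = 0" "c1 * y1 1 + c2 * y2 1 = 0" for c1 c2
 proof (rule ind)
 fix n
 have "second_order w A B (%n. c1 * y1 n + c2 * y2 n) m = x * (c1 * y1 m + c2 * y2 m)" for m
 by (simp only: lin[of c1 y1 c2 y2 m] ev, simp add: algebra_simps)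
 from second_order_unique[OF A w this that] have "c1 * y1 n + c2 * y2 n = 0" .
 then have "g (tn n) * (c1 * p1 (tn n) + c2 * p2 (tn n)) = 0" by (simp add: y1_def y2_def algebra_simps)
 then show "c1 * p1 (tn n) + c2 * p2 (tn n) = 0" using gn by simp
 qed
 have D': "y1 0 * y2 1 = y1 1 * y2 0" using D by (simp add: D_def)
 have "y2 0 = 0 & - y1 0 = 0" by (rule z) (use D' in \<open>simp_all add: mult.commute\<close>)
 moreover have "y2 1 = 0 & - y1 1 = 0" by (rule z) (use D' in \<open>simp_all add: mult.commute\<close>)
 ultimately have "(1::complex) = 0 & (0::complex) = 0" by (intro z) simp_all
 then show False by simp
 qed
 define c1 where "c1 = (ps 0 * y2 1 - ps 1 * y2 0) / D"
 define c2 where "c2 = (y1 0 * ps 1 - y1 1 * ps 0) / D"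
 have c: "c1 * y1 0 + c2 * y2 0 = ps 0" "c1 * y1 1 + c2 * y2 1 = ps 1"
 proof -
 have "c1 * y1 0 + c2 * y2 0 = ps 0 * D / D" "c1 * y1 1 + c2 * y2 1 = ps 1 * D / D"
 by (simp_all add: c1_def c2_def D_def add_divide_distrib[symmetric] algebra_simps)
 then show "c1 * y1 0 + c2 * y2 0 = ps 0" "c1 * y1 1 + c2 * y2 1 = ps 1" using D by simp_all
 qed
 have psy: "ps n = c1 * y1 n + c2 * y2 n" for n
 proof -
 have "second_order w A B (%n. c1 * y1 n + c2 * y2 n) m = x * (c1 * y1 m + c2 * y2 m)" for m
 by (simp only: lin[of c1 y1 c2 y2 m] ev, simp add: algebra_simps)
 then have "second_order w A B (%n. 1 * ps n + (- 1) * (c1 * y1 n + c2 * y2 n)) m =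
 x * (1 * ps m + (- 1) * (c1 * y1 m + c2 * y2 m))" for m
 using ps by (simp only: lin[of 1 ps "- 1" _ m], simp add: algebra_simps)
 from second_order_unique[OF A w this] c have "1 * ps n + (- 1) * (c1 * y1 n + c2 * y2 n) = 0" by simp
 then show ?thesis by algebra
 qed
 have "extends w ps (%t. g t * (c1 * p1 t + c2 * p2 t))"
 unfolding extends_def
 proof (intro conjI allI)
 show "g (tn n) * (c1 * p1 (tn n) + c2 * p2 (tn n)) = ps n" for n
 by (simp add: psy y1_def y2_def algebra_simps)
 show "EX s. (s = 1 | s = - 1) & (\<forall>t\<in>T. g (w / t) * (c1 * p1 (w / t) + c2 * p2 (w / t)) =
 s * (g t * (c1 * p1 t + c2 * p2 t)))"
 by (rule exI[of _ 1]) (use g(3) p(3,4) in simp)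
 have "rfun T (%t. c1 * p1 t + c2 * p2 t)" by (intro rfun_add rfun_mult rfun_const p)
 with g(1,2) show "EX g' p r. rfun T p & rfun T r & (\<forall>t\<in>T. r t ~= 0 & g' t ~= 0 & g' t = r t * g' (t / q) &
 g t * (c1 * p1 t + c2 * p2 t) = g' t * p t)"
 by blast
 qed
 then show "\<exists>pst. extends w ps pst" by blast
qed

end

lemma awphi_sum_leading:
 fixes q P :: complex
 assumes "q ~= 0" "e k = 1"
 obtains F where "isCont F 0" "F 0 ~= 0" "!!t. t ~= 0 ==> t ^ k * (\<Sum>j\<le>k. e j * awphi q P j t) = F t"
proof
 define F where "F t = (\<Sum>j\<le>k. e j * t ^ (k - j) * (\<Prod>i<j. (t - q^i) * (1 - P * q^i * t / q)))" for t
 show "isCont F 0" unfolding F_def using assms(1) by (intro continuous_intros) auto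
 have "F 0 = (\<Sum>j\<in>{k}. e j * 0 ^ (k - j) * (\<Prod>i<j. (0 - q^i) * (1 - P * q^i * 0 / q)))"
 unfolding F_def by (rule sum.mono_neutral_right) (auto simp: zero_power)
 then show "F 0 ~= 0" using assms by (simp add: prod_zero_iff)
 show "t ^ k * (\<Sum>j\<le>k. e j * awphi q P j t) = F t" if t: "t ~= 0" for t
 unfolding F_def sum_distrib_left
 proof (rule sum.cong[OF refl])
 fix j assume "j \<in> {..k}"
 then have "t ^ k = t ^ (k - j) * t ^ j" by (simp flip: power_add)
 then show "t ^ k * (e j * awphi q P j t) = e j * t ^ (k - j) * (\<Prod>i<j. (t - q^i) * (1 - P * q^i * t / q))"
 unfolding awphi_leading[OF t, symmetric] by (simp add: mult_ac)
 qed
qed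

lemma gblock_leading':
 obtains H where "isCont H (0::complex)" "H 0 = 1" "!!t. t ~= 0 ==> gblock q y1 y2 N t = t ^ N * H t"
proof
 define H where "H t = (\<Prod>i<N. 1 / ((1 - y1 * t * q^i) * (1 - y2 * t * q^i)))" for t
 show "isCont H 0" unfolding H_def by (intro continuous_intros) auto
 show "H 0 = 1" by (simp add: H_def)
 show "gblock q y1 y2 N t = t ^ N * H t" if "t ~= 0" for t
 unfolding H_def gblock_leading[OF that, symmetric] using that by simp
qed

lemma powi_inj:
 fixes q :: complex assumes "q ~= 0" "norm q < 1" "q powi m = q powi n" shows "m = n"
proof -
 have "norm q powi m = norm q powi n" using assms(3) by (metis norm_power_int)
 then show ?thesis using assms(1,2) by (smt (verit, best) power_int_strict_decreasing zero_less_norm_iff)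
qed

lemma joukowski_distinct:
 fixes q u :: complex
 assumes q: "q ~= 0" "norm q < 1" and u: "u ^ 2 = q powi M" "M + int j + int k ~= 0" and "j ~= k"
 shows "u * q^j + 1 / (u * q^j) ~= u * q^k + 1 / (u * q^k)"
proof
 assume e: "u * q^j + 1 / (u * q^j) = u * q^k + 1 / (u * q^k)"
 have u0: "u ~= 0" using u(1) q by auto
 define x where "x = u * q^j" define y where "y = u * q^k"
 have nz: "x ~= 0" "y ~= 0" using u0 q by (auto simp: x_def y_def)
 have "x + 1/x = y + 1/y" using e by (simp add: x_def y_def)
 then have "(x - y) * (x * y - 1) = 0" using nz by (simp add: field_simps)
 then consider "x = y" | "x * y = 1" by auto
 then show False
 proof cases
 case 1
 then have "q powi int j = q powi int k" using u0 by (simp add: x_def y_def)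
 then show False using powi_inj[OF q] \<open>j ~= k\<close> by fastforce
 next
 case 2
 have "x * y = u^2 * (q^j * q^k)" by (simp add: x_def y_def sqr_eq mult_ac)
 also have "... = q powi (M + int j + int k)" using q by (simp add: u power_int_add)
 finally have "q powi (M + int j + int k) = q powi 0" using 2 by simp
 then show False using powi_inj[OF q] u(2) by blast
 qed
qed

lemma rfun_sum: "(!!i. i \<in> I ==> rfun T (f i)) ==> rfun T (%t. \<Sum>i\<in>I. f i t)"
 by (induction I rule: infinite_finite_induct) auto

section \<open>The eigenfunctions at the points of J and K\<close>

locale aw_pair = bispectral_pair q t0 w0 a Ps "AWA q a b c d" "AWB q a b c d" "AWC q a b c d" T
 for q t0 w0 a b c d :: complex and Ps :: "bool => int => complex => complex" and T :: "complex set" +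
 assumes bcd: "b ~= 0" "c ~= 0" "d ~= 0" and w0_eq: "w0 = q / (a*b*c*d)"
 and P: "\<exists>k::int. a*b*c*d = q powi k"
 and nonres: "!!t k. t \<in> T ==> t ^ 2 ~= q powi (k::int)"
begin

text \<open>In the application the products of parameters are, up to sign, half-integral powers of
  \<open>q\<close>. With \<open>nonres\<close> this keeps the factors
  \<open>1 - v * t * q ^ i\<close> away from zero on \<open>T\<close>.\<close>

definition halfint :: "complex => bool" where "halfint v \<longleftrightarrow> (\<exists>k::int. v ^ 2 = q powi k)"

lemma halfint_ne: assumes "t \<in> T" "halfint v" shows "v * t * q ^ i ~= q ^ j"
proof
 assume e: "v * t * q ^ i = q ^ j"
 obtain k where k: "v ^ 2 = q powi k" using assms(2) by (auto simp: halfint_def)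
 have "(v * t * q ^ i) ^ 2 = (q ^ j) ^ 2" by (simp add: e)
 then have "q powi k * t ^ 2 * q powi (int (i + i)) = q powi (int (j + j))"
 unfolding power_int_of_nat power_add k[symmetric] by (simp add: sqr_eq mult_ac)
 then have "t ^ 2 = q powi (int (j + j)) / (q powi k * q powi (int (i + i)))" using q by (simp add: field_simps)
 also have "... = q powi (int (j + j) - (k + int (i + i)))" using q by (simp add: power_int_add power_int_diff)
 finally show False using nonres[OF assms(1)] by blast
qed

lemma P_ne: assumes "t \<in> T" shows "a*b*c*d * t ^ 2 ~= q ^ j"
proof
 assume e: "a*b*c*d * t ^ 2 = q ^ j"
 obtain k where k: "a*b*c*d = q powi k" using P by blast
 have "q powi k * t ^ 2 = q ^ j" using e unfolding k .
 then have "t ^ 2 = q powi (int j - k)" using q by (simp add: power_int_diff field_simps)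
 then show False using nonres[OF assms(1)] by blast
qed

lemma P_nz: assumes "t \<in> T"
 shows "q - a*b*c*d*t^2 ~= 0" "1 - a*b*c*d*t^2 ~= 0" "q^2 - a*b*c*d*t^2 ~= 0"
 using P_ne[OF assms, of 0] P_ne[OF assms, of 1] P_ne[OF assms, of 2] by auto

lemma halfint_nz: assumes "t \<in> T" "halfint v" shows "1 - v * t * q ^ i ~= 0"
 using halfint_ne[OF assms, of i 0] by simp

lemma halfint_mult: "halfint u ==> halfint v ==> halfint (u * v)"
 using q unfolding halfint_def by (metis power_int_add power_mult_distrib)

lemma halfint_q: "halfint q" unfolding halfint_def by (rule exI[of _ 2]) simp

lemma reflect0: "t \<in> T ==> w0 / t \<in> T" using T_reflect[of t w0 0] by simp

text \<open>The condition on the lower coefficient is the reflection of the one on the upper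
  coefficient, so only the latter needs a computation.\<close>

lemma AWL_gauge:
 assumes t: "t \<in> T" and u: "u ~= 0" "v ~= 0" "u * b' * c' * v = a*b*c*d" "b' ~= 0" "c' ~= 0"
 and A: "!!t. t \<in> T ==> AWA q u b' c' v t * g (q * t) = g t * A1 t"
 and sym: "!!t. t \<in> T ==> g (w0 / t) = g t"
 and C: "A1 (w0 / t) = C1"
 shows "AWC q u b' c' v t * g (t / q) = g t * C1"
proof -
 have "AWA q u b' c' v (w0 / t) = AWC q u b' c' v t"
 using AWA_reflect[of q u b' c' v t] u P_nz[OF t] T_nz[OF t] q by (simp add: w0_eq)
 moreover have "g (q * (w0 / t)) = g (t / q)"
 using sym[OF T_div[OF t]] by (simp add: mult.commute)
 ultimately show ?thesis using A[OF reflect0[OF t]] sym[OF t] C by simp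
qed

text \<open>Here \<open>u\<close>, \<open>v\<close> are \<open>a\<close>, \<open>d\<close> or
  \<open>b\<close>, \<open>c\<close>. Their exchange is a gauge by \<open>g1\<close>, a finite
  product because \<open>u / v\<close> is a power of \<open>q\<close>; passing to
  \<open>q / u\<close>, \<open>q / v\<close> takes in addition \<open>gq\<close>, finite because
  \<open>u * v\<close> is one. In both pictures the point \<open>v * q ^ k\<close> gives a diagonal
  entry of the bidiagonal operator, hence a terminating sum.\<close>

lemma two_rational_eigenfunctions:
 assumes u: "u = v * q ^ \<alpha>" "u * v = q ^ m" and m: "\<alpha> < m" and k: "k < \<alpha>"
 and v0: "v ~= 0" "b' ~= 0" "c' ~= 0" and P': "u * b' * c' * v = a*b*c*d"
 and hi: "halfint (v * b')" "halfint (v * c')" "halfint (b' * c')"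
 obtains p1 p2 where "rfun T p1" "rfun T p2" "!!t. t \<in> T ==> p1 (w0 / t) = p1 t" "!!t. t \<in> T ==> p2 (w0 / t) = p2 t"
 "!!t. t \<in> T ==> AWL q u b' c' v p1 t = (v * q^k + 1/(v * q^k)) * p1 t"
 "!!t. t \<in> T ==> AWL q u b' c' v p2 t = (v * q^k + 1/(v * q^k)) * p2 t"
 "!!c1 c2. (!!n. c1 * p1 (tn n) + c2 * p2 (tn n) = 0) ==> c1 = 0 & c2 = 0"
proof -
 define PP where "PP = a*b*c*d"
 have PP0: "PP ~= 0" using a bcd by (simp add: PP_def)
 have u0: "u ~= 0" using u v0 q by auto
 have P1: "u * b' * c' * v = PP" "v * b' * c' * u = PP" using P' by (simp_all add: PP_def mult_ac)
 have v2: "v ^ 2 = q powi (int m - int \<alpha>)"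
 proof -
 have "v ^ 2 * q ^ \<alpha> = q ^ m" using u by (simp add: sqr_eq mult_ac)
 then show ?thesis using q by (simp add: power_int_diff field_simps)
 qed
 have u2: "(q / u) ^ 2 = q powi (2 - int m - int \<alpha>)"
 proof -
 have "u ^ 2 = q ^ m * q ^ \<alpha>" using u by (simp add: sqr_eq mult_ac)
 then show ?thesis using q by (simp add: power_int_diff power_divide)
 qed
 have nz: "1 - (v * b') * t * q^i ~= 0" "1 - (v * c') * t * q^i ~= 0" "1 - q * t * q^i ~= 0" "1 - (b'*c') * t * q^i ~= 0"
 if "t \<in> T" for t i
 using halfint_nz[OF that] hi halfint_q by blast+
 have Pnz: "q - PP*t^2 ~= 0" "1 - PP*t^2 ~= 0" "q^2 - PP*t^2 ~= 0" if "t \<in> T" for t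
 using P_nz[OF that] by (simp_all add: PP_def)
 have w0: "w0 = q / PP" by (simp add: w0_eq PP_def)
 define g1 where "g1 = gblock q (v * b') (v * c') \<alpha>"
 define gq where "gq = gblock q q (b'*c') (m - 1)"
 define g2 where "g2 t = g1 t * gq t" for t
 have g1_rfun: "rfun T g1" unfolding g1_def by (rule gblock_rfun) (use nz in blast)+
 have gq_rfun: "rfun T gq" unfolding gq_def by (rule gblock_rfun) (use nz in blast)+
 \<comment> \<open>The invariance condition of \<open>gblock_reflect\<close>, which holds because
   the block length is \<open>\<alpha>\<close>; below, the length \<open>m - 1\<close> does the same
   for \<open>gq\<close>.\<close>
 have e1: "w0 * (v * b') * (v * c') * q ^ (\<alpha> - 1) = 1"
 proof -
 have "q * q ^ (\<alpha> - 1) = q ^ \<alpha>" using k by (cases \<alpha>) auto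
 then have "w0 * (v * b') * (v * c') * q ^ (\<alpha> - 1) * PP = (v * b' * c') * (v * q ^ \<alpha>)"
 using PP0 by (simp add: w0 mult_ac)
 also have "... = PP" using P1 u by (simp add: mult_ac)
 finally show ?thesis using PP0 by simp
 qed
 have g1_sym: "g1 (w0 / t) = g1 t" if "t \<in> T" for t
 unfolding g1_def
 by (rule gblock_reflect[OF q(1) T_nz[OF that] _ _ e1 nz(1)[OF that] nz(2)[OF that]]) (use v0 in auto)
 have e2: "w0 * q * (b'*c') * q ^ (m - 1 - 1) = 1"
 proof -
 have "q * q * q ^ (m - 1 - 1) = q ^ m" using k m by (cases m; cases "m - 1") (auto simp: mult_ac)
 then have "w0 * q * (b'*c') * q ^ (m - 1 - 1) * PP = (b' * c') * q ^ m"
 using PP0 by (simp add: w0 mult_ac)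
 also have "... = PP" using P1 u by (simp add: mult_ac)
 finally show ?thesis using PP0 by simp
 qed
 have gq_sym: "gq (w0 / t) = gq t" if "t \<in> T" for t
 unfolding gq_def
 by (rule gblock_reflect[OF q(1) T_nz[OF that] _ _ e2 nz(3)[OF that] nz(4)[OF that]]) (use v0 q in auto)
 have g1_up: "g1 (q * t) * ((1 - u*b'*t) * (1 - u*c'*t)) = u / v * ((1 - v * b'*t) * (1 - v * c'*t)) * g1 t" if "t \<in> T" for t
 using gblock_shift[of \<alpha> "v * b'" t q "v * c'"] nz[OF that] v0 by (simp add: g1_def u(1) mult_ac)
 have gq_up: "gq (q * t) * ((1 - u* v * t) * (1 - PP*t/q)) = (u * v / q) * ((1 - q*t) * (1 - b'*c'*t)) * gq t" if "t \<in> T" for t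
 proof -
 have qm: "q ^ (m - 1) = u * v / q" using k m q u(2) by (cases m) auto
 have e: "q * t * (u * v / q) = u* v * t" "b' * c' * t * (u * v / q) = PP*t/q" using q P1(1)[symmetric] by simp_all
 show ?thesis
 using gblock_shift[of "m - 1" q t q "b'*c'"] nz[OF that] unfolding gq_def qm e by simp
 qed
 have A1: "AWA q u b' c' v t * g1 (q * t) = g1 t * AWA q v b' c' u t" if t: "t \<in> T" for t
 proof -
 have 1: "(1 - u*b'*t) * (1 - u*c'*t) * g1 (q * t) = u / v * ((1 - v * b'*t) * (1 - v * c'*t)) * g1 t"
 using g1_up[OF t] by (simp add: mult_ac)
 have "AWA q u b' c' v t * g1 (q * t) = ((1 - u*b'*t) * (1 - u*c'*t) * g1 (q * t)) * ((1 - u* v * t) * (q - PP*t)) / (u * (q - PP*t^2) * (1 - PP*t^2))"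
 unfolding AWA_def P1 by simp
 also have "... = g1 t * AWA q v b' c' u t"
 unfolding 1 AWA_def P1 using u0 v0 by (simp add: mult_ac)
 finally show ?thesis .
 qed
 have A2: "AWA q u b' c' v t * g2 (q * t) = g2 t * AWA q (q/u) b' c' (q/v) (u* v * t/q)" if t: "t \<in> T" for t
 proof -
 have 1: "(1 - u*b'*t) * (1 - u*c'*t) * g1 (q * t) = u / v * ((1 - v * b'*t) * (1 - v * c'*t)) * g1 t"
 using g1_up[OF t] by (simp add: mult_ac)
 have 2: "(1 - u* v * t) * (q - PP*t) * gq (q * t) = u * v * ((1 - q*t) * (1 - b'*c'*t)) * gq t"
 proof -
 have "(q - PP*t) = q * (1 - PP*t/q)" using q by (simp add: field_simps)
 then show ?thesis using gq_up[OF t] q by (simp add: mult_ac)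
 qed
 have "AWA q u b' c' v t * g2 (q * t) = ((1 - u*b'*t) * (1 - u*c'*t) * g1 (q * t)) * ((1 - u* v * t) * (q - PP*t) * gq (q * t)) / (u * (q - PP*t^2) * (1 - PP*t^2))"
 unfolding AWA_def P1 g2_def by simp
 also have "... = g2 t * AWA q (q/u) b' c' (q/v) (u* v * t/q)"
 unfolding 1 2 AWA_dual[OF q(1) u0 v0(1)] P1 g2_def using u0 v0 by (simp add: mult_ac)
 finally show ?thesis .
 qed
 have C1: "AWC q u b' c' v t * g1 (t / q) = g1 t * AWC q v b' c' u t" if t: "t \<in> T" for t
 proof (rule AWL_gauge[OF t u0 v0(1) P' v0(2,3) A1 g1_sym])
 show "AWA q v b' c' u (w0 / t) = AWC q v b' c' u t"
 using AWA_reflect[of q v b' c' u t] u0 v0 Pnz[OF t] T_nz[OF t] q by (simp add: w0 P1)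
 qed
 have C2: "AWC q u b' c' v t * g2 (t / q) = g2 t * AWC q (q/u) b' c' (q/v) (u* v * t/q)" if t: "t \<in> T" for t
 proof (rule AWL_gauge[OF t u0 v0(1) P' v0(2,3) A2])
 show "g2 (w0 / t) = g2 t" if "t \<in> T" for t using that by (simp add: g2_def g1_sym gq_sym)
 have e: "q/u*b'*c'*(q/v)*(u* v * t/q)^2 = PP*t^2" "q / (q/u*b'*c'*(q/v)) / (u* v * t/q) = u* v * (w0/t)/q"
 using q u0 v0 PP0 T_nz[OF t] P1(1)[symmetric] by (auto simp: sqr_eq w0)
 show "AWA q (q/u) b' c' (q/v) (u* v * (w0/t)/q) = AWC q (q/u) b' c' (q/v) (u* v * t/q)"
 using AWA_reflect[of q "q/u" b' c' "q/v" "u* v * t/q"] u0 v0 Pnz[OF t] T_nz[OF t] q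
 unfolding e by simp
 qed
 have B1: "AWB q v b' c' u t = AWB q u b' c' v t" if t: "t \<in> T" for t
 using AWB_swap4[of u v q b' c' t] u0 v0 Pnz[OF t] by (simp add: P1)
 have B2: "AWB q (q/u) b' c' (q/v) (u* v * t/q) = AWB q u b' c' v t" if t: "t \<in> T" for t
 using AWB_dual[of q u v b' c' t] u0 v0 q Pnz[OF t] by (simp add: P1)
 have "v * q^j + 1 / (v * q^j) ~= v * q^k + 1 / (v * q^k)" if "j < k" for j
 by (rule joukowski_distinct[OF q v2]) (use that m in auto)
 from AWL_polynomial_eigenfunction[OF q(1) v0(1) this, of b' c' u] obtain e1 where
 e1: "e1 k = 1" "!!t. t ~= 0 ==> q - PP*t^2 ~= 0 ==> 1 - PP*t^2 ~= 0 ==> q^2 - PP*t^2 ~= 0 ==>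
 AWL q v b' c' u (%t. \<Sum>j\<le>k. e1 j * awphi q PP j t) t = (v * q^k + 1 / (v * q^k)) * (\<Sum>j\<le>k. e1 j * awphi q PP j t)"
 unfolding P1 by blast
 \<comment> \<open>In the dual picture the same eigenvalue belongs to
   \<open>q / u * q ^ k2 = 1 / (v * q ^ k)\<close>, so the two degrees add up to
   \<open>\<alpha> - 1\<close>.\<close>
 define k2 where "k2 = \<alpha> - 1 - k"
 define P2 where "P2 = q/u*b'*c'*(q/v)"
 have P2: "P2 ~= 0" using q u0 v0 by (simp add: P2_def)
 have ne2: "q/u * q^j + 1 / (q/u * q^j) ~= q/u * q^k2 + 1 / (q/u * q^k2)" if "j < k2" for j
 by (rule joukowski_distinct[OF q u2]) (use that m k in \<open>auto simp: k2_def\<close>)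
 have qu: "q / u ~= 0" using q u0 by simp
 from AWL_polynomial_eigenfunction[OF q(1) qu ne2, of b' c' "q/v"] obtain e2 where
 e2: "e2 k2 = 1" "!!t. t ~= 0 ==> q - P2*t^2 ~= 0 ==> 1 - P2*t^2 ~= 0 ==> q^2 - P2*t^2 ~= 0 ==>
 AWL q (q/u) b' c' (q/v) (%t. \<Sum>j\<le>k2. e2 j * awphi q P2 j t) t = (q/u * q^k2 + 1 / (q/u * q^k2)) * (\<Sum>j\<le>k2. e2 j * awphi q P2 j t)"
 unfolding P2_def by blast
 have x2: "q/u * q^k2 + 1 / (q/u * q^k2) = v * q^k + 1/(v * q^k)"
 proof -
 have "q * q^k2 * q^k = q ^ \<alpha>" using k by (simp add: k2_def flip: power_Suc power_add)
 then have "q/u * q^k2 = 1 / (v * q^k)" using u0 v0 q by (simp add: u(1) field_simps)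
 then show ?thesis by simp
 qed
 define f1 where "f1 t = (\<Sum>j\<le>k. e1 j * awphi q PP j t)" for t
 define f2 where "f2 t = (\<Sum>j\<le>k2. e2 j * awphi q P2 j t)" for t
 define p1 where "p1 t = g1 t * f1 t" for t
 define p2 where "p2 t = g2 t * f2 (u* v * t/q)" for t
 have qm: "u * v / q = q ^ (m - 1)" using k m q u(2) by (cases m) auto
 have T_q: "q ^ i * t \<in> T" if "t \<in> T" for t i
 using that by (induction i) (auto simp: mult.assoc intro: T_mult)
 have f_rfun: "rfun T f1" "rfun T f2"
 unfolding f1_def[abs_def] f2_def[abs_def] by (intro rfun_sum rfun_mult rfun_const awphi_rfun T_0)+
 show ?thesis
 proof (rule that[of p1 p2])
 show "rfun T p1" unfolding p1_def[abs_def] by (rule rfun_mult[OF g1_rfun f_rfun(1)])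
 have "rfun T (%t. f2 (q ^ (m - 1) * t))" by (rule rfun_scale[OF f_rfun(2) T_q])
 moreover have "q ^ (m - 1) * t = u* v * t/q" for t unfolding qm[symmetric] by simp
 ultimately have "rfun T (%t. f2 (u* v * t/q))" by simp
 then show "rfun T p2" unfolding p2_def[abs_def] g2_def
 by (rule rfun_mult[OF rfun_mult[OF g1_rfun gq_rfun]])
 fix t assume t: "t \<in> T"
 note t0 = T_nz[OF t]
 have f1s: "f1 (w0 / t) = f1 t" unfolding f1_def w0 by (simp only: awphi_reflect[OF q(1) PP0 t0])
 show "p1 (w0 / t) = p1 t" by (simp add: p1_def f1s g1_sym[OF t])
 have "u* v * (w0/t)/q = q / P2 / (u* v * t/q)"
 using q u0 v0 PP0 t0 P1(1)[symmetric] by (simp add: w0 P2_def)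
 moreover have nz2: "u * v * t/q ~= 0" using q u0 v0 t0 by simp
 ultimately have f2s: "f2 (u * v * (w0/t)/q) = f2 (u * v * t/q)"
 unfolding f2_def by (simp only: awphi_reflect[OF q(1) P2 nz2])
 show "p2 (w0 / t) = p2 t" by (simp only: p2_def f2s g2_def g1_sym[OF t] gq_sym[OF t])
 have "AWL q u b' c' v p1 t = (AWA q u b' c' v t * g1 (q*t)) * f1 (q*t) + AWB q u b' c' v t * (g1 t * f1 t) + (AWC q u b' c' v t * g1 (t/q)) * f1 (t/q)"
 by (simp add: AWL_def p1_def mult_ac)
 also have "... = g1 t * AWL q v b' c' u f1 t"
 unfolding A1[OF t] C1[OF t] B1[OF t, symmetric] by (simp add: AWL_def algebra_simps)
 also have "AWL q v b' c' u f1 t = (v * q^k + 1/(v * q^k)) * f1 t"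
 unfolding f1_def[abs_def] by (rule e1(2)[OF t0 Pnz[OF t]])
 finally show "AWL q u b' c' v p1 t = (v * q^k + 1/(v * q^k)) * p1 t" unfolding p1_def[of t] by (simp only: mult_ac)
 have e: "u* v * (q*t)/q = q*(u* v * t/q)" "u* v * (t/q)/q = u* v * t/q/q" by simp_all
 have "AWL q u b' c' v p2 t = (AWA q u b' c' v t * g2 (q*t)) * f2 (q*(u* v * t/q)) + AWB q u b' c' v t * (g2 t * f2 (u* v * t/q))
 + (AWC q u b' c' v t * g2 (t/q)) * f2 (u* v * t/q/q)"
 unfolding AWL_def p2_def e by (simp only: mult_ac)
 also have "... = g2 t * AWL q (q/u) b' c' (q/v) f2 (u* v * t/q)"
 unfolding A2[OF t] C2[OF t] B2[OF t, symmetric] by (simp only: AWL_def distrib_left mult_ac)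
 also have "AWL q (q/u) b' c' (q/v) f2 (u* v * t/q) = (v * q^k + 1/(v * q^k)) * f2 (u* v * t/q)"
 proof -
 have e: "P2 * (u* v * t/q)^2 = PP*t^2"
 using q u0 v0 P1(1)[symmetric] by (simp add: P2_def sqr_eq)
 show ?thesis unfolding x2[symmetric] f2_def[abs_def]
 by (rule e2(2)) (use Pnz[OF t] t0 u0 v0 q in \<open>simp_all add: e\<close>)
 qed
 finally show "AWL q u b' c' v p2 t = (v * q^k + 1/(v * q^k)) * p2 t" unfolding p2_def[of t] by (simp only: mult_ac)
 next
 fix c1 c2 assume 0: "!!n. c1 * p1 (tn n) + c2 * p2 (tn n) = 0"
 obtain F1 where F1: "isCont F1 0" "F1 0 ~= 0" "!!t. t ~= 0 ==> t ^ k * f1 t = F1 t"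
 using awphi_sum_leading[where e = e1 and k = k and P = PP, OF q(1) e1(1)] unfolding f1_def by blast
 obtain F2 where F2: "isCont F2 0" "F2 0 ~= 0" "!!t. t ~= 0 ==> t ^ k2 * f2 t = F2 t"
 using awphi_sum_leading[where e = e2 and k = k2 and P = P2, OF q(1) e2(1)] unfolding f2_def by blast
 obtain H1 where H1: "isCont H1 0" "H1 0 = 1" "!!t. t ~= 0 ==> g1 t = t ^ \<alpha> * H1 t"
 using gblock_leading'[of q "v * b'" "v * c'" \<alpha>] unfolding g1_def by metis
 obtain H2 where H2: "isCont H2 0" "H2 0 = 1" "!!t. t ~= 0 ==> gq t = t ^ (m - 1) * H2 t"
 using gblock_leading'[of q q "b'*c'" "m - 1"] unfolding gq_def by metis
 define r where "r = u * v / q"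
 have r0: "r ~= 0" using q u0 v0 by (simp add: r_def)
 \<comment> \<open>Orders at \<open>t = 0\<close>: the first solution begins with
   \<open>t ^ (\<alpha> - k)\<close>, the second with \<open>t ^ (m + k)\<close>, and these differ
   because \<open>\<alpha> < m\<close>.\<close>
 have q1: "p1 t = t ^ (\<alpha> - k) * (H1 t * F1 t)" if "t ~= 0" for t
 proof -
 have "t ^ \<alpha> = t ^ (\<alpha> - k) * t ^ k" using k by (simp flip: power_add)
 then show ?thesis using that by (simp add: p1_def H1(3) F1(3)[symmetric] mult_ac)
 qed
 have q2: "p2 t = t ^ (m + k) * (H1 t * H2 t * F2 (r * t) / r ^ k2)" if t: "t ~= 0" for t
 proof -
 have "t ^ \<alpha> * t ^ (m - 1) = t ^ (m + k) * t ^ k2" using k m by (simp add: k2_def add.commute flip: power_add)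
 moreover have "u* v * t/q = r * t" by (simp add: r_def)
 moreover have "F2 (r * t) = r ^ k2 * t ^ k2 * f2 (r * t)"
 using F2(3)[of "r * t"] r0 t by (simp add: power_mult_distrib)
 moreover have "p2 t = t ^ \<alpha> * t ^ (m - 1) * (H1 t * H2 t * f2 (u* v * t/q))"
 using t by (simp add: p2_def g2_def H1(3) H2(3) mult_ac)
 ultimately show ?thesis using r0 by (simp add: mult_ac)
 qed
 have tnz: "tn (int n) ~= 0" for n using T_nz by blast
 have "(%n. t0 * q ^ n) \<longlonglongrightarrow> 0" using LIMSEQ_power_zero[OF q(2)] by (rule tendsto_mult_right_zero)
 then have lim: "(%n. tn (int n)) \<longlonglongrightarrow> 0" by (simp add: tn_nat)
 show "c1 = 0 & c2 = 0"
 proof (rule leading_powers_independent[OF lim tnz])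
 show "isCont (%t. H1 t * F1 t) 0" using H1 F1 by (intro continuous_intros)
 have "isCont (%t. F2 (r * t)) 0"
 by (rule isCont_o2[where f = "%t. r * t" and a = 0 and g = F2]) (use F2(1) in simp_all)
 then show "isCont (%t. H1 t * H2 t * F2 (r * t) / r ^ k2) 0" using H1(1) H2(1) r0
 by (intro continuous_divide continuous_mult continuous_const) simp_all
 show "\<alpha> - k < m + k" using m k by simp
 show "c1 * (tn (int n) ^ (\<alpha> - k) * (H1 (tn (int n)) * F1 (tn (int n)))) +
 c2 * (tn (int n) ^ (m + k) * (H1 (tn (int n)) * H2 (tn (int n)) * F2 (r * tn (int n)) / r ^ k2)) = 0" for n
 using 0[of "int n"] by (simp only: q1[OF tnz] q2[OF tnz])
 qed (use H1 H2 F1 F2 r0 in auto)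
 qed
qed

end

context bispectral_pair
begin

lemma inj_tn: "inj tn"
proof (rule injI)
 fix n m assume "tn n = tn m"
 then show "n = m" using powi_inj[OF q] t0 by (simp add: tn_def)
qed

text \<open>A factor with prescribed ratio is obtained on the lattice by summing logarithms and is
  copied to the reflected lattice, which must not meet the first. The relation for \<open>r\<close>
  makes the copy obey the same recurrence.\<close>

lemma symmetric_gauge_exists:
 fixes r :: "complex => complex"
 assumes r: "!!t. t \<in> T ==> r t ~= 0" "!!t. t \<in> T ==> r (q * (w0 / t)) = 1 / r t"
 and disj: "!!n m. tn n ~= w0 / tn m"
 obtains g :: "complex => complex" where "!!t. t \<in> T ==> g t ~= 0" "!!t. t \<in> T ==> g t = r t * g (t / q)" "!!t. t \<in> T ==> g (w0 / t) = g t"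
proof -
 obtain F where F: "!!n. F n - F (n - 1) = Ln (r (tn n))"
 using int_antidifference[of "%n. Ln (r (tn n))"] by blast
 define \<Gamma> where "\<Gamma> n = exp (F n)" for n
 have \<Gamma>: "\<Gamma> n = r (tn n) * \<Gamma> (n - 1)" for n
 proof -
 have "F n = Ln (r (tn n)) + F (n - 1)" using F[of n] by (simp add: algebra_simps)
 then show ?thesis using r(1)[OF tn_T[of n]] by (simp add: \<Gamma>_def exp_add)
 qed
 define g where "g t = (if t \<in> range tn then \<Gamma> (inv tn t) else \<Gamma> (inv tn (w0 / t)))" for t
 have g1: "g (tn n) = \<Gamma> n" for n using inj_tn by (simp add: g_def inv_f_f)
 have g2: "g (w0 / tn n) = \<Gamma> n" for n
 proof -
 have "w0 / tn n \<notin> range tn" using disj by (metis imageE)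
 then show ?thesis using inj_tn w0 T_nz[OF tn_T] by (simp add: g_def inv_f_f)
 qed
 have cases: "(EX n. t = tn n) | (EX n. t = w0 / tn n)" if "t \<in> T" for t
 using that by (auto simp: T tn_def)
 show ?thesis
 proof (rule that[of g])
 fix t assume "t \<in> T"
 from cases[OF this] show "g t ~= 0" using g1 g2 by (auto simp: \<Gamma>_def)
 from cases[OF \<open>t \<in> T\<close>] show "g (w0 / t) = g t" using w0 by (auto simp: g1 g2)
 from cases[OF \<open>t \<in> T\<close>] show "g t = r t * g (t / q)"
 proof (elim disjE exE)
 fix n assume t: "t = tn n"
 show ?thesis unfolding t tn_diff1[symmetric] g1 by (rule \<Gamma>)
 next
 fix n assume t: "t = w0 / tn n"
 have tq: "t / q = w0 / tn (n + 1)" by (simp add: t tn_add1)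
 have "g t = \<Gamma> n" "g (t / q) = \<Gamma> (n + 1)" unfolding tq by (simp_all add: t g2)
 moreover have "r t = 1 / r (tn (n + 1))"
 using r(2)[OF tn_T[of "n + 1"]] q by (simp add: t tn_add1)
 moreover have "\<Gamma> (n + 1) = r (tn (n + 1)) * \<Gamma> n" using \<Gamma>[of "n + 1"] by simp
 ultimately show ?thesis using r(1)[OF tn_T[of "n + 1"]] by simp
 qed
 qed
qed

lemma zact_polynomial:
 assumes "zact q Ps (%j n z. l n * Ps j n z)" shows "zact q Ps (%j n z. poly m (l n) * Ps j n z)"
proof (induction m)
 case 0
 have "(%_. 0) meromorphic_on UNIV" by (intro meromorphic_intros)
 from zact_mult[OF this, of q Ps] show ?case by simp
next
 case (pCons c p)
 have "(%_. c) meromorphic_on UNIV" by (intro meromorphic_intros)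
 from zact_mult[OF this] have 1: "zact q Ps (%j n z. c * Ps j n z)" .
 obtain B where B: "zrel q B Ps (%j n z. l n * Ps j n z)" using assms by (auto simp: zact_def)
 from zrel_lincomb[OF B B, of "%n. poly p (l n)" "%_. 0"]
 have "zact q (%j n z. poly p (l n) * Ps j n z) (%j n z. poly p (l n) * (l n * Ps j n z))"
 by (auto simp: zact_def)
 from zact_add[OF 1 zact_comp[OF q(1) pCons.IH this]] show ?case by (simp add: algebra_simps)
qed

end

context aw_pair
begin

lemma AWA_w0: assumes "t \<in> T" shows "AWA q a b c d (w0 / t) = AWC q a b c d t"
 unfolding w0_eq using AWA_reflect[of q a b c d t] a bcd P_nz[OF assms] T_nz[OF assms] q by simp

lemma AWB_w0: assumes "t \<in> T" shows "AWB q a b c d (w0 / t) = AWB q a b c d t"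
 using AWA_w0[OF assms] AWA_w0[OF reflect0[OF assms]] w0 T_nz[OF assms] by (simp add: AWB_def)

lemma second_order_AWL:
 "second_order w0 (AWA q a b c d) (AWB q a b c d) (%n. h (tn n)) n = AWL q a b c d h (tn n)"
 by (simp add: second_order_def AWL_def AWA_w0 tn_add1 tn_diff1)

lemma eigen_ext_ad:
 assumes ad: "a = d * q ^ \<alpha>" "a * d = q ^ m" "\<alpha> < m" "k < \<alpha>"
 and hi: "halfint (d * b)" "halfint (d * c)" "halfint (b * c)"
 shows "eigen_ext w0 (AWA q a b c d) (AWB q a b c d) (d * q^k + 1 / (d * q^k))"
proof -
 obtain p1 p2 where p: "rfun T p1" "rfun T p2" "!!t. t \<in> T ==> p1 (w0 / t) = p1 t" "!!t. t \<in> T ==> p2 (w0 / t) = p2 t"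
 "!!t. t \<in> T ==> AWL q a b c d p1 t = (d * q^k + 1/(d * q^k)) * p1 t"
 "!!t. t \<in> T ==> AWL q a b c d p2 t = (d * q^k + 1/(d * q^k)) * p2 t"
 "!!c1 c2. (!!n. c1 * p1 (tn n) + c2 * p2 (tn n) = 0) ==> c1 = 0 & c2 = 0"
 using two_rational_eigenfunctions[OF ad bcd(3,1,2) refl hi] by blast
 show ?thesis
 proof (rule eigen_extI[where g = "%_. 1" and r = "%_. 1" and i = 0 and ?p1.0 = p1 and ?p2.0 = p2])
 show "second_order w0 (AWA q a b c d) (AWB q a b c d) (%n. 1 * p1 (tn n)) n =
 (d * q^k + 1 / (d * q^k)) * (1 * p1 (tn n))" for n
 using second_order_AWL[of p1 n] p(5)[OF tn_T[of n]] by simp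
 show "second_order w0 (AWA q a b c d) (AWB q a b c d) (%n. 1 * p2 (tn n)) n =
 (d * q^k + 1 / (d * q^k)) * (1 * p2 (tn n))" for n
 using second_order_AWL[of p2 n] p(6)[OF tn_T[of n]] by simp
 show "c1 = 0 & c2 = 0" if "!!n. c1 * p1 (tn n) + c2 * p2 (tn n) = 0" for c1 c2 by (rule p(7)[OF that])
 qed (use p(1-4) coeffs(4) in \<open>auto intro: rfun_const\<close>)
qed

lemma w0_disjoint: "tn n ~= w0 / tn m"
proof
 assume "tn n = w0 / tn m"
 moreover obtain k where k: "a*b*c*d = q powi k" using P by blast
 ultimately have "tn n * tn m = q / q powi k" using T_nz[OF tn_T[of m]] by (simp add: w0_eq[unfolded k])
 moreover have "tn n * tn m = tn n ^ 2 * q powi (m - n)"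
 using q by (simp add: tn_def sqr_eq power_int_diff)
 ultimately have "tn n ^ 2 = q powi 1 / q powi k / q powi (m - n)" using q by (simp add: field_simps)
 also have "... = q powi (1 - k - (m - n))" using q by (simp add: power_int_diff)
 finally show False using nonres[OF tn_T] by blast
qed

text \<open>The operator with \<open>b\<close> in front differs from the given one by a gauge of
  ratio \<open>Ab / Aa\<close>: the diagonals agree by \<open>AWB_swap\<close>, and so do the
  products of opposite off-diagonal coefficients. The two rational solutions for the pair
  \<open>b\<close>, \<open>c\<close> are transported by it.\<close>

lemma eigen_ext_bc:
 assumes bc: "b = c * q ^ \<beta>" "b * c = q ^ m" "\<beta> < m" "k < \<beta>"
 and hi: "halfint (c * a)" "halfint (c * d)" "halfint (a * d)" "halfint (a * b)" "halfint (b * d)"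
 shows "eigen_ext w0 (AWA q a b c d) (AWB q a b c d) (c * q^k + 1 / (c * q^k))"
proof -
 have P': "b * a * d * c = a * b * c * d" by (simp add: mult_ac)
 obtain p1 p2 where p: "rfun T p1" "rfun T p2" "!!t. t \<in> T ==> p1 (w0 / t) = p1 t" "!!t. t \<in> T ==> p2 (w0 / t) = p2 t"
 "!!t. t \<in> T ==> AWL q b a d c p1 t = (c * q^k + 1/(c * q^k)) * p1 t"
 "!!t. t \<in> T ==> AWL q b a d c p2 t = (c * q^k + 1/(c * q^k)) * p2 t"
 "!!c1 c2. (!!n. c1 * p1 (tn n) + c2 * p2 (tn n) = 0) ==> c1 = 0 & c2 = 0"
 using two_rational_eigenfunctions[OF bc bcd(2) a bcd(3) P' hi(1-3)] by blast
 define Ab where "Ab = AWA q b a d c"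
 define Aa where "Aa = AWA q a b c d"
 have Aa0: "Aa t ~= 0" if "t \<in> T" for t using coeffs(4) that by (simp add: Aa_def)
 have hbc: "halfint (b * c)" unfolding halfint_def bc(2) by (rule exI[of _ "int (m + m)"])
 (simp only: power_int_of_nat sqr_eq power_add)
 obtain k0 where k0: "a*b*c*d = q powi k0" using P by blast
 have hP: "halfint (a*b*c*d)" unfolding halfint_def k0 sqr_eq
 by (rule exI[of _ "k0 + k0"], rule power_int_add[symmetric]) (use q in blast)
 have Ab_form: "Ab t = (1 - a*b*t) * (1 - b*d*t) * (1 - b*c*t) * (q - a*b*c*d*t) / (b * (q - a*b*c*d*t^2) * (1 - a*b*c*d*t^2))" for t
 by (simp add: Ab_def AWA_def mult_ac)
 have Ab0: "Ab t ~= 0" if "t \<in> T" for t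
 using halfint_nz[OF that hi(4), of 0] halfint_nz[OF that hi(5), of 0] halfint_nz[OF that hbc, of 0]
 halfint_ne[OF that hP, of 0 1] P_nz[OF that] bcd
 by (auto simp: Ab_form)
 have Ab_rfun: "rfun T Ab" unfolding Ab_form[abs_def]
 by (intro rfun_divide rfun_mult rfun_diff rfun_const rfun_id rfun_power) (use P_nz bcd in auto)
 have Ab_C: "Ab (w0 / t) = AWC q b a d c t" if "t \<in> T" for t
 unfolding Ab_def w0_eq P'[symmetric]
 using AWA_reflect[of q b a d c t] a bcd P_nz[OF that] T_nz[OF that] q by (simp add: P')
 define r where "r t = Ab (t / q) / Aa (t / q)" for t
 \<comment> \<open>By the reflection, \<open>Ab (w0 / (q * t))\<close> is the lower coefficient at
   \<open>q * t\<close>; its product with the upper one at \<open>t\<close> is symmetric in the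
   parameters.\<close>
 have prod: "Ab t * Ab (w0 / (q * t)) = Aa t * Aa (w0 / (q * t))" if t: "t \<in> T" for t
 proof -
 have qt: "q * t \<in> T" by (rule T_mult[OF t])
 have "Ab (w0 / (q * t)) = AWC q b a d c (q * t)" "Aa (w0 / (q * t)) = AWC q a b c d (q * t)"
 using Ab_C[OF qt] AWA_w0[OF qt] by (simp_all add: Aa_def)
 moreover have "q - u * (v * (q * t)) = q * (1 - u * (v * t))" for u v by (simp add: algebra_simps)
 then have "Ab t * AWC q b a d c (q * t) = Aa t * AWC q a b c d (q * t)"
 unfolding Ab_form Aa_def AWA_def AWC_def using a bcd by (simp add: mult_ac)
 ultimately show ?thesis by simp
 qed
 have r0: "r t ~= 0" if "t \<in> T" for t using Ab0 Aa0 T_div[OF that] by (simp add: r_def)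
 have rsym: "r (q * (w0 / t)) = 1 / r t" if t: "t \<in> T" for t
 proof -
 have "Ab (t / q) * Ab (w0 / t) = Aa (t / q) * Aa (w0 / t)" using prod[OF T_div[OF t]] q by simp
 moreover have "Ab (w0 / t) ~= 0" "Aa (w0 / t) ~= 0" "Ab (t / q) ~= 0" "Aa (t / q) ~= 0"
 using Ab0 Aa0 reflect0[OF t] T_div[OF t] by auto
 ultimately show ?thesis using q by (simp add: r_def field_simps)
 qed
 have r_rfun: "rfun T r" unfolding r_def[abs_def] Aa_def
 by (intro rfun_divide rfun_down[OF Ab_rfun] rfun_down[OF coeffs(1)]) (use Aa0 T_div in \<open>auto simp: Aa_def\<close>)
 obtain g where g: "!!t. t \<in> T ==> g t ~= 0" "!!t. t \<in> T ==> g t = r t * g (t / q)" "!!t. t \<in> T ==> g (w0 / t) = g t"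
 using symmetric_gauge_exists[of r, OF r0 rsym w0_disjoint] by blast
 have A: "AWA q a b c d t * g (q * t) = g t * Ab t" if t: "t \<in> T" for t
 using g(2)[OF T_mult[OF t]] Aa0[OF t] q by (simp add: r_def Aa_def)
 have C: "AWC q a b c d t * g (t / q) = g t * AWC q b a d c t" if t: "t \<in> T" for t
 by (rule AWL_gauge[OF t a bcd(3) refl bcd(1,2) A g(3) Ab_C[OF t]])
 have B: "AWB q b a d c t = AWB q a b c d t" if t: "t \<in> T" for t
 proof -
 have "AWB q b a d c t = AWB q b a c d t" by (simp add: AWB_def AWA_def AWC_def mult_ac)
 then show ?thesis using AWB_swap[of a b q c d t] P_nz[OF t] a bcd by simp
 qed
 have L: "AWL q a b c d (%t. g t * h t) t = g t * AWL q b a d c h t" if t: "t \<in> T" for h t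
 proof -
 have "AWL q a b c d (%t. g t * h t) t = (AWA q a b c d t * g (q * t)) * h (q * t) + AWB q a b c d t * (g t * h t)
 + (AWC q a b c d t * g (t / q)) * h (t / q)" by (simp add: AWL_def mult_ac)
 then show ?thesis unfolding A[OF t] C[OF t] B[OF t, symmetric] by (simp add: AWL_def Ab_def algebra_simps)
 qed
 show ?thesis
 proof (rule eigen_extI[where g = g and r = r and i = 0 and ?p1.0 = p1 and ?p2.0 = p2])
 show "second_order w0 (AWA q a b c d) (AWB q a b c d) (%n. g (tn n) * p1 (tn n)) n =
 (c * q^k + 1 / (c * q^k)) * (g (tn n) * p1 (tn n))" for n
 using second_order_AWL[of "%t. g t * p1 t" n] L[OF tn_T[of n], of p1] p(5)[OF tn_T[of n]] by simp
 show "second_order w0 (AWA q a b c d) (AWB q a b c d) (%n. g (tn n) * p2 (tn n)) n =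
 (c * q^k + 1 / (c * q^k)) * (g (tn n) * p2 (tn n))" for n
 using second_order_AWL[of "%t. g t * p2 t" n] L[OF tn_T[of n], of p2] p(6)[OF tn_T[of n]] by simp
 show "r t ~= 0 & g t ~= 0 & g t = r t * g (t / q)" if "t \<in> T" for t
 using r0[OF that] g(1,2)[OF that] by blast
 show "c1 = 0 & c2 = 0" if "!!n. c1 * p1 (tn n) + c2 * p2 (tn n) = 0" for c1 c2 by (rule p(7)[OF that])
 qed (use p(1-4) g(3) r_rfun coeffs(4) in auto)
qed

text \<open>Initially every polynomial in \<open>t + w0 / t\<close> is realised, so
  \<open>G = 1\<close>, and the family is its own span with trivial gauge.\<close>

lemma base_stage:
 assumes "zact q Ps (%j n z. (tn n + w0 / tn n) * Ps j n z)"
 and "!!x. x \<in> X ==> eigen_ext w0 (AWA q a b c d) (AWB q a b c d) x"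
 shows "stage w0 (AWA q a b c d) (AWB q a b c d) Ps X"
 unfolding stage_def
proof (intro conjI ballI)
 have "w0 = q ^ 0 * w0" by simp
 then show "sym_op w0 (AWA q a b c d) (AWB q a b c d)"
 unfolding sym_op_def using coeffs AWB_w0 by blast
 show "eigenfamily w0 (AWA q a b c d) (AWB q a b c d) Ps"
 unfolding eigenfamily_def by (rule generic_mono[OF generic_eig]) (simp add: second_order_def eig_def AWA_w0)
 show "has_zops w0 Ps" unfolding has_zops_def
 proof (rule exI[of _ 1], intro conjI ballI allI)
 fix m
 show "EX B. zrel q B Ps (%j n z. poly (1 * m) (tn n + w0 / tn n) * Ps j n z)"
 using zact_polynomial[OF assms(1), of m] by (simp add: zact_def)
 qed simp
 show "gauge_span Ps" unfolding gauge_span_def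
 by (rule exI[of _ "%_. 1"], rule exI[of _ "%_. 1"]) (simp add: inspan_Ps generic_True)
qed (rule assms)

end

section \<open>Infinite products and series with rational coefficient ratios\<close>

definition qp :: "complex => complex => complex" where
 "qp q w = prodinf (%i. 1 - w * q ^ i)"

lemma qpoch_inf_Nil [simp]: "qpoch_inf [] q = 1"
 and qpoch_inf_Cons [simp]: "qpoch_inf (w # ws) q = qp q w * qpoch_inf ws q"
 by (simp_all add: qpoch_inf_def qp_def)

lemma qp_0 [simp]: "qp q 0 = 1"
 by (simp add: qp_def)

lemma poly_sum_le:
 fixes p :: "complex poly"
 shows "degree p <= N ==> poly p x = (\<Sum>j\<le>N. coeff p j * x ^ j)"
 unfolding poly_altdef by (rule sum.mono_neutral_left) (auto simp: coeff_eq_0)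

definition apoly :: "(complex => complex poly) => complex => bool" where
 "apoly P z0 \<longleftrightarrow> (ALL j. (%z. coeff (P z) j) analytic_on {z0})"

lemma apoly_const: "apoly (%_. P) z0"
 by (simp add: apoly_def)

lemma apoly_pCons: "f analytic_on {z0} ==> apoly P z0 ==> apoly (%z. pCons (f z) (P z)) z0"
 unfolding apoly_def
proof
 fix j assume "f analytic_on {z0}" "ALL j. (%z. coeff (P z) j) analytic_on {z0}"
 then show "(%z. coeff (pCons (f z) (P z)) j) analytic_on {z0}" by (cases j) simp_all
qed

lemma apoly_mult: "apoly P z0 ==> apoly Q z0 ==> apoly (%z. P z * Q z) z0"
 unfolding apoly_def coeff_mult by (auto intro!: analytic_intros)

text \<open>Consecutive coefficients have the ratio of \<open>poly r (q ^ k)\<close> to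
  \<open>poly p (q ^ Suc k)\<close>. The constant terms make it tend to \<open>1\<close>, and the
  zero of \<open>p\<close> at \<open>1\<close> lets the recursion start at
  \<open>k = 0\<close>.\<close>

definition ratio_pair :: "nat => complex poly => complex poly => bool" where
 "ratio_pair N r p \<longleftrightarrow> degree r <= N & degree p <= N & coeff r 0 = 1 & coeff p 0 = 1 & poly p 1 = 0"

context
 fixes q :: complex
 assumes q: "q ~= 0" "norm q < 1"
begin

lemma qp_convergent: "convergent_prod (%i. 1 - w * q ^ i)"
 by (rule abs_convergent_prod_imp_convergent_prod)
 (use q in \<open>simp add: abs_convergent_prod_conv_summable norm_mult norm_power summable_mult summable_geometric\<close>)

lemma qp_LIMSEQ: "(%n. \<Prod>i<n. 1 - w * q ^ i) \<longlonglongrightarrow> qp q w"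
proof -
 have "(%n. \<Prod>i\<le>n. 1 - w * q ^ i) \<longlonglongrightarrow> qp q w"
 unfolding qp_def by (rule convergent_prod_LIMSEQ[OF qp_convergent])
 then have "(%n. \<Prod>i<Suc n. 1 - w * q ^ i) \<longlonglongrightarrow> qp q w" by (simp add: lessThan_Suc_atMost)
 then show ?thesis by (rule LIMSEQ_imp_Suc)
qed

lemma qp_shift: "qp q w = (1 - w) * qp q (q * w)"
proof -
 have "(\<Prod>i<Suc n. 1 - w * q ^ i) = (1 - w) * (\<Prod>i<n. 1 - q * w * q ^ i)" for n
 by (subst prod.lessThan_Suc_shift) (simp add: mult_ac)
 then have "(%n. \<Prod>i<Suc n. 1 - w * q ^ i) \<longlonglongrightarrow> (1 - w) * qp q (q * w)"
 using tendsto_mult_left[OF qp_LIMSEQ[of "q * w"], of "1 - w"] by simp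
 then show ?thesis using LIMSEQ_unique[OF LIMSEQ_Suc[OF qp_LIMSEQ[of w]]] by blast
qed

lemma qp_eq_0_iff: "qp q w = 0 \<longleftrightarrow> (EX i. w * q ^ i = 1)"
proof
 assume "qp q w = 0"
 then show "EX i. w * q ^ i = 1"
 using prodinf_nonzero[OF qp_convergent[of w]] by (auto simp: qp_def)
next
 assume "EX i. w * q ^ i = 1"
 then obtain i where i: "w * q ^ i = 1" ..
 have "eventually (%n. (\<Prod>i<n. 1 - w * q ^ i) = 0) sequentially"
 using eventually_gt_at_top[of i] by eventually_elim (use i in auto)
 then have "(%n. \<Prod>i<n. 1 - w * q ^ i) \<longlonglongrightarrow> 0" by (rule tendsto_eventually)
 then show "qp q w = 0" using LIMSEQ_unique[OF qp_LIMSEQ] by blast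
qed

lemma qp_holomorphic: "qp q holomorphic_on UNIV"
proof (rule holomorphic_uniform_sequence[OF open_UNIV])
 show "(%w. \<Prod>i<n. 1 - w * q ^ i) holomorphic_on UNIV" for n by (intro holomorphic_intros)
 fix x :: complex
 have "uniformly_convergent_on (cball x 1) (%N w. \<Prod>n<N. 1 - w * q ^ n)"
 proof (rule uniformly_convergent_on_prod')
 have "uniform_limit (cball x 1) (%N w. \<Sum>n<N. norm (1 - w * q ^ n - 1)) (%w. \<Sum>n. norm (1 - w * q ^ n - 1)) sequentially"
 proof (rule Weierstrass_m_test)
 show "norm (norm (1 - w * q ^ n - 1)) <= (norm x + 1) * norm q ^ n" if "w \<in> cball x 1" for n w
 proof -
 have "norm w <= norm x + 1" using that norm_triangle_ineq2[of w x] by (simp add: dist_norm norm_minus_commute)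
 then show ?thesis by (simp add: norm_mult norm_power mult_right_mono)
 qed
 show "summable (%n. (norm x + 1) * norm q ^ n)" using q by (simp add: summable_mult summable_geometric)
 qed
 then show "uniformly_convergent_on (cball x 1) (%N w. \<Sum>n<N. norm (1 - w * q ^ n - 1))"
 by (auto simp: uniformly_convergent_on_def)
 qed (auto intro!: continuous_intros)
 then obtain l where l: "uniform_limit (cball x 1) (%N w. \<Prod>n<N. 1 - w * q ^ n) l sequentially"
 by (auto simp: uniformly_convergent_on_def)
 have "l w = qp q w" if "w \<in> cball x 1" for w
 using LIMSEQ_unique[OF tendsto_uniform_limitI[OF l that] qp_LIMSEQ] .
 with l have "uniform_limit (cball x 1) (%N w. \<Prod>n<N. 1 - w * q ^ n) (qp q) sequentially"
 by (metis (no_types, lifting) uniform_limit_cong')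
 then show "\<exists>d>0. cball x d \<subseteq> UNIV & uniform_limit (cball x d) (%N w. \<Prod>n<N. 1 - w * q ^ n) (qp q) sequentially"
 by (intro exI[of _ 1]) simp
qed

lemma qp_analytic: "f analytic_on {z0} ==> (%z. qp q (f z)) analytic_on {z0}"
proof -
 assume "f analytic_on {z0}"
 moreover have "qp q analytic_on UNIV" using qp_holomorphic by (simp add: analytic_on_open)
 ultimately show ?thesis using analytic_on_compose_gen[of f "{z0}" "qp q" UNIV] by (simp add: comp_def)
qed

lemma qp_isCont: "isCont (qp q) w"
 using qp_analytic[of "%z. z" w] by (simp add: analytic_at_imp_isCont)

definition qc :: "complex poly => complex poly => nat => complex" where
 "qc r p k = (\<Prod>i<k. poly r (q ^ i) / poly p (q ^ Suc i))"

definition qreg :: "complex poly => bool" where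
 "qreg p \<longleftrightarrow> (ALL k. poly p (q ^ Suc k) ~= 0)"

lemma qc_Suc: "qc r p (Suc k) = qc r p k * (poly r (q ^ k) / poly p (q ^ Suc k))"
 by (simp add: qc_def)

lemma poly_minus_1_bound:
 fixes p :: "complex poly"
 assumes "degree p <= N" "coeff p 0 = 1" "!!j. j <= N ==> norm (coeff p j) <= M" "norm u <= 1"
 shows "norm (poly p u - 1) <= N * M * norm u"
proof -
 have "poly p u = (\<Sum>j\<in>insert 0 {1..N}. coeff p j * u ^ j)"
 unfolding poly_sum_le[OF assms(1)] by (rule sum.cong) auto
 then have "poly p u - 1 = (\<Sum>j=1..N. coeff p j * u ^ j)" by (subst (asm) sum.insert) (auto simp: assms(2))
 also have "norm ... <= (\<Sum>j=1..N. M * norm u)"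
 proof (rule sum_norm_le)
 fix j assume j: "j \<in> {1..N}"
 have "norm u ^ j <= norm u ^ 1" by (rule power_decreasing) (use j assms(4) in auto)
 then show "norm (coeff p j * u ^ j) <= M * norm u"
 unfolding norm_mult norm_power using assms(3)[of j] j
 by (intro mult_mono) (auto intro: order_trans[OF norm_ge_zero])
 qed
 finally show ?thesis by simp
qed

text \<open>Near \<open>z0\<close> the ratio of consecutive terms is uniformly close to
  \<open>X z\<close>, because the polynomials at \<open>q ^ k\<close> differ from \<open>1\<close>
  by at most \<open>C * norm q ^ k\<close>. Finitely many denominators are controlled by continuity,
  all others by this bound.\<close>

lemma local_bounds:
 assumes an: "apoly r z0" "apoly p z0" "X analytic_on {z0}" and X: "norm (X z0) < 1"
 and rp: "!!z. ratio_pair N (r z) (p z)" and reg: "qreg (p z0)"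
 shows "\<exists>S K ro B. open S & z0 \<in> S & 0 <= ro & ro < 1 & (\<forall>z\<in>S. qreg (p z)) &
 (ALL k. (%z. qc (r z) (p z) k * X z ^ k) holomorphic_on S) &
 (\<forall>z\<in>S. ALL k. norm (qc (r z) (p z) (K + k) * X z ^ (K + k)) <= B * ro ^ k)"
proof -
 have deg: "degree (r z) <= N" "degree (p z) <= N" "coeff (r z) 0 = 1" "coeff (p z) 0 = 1" for z
 using rp[of z] by (auto simp: ratio_pair_def)
 have anr: "(%z. coeff (r z) j) analytic_on {z0}" and anp: "(%z. coeff (p z) j) analytic_on {z0}" for j
 using an by (auto simp: apoly_def)
 define M where "M = 1 + (\<Sum>j\<le>N. norm (coeff (r z0) j) + norm (coeff (p z0) j))"
 have near: "\<forall>\<^sub>F z in nhds z0. norm (f z) < m" if "f analytic_on {z0}" "norm (f z0) < m" for f m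
 proof -
 have "isCont (%z. norm (f z)) z0" using analytic_at_imp_isCont[OF that(1)] by (intro continuous_intros)
 then have "((%z. norm (f z)) \<longlongrightarrow> norm (f z0)) (nhds z0)" by (simp add: isCont_def tendsto_nhds_iff)
 then show ?thesis using that(2) by (rule order_tendstoD)
 qed
 have nz: "\<forall>\<^sub>F z in nhds z0. f z ~= 0" if "f analytic_on {z0}" "f z0 ~= 0" for f
 proof -
 have "(f \<longlongrightarrow> f z0) (nhds z0)"
 using analytic_at_imp_isCont[OF that(1)] by (simp add: isCont_def flip: tendsto_at_iff_tendsto_nhds)
 then show ?thesis using that(2) by (rule tendsto_imp_eventually_ne)
 qed
 have hol: "\<forall>\<^sub>F z in nhds z0. f analytic_on {z}" if fan: "f analytic_on {z0}" for f :: "complex => complex"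
 proof -
 obtain s where s: "open s" "z0 \<in> s" "f holomorphic_on s" using fan unfolding analytic_at by auto
 then have "f analytic_on s" by (simp add: analytic_on_open)
 then show ?thesis using s(1,2) unfolding eventually_nhds
 by (intro exI[of _ s]) (auto intro: analytic_on_subset)
 qed
 have le: "norm (coeff (r z0) j) + norm (coeff (p z0) j) <= M - 1" if "j <= N" for j
 unfolding M_def using member_le_sum[of j "{..N}" "%j. norm (coeff (r z0) j) + norm (coeff (p z0) j)"] that by simp
 have e1: "\<forall>\<^sub>F z in nhds z0. \<forall>j\<in>{..N}. norm (coeff (r z) j) < M & norm (coeff (p z) j) < M
 & (%z. coeff (r z) j) analytic_on {z} & (%z. coeff (p z) j) analytic_on {z}"
 proof (rule eventually_ball_finite, simp, intro ballI eventually_conj)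
 fix j assume "j \<in> {..N}"
 then have "norm (coeff (r z0) j) + norm (coeff (p z0) j) <= M - 1" using le by simp
 then have "norm (coeff (r z0) j) < M" "norm (coeff (p z0) j) < M"
 using norm_ge_zero[of "coeff (r z0) j"] norm_ge_zero[of "coeff (p z0) j"] by linarith+
 then show "\<forall>\<^sub>F z in nhds z0. norm (coeff (r z) j) < M" "\<forall>\<^sub>F z in nhds z0. norm (coeff (p z) j) < M"
 using near[OF anr] near[OF anp] by auto
 show "\<forall>\<^sub>F z in nhds z0. (%z. coeff (r z) j) analytic_on {z}" "\<forall>\<^sub>F z in nhds z0. (%z. coeff (p z) j) analytic_on {z}"
 using hol[OF anr] hol[OF anp] .
 qed
 \<comment> \<open>\<open>x1\<close> bounds the argument near \<open>z0\<close>; the gap between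
   \<open>x1\<close> and \<open>ro\<close> absorbs the deviation of the coefficient ratios from
   \<open>1\<close> beyond the index \<open>K\<close>.\<close>
 obtain x1 where x1: "norm (X z0) < x1" "x1 < 1" using X dense by blast
 obtain ro where ro: "x1 < ro" "ro < 1" using x1 dense by blast
 have x10: "0 < x1" using x1 norm_ge_zero[of "X z0"] by linarith
 define C where "C = real N * M"
 have C0: "C >= 0" unfolding C_def M_def by (intro mult_nonneg_nonneg add_nonneg_nonneg sum_nonneg) auto
 have qk: "(%k. norm q ^ k) \<longlonglongrightarrow> 0" using q by (intro LIMSEQ_power_zero) auto
 have "(%k. (1 + C * norm q ^ k) / (1 - C * norm q ^ Suc k) * x1) \<longlonglongrightarrow> (1 + C * 0) / (1 - C * 0) * x1"
 by (intro tendsto_intros qk LIMSEQ_Suc[OF qk]) simp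
 then have "\<forall>\<^sub>F k in sequentially. (1 + C * norm q ^ k) / (1 - C * norm q ^ Suc k) * x1 < ro"
 by (rule order_tendstoD) (use ro in simp)
 moreover have "(%k. C * norm q ^ Suc k) \<longlonglongrightarrow> C * 0" by (intro tendsto_intros LIMSEQ_Suc[OF qk])
 then have "\<forall>\<^sub>F k in sequentially. C * norm q ^ Suc k < 1" by (rule order_tendstoD) simp
 ultimately have "\<forall>\<^sub>F k in sequentially. (1 + C * norm q ^ k) / (1 - C * norm q ^ Suc k) * x1 < ro & C * norm q ^ Suc k < 1"
 by (rule eventually_conj)
 then obtain K where K: "!!k. k >= K ==> (1 + C * norm q ^ k) / (1 - C * norm q ^ Suc k) * x1 < ro"
 "!!k. k >= K ==> C * norm q ^ Suc k < 1"
 unfolding eventually_sequentially by blast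
 have anpoly: "(%z. poly (r z) u) analytic_on {z}" "(%z. poly (p z) u) analytic_on {z}"
 if "\<forall>j\<in>{..N}. (%z. coeff (r z) j) analytic_on {z} & (%z. coeff (p z) j) analytic_on {z}" for z u
 using that by (auto simp: poly_sum_le[OF deg(1)] poly_sum_le[OF deg(2)] intro!: analytic_intros)
 have an0: "\<forall>j\<in>{..N}. (%z. coeff (r z) j) analytic_on {z0} & (%z. coeff (p z) j) analytic_on {z0}"
 using anr anp by blast
 have e2: "\<forall>\<^sub>F z in nhds z0. \<forall>k\<in>{..<K}. poly (p z) (q ^ Suc k) ~= 0"
 by (rule eventually_ball_finite, simp, intro ballI nz anpoly(2)[OF an0]) (use reg in \<open>simp add: qreg_def\<close>)
 define tm where "tm k z = qc (r z) (p z) k * X z ^ k" for k z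
 have tm_an: "tm k analytic_on {z}"
 if "\<forall>j\<in>{..N}. (%z. coeff (r z) j) analytic_on {z} & (%z. coeff (p z) j) analytic_on {z}"
 "X analytic_on {z}" "qreg (p z)" for k z
 unfolding tm_def[abs_def] qc_def using that(2,3)
 by (intro analytic_intros analytic_on_prod anpoly[OF that(1)]) (auto simp: qreg_def)
 have "norm (tm K z0) < norm (tm K z0) + 1" by simp
 from near[OF tm_an[OF an0 an(3) reg] this]
 have e3: "\<forall>\<^sub>F z in nhds z0. norm (tm K z) < norm (tm K z0) + 1" .
 obtain S where S: "open S" "z0 \<in> S" "!!z. z \<in> S ==> (\<forall>j\<in>{..N}. norm (coeff (r z) j) < M & norm (coeff (p z) j) < M
 & (%z. coeff (r z) j) analytic_on {z} & (%z. coeff (p z) j) analytic_on {z}) & (\<forall>k\<in>{..<K}. poly (p z) (q ^ Suc k) ~= 0)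
 & norm (tm K z) < norm (tm K z0) + 1 & norm (X z) < x1 & X analytic_on {z}"
 using eventually_conj[OF e1 eventually_conj[OF e2 eventually_conj[OF e3 eventually_conj[OF near[OF an(3) x1(1)] hol[OF an(3)]]]]]
 unfolding eventually_nhds by blast
 have pb: "norm (poly (p z) (q ^ k) - 1) <= C * norm q ^ k" "norm (poly (r z) (q ^ k) - 1) <= C * norm q ^ k"
 if "z \<in> S" for z k
 proof -
 have u: "norm (q ^ k) <= 1" using q by (simp add: norm_power power_le_one)
 have "norm (coeff (p z) j) <= M" "norm (coeff (r z) j) <= M" if "j <= N" for j
 using S(3)[OF \<open>z \<in> S\<close>] that by (auto intro: less_imp_le)
 then show "norm (poly (p z) (q ^ k) - 1) <= C * norm q ^ k" "norm (poly (r z) (q ^ k) - 1) <= C * norm q ^ k"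
 using poly_minus_1_bound[OF deg(2) deg(4) _ u] poly_minus_1_bound[OF deg(1) deg(3) _ u]
 by (auto simp: C_def norm_power)
 qed
 have plow: "norm (poly (p z) (q ^ Suc k)) >= 1 - C * norm q ^ Suc k" if "z \<in> S" for z k
 proof -
 have "1 - norm (poly (p z) (q ^ Suc k)) <= norm (1 - poly (p z) (q ^ Suc k))"
 using norm_triangle_ineq2[of 1 "poly (p z) (q ^ Suc k)"] by simp
 then show ?thesis using pb(1)[OF that, of "Suc k"] by (simp only: norm_minus_commute)
 qed
 have regS: "qreg (p z)" if "z \<in> S" for z
 unfolding qreg_def
 proof
 fix k show "poly (p z) (q ^ Suc k) ~= 0"
 proof (cases "k < K")
 case True then show ?thesis using S(3)[OF that] by simp
 next
 case False
 then have "0 < 1 - C * norm q ^ Suc k" using K(2)[of k] by simp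
 with plow[OF that, of k] show ?thesis by auto
 qed
 qed
 have bound: "norm (tm (K + k) z) <= (norm (tm K z0) + 1) * ro ^ k" if z: "z \<in> S" for z k
 proof (induction k)
 case 0 then show ?case using S(3)[OF z] by simp
 next
 case (Suc k)
 define ka where "ka = K + k"
 have d: "0 < 1 - C * norm q ^ Suc ka" using K(2)[of ka] by (simp add: ka_def)
 have "norm (poly (r z) (q ^ ka)) <= 1 + C * norm q ^ ka"
 using norm_triangle_ineq2[of "poly (r z) (q ^ ka)" 1] pb(2)[OF z, of ka] by simp
 then have "norm (poly (r z) (q ^ ka) / poly (p z) (q ^ Suc ka)) <= (1 + C * norm q ^ ka) / (1 - C * norm q ^ Suc ka)"
 unfolding norm_divide using plow[OF z, of ka] d C0 by (intro frac_le) auto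
 then have "norm (poly (r z) (q ^ ka) / poly (p z) (q ^ Suc ka)) * norm (X z) <=
 (1 + C * norm q ^ ka) / (1 - C * norm q ^ Suc ka) * x1"
 using S(3)[OF z] d C0 by (intro mult_mono) auto
 also have "... <= ro" using K(1)[of ka] by (simp add: ka_def)
 finally have rat: "norm (poly (r z) (q ^ ka) / poly (p z) (q ^ Suc ka)) * norm (X z) <= ro" .
 have "tm (Suc ka) z = tm ka z * (poly (r z) (q ^ ka) / poly (p z) (q ^ Suc ka) * X z)"
 by (simp add: tm_def qc_Suc)
 then have "norm (tm (Suc ka) z) = norm (tm ka z) * (norm (poly (r z) (q ^ ka) / poly (p z) (q ^ Suc ka)) * norm (X z))"
 by (simp only: norm_mult)
 also have "... <= ((norm (tm K z0) + 1) * ro ^ k) * ro"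
 using Suc rat x10 ro by (intro mult_mono) (auto simp: ka_def)
 finally show ?case by (simp add: ka_def mult_ac)
 qed
 have "tm k analytic_on {z}" if "z \<in> S" for k z by (rule tm_an) (use S(3)[OF that] regS[OF that] in auto)
 then have "tm k holomorphic_on S" for k
 by (intro analytic_imp_holomorphic, subst analytic_on_analytic_at) blast
 then show ?thesis using S(1,2) regS bound ro x10 unfolding tm_def[abs_def]
 by (intro exI[of _ S] exI[of _ K] exI[of _ ro] exI[of _ "norm (tm K z0) + 1"]) (auto simp: tm_def)
qed

lemma qreg_eventually:
 assumes "apoly r z0" "apoly p z0" "!!z. ratio_pair N (r z) (p z)" "qreg (p z0)"
 shows "\<forall>\<^sub>F z in nhds z0. qreg (p z)"
 using local_bounds[where X = "%_. 0", OF assms(1,2) analytic_on_const _ assms(3,4)]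
 unfolding eventually_nhds by (elim meta_impE, simp, blast)

lemma qser_summable:
 assumes "ratio_pair N r p" "qreg p" "norm x < 1"
 shows "summable (%k. qc r p k * x ^ k)"
proof -
 obtain K ro B where b: "0 <= ro" "ro < 1" "!!k. norm (qc r p (K + k) * x ^ (K + k)) <= B * ro ^ k"
 using local_bounds[OF apoly_const apoly_const, of "%_. x" 0 N r p] assms by auto
 have "summable (%k. qc r p (k + K) * x ^ (k + K))"
 by (rule summable_comparison_test'[where N = 0 and g = "%k. B * ro ^ k"])
 (use b in \<open>auto simp: add.commute intro!: summable_mult summable_geometric\<close>)
 then show ?thesis by (subst (asm) summable_iff_shift)
qed

lemma qser_analytic:
 assumes an: "apoly r z0" "apoly p z0" "X analytic_on {z0}" and X: "norm (X z0) < 1"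
 and rp: "!!z. ratio_pair N (r z) (p z)" and reg: "qreg (p z0)"
 shows "(%z. \<Sum>k. qc (r z) (p z) k * X z ^ k) analytic_on {z0}"
proof -
 obtain S K ro B where S: "open S" "z0 \<in> S" "0 <= ro" "ro < 1"
 "!!k. (%z. qc (r z) (p z) k * X z ^ k) holomorphic_on S"
 "!!z k. z \<in> S ==> norm (qc (r z) (p z) (K + k) * X z ^ (K + k)) <= B * ro ^ k"
 using local_bounds[OF assms] by (elim exE conjE) (erule (2) that; blast)
 have ul: "uniform_limit S (%n z. \<Sum>k<n. qc (r z) (p z) k * X z ^ k) (%z. \<Sum>k. qc (r z) (p z) k * X z ^ k) sequentially"
 proof (rule Weierstrass_m_test_ev)
 show "\<forall>\<^sub>F n in sequentially. \<forall>z\<in>S. norm (qc (r z) (p z) n * X z ^ n) <= B * ro ^ (n - K)"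
 using eventually_ge_at_top[of K]
 proof eventually_elim
 case (elim n) then show ?case using S(6)[of _ "n - K"] by simp
 qed
 have "summable (%n. B * ro ^ (n + K - K))" using S by (auto intro!: summable_mult summable_geometric)
 then show "summable (%n. B * ro ^ (n - K))" by (subst (asm) summable_iff_shift)
 qed
 have "(%z. \<Sum>k. qc (r z) (p z) k * X z ^ k) holomorphic_on S"
 proof (rule holomorphic_uniform_sequence[OF S(1)])
 show "(%z. \<Sum>k<n. qc (r z) (p z) k * X z ^ k) holomorphic_on S" for n by (intro holomorphic_intros S)
 fix x assume "x \<in> S"
 then obtain d where "d > 0" "cball x d \<subseteq> S" using S(1) open_contains_cball by blast
 with ul show "\<exists>d>0. cball x d \<subseteq> S & uniform_limit (cball x d) (%n z. \<Sum>k<n. qc (r z) (p z) k * X z ^ k)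
 (%z. \<Sum>k. qc (r z) (p z) k * X z ^ k) sequentially" by (blast intro: uniform_limit_on_subset)
 qed
 then show ?thesis unfolding analytic_at using S(1,2) by blast
qed

text \<open>Multiplying the \<open>k\<close>-th coefficient by \<open>q ^ (j * k)\<close> is the
  dilation \<open>x \<mapsto> q ^ j * x\<close>, so the recursion of the coefficients becomes this
  equation. It expresses \<open>F x\<close> by values at smaller arguments and thereby continues
  \<open>F\<close>.\<close>

lemma qser_functional:
 assumes rp: "ratio_pair N r p" "qreg p" and x: "norm x < 1"
 defines "F \<equiv> %x. \<Sum>k. qc r p k * x ^ k"
 shows "(1 - x) * F x = (\<Sum>j=1..N. (x * coeff r j - coeff p j) * F (q ^ j * x))"
proof -
 have deg: "degree r <= N" "degree p <= N" "coeff r 0 = 1" "coeff p 0 = 1" "poly p 1 = 0"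
 using rp(1) by (auto simp: ratio_pair_def)
 have small: "norm (q ^ j * x) < 1" for j
 proof -
 have "norm q ^ j * norm x <= 1 * norm x" using q by (intro mult_right_mono power_le_one) auto
 then show ?thesis using x by (simp add: norm_mult norm_power)
 qed
 have sm: "(%k. qc r p k * (q ^ j * x) ^ k) sums F (q ^ j * x)" for j
 unfolding F_def by (rule summable_sums[OF qser_summable[OF rp small]])
 have expand: "(%k. qc r p k * poly s (q ^ k) * x ^ k) sums (\<Sum>j\<le>N. coeff s j * F (q ^ j * x))"
 if "degree s <= N" for s
 proof -
 have "(%k. \<Sum>j\<le>N. coeff s j * (qc r p k * (q ^ j * x) ^ k)) sums (\<Sum>j\<le>N. coeff s j * F (q ^ j * x))"
 by (intro sums_sum sums_mult sm)
 moreover have "(\<Sum>j\<le>N. coeff s j * (qc r p k * (q ^ j * x) ^ k)) = qc r p k * poly s (q ^ k) * x ^ k" for k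
 unfolding poly_sum_le[OF that] sum_distrib_left sum_distrib_right
 by (rule sum.cong) (simp_all add: power_mult_distrib mult_ac flip: power_mult)
 ultimately show ?thesis by simp
 qed
 \<comment> \<open>The term with \<open>k = 0\<close> drops out because
   \<open>poly p 1 = 0\<close>.\<close>
 have "(%k. qc r p (Suc k) * poly p (q ^ Suc k) * x ^ Suc k) sums (\<Sum>j\<le>N. coeff p j * F (q ^ j * x))"
 using expand[OF deg(2)] deg(5) by (subst sums_Suc_iff) simp
 moreover have "qc r p (Suc k) * poly p (q ^ Suc k) * x ^ Suc k = x * (qc r p k * poly r (q ^ k) * x ^ k)" for k
 proof -
 have "poly p (q ^ Suc k) ~= 0" using rp(2)[unfolded qreg_def, THEN spec[of _ k]] .
 then have "qc r p (Suc k) * poly p (q ^ Suc k) = qc r p k * poly r (q ^ k)" by (simp only: qc_Suc) (simp del: power_Suc)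
 then show ?thesis by simp
 qed
 ultimately have "(\<Sum>j\<le>N. coeff p j * F (q ^ j * x)) = x * (\<Sum>j\<le>N. coeff r j * F (q ^ j * x))"
 using sums_unique2[OF _ sums_mult[OF expand[OF deg(1)], of x]] by (simp only:)
 moreover have "{..N} = insert 0 {1..N}" by auto
 ultimately have "F x + (\<Sum>j=1..N. coeff p j * F (q ^ j * x)) = x * (F x + (\<Sum>j=1..N. coeff r j * F (q ^ j * x)))"
 using deg(3,4) by simp
 then have "F x - x * F x = x * (\<Sum>j=1..N. coeff r j * F (q ^ j * x)) - (\<Sum>j=1..N. coeff p j * F (q ^ j * x))"
 by (simp add: algebra_simps)
 also have "... = (\<Sum>j=1..N. (x * coeff r j - coeff p j) * F (q ^ j * x))"
 by (simp add: sum_distrib_left sum_subtractf left_diff_distrib mult.assoc)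
 finally show ?thesis by (simp add: left_diff_distrib)
qed

text \<open>The recursion is the \<open>q\<close>-difference equation in \<open>x\<close> that the ratio of consecutive
 coefficients imposes on the series.\<close>

primrec qF :: "nat => complex poly => complex poly => nat => complex => complex" where
 "qF N r p 0 x = (\<Sum>k. qc r p k * x ^ k)"
| "qF N r p (Suc n) x = (\<Sum>j=1..N. (x * coeff r j - coeff p j) * qF N r p n (q ^ j * x)) / (1 - x)"

lemma norm_qj:
 assumes "norm x * norm q ^ Suc n < 1" "j >= 1" shows "norm (q ^ j * x) * norm q ^ n < 1"
proof -
 have "norm q ^ j <= norm q ^ 1" using q assms(2) by (intro power_decreasing) auto
 then have "norm q ^ j * (norm x * norm q ^ n) <= norm q * (norm x * norm q ^ n)" by (intro mult_right_mono) auto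
 then show ?thesis using assms(1) by (simp add: norm_mult norm_power mult_ac)
qed

lemma poles_mult: "q ^ j * x \<in> W87_poles q ==> x \<in> W87_poles q"
proof -
 assume "q ^ j * x \<in> W87_poles q"
 then obtain i where "q ^ j * x * q ^ i = 1" by (auto simp: W87_poles_def)
 then have "x * q ^ (i + j) = 1" by (simp add: power_add mult_ac)
 then show ?thesis by (auto simp: W87_poles_def)
qed

lemma poles_iff: "x \<in> W87_poles q \<longleftrightarrow> qp q x = 0"
 by (simp add: W87_poles_def qp_eq_0_iff)

lemma poles_ne_1: "x \<notin> W87_poles q ==> x ~= 1"
 by (auto simp: W87_poles_def dest: spec[of _ "0::nat"])

lemma small_not_pole: assumes "norm x < 1" shows "x \<notin> W87_poles q"
proof
 assume "x \<in> W87_poles q"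
 then obtain j where "x * q ^ j = 1" by (auto simp: W87_poles_def)
 then have "norm (x * q ^ j) = 1" by simp
 moreover have "norm x * norm q ^ j <= norm x * 1" using q by (intro mult_left_mono power_le_one) auto
 ultimately show False using assms by (simp add: norm_mult norm_power)
qed

lemma closed_poles: "closed (W87_poles q)"
proof -
 have "closed {x. qp q x = 0}"
 by (intro closed_Collect_eq continuous_intros) (simp add: continuous_at_imp_continuous_on qp_isCont)
 moreover have "{x. qp q x = 0} = W87_poles q" using poles_iff by auto
 ultimately show ?thesis by simp
qed

text \<open>Once all arguments are inside the unit disc, a further application of the functional
  equation changes nothing.\<close>

lemma qF_consistent:
 assumes rp: "ratio_pair N r p" "qreg p" and "x \<notin> W87_poles q"
 shows "norm x * norm q ^ n < 1 ==> qF N r p (Suc n) x = qF N r p n x"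
 using assms(3)
proof (induction n arbitrary: x)
 case 0
 then show ?case using qser_functional[OF rp, of x] poles_ne_1[OF 0(2)] by (simp add: field_simps)
next
 case (Suc n)
 have "qF N r p (Suc n) (q ^ j * x) = qF N r p n (q ^ j * x)" if "j \<in> {1..N}" for j
 using Suc.IH[OF norm_qj[OF Suc.prems(1)]] poles_mult Suc.prems(2) that by auto
 then have "(\<Sum>j=1..N. (x * coeff r j - coeff p j) * qF N r p (Suc n) (q ^ j * x)) =
 (\<Sum>j=1..N. (x * coeff r j - coeff p j) * qF N r p n (q ^ j * x))"
 by (intro sum.cong) (auto simp del: qF.simps)
 then show ?case by (simp only: qF.simps(2)[of N r p "Suc n"] qF.simps(2)[of N r p n])
qed

lemma qF_consistent_add:
 assumes "ratio_pair N r p" "qreg p" "x \<notin> W87_poles q" "norm x * norm q ^ n < 1"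
 shows "qF N r p (n + m) x = qF N r p n x"
proof (induction m)
 case (Suc m)
 have "norm x * norm q ^ (n + m) <= norm x * norm q ^ n"
 using q by (intro mult_left_mono power_decreasing) auto
 then show ?case using qF_consistent[OF assms(1-3), of "n + m"] assms(4) Suc by simp
qed simp

lemma qF_analytic:
 assumes an: "apoly r z0" "apoly p z0" and rp: "!!z. ratio_pair N (r z) (p z)" and reg: "qreg (p z0)"
 shows "X analytic_on {z0} ==> X z0 \<notin> W87_poles q ==> norm (X z0) * norm q ^ n < 1 ==>
 (%z. qF N (r z) (p z) n (X z)) analytic_on {z0}"
proof (induction n arbitrary: X)
 case 0 then show ?case using qser_analytic[OF an _ _ rp reg, of X] by simp
next
 case (Suc n)
 have "(%z. qF N (r z) (p z) n (q ^ j * X z)) analytic_on {z0}" if "j \<in> {1..N}" for j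
 by (rule Suc.IH) (use Suc.prems norm_qj[OF Suc.prems(3)] poles_mult that in \<open>auto intro!: analytic_intros\<close>)
 then show ?case using an poles_ne_1[OF Suc.prems(2)] Suc.prems(1)
 by (auto simp: apoly_def intro!: analytic_intros)
qed

text \<open>By \<open>qcont_eq\<close> any sufficient recursion depth gives the same value; the
  least one makes the choice definite.\<close>

definition qcont :: "nat => complex poly => complex poly => complex => complex" where
 "qcont N r p x = qF N r p (LEAST n. norm x * norm q ^ n < 1) x"

lemma ex_small: "EX n. norm (x::complex) * norm q ^ n < 1"
proof -
 have "(%n. norm x * norm q ^ n) \<longlonglongrightarrow> norm x * 0" using q by (intro tendsto_intros LIMSEQ_power_zero) auto
 then have "\<forall>\<^sub>F n in sequentially. norm x * norm q ^ n < 1" by (rule order_tendstoD) simp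
 then show ?thesis by (auto simp: eventually_sequentially)
qed

lemma qcont_eq:
 assumes "ratio_pair N r p" "qreg p" "x \<notin> W87_poles q" "norm x * norm q ^ n < 1"
 shows "qcont N r p x = qF N r p n x"
proof -
 define m where "m = (LEAST n. norm x * norm q ^ n < 1)"
 have m: "norm x * norm q ^ m < 1" "m <= n" unfolding m_def using LeastI_ex[OF ex_small] Least_le assms(4) by auto
 then show ?thesis using qF_consistent_add[OF assms(1-3) m(1), of "n - m"] by (simp add: qcont_def m_def)
qed

lemma qcont_sums:
 assumes "ratio_pair N r p" "qreg p" "norm x < 1"
 shows "(%k. qc r p k * x ^ k) sums qcont N r p x"
 using qcont_eq[OF assms(1,2) small_not_pole[OF assms(3)], of 0] summable_sums[OF qser_summable[OF assms]] assms(3)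
 by simp

lemma qcont_analytic:
 assumes an: "apoly r z0" "apoly p z0" "X analytic_on {z0}" and rp: "!!z. ratio_pair N (r z) (p z)"
 and reg: "qreg (p z0)" "X z0 \<notin> W87_poles q"
 shows "(%z. qcont N (r z) (p z) (X z)) analytic_on {z0}"
proof -
 obtain n where n: "norm (X z0) * norm q ^ n < 1" using ex_small by blast
 have lim: "(X \<longlongrightarrow> X z0) (nhds z0)"
 using analytic_at_imp_isCont[OF an(3)] by (simp add: isCont_def tendsto_at_iff_tendsto_nhds)
 have "((%z. norm (X z) * norm q ^ n) \<longlongrightarrow> norm (X z0) * norm q ^ n) (nhds z0)" by (intro tendsto_intros lim)
 then have "\<forall>\<^sub>F z in nhds z0. norm (X z) * norm q ^ n < 1" using n by (rule order_tendstoD)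
 moreover have "\<forall>\<^sub>F z in nhds z0. X z \<in> - W87_poles q"
 by (rule topological_tendstoD[OF lim]) (use closed_poles reg(2) in auto)
 ultimately have "\<forall>\<^sub>F z in nhds z0. qcont N (r z) (p z) (X z) = qF N (r z) (p z) n (X z)"
 using qreg_eventually[OF an(1,2) rp reg(1)] by eventually_elim (auto intro!: qcont_eq rp)
 from analytic_at_cong[OF this refl] show ?thesis using qF_analytic[OF an(1,2) rp reg(1) an(3) reg(2) n] by simp
qed

end

section \<open>Analytic continuation past countable sets\<close>

lemma analytic_locus:
 fixes H :: "complex => complex"
 assumes "generic (%z. H analytic_on {z})"
 defines "S \<equiv> {z. H analytic_on {z}}"
 shows "open S" "connected S" "H holomorphic_on S"
proof -
 show "open S" unfolding open_subopen[of S]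
 proof
 fix z assume "z \<in> S"
 then obtain s where s: "open s" "z \<in> s" "H holomorphic_on s" by (auto simp: S_def analytic_at)
 then have "H analytic_on s" by (simp add: analytic_on_open)
 then have "s \<subseteq> S" unfolding S_def by (auto intro: analytic_on_subset)
 with s show "EX T. open T & z \<in> T & T \<subseteq> S" by blast
 qed
 have "countable (- S)" using assms(1) by (simp add: generic_def S_def Compl_eq)
 then show "connected S"
 using path_connected_imp_connected[OF path_connected_complement_countable[of "- S"]] by simp
 have "H analytic_on S" by (subst analytic_on_analytic_at) (simp add: S_def)
 then show "H holomorphic_on S" by (rule analytic_imp_holomorphic)
qed

text \<open>The set of points of analyticity is open with countable complement, hence connected, and
  the identity theorem applies. A relation proved for small \<open>z\<close> thus holds wherever its
  ingredients are analytic.\<close>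

lemma generic_continuation:
 fixes H :: "complex => complex"
 assumes an: "generic (%z. H analytic_on {z})" and P: "generic P" and U: "open U" "u \<in> U"
 and 0: "!!z. z \<in> U ==> P z ==> H z = 0" and z: "H analytic_on {z}"
 shows "H z = 0"
proof -
 define S where "S = {z. H analytic_on {z}}"
 note S = analytic_locus[OF an, folded S_def]
 obtain \<xi> where \<xi>: "\<xi> \<in> U" "\<xi> \<in> S" using generic_dense[OF an U] by (auto simp: S_def)
 have "\<xi> islimpt {z \<in> U \<inter> S. P z}"
 proof (rule islimptI)
 fix T assume T: "\<xi> \<in> T" "open T"
 have "generic (%z. (z \<in> S & P z) & z ~= \<xi>)"
 using generic_conj[OF generic_conj[OF an P] generic_neq] by (simp add: S_def)
 from generic_dense[OF this open_Int[OF T(2) U(1)]] T(1) \<xi>(1)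
 show "\<exists>y\<in>{z \<in> U \<inter> S. P z}. y \<in> T & y ~= \<xi>" by auto
 qed
 from analytic_continuation[OF S(3,1,2) _ \<xi>(2) this] show ?thesis using 0 z by (auto simp: S_def)
qed

text \<open>One nonzero value is enough: on a connected domain a nonconstant holomorphic function
  has only countably many zeros.\<close>

lemma generic_nonzero:
 fixes H :: "complex => complex"
 assumes an: "generic (%z. H analytic_on {z})" and z: "H analytic_on {z}" "H z ~= 0"
 shows "generic (%z. H z ~= 0)"
proof -
 define S where "S = {z. H analytic_on {z}}"
 note S = analytic_locus[OF an, folded S_def]
 have "generic (%z. z \<in> S --> H z ~= 0)"
 proof (cases "H constant_on S")
 case True
 then have "H x = H z" if "x \<in> S" for x using that z(1) by (auto simp: constant_on_def S_def)
 then show ?thesis using z(2) by (intro generic_True) auto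
 next
 case False
 obtain F :: "nat => complex set" where F: "!!C. C \<in> range F ==> compact C" "\<Union> (range F) = S"
 using open_Union_compact_subsets[OF S(1)] by (metis image_iff)
 have fs: "fsigma S" unfolding F(2)[symmetric] by (rule fsigma.intros) (use F(1) compact_imp_closed in blast)
 from holomorphic_countable_zeros[OF S(3,1,2) fs False]
 show ?thesis by (simp add: generic_def)
 qed
 from generic_conj[OF this an] show ?thesis by (rule generic_mono) (auto simp: S_def)
qed

section \<open>The very-well-poised series in product form\<close>

definition rW :: "complex => complex => complex list => complex poly" where
 "rW q ga as = [:1, -ga:] * ([:1, 0, - (ga * q^2):] * (\<Prod>a\<leftarrow>as. [:1, -a:]))"

text \<open>To be evaluated at \<open>q ^ Suc k\<close>, hence \<open>ga / a\<close> in place of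
  \<open>q * ga / a\<close> and \<open>ga / q^2\<close> in place of \<open>ga\<close>. The two
  square roots are multiplied out, here and in \<open>rW\<close>, so that the coefficients depend
  analytically on \<open>ga\<close>.\<close>

definition pW :: "complex => complex => complex list => complex poly" where
 "pW q ga as = [:1, -1:] * ([:1, 0, - (ga / q^2):] * (\<Prod>a\<leftarrow>as. [:1, -(ga / a):]))"

lemma poly_linear_factors: "poly (\<Prod>a\<leftarrow>as. [:1, - f a:]) u = (\<Prod>a\<leftarrow>as. 1 - f a * u)"
 for f :: "complex => complex"
 by (induction as) (simp_all add: algebra_simps)

lemma degree_linear_factors: "degree (\<Prod>a\<leftarrow>as. [:1, - f a:]) <= length as"
 for f :: "complex => complex"
proof (induction as)
 case (Cons a as)
 have "degree ([:1, - f a:] * (\<Prod>a\<leftarrow>as. [:1, - f a:])) <= degree [:1, - f a:] + degree (\<Prod>a\<leftarrow>as. [:1, - f a:])"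
 by (rule degree_mult_le)
 also have "... <= 1 + length as" using Cons by (intro add_mono) auto
 finally show ?case by simp
qed simp

lemma poly_rW: "poly (rW q ga as) u = (1 - ga * u) * ((1 - ga * q^2 * u^2) * (\<Prod>a\<leftarrow>as. 1 - a * u))"
proof -
 have "poly [:1, 0, - (ga * q^2):] u = 1 - ga * q^2 * u^2" by (simp add: sqr_eq mult_ac)
 moreover have "poly [:1, - ga:] u = 1 - ga * u" by (simp add: mult.commute)
 ultimately show ?thesis unfolding rW_def poly_mult poly_linear_factors[of "%a. a"] by (simp only:)
qed

lemma poly_pW: "poly (pW q ga as) u = (1 - u) * ((1 - ga / q^2 * u^2) * (\<Prod>a\<leftarrow>as. 1 - ga / a * u))"
proof -
 have "poly [:1, 0, - (ga / q^2):] u = 1 - ga / q^2 * u^2" by (simp add: sqr_eq mult_ac)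
 then show ?thesis unfolding pW_def poly_mult poly_linear_factors[of "%a. ga / a"] by simp
qed

lemma ratio_pair_W: "length as = N ==> ratio_pair (N + 3) (rW q ga as) (pW q ga as)"
proof -
 assume N: "length as = N"
 have d: "degree ([:1, x:] * ([:1, 0, y:] * P)) <= N + 3" if "degree P <= N" for x y :: complex and P
 proof -
 have "degree [:1, x:] <= 1" "degree [:1, 0, y:] <= 2" by simp_all
 then show ?thesis
 using degree_mult_le[of "[:1, x:]" "[:1, 0, y:] * P"] degree_mult_le[of "[:1, 0, y:]" P] that by linarith
 qed
 have c: "coeff (\<Prod>a\<leftarrow>as. [:1, - f a:]) 0 = 1" for f :: "complex => complex"
 by (induction as) (simp_all add: coeff_mult_0)
 show ?thesis unfolding ratio_pair_def rW_def pW_def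
 using degree_linear_factors[of "%a. a" as] degree_linear_factors[of "%a. ga / a" as] c[of "%a. a"] c[of "%a. ga / a"] N
 by (intro conjI d) (simp_all only: coeff_mult_0 coeff_pCons_0 poly_mult, simp_all)
qed

lemma qpoch_0: "qpoch ws q 0 = 1"
 by (induction ws) (simp_all add: qpoch_def)

lemma qpoch_Suc: "qpoch ws q (Suc k) = qpoch ws q k * (\<Prod>w\<leftarrow>ws. 1 - w * q ^ k)"
 by (induction ws) (simp_all add: qpoch_def mult_ac)

lemma apoly_linear_factors:
 assumes "!!a. a \<in> set as ==> (%z. f z (a z)) analytic_on {z0}"
 shows "apoly (%z. \<Prod>a\<leftarrow>map (%a. a z) as. [:1, - (f z a):]) z0"
 using assms
proof (induction as)
 case Nil then show ?case by (simp add: apoly_const)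
next
 case (Cons a as)
 have "apoly (%z. [:1, - f z (a z):]) z0"
 using Cons.prems[of a] by (intro apoly_pCons analytic_intros apoly_const) auto
 from apoly_mult[OF this Cons.IH] show ?case using Cons.prems by simp
qed

lemma apoly_W:
 assumes "ga analytic_on {z0}" "!!a. a \<in> set as ==> a analytic_on {z0} & (%z. ga z / a z) analytic_on {z0}" "q ~= 0"
 shows "apoly (%z. rW q (ga z) (map (%a. a z) as)) z0" "apoly (%z. pW q (ga z) (map (%a. a z) as)) z0"
proof -
 have 1: "apoly (%z. \<Prod>a\<leftarrow>map (%a. a z) as. [:1, - a:]) z0"
 by (rule apoly_linear_factors[of as "%z a. a"]) (use assms in blast)
 have 2: "apoly (%z. \<Prod>a\<leftarrow>map (%a. a z) as. [:1, - (ga z / a):]) z0"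
 by (rule apoly_linear_factors[of as "%z a. ga z / a"]) (use assms in blast)
 show "apoly (%z. rW q (ga z) (map (%a. a z) as)) z0" "apoly (%z. pW q (ga z) (map (%a. a z) as)) z0"
 unfolding rW_def pW_def using assms(1,3)
 by (intro apoly_mult apoly_pCons apoly_const 1 2 analytic_intros; simp)+
qed

text \<open>Up to a constant and \<open>x ^ k\<close>, the \<open>k\<close>-th term of the series is
  this one function at \<open>S = ga * q ^ (2 * k)\<close> and at the parameters times
  \<open>q ^ k\<close>. Moving parameters by powers of \<open>q\<close> then only moves arguments,
  and contiguous relations become pointwise identities.\<close>

definition vw :: "complex => complex => complex list => complex" where
 "vw q S ns = (1 - S) * (\<Prod>n\<leftarrow>ns. qp q (q * S / n) / qp q n)"

context
 fixes q :: complex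
 assumes q: "q ~= 0" "norm q < 1"
begin

lemma qpoch_num: "qpoch ([ga, q * csqrt ga, - q * csqrt ga] @ as) q k = (\<Prod>i<k. poly (rW q ga as) (q ^ i))"
proof (induction k)
 case 0 show ?case by (simp add: qpoch_0)
next
 case (Suc k)
 have s: "csqrt ga * csqrt ga = ga" by (simp flip: sqr_eq)
 have "(1 - q * csqrt ga * u) * ((1 - - q * csqrt ga * u) * P) = (1 - csqrt ga * csqrt ga * q^2 * u^2) * P" for u P
 by (simp add: algebra_simps sqr_eq)
 then show ?case unfolding qpoch_Suc Suc
 by (simp only: s poly_rW prod.lessThan_Suc append_Cons append_Nil list.map prod_list.Cons)
qed

lemma qpoch_den: "qpoch (W87_den ga as q) q k = (\<Prod>i<k. poly (pW q ga as) (q ^ Suc i))"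
proof (induction k)
 case 0 show ?case by (simp add: qpoch_0)
next
 case (Suc k)
 have s: "csqrt ga * csqrt ga = ga" by (simp flip: sqr_eq)
 have "(1 - csqrt ga * u) * ((1 - - csqrt ga * u) * P) = (1 - csqrt ga * csqrt ga * u^2) * P" for u P
 by (simp add: algebra_simps sqr_eq)
 moreover have "poly (pW q ga as) (q * u) = (1 - q * u) * ((1 - ga * u^2) * (\<Prod>a\<leftarrow>map (%a. q * ga / a) as. 1 - a * u))" for u
 proof -
 have "(\<Prod>a\<leftarrow>as. 1 - ga / a * (q * u)) = (\<Prod>a\<leftarrow>map (%a. q * ga / a) as. 1 - a * u)"
 by (simp add: comp_def mult_ac)
 moreover have "ga / q^2 * (q * u)^2 = ga * u^2" using q by (simp add: power_mult_distrib)
 ultimately show ?thesis by (simp only: poly_pW)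
 qed
 ultimately show ?case unfolding qpoch_Suc Suc unfolding W87_den_def
 by (simp only: s prod.lessThan_Suc append_Cons append_Nil list.map prod_list.Cons power_Suc)
qed

lemma W87_coeff_eq: "W87_coeff ga as q k = qc q (rW q ga as) (pW q ga as) k"
 unfolding W87_coeff_def qpoch_num qpoch_den qc_def[OF q] by (rule prod_dividef[symmetric])

lemma W87_regular_iff: "W87_regular ga as q x \<longleftrightarrow> qreg q (pW q ga as) & x \<notin> W87_poles q"
proof -
 have "(ALL k. qpoch (W87_den ga as q) q k ~= 0) \<longleftrightarrow> qreg q (pW q ga as)"
 unfolding qpoch_den qreg_def[OF q]
 proof
 assume 0: "ALL k. (\<Prod>i<k. poly (pW q ga as) (q ^ Suc i)) ~= 0"
 show "ALL k. poly (pW q ga as) (q ^ Suc k) ~= 0"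
 using 0 by (metis mult_zero_right prod.lessThan_Suc)
 qed (simp only: prod_zero_iff finite_lessThan, blast)
 then show ?thesis by (simp add: W87_regular_def)
qed

text \<open>Both continuations have the same sum in the unit disc and the complement of the poles is
  connected, so the function selected by \<open>W87\<close> is the one built from the functional
  equation.\<close>

lemma W87_eq:
 assumes "W87_regular ga as q x" "length as = N"
 shows "W87 ga as q x = qcont q (N + 3) (rW q ga as) (pW q ga as) x"
proof -
 define r p where rp: "r = rW q ga as" "p = pW q ga as"
 have reg: "qreg q p" "x \<notin> W87_poles q" using assms by (auto simp: W87_regular_iff rp)
 have pair: "ratio_pair (N + 3) r p" using ratio_pair_W[OF assms(2)] by (simp add: rp)
 define S where "S = - W87_poles q"
 have S: "open S" "connected S"
 proof -
 show "open S" using closed_poles[OF q] by (simp add: S_def open_Compl)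
 have "W87_poles q \<subseteq> (%j::nat. 1 / q ^ j) ` UNIV"
 proof
 fix x assume "x \<in> W87_poles q"
 then obtain j where "x * q ^ j = 1" by (auto simp: W87_poles_def)
 then have "x = 1 / q ^ j" using q by (simp add: field_simps)
 then show "x \<in> (%j::nat. 1 / q ^ j) ` UNIV" by blast
 qed
 then have "countable (W87_poles q)" by (rule countable_subset) auto
 then show "connected S"
 using path_connected_imp_connected[OF path_connected_complement_countable[of "W87_poles q"]] by (simp add: S_def)
 qed
 let ?Q = "%f w. f holomorphic_on S & (ALL y. norm y < 1 --> (%k. W87_coeff ga as q k * y ^ k) sums f y) & w = f x"
 have ex: "?Q (qcont q (N + 3) r p) (qcont q (N + 3) r p x)"
 proof (intro conjI allI impI refl)
 have "qcont q (N + 3) r p analytic_on {y}" if "y \<in> S" for y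
 using qcont_analytic[OF q apoly_const apoly_const, of "%y. y" y "N + 3" r p] pair reg that by (simp add: S_def)
 then have "qcont q (N + 3) r p analytic_on S" by (subst analytic_on_analytic_at) blast
 then show "qcont q (N + 3) r p holomorphic_on S" by (rule analytic_imp_holomorphic)
 show "(%k. W87_coeff ga as q k * y ^ k) sums qcont q (N + 3) r p y" if "norm y < 1" for y
 using qcont_sums[OF q pair reg(1) that] by (simp add: W87_coeff_eq rp)
 qed
 have "w = qcont q (N + 3) r p x" if exw: "EX f. ?Q f w" for w
 proof -
 obtain f where f: "?Q f w" using exw ..
 have ball: "ball 0 1 \<subseteq> S" using small_not_pole[OF q] by (auto simp: S_def)
 have "f x = qcont q (N + 3) r p x"
 proof (rule analytic_continuation_open[where f = f and g = "qcont q (N + 3) r p", OF open_ball S(1) _ S(2) ball])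
 show "f y = qcont q (N + 3) r p y" if "y \<in> ball 0 1" for y
 using f ex that sums_unique2 by (metis dist_0_norm mem_ball)
 qed (use f ex reg in \<open>auto simp: S_def\<close>)
 then show ?thesis using f by simp
 qed
 with ex show ?thesis unfolding W87_def rp[symmetric] S_def by (intro the_equality) blast+
qed

lemma W87_analytic:
 assumes an: "ga analytic_on {z0}" "X analytic_on {z0}"
 "!!a. a \<in> set as ==> a analytic_on {z0} & (%z. ga z / a z) analytic_on {z0}"
 and reg: "W87_regular (ga z0) (map (%a. a z0) as) q (X z0)"
 shows "(%z. W87 (ga z) (map (%a. a z) as) q (X z)) analytic_on {z0}"
proof -
 let ?r = "%z. rW q (ga z) (map (%a. a z) as)" and ?p = "%z. pW q (ga z) (map (%a. a z) as)"
 have ap: "apoly ?r z0" "apoly ?p z0" using apoly_W[OF an(1) an(3) q(1)] by blast+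
 have pair: "ratio_pair (length as + 3) (?r z) (?p z)" for z by (rule ratio_pair_W) simp
 have reg': "qreg q (?p z0)" "X z0 \<notin> W87_poles q" using reg by (auto simp: W87_regular_iff)
 have "(X \<longlongrightarrow> X z0) (nhds z0)"
 using analytic_at_imp_isCont[OF an(2)] by (simp add: isCont_def tendsto_at_iff_tendsto_nhds)
 then have "\<forall>\<^sub>F z in nhds z0. X z \<in> - W87_poles q"
 by (rule topological_tendstoD) (use closed_poles[OF q] reg'(2) in auto)
 with qreg_eventually[OF q ap pair reg'(1)]
 have "\<forall>\<^sub>F z in nhds z0. W87 (ga z) (map (%a. a z) as) q (X z) = qcont q (length as + 3) (?r z) (?p z) (X z)"
 by eventually_elim (auto intro!: W87_eq simp: W87_regular_iff)
 from analytic_at_cong[OF this refl] show ?thesis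
 using qcont_analytic[OF q ap an(2) pair reg'] by simp
qed

lemma vw_step:
 assumes "!!n. n \<in> set ns ==> n ~= 0 & qp q n ~= 0 & q * S / n ~= 1" "S ~= 1"
 shows "vw q (q^2 * S) (map (%n. q * n) ns) = vw q S ns * ((1 - q^2 * S) / (1 - S) * (\<Prod>n\<leftarrow>ns. (1 - n) / (1 - q * S / n)))"
proof -
 have "(\<Prod>n\<leftarrow>map (%n. q * n) ns. qp q (q * (q^2 * S) / n) / qp q n) =
 (\<Prod>n\<leftarrow>ns. qp q (q * S / n) / qp q n) * (\<Prod>n\<leftarrow>ns. (1 - n) / (1 - q * S / n))"
 using assms(1)
 proof (induction ns)
 case (Cons n ns)
 have n: "n ~= 0" "qp q n ~= 0" "1 - q * S / n ~= 0" using Cons.prems[of n] by auto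
 have 1: "q * (q^2 * S) / (q * n) = q * (q * S / n)" using q n by (simp add: sqr_eq)
 have 2: "qp q (q * S / n) = (1 - q * S / n) * qp q (q * (q * S / n))" "qp q n = (1 - n) * qp q (q * n)"
 by (rule qp_shift[OF q])+
 have "1 - n ~= 0" "qp q (q * n) ~= 0" using n(2) 2(2) by auto
 then have "qp q (q * (q^2 * S) / (q * n)) / qp q (q * n) = qp q (q * S / n) / qp q n * ((1 - n) / (1 - q * S / n))"
 unfolding 1 2 using n(3) by simp
 moreover have "(\<Prod>n\<leftarrow>map (%n. q * n) ns. qp q (q * (q^2 * S) / n) / qp q n) =
 (\<Prod>n\<leftarrow>ns. qp q (q * S / n) / qp q n) * (\<Prod>n\<leftarrow>ns. (1 - n) / (1 - q * S / n))"
 by (rule Cons.IH, rule Cons.prems) simp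
 ultimately show ?case by (simp only: list.map prod_list.Cons mult_ac)
 qed simp
 then show ?thesis using assms(2) by (simp add: vw_def)
qed

lemma vw_sums:
 assumes reg: "W87_regular ga as q x" and x: "norm x < 1" and ga: "ga ~= 0" "qp q ga ~= 0"
 and as: "!!a. a \<in> set as ==> a ~= 0 & qp q a ~= 0"
 shows "(%k. vw q (ga * q ^ (2 * k)) (map (%a. a * q ^ k) (ga # as)) * x ^ k) sums (vw q ga (ga # as) * W87 ga as q x)"
proof -
 define r p where rp: "r = rW q ga as" "p = pW q ga as"
 have qr: "qreg q p" using reg by (simp add: W87_regular_iff rp)
 have nz: "a * q ^ k ~= 0 & qp q (a * q ^ k) ~= 0" if "a \<in> set (ga # as)" for a k
 proof -
 have a: "a ~= 0" "qp q a ~= 0" using that ga as by auto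
 have "a * q ^ k * q ^ i ~= 1" for i
 using a(2) by (auto simp: qp_eq_0_iff[OF q] power_add mult.assoc dest: spec[of _ "k + i"])
 then show ?thesis using a(1) q by (simp add: qp_eq_0_iff[OF q])
 qed
 have "vw q (ga * q ^ (2 * k)) (map (%a. a * q ^ k) (ga # as)) = vw q ga (ga # as) * qc q r p k" for k
 proof (induction k)
 case 0 show ?case by (simp add: qc_def[OF q])
 next
 case (Suc k)
 define u where "u = q ^ k"
 define S where "S = ga * u^2"
 have u0: "u ~= 0" using q by (simp add: u_def)
 have "q ^ (2 * k) = u^2" by (simp add: u_def mult.commute flip: power_mult)
 then have S: "ga * q ^ (2 * k) = S" "ga * q ^ (2 * Suc k) = q^2 * S"
 by (simp_all add: S_def power_add sqr_eq)
 have pol: "poly p (q * u) = (1 - q * u) * ((1 - S) * (\<Prod>a\<leftarrow>as. 1 - q * S / (a * u)))"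
 proof -
 have "ga / q^2 * (q * u)^2 = S" using q by (simp add: S_def power_mult_distrib)
 moreover have "ga / a * (q * u) = q * S / (a * u)" for a using u0 by (simp add: S_def sqr_eq)
 ultimately show ?thesis by (simp only: rp poly_pW)
 qed
 have rpol: "poly r u = (1 - ga * u) * ((1 - q^2 * S) * (\<Prod>a\<leftarrow>as. 1 - a * u))"
 by (simp add: rp poly_rW S_def mult_ac)
 have "poly p (q * u) ~= 0" using qr[unfolded qreg_def[OF q], THEN spec[of _ k]] by (simp add: u_def)
 then have ne: "q * u ~= 1" "S ~= 1" "!!a. a \<in> set as ==> q * S / (a * u) ~= 1"
 unfolding pol by (auto simp: prod_list_zero_iff)
 have su: "q * S / (ga * u) = q * u" using ga u0 by (simp add: S_def sqr_eq)
 have "vw q (ga * q ^ (2 * Suc k)) (map (%a. a * q ^ Suc k) (ga # as)) =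
 vw q (q^2 * S) (map (%n. q * n) (map (%a. a * u) (ga # as)))" unfolding S(2) by (simp add: u_def comp_def mult_ac)
 also have "... = vw q S (map (%a. a * u) (ga # as)) * ((1 - q^2 * S) / (1 - S) *
 (\<Prod>n\<leftarrow>map (%a. a * u) (ga # as). (1 - n) / (1 - q * S / n)))"
 by (rule vw_step) (use q nz[of _ k] ne su in \<open>auto simp: u_def\<close>)
 also have "(1 - q^2 * S) / (1 - S) * (\<Prod>n\<leftarrow>map (%a. a * u) (ga # as). (1 - n) / (1 - q * S / n)) = poly r u / poly p (q * u)"
 proof -
 have "(\<Prod>n\<leftarrow>map (%a. a * u) as. (1 - n) / (1 - q * S / n)) = (\<Prod>a\<leftarrow>as. 1 - a * u) / (\<Prod>a\<leftarrow>as. 1 - q * S / (a * u))"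
 by (induction as) simp_all
 then show ?thesis unfolding pol rpol list.map prod_list.Cons su by (simp add: mult_ac)
 qed
 finally show ?case using Suc by (simp add: S(1) u_def qc_Suc[OF q] del: list.map)
 qed
 moreover have "(%k. vw q ga (ga # as) * (qc q r p k * x ^ k)) sums (vw q ga (ga # as) * W87 ga as q x)"
 unfolding W87_eq[OF reg refl]
 by (intro sums_mult) (use qcont_sums[OF q ratio_pair_W[OF refl] _ x] qr in \<open>simp add: rp\<close>)
 ultimately show ?thesis by (simp add: mult.assoc del: list.map)
qed

end

text \<open>Three identities behind the contiguous relations. The first one is linear in
 the polynomial \<open>P\<close> of degree four, hence an interpolation identity.\<close>

lemma gamma_identity:
 fixes S v w q p1 p2 p3 p4 am ap bb :: "'a::field"
 defines "P \<equiv> %y. 1 - p1 * y + p2 * y^2 - p3 * y^3 + p4 * y^4"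
 assumes am: "am * ((w - q * v) * (w - v) * (q * S - v * w)) = - (P v * (w^2 * q * S))"
 and ap: "ap * ((v - q * w) * (v - w) * (q * S - v * w)) = - (P w * (v^2 * q * S))"
 and bb: "bb = p4 * S * v * w - 1 - am - ap"
 and nz: "w - q * v ~= 0" "w - v ~= 0" "q * S - v * w ~= 0" "v - q * w ~= 0"
 shows "(1 - S) * (am * ((q - w) * (1 - w) * (w - S) * (w - q * S)) * v^2 +
 bb * ((v - S) * (1 - v) * (w - S) * (1 - w)) * q * v * w +
 ap * ((v - S) * (v - q * S) * (1 - v) * (q - v)) * w^2) =
 q * v^2 * w^2 * (S * P 1 * (v - S) * (w - S) - (1 - v) * (1 - w) * P S)"
proof -
 define \<Delta> where "\<Delta> = (w - q * v) * (w - v) * (v - q * w) * (q * S - v * w)"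
 have \<Delta>: "\<Delta> ~= 0" using nz by (simp add: \<Delta>_def)
 have 1: "am * \<Delta> = - (P v * (w^2 * q * S)) * (v - q * w)"
 unfolding am[symmetric] \<Delta>_def by (simp add: mult_ac)
 have 2: "ap * \<Delta> = P w * (v^2 * q * S) * (w - q * v)"
 proof -
 have "ap * \<Delta> = - (ap * ((v - q * w) * (v - w) * (q * S - v * w))) * (w - q * v)"
 unfolding \<Delta>_def by algebra
 then show ?thesis unfolding ap by simp
 qed
 have 3: "bb * \<Delta> = (p4 * S * v * w - 1) * \<Delta> - am * \<Delta> - ap * \<Delta>" by (simp add: bb left_diff_distrib)
 have P1: "P 1 = 1 - p1 + p2 - p3 + p4" by (simp add: P_def)
 define X where "X = am * \<Delta>"
 define Y where "Y = ap * \<Delta>"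
 have "(1 - S) * (X * ((q - w) * (1 - w) * (w - S) * (w - q * S)) * v^2 +
 ((p4 * S * v * w - 1) * \<Delta> - X - Y) * ((v - S) * (1 - v) * (w - S) * (1 - w)) * q * v * w +
 Y * ((v - S) * (v - q * S) * (1 - v) * (q - v)) * w^2) =
 q * v^2 * w^2 * (S * P 1 * (v - S) * (w - S) - (1 - v) * (1 - w) * P S) * \<Delta>"
 unfolding X_def Y_def 1 2 P1 unfolding \<Delta>_def P_def by algebra
 then have "\<Delta> * ((1 - S) * (am * ((q - w) * (1 - w) * (w - S) * (w - q * S)) * v^2 +
 bb * ((v - S) * (1 - v) * (w - S) * (1 - w)) * q * v * w +
 ap * ((v - S) * (v - q * S) * (1 - v) * (q - v)) * w^2)) =
 \<Delta> * (q * v^2 * w^2 * (S * P 1 * (v - S) * (w - S) - (1 - v) * (1 - w) * P S))"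
 using 3 unfolding X_def Y_def by algebra
 then show ?thesis using \<Delta> by simp
qed

lemma raise_identity:
 fixes S n0 n1 n2 n3 :: "'a::field"
 assumes nz: "n0 ~= 0" "n1 ~= 0" "n2 ~= 0" "n3 ~= 0"
 and c0: "c0 = (S^2 / (n0*n1*n2*n3) - 1) * (n1 + S / n1) - S^2 * (n0+n1+n2+n3) / (n0*n1*n2*n3) + S * (1/n0+1/n1+1/n2+1/n3)"
 and c2: "c2 = S^2 / (n0*n1*n2*n3) - 1"
 shows "(1 - S) * (c0 + c2 * ((1 - n1) * (1 - S / n1))) =
 S^2 / (n0*n1*n2*n3) * ((1-n0)*(1-n1)*(1-n2)*(1-n3)) - (1 - S/n0)*(1 - S/n1)*(1 - S/n2)*(1 - S/n3)"
proof -
 define M where "M = n0*n1*n2*n3"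
 have M: "M ~= 0" using nz by (simp add: M_def)
 have "c0 + c2 * ((1 - n1) * (1 - S / n1)) = c2 * (1 + S) - S^2 * (n0+n1+n2+n3) / M + S * (1/n0+1/n1+1/n2+1/n3)"
 proof -
 have "(1 - n1) * (1 - S / n1) = 1 + S - (n1 + S / n1)" using nz by (simp add: field_simps)
 moreover have "c0 = c2 * (n1 + S / n1) - S^2 * (n0+n1+n2+n3) / M + S * (1/n0+1/n1+1/n2+1/n3)"
 unfolding c0 c2 M_def ..
 ultimately show ?thesis by (simp only: right_diff_distrib) simp
 qed
 moreover have "M * (c2 * (1 + S) - S^2 * (n0+n1+n2+n3) / M + S * (1/n0+1/n1+1/n2+1/n3)) =
 (S^2 - M) * (1 + S) - S^2 * (n0+n1+n2+n3) + S * (n1*n2*n3 + n0*n2*n3 + n0*n1*n3 + n0*n1*n2)"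
 unfolding c2 M_def using nz by (simp add: field_simps)
 moreover have "M * (S^2 / M * ((1-n0)*(1-n1)*(1-n2)*(1-n3)) - (1 - S/n0)*(1 - S/n1)*(1 - S/n2)*(1 - S/n3)) =
 S^2 * ((1-n0)*(1-n1)*(1-n2)*(1-n3)) - (n0-S)*(n1-S)*(n2-S)*(n3-S)"
 proof -
 have "(1 - S/n) = (n - S) / n" if "n ~= 0" for n using that by (simp add: diff_divide_distrib)
 then have h: "(1 - S/n0)*(1 - S/n1)*(1 - S/n2)*(1 - S/n3) = (n0-S)*(n1-S)*(n2-S)*(n3-S) / M"
 using nz by (simp add: M_def)
 show ?thesis unfolding h right_diff_distrib[of M] using M by simp
 qed
 moreover have "(1 - S) * ((S^2 - M) * (1 + S) - S^2 * (n0+n1+n2+n3) + S * (n1*n2*n3 + n0*n2*n3 + n0*n1*n3 + n0*n1*n2)) =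
 S^2 * ((1-n0)*(1-n1)*(1-n2)*(1-n3)) - (n0-S)*(n1-S)*(n2-S)*(n3-S)" unfolding M_def by algebra
 moreover have "M * ((1 - S) * Y) = (1 - S) * (M * Y)" for Y by (simp only: mult.left_commute)
 ultimately have "M * ((1 - S) * (c0 + c2 * ((1 - n1) * (1 - S / n1)))) = M *
 (S^2 / M * ((1-n0)*(1-n1)*(1-n2)*(1-n3)) - (1 - S/n0)*(1 - S/n1)*(1 - S/n2)*(1 - S/n3))"
 by (simp only:)
 then show ?thesis using M by (simp add: M_def)
qed

lemma lower_identity:
 fixes S n0 n2 n3 g :: "'a::field"
 assumes nz: "n0 ~= 0" "n2 ~= 0" "n3 ~= 0" "S ~= 0"
 and g: "g = n0 * n2 * n3 / S"
 and c0: "c0 = g - (n0+n2+n3) + S * (1/n0+1/n2+1/n3) - S / g"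
 shows "(1 - S) * c0 = (1-n0)*(1-n2)*(1-n3) * (1 - S / g) - (1-S/n0)*(1-S/n2)*(1-S/n3) * (1 - g)"
proof -
 have g0: "g ~= 0" using nz by (simp add: g)
 define a1 a2 where "a1 = n0 + n2 + n3" and "a2 = n0*n2 + n0*n3 + n2*n3"
 have gS: "n0 * n2 * n3 = g * S" using nz by (simp add: g)
 have "S * (1/n0+1/n2+1/n3) = a2 / g" unfolding g a2_def using nz by (simp add: field_simps)
 then have f1: "c0 = g - a1 + a2 / g - S / g" by (simp add: c0 a1_def)
 have f2: "(1-n0)*(1-n2)*(1-n3) = 1 - a1 + a2 - g * S" unfolding gS[symmetric] a1_def a2_def by algebra
 have f3: "(1-S/n0)*(1-S/n2)*(1-S/n3) = 1 - a2 / g + S * a1 / g - S^2 / g"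
 unfolding g a1_def a2_def using nz by (simp add: field_simps sqr_eq)
 show ?thesis unfolding f1 f2 f3 using g0 by (simp add: field_simps sqr_eq)
qed

text \<open>The argument \<open>x\<close> is tied to the parameters; these relations use this to
  trade the factors in \<open>e\<close> and \<open>f\<close> against factors in
  \<open>S\<close>.\<close>

lemma lower_identity_quotient:
 fixes S n1 e f q g x ka :: "'a::field"
 assumes nz: "n1 ~= 0" "e ~= 0" "f ~= 0" "S ~= 0" "g ~= 0" "q ~= 0"
 and x: "x = q^2 * S^2 / (g * n1 * e * f)" and ka: "ka = S / (g * n1)"
 and c2: "c2 = - ((ka - 1) * q * S * (1/e + 1/f)) + (x/q - 1) * (n1 + q*S/n1) - (x/q - ka) * (n1 + q*g)"
 shows "(x/q - 1) * (1 - n1) * (1 - q*S/n1) + c2 = (x/q - ka) * (1 - n1) * (1 - q*g) + (ka - 1) * ((1 - q*S/e) * (1 - q*S/f))"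
 and "(x/q) * (1 - e) * (1 - f) = (x/q - ka) * (1 - q * S) + ka * ((1 - q*S/e) * (1 - q*S/f))"
 and "ka * (1 - n1) * (1 - q*g) - (ka - 1) * (1 - q * S) = (1 - q*S/n1) * (1 - S / g)"
 unfolding c2 x ka using nz by (simp_all add: field_simps sqr_eq)

lemma raise_identity_quotient:
 fixes S M e f q x ka :: "'a::field"
 assumes nz: "M ~= 0" "e ~= 0" "f ~= 0" "q ~= 0"
 and x: "x = q^2 * S^3 / (M * e * f)" and ka: "ka = S^2 / M"
 shows "(x/q) * (1 - e) * (1 - f) = (x/q - ka) * (1 - q * S) + ka * ((1 - q*S/e) * (1 - q*S/f))"
 unfolding x ka using nz by (simp add: field_simps sqr_eq power3_eq_cube)

section \<open>Telescoping certificates for single terms\<close>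

context
 fixes q :: complex
 assumes q: "q ~= 0" "norm q < 1"
begin

lemma qp_num: "qp q a / X = (1 - a) * (qp q (q * a) / X)"
 by (subst qp_shift[OF q]) simp

lemma qp_den: "qp q b ~= 0 ==> X / qp q (q * b) = (1 - b) * (X / qp q b)"
 using qp_shift[OF q, of b] by simp

lemma qp_scale_nz: "qp q a ~= 0 ==> qp q (a * q ^ k) ~= 0"
proof (induction k)
 case (Suc k)
 then show ?case using qp_shift[OF q, of "a * q ^ k"] by (auto simp: mult_ac)
qed simp

lemma qp_1 [simp]: "qp q 1 = 0"
 by (auto simp: qp_eq_0_iff[OF q] intro: exI[of _ 0])

lemma qp_tendsto: "(%k. qp q (a * q ^ k)) \<longlonglongrightarrow> 1"
proof -
 have "(%k. a * q ^ k) \<longlonglongrightarrow> a * 0" by (intro tendsto_intros LIMSEQ_power_zero q)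
 then have "(%k. qp q (a * q ^ k)) \<longlonglongrightarrow> qp q (a * 0)"
 by (rule isCont_tendsto_compose[OF qp_isCont[OF q]])
 then show ?thesis by simp
qed

lemma telescoping_sums:
 assumes "u \<longlonglongrightarrow> (L::complex)" "norm (y::complex) < 1"
 shows "(%k. y ^ k * (y * u (Suc k) - u k)) sums (- u 0)"
proof -
 have "(%k. y ^ k * u k) \<longlonglongrightarrow> 0 * L" by (intro tendsto_mult assms LIMSEQ_power_zero)
 from telescope_sums[OF this] show ?thesis by (simp add: algebra_simps)
qed

text \<open>Certificate for the shift of \<open>\<gamma>\<close>, in which \<open>e\<close> and
  \<open>f\<close> move in opposite directions. After the common products \<open>N\<close> are
  divided out, the substitution \<open>v = S / e\<close>, \<open>w = q^2 * S / f\<close> turns the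
  claim into \<open>gamma_identity\<close>.\<close>

lemma gamma_pointwise:
 assumes nz: "S ~= 0" "n0 ~= 0" "n1 ~= 0" "n2 ~= 0" "n3 ~= 0" "e ~= 0" "f ~= 0"
 and p: "qp q n0 ~= 0" "qp q n1 ~= 0" "qp q n2 ~= 0" "qp q n3 ~= 0" "qp q e ~= 0" "qp q (f / q^2) ~= 0"
 and x: "x * (n0*n1*n2*n3*e*f) = q^2 * S^3"
 and am: "am * ((1 - f/(q*e)) * (1 - f/(q^2*e)) * (1 - q*S/(e*f))) =
 - ((1 - S/(e*n0)) * (1 - S/(e*n1)) * (1 - S/(e*n2)) * (1 - S/(e*n3)))"
 and ap: "ap * ((1 - q^3*e/f) * (1 - q^2*e/f) * (1 - q*S/(e*f))) =
 - ((1 - q^2*S/(f*n0)) * (1 - q^2*S/(f*n1)) * (1 - q^2*S/(f*n2)) * (1 - q^2*S/(f*n3)))"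
 and bb: "bb = x - 1 - am - ap"
 and ne: "f ~= q*e" "f ~= q^2*e" "e*f ~= q*S" "f ~= q^3*e"
 defines "u \<equiv> %S n0 n1 n2 n3 e f. qp q (S/n0) / qp q n0 * (qp q (S/n1) / qp q n1) * (qp q (S/n2) / qp q n2) *
 (qp q (S/n3) / qp q n3) * (qp q (S/e) / qp q e) * (qp q (q^2*S/f) / qp q (f/q^2))"
 shows "am * vw q S [n0,n1,n2,n3,e,f] + bb * vw q S [n0,n1,n2,n3,q*e,f/q] + ap * vw q S [n0,n1,n2,n3,q^2*e,f/q^2] =
 x * u (q^2*S) (q*n0) (q*n1) (q*n2) (q*n3) (q*e) (q*f) - u S n0 n1 n2 n3 e f"
proof -
 define r where "r n = qp q (q*S/n) / qp q n" for n
 define R where "R = r n0 * r n1 * r n2 * r n3 * r e * (qp q (q^3*S/f) / qp q (f/q^2))"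
 have U: "qp q (S/n) / qp q n = (1 - S/n) * r n" for n unfolding r_def by (subst qp_num) simp
 have U': "qp q (q^2*S/(q*n)) / qp q (q*n) = (1 - n) * r n" if "qp q n ~= 0" for n
 unfolding r_def qp_den[OF that] using q by (simp add: sqr_eq)
 have e1: "qp q (q*S/(q*e)) / qp q (q*e) = (1 - e) * ((1 - S/e) * r e)"
 unfolding qp_den[OF p(5)] U[symmetric] using q by simp
 have pqe: "qp q (q*e) ~= 0" using qp_scale_nz[OF p(5), of 1] by (simp add: mult.commute)
 have e2: "qp q (q*S/(q^2*e)) / qp q (q^2*e) = (1 - q*e) * ((1 - S/(q*e)) * ((1 - e) * ((1 - S/e) * r e)))"
 proof -
 have "qp q (q*S/(q^2*e)) / qp q (q^2*e) = qp q (S/(q*e)) / qp q (q*(q*e))" using q by (simp add: sqr_eq mult_ac)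
 also have "... = (1 - q*e) * ((1 - S/(q*e)) * (qp q (q*S/(q*e)) / qp q (q*e)))"
 unfolding qp_den[OF pqe] by (subst qp_num) simp
 finally show ?thesis unfolding e1 .
 qed
 define rf where "rf = qp q (q^3*S/f) / qp q (f/q^2)"
 have f0: "q * (f/q^2) = f/q" using q by (simp add: sqr_eq)
 have pf1: "qp q (f/q) ~= 0" using qp_scale_nz[OF p(6), of 1] f0 by (simp add: mult.commute)
 have d1: "X / qp q (f/q) = (1 - f/q^2) * (X / qp q (f/q^2))" for X using qp_den[OF p(6), of X] unfolding f0 .
 have d2: "X / qp q f = (1 - f/q) * ((1 - f/q^2) * (X / qp q (f/q^2)))" for X
 using qp_den[OF pf1, of X] q unfolding d1 by simp
 have n2: "qp q (q^2*S/f) / X = (1 - q^2*S/f) * (qp q (q^3*S/f) / X)" for X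
 unfolding qp_num[of "q^2*S/f"] by (simp add: sqr_eq power3_eq_cube mult_ac)
 have n1': "qp q (q*S/f) / X = (1 - q*S/f) * ((1 - q^2*S/f) * (qp q (q^3*S/f) / X))" for X
 using qp_num[of "q*S/f" X] unfolding n2[symmetric] by (simp add: sqr_eq mult.assoc)
 have f1: "qp q (q*S/f) / qp q f = (1 - q*S/f) * ((1 - q^2*S/f) * ((1 - f/q) * ((1 - f/q^2) * rf)))"
 unfolding n1' d2 rf_def by (simp add: mult_ac)
 have f2: "qp q (q*S/(f/q)) / qp q (f/q) = (1 - q^2*S/f) * ((1 - f/q^2) * rf)"
 proof -
 have h: "q*S/(f/q) = q^2*S/f" by (simp add: sqr_eq mult_ac)
 show ?thesis unfolding h n2 d1 rf_def by (simp add: mult_ac)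
 qed
 have f3: "qp q (q*S/(f/q^2)) / qp q (f/q^2) = rf"
 unfolding rf_def by (simp add: sqr_eq power3_eq_cube mult_ac)
 have f4: "qp q (q^2*S/f) / qp q (f/q^2) = (1 - q^2*S/f) * rf" unfolding n2 rf_def ..
 have f5: "qp q (q^2*(q^2*S)/(q*f)) / qp q (q*f/q^2) = (1 - f/q^2) * rf"
 proof -
 have h: "q^2*(q^2*S)/(q*f) = q^3*S/f" "q*f/q^2 = f/q" using q by (simp_all add: sqr_eq power3_eq_cube)
 show ?thesis unfolding h rf_def by (rule d1)
 qed
 define v w where "v = S/e" and "w = q^2*S/f"
 have vw0: "v ~= 0" "w ~= 0" using nz q by (auto simp: v_def w_def)
 have ef: "e = S/v" "f = q^2*S/w" using nz q by (auto simp: v_def w_def)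
 define m where "m n = 1 / n" for n :: complex
 define p1 where "p1 = m n0 + m n1 + m n2 + m n3"
 define p2 where "p2 = m n0 * m n1 + m n0 * m n2 + m n0 * m n3 + m n1 * m n2 + m n1 * m n3 + m n2 * m n3"
 define p3 where "p3 = m n1 * m n2 * m n3 + m n0 * m n2 * m n3 + m n0 * m n1 * m n3 + m n0 * m n1 * m n2"
 define p4 where "p4 = m n0 * m n1 * m n2 * m n3"
 define P where "P y = 1 - p1 * y + p2 * y^2 - p3 * y^3 + p4 * y^4" for y
 have P: "(1 - y/n0) * (1 - y/n1) * (1 - y/n2) * (1 - y/n3) = P y" for y
 proof -
 have "(1 - y * m n0) * (1 - y * m n1) * (1 - y * m n2) * (1 - y * m n3) = P y"
 unfolding P_def p1_def p2_def p3_def p4_def by algebra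
 then show ?thesis by (simp add: m_def)
 qed
 have x': "x = p4 * S * v * w"
 using x nz q unfolding p4_def m_def v_def w_def by (simp add: field_simps sqr_eq power3_eq_cube)
 have xP: "x * ((1-n0)*(1-n1)*(1-n2)*(1-n3)) = S * v * w * P 1"
 proof -
 have h: "m n * (1 - n) = - (1 - 1/n)" if "n ~= 0" for n using that by (simp add: m_def field_simps)
 have "p4 * ((1-n0)*(1-n1)*(1-n2)*(1-n3)) = (m n0 * (1 - n0)) * (m n1 * (1 - n1)) * (m n2 * (1 - n2)) * (m n3 * (1 - n3))"
 unfolding p4_def by (simp only: mult_ac)
 then have "p4 * ((1-n0)*(1-n1)*(1-n2)*(1-n3)) = (1 - 1/n0)*(1 - 1/n1)*(1 - 1/n2)*(1 - 1/n3)"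
 unfolding h[OF nz(2)] h[OF nz(3)] h[OF nz(4)] h[OF nz(5)] by (simp only: minus_mult_minus mult_minus_left mult_minus_right minus_minus)
 then show ?thesis unfolding x' P[symmetric] by (simp add: mult_ac)
 qed
 have id: "(1 - S) * (am * ((q - w) * (1 - w) * (w - S) * (w - q * S)) * v^2 +
 bb * ((v - S) * (1 - v) * (w - S) * (1 - w)) * q * v * w +
 ap * ((v - S) * (v - q * S) * (1 - v) * (q - v)) * w^2) =
 q * v^2 * w^2 * (S * P 1 * (v - S) * (w - S) - (1 - v) * (1 - w) * P S)"
 unfolding P_def
 proof (rule gamma_identity, fold P_def)
 have y: "S/(e*n) = v/n" "q^2*S/(f*n) = w/n" for n by (simp_all add: v_def w_def)
 have r1: "1 - f/(q*e) = (w - q * v)/w" "1 - f/(q^2*e) = (w - v)/w" "1 - q*S/(e*f) = (q*S - v * w)/(q*S)"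
 "1 - q^3*e/f = (v - q * w)/v" "1 - q^2*e/f = (v - w)/v"
 unfolding ef using nz vw0 q by (simp_all add: field_simps sqr_eq power3_eq_cube)
 show "am * ((w - q * v) * (w - v) * (q * S - v * w)) = - (P v * (w^2 * q * S))"
 using am unfolding y P r1 using vw0 nz q by (simp add: field_simps sqr_eq)
 show "ap * ((v - q * w) * (v - w) * (q * S - v * w)) = - (P w * (v^2 * q * S))"
 using ap unfolding y P r1 using vw0 nz q by (simp add: field_simps sqr_eq)
 show "bb = p4 * S * v * w - 1 - am - ap" unfolding bb x' ..
 show "w - q * v ~= 0" "w - v ~= 0" "q * S - v * w ~= 0" "v - q * w ~= 0"
 using ne nz q unfolding v_def w_def by (auto simp: field_simps sqr_eq power3_eq_cube)
 qed
 define N where "N = r n0 * r n1 * r n2 * r n3 * r e * rf"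
 have L: "am * vw q S [n0,n1,n2,n3,e,f] + bb * vw q S [n0,n1,n2,n3,q*e,f/q] + ap * vw q S [n0,n1,n2,n3,q^2*e,f/q^2] =
 N * ((1 - S) * (am * ((1 - q*S/f) * (1 - q^2*S/f) * (1 - f/q) * (1 - f/q^2)) +
 bb * ((1 - e) * (1 - S/e) * (1 - q^2*S/f) * (1 - f/q^2)) + ap * ((1 - q*e) * (1 - S/(q*e)) * (1 - e) * (1 - S/e))))"
 unfolding vw_def list.map prod_list.Cons prod_list.Nil e1 e2 f1 f2 f3 unfolding r_def[symmetric] N_def
 by (simp only: mult_1_right) algebra
 have Rr: "x * u (q^2*S) (q*n0) (q*n1) (q*n2) (q*n3) (q*e) (q*f) - u S n0 n1 n2 n3 e f =
 N * (x * ((1-n0)*(1-n1)*(1-n2)*(1-n3)) * (1 - e) * (1 - f/q^2) -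
 ((1 - S/n0) * (1 - S/n1) * (1 - S/n2) * (1 - S/n3)) * (1 - S/e) * (1 - q^2*S/f))"
 unfolding u_def U U'[OF p(1)] U'[OF p(2)] U'[OF p(3)] U'[OF p(4)] U'[OF p(5)] f4 f5 N_def by algebra
 have "(1 - S) * (am * ((1 - q*S/f) * (1 - q^2*S/f) * (1 - f/q) * (1 - f/q^2)) +
 bb * ((1 - e) * (1 - S/e) * (1 - q^2*S/f) * (1 - f/q^2)) + ap * ((1 - q*e) * (1 - S/(q*e)) * (1 - e) * (1 - S/e))) =
 S * v * w * P 1 * (1 - e) * (1 - f/q^2) - P S * (1 - S/e) * (1 - q^2*S/f)" (is "?l = ?r")
 proof -
 have fac: "1 - q*S/f = (q - w)/q" "1 - q^2*S/f = 1 - w" "1 - f/q = (w - q*S)/w" "1 - f/q^2 = (w - S)/w"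
 "1 - e = (v - S)/v" "1 - S/e = 1 - v" "1 - q*e = (v - q*S)/v" "1 - S/(q*e) = (q - v)/q"
 unfolding ef using nz vw0 q by (simp_all add: field_simps sqr_eq)
 have "?l = (1 - S) * (am * ((q - w) * (1 - w) * (w - S) * (w - q * S)) * v^2 +
 bb * ((v - S) * (1 - v) * (w - S) * (1 - w)) * q * v * w +
 ap * ((v - S) * (v - q * S) * (1 - v) * (q - v)) * w^2) / (q * v^2 * w^2)"
 unfolding fac using vw0 q by (simp add: field_simps sqr_eq)
 also have "... = S * P 1 * (v - S) * (w - S) - (1 - v) * (1 - w) * P S"
 unfolding id using vw0 q by simp
 also have "... = ?r" unfolding fac using vw0 by simp
 finally show ?thesis .
 qed
 then show ?thesis unfolding L Rr xP P by simp
qed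

text \<open>Certificate linking a term to the one with base \<open>q * S\<close>, which later is a
  shift of \<open>z\<close>, and to the one with the single parameter \<open>n1\<close>
  raised.\<close>

lemma raise_pointwise:
 assumes nz: "S ~= 0" "n0 ~= 0" "n1 ~= 0" "n2 ~= 0" "n3 ~= 0" "e ~= 0" "f ~= 0"
 and p: "qp q n0 ~= 0" "qp q n1 ~= 0" "qp q n2 ~= 0" "qp q n3 ~= 0" "qp q e ~= 0" "qp q f ~= 0"
 and x: "x = q^2 * S^3 / (n0*n1*n2*n3*e*f)"
 and c0: "c0 = (S^2 / (n0*n1*n2*n3) - 1) * (n1 + S / n1) - S^2 * (n0+n1+n2+n3) / (n0*n1*n2*n3) + S * (1/n0+1/n1+1/n2+1/n3)"
 and c1: "c1 = x/q - S^2 / (n0*n1*n2*n3)"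
 and c2: "c2 = S^2 / (n0*n1*n2*n3) - 1"
 defines "u \<equiv> %S n0 n1 n2 n3 e f. qp q (S/n0) / qp q n0 * (qp q (S/n1) / qp q n1) * (qp q (S/n2) / qp q n2) *
 (qp q (S/n3) / qp q n3) * (qp q (q*S/e) / qp q e) * (qp q (q*S/f) / qp q f)"
 shows "c0 * vw q S [n0,n1,n2,n3,e,f] + c1 * vw q (q*S) [q*n0,q*n1,q*n2,q*n3,e,f] + c2 * vw q S [n0,q*n1,n2,n3,e,f] =
 x/q * u (q^2*S) (q*n0) (q*n1) (q*n2) (q*n3) (q*e) (q*f) - u S n0 n1 n2 n3 e f"
proof -
 define r where "r n = qp q (q*S/n) / qp q n" for n
 define M where "M = n0*n1*n2*n3"
 define D where "D = (1 - q*S/e) * (1 - q*S/f)"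
 define re where "re n = qp q (q*(q*S)/n) / qp q n" for n
 define N where "N = r n0 * r n1 * r n2 * r n3 * re e * re f"
 have U: "qp q (S/n) / qp q n = (1 - S/n) * r n" for n unfolding r_def by (subst qp_num) simp
 have U': "qp q (q^2*S/(q*n)) / qp q (q*n) = (1 - n) * r n" if "qp q n ~= 0" for n
 unfolding r_def qp_den[OF that] using q by (simp add: sqr_eq)
 have V: "qp q (q*(q*S)/(q*n)) / qp q (q*n) = (1 - n) * r n" if "qp q n ~= 0" for n
 unfolding r_def qp_den[OF that] using q by simp
 have T: "qp q (q*S/(q*n)) / qp q (q*n) = (1 - n) * ((1 - S/n) * r n)" if "qp q n ~= 0" for n
 unfolding qp_den[OF that] U[symmetric] using q by simp
 have E: "r n = (1 - q*S/n) * re n" for n unfolding r_def re_def by (subst qp_num) simp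
 have E': "qp q (q*(q^2*S)/(q*n)) / qp q (q*n) = (1 - n) * re n" if "qp q n ~= 0" for n
 unfolding re_def qp_den[OF that] using q by (simp add: sqr_eq mult.assoc)
 define ka where "ka = S^2 / M"
 have xM: "x = q^2 * S^3 / (M * e * f)" unfolding x M_def ..
 have quot: "(x/q) * (1 - e) * (1 - f) = c1 * (1 - q * S) + ka * D"
 unfolding c1 D_def M_def[symmetric] ka_def
 by (rule raise_identity_quotient[OF _ _ _ q(1) xM refl]) (use nz in \<open>auto simp: M_def\<close>)
 have core: "(1 - S) * (c0 + c2 * ((1 - n1) * (1 - S / n1))) =
 ka * ((1-n0)*(1-n1)*(1-n2)*(1-n3)) - (1 - S/n0)*(1 - S/n1)*(1 - S/n2)*(1 - S/n3)"
 unfolding ka_def M_def by (rule raise_identity[OF nz(2-5) c0 c2])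
 have L: "c0 * vw q S [n0,n1,n2,n3,e,f] + c1 * vw q (q*S) [q*n0,q*n1,q*n2,q*n3,e,f] + c2 * vw q S [n0,q*n1,n2,n3,e,f] =
 N * (D * ((1 - S) * (c0 + c2 * ((1 - n1) * (1 - S / n1)))) + c1 * (1 - q*S) * ((1-n0)*(1-n1)*(1-n2)*(1-n3)))"
 unfolding vw_def list.map prod_list.Cons prod_list.Nil V[OF p(1)] V[OF p(2)] V[OF p(3)] V[OF p(4)] T[OF p(2)]
 unfolding re_def[symmetric] unfolding r_def[symmetric] E[of e] E[of f] N_def D_def
 by (simp only: mult_1_right) algebra
 have R: "x/q * u (q^2*S) (q*n0) (q*n1) (q*n2) (q*n3) (q*e) (q*f) - u S n0 n1 n2 n3 e f =
 N * ((x/q * (1 - e) * (1 - f)) * ((1-n0)*(1-n1)*(1-n2)*(1-n3)) - D * ((1 - S/n0)*(1 - S/n1)*(1 - S/n2)*(1 - S/n3)))"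
 unfolding u_def U U'[OF p(1)] U'[OF p(2)] U'[OF p(3)] U'[OF p(4)] E'[OF p(5)] E'[OF p(6)]
 unfolding r_def[symmetric] E[of e] E[of f] N_def D_def by algebra
 show ?thesis unfolding L R quot core by (simp add: algebra_simps)
qed

text \<open>The companion that leads back from the raised series: compared with the middle term, the
  last one has \<open>n1\<close> lowered. Besides infinite products its certificate contains the
  linear factor \<open>1 - n0 * n2 * n3 / S\<close>.\<close>

lemma lower_pointwise:
 assumes nz: "S ~= 0" "n0 ~= 0" "n1 ~= 0" "n2 ~= 0" "n3 ~= 0" "e ~= 0" "f ~= 0"
 and p: "qp q n0 ~= 0" "qp q n1 ~= 0" "qp q n2 ~= 0" "qp q n3 ~= 0" "qp q e ~= 0" "qp q f ~= 0"
 and g: "g = n0*n2*n3/S" and ka: "ka = S / (g * n1)"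
 and x: "x = q^2 * S^2 / (g * n1 * e * f)"
 and c0: "c0 = g - (n0+n2+n3) + S * (1/n0+1/n2+1/n3) - S / g"
 and c1: "c1 = x/q - 1"
 and c2: "c2 = - ((ka - 1) * q * S * (1/e + 1/f)) + (x/q - 1) * (n1 + q*S/n1) - (x/q - ka) * (n1 + q*g)"
 defines "u \<equiv> %S n0 n1 n2 n3 e f. qp q (S/n0) / qp q n0 * (qp q (q*S/n1) / qp q n1) * (qp q (S/n2) / qp q n2) *
 (qp q (S/n3) / qp q n3) * (qp q (q*S/e) / qp q e) * (qp q (q*S/f) / qp q f) * (1 - n0*n2*n3/S)"
 shows "c0 * vw q S [n0,n1,n2,n3,e,f] + c1 * vw q (q*S) [q*n0,q*n1,q*n2,q*n3,e,f] + c2 * vw q (q*S) [q*n0,n1,q*n2,q*n3,e,f] =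
 x/q * u (q^2*S) (q*n0) (q*n1) (q*n2) (q*n3) (q*e) (q*f) - u S n0 n1 n2 n3 e f"
proof -
 define r where "r n = qp q (q*S/n) / qp q n" for n
 define D where "D = (1 - q*S/e) * (1 - q*S/f)"
 define re where "re n = qp q (q*(q*S)/n) / qp q n" for n
 define N where "N = r n0 * re n1 * r n2 * r n3 * re e * re f"
 define PA where "PA = (1-n0)*(1-n2)*(1-n3)"
 define PB where "PB = (1-S/n0)*(1-S/n2)*(1-S/n3)"
 have g0: "g ~= 0" using nz by (simp add: g)
 have U: "qp q (S/n) / qp q n = (1 - S/n) * r n" for n unfolding r_def by (subst qp_num) simp
 have U': "qp q (q^2*S/(q*n)) / qp q (q*n) = (1 - n) * r n" if "qp q n ~= 0" for n
 unfolding r_def qp_den[OF that] using q by (simp add: sqr_eq)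
 have V: "qp q (q*(q*S)/(q*n)) / qp q (q*n) = (1 - n) * r n" if "qp q n ~= 0" for n
 unfolding r_def qp_den[OF that] using q by simp
 have E: "r n = (1 - q*S/n) * re n" for n unfolding r_def re_def by (subst qp_num) simp
 have E': "qp q (q*(q^2*S)/(q*n)) / qp q (q*n) = (1 - n) * re n" if "qp q n ~= 0" for n
 unfolding re_def qp_den[OF that] using q by (simp add: sqr_eq mult.assoc)
 have g': "q*n0*(q*n2)*(q*n3)/(q^2*S) = q*g" using q by (simp add: g sqr_eq)
 note quot = lower_identity_quotient[OF nz(3,6,7,1) g0 q(1) x ka c2]
 have core: "(1 - S) * c0 = PA * (1 - S / g) - PB * (1 - g)"
 unfolding PA_def PB_def by (rule lower_identity[OF nz(2,4,5,1) g c0])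
 have L: "c0 * vw q S [n0,n1,n2,n3,e,f] + c1 * vw q (q*S) [q*n0,q*n1,q*n2,q*n3,e,f] + c2 * vw q (q*S) [q*n0,n1,q*n2,q*n3,e,f] =
 N * (D * (1 - q*S/n1) * ((1 - S) * c0) + (1 - q*S) * PA * (c1 * (1 - n1) * (1 - q*S/n1) + c2))"
 unfolding vw_def list.map prod_list.Cons prod_list.Nil V[OF p(1)] V[OF p(2)] V[OF p(3)] V[OF p(4)]
 unfolding re_def[symmetric] unfolding r_def[symmetric] E[of e] E[of f] E[of n1] N_def D_def PA_def
 by (simp only: mult_1_right) algebra
 have R: "x/q * u (q^2*S) (q*n0) (q*n1) (q*n2) (q*n3) (q*e) (q*f) - u S n0 n1 n2 n3 e f =
 N * ((x/q * (1 - e) * (1 - f)) * PA * (1 - n1) * (1 - q*g) - PB * (1 - g) * D * (1 - q*S/n1))"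
 unfolding u_def U U'[OF p(1)] U'[OF p(3)] U'[OF p(4)] E'[OF p(2)] E'[OF p(5)] E'[OF p(6)] g'
 unfolding r_def[symmetric] E[of e] E[of f] E[of n1] g[symmetric] N_def D_def PA_def PB_def by algebra
 have "D * (1 - q*S/n1) * ((1 - S) * c0) + (1 - q*S) * PA * (c1 * (1 - n1) * (1 - q*S/n1) + c2) =
 (x/q * (1 - e) * (1 - f)) * PA * (1 - n1) * (1 - q*g) - PB * (1 - g) * D * (1 - q*S/n1)"
 unfolding quot(2)[folded D_def] c1 quot(1)[folded D_def] core using quot(3) by algebra
 then show ?thesis unfolding L R by simp
qed

end

section \<open>Contiguous relations for the sums\<close>

definition vt :: "complex => complex => complex list => complex => nat => complex" where
 "vt q ga as x k = vw q (ga * (q ^ k)^2) (map (%a. a * q ^ k) as) * x ^ k"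

definition Wh :: "complex => complex => complex list => complex => complex" where
 "Wh q ga as x = vw q ga (ga # as) * W87 ga as q x"

definition Wok :: "complex => complex => complex list => complex => bool" where
 "Wok q ga as x \<longleftrightarrow> W87_regular ga as q x & ga ~= 0 & qp q ga ~= 0 & (\<forall>a\<in>set as. a ~= 0 & qp q a ~= 0)"

lemma vt_perm: "vt q ga [n0,n1,n2,n3,e,f] x k = vt q ga [e,n0,n1,n2,n3,f] x k"
 by (simp add: vt_def vw_def mult_ac)

lemma vt_Suc: "vt q ga as x (Suc k) = x * vt q (q^2 * ga) (map (%a. q * a) as) x k"
 by (simp add: vt_def comp_def power_mult_distrib mult_ac)

text \<open>Needed because series with arguments \<open>x\<close> and \<open>x / q\<close> occur
  together: \<open>x ^ k = q ^ k * (x / q) ^ k\<close>, and the power of \<open>q\<close> is moved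
  into the coefficients.\<close>

lemma scaled_combination:
 fixes y :: complex
 shows "a1 * A + a2 * B + a3 * C = r ==> v1 = A * y ==> v2 = B * y ==> v3 = C * y ==>
 a1 * v1 + a2 * v2 + a3 * v3 = y * r"
 and "a1 * s * A + a2 * B + a3 * C = r ==> X = s * y ==> v1 = A * X ==> v2 = B * y ==> v3 = C * y ==>
 a1 * v1 + a2 * v2 + a3 * v3 = y * r"
 and "a1 * s * A + a2 * B + a3 * s * C = r ==> X = s * y ==> v1 = A * X ==> v2 = B * y ==> v3 = C * X ==>
 a1 * v1 + a2 * v2 + a3 * v3 = y * r"
 by (auto simp: algebra_simps)

context
 fixes q :: complex
 assumes q: "q ~= 0" "norm q < 1"
begin

lemma vt_sums: "Wok q ga as x ==> norm x < 1 ==> vt q ga (ga # as) x sums Wh q ga as x"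
proof -
 have h: "(q ^ k)^2 = q ^ (2 * k)" for k by (simp add: mult.commute flip: power_mult)
 assume "Wok q ga as x" "norm x < 1"
 then show ?thesis using vw_sums[OF q, of ga as x] unfolding vt_def[abs_def] Wh_def Wok_def h by blast
qed

lemma vt_zero: "e = q * ga ==> ga ~= 0 ==> vt q ga [n0,n1,n2,n3,e,f] x 0 = 0"
 using q by (simp add: vt_def vw_def qp_1[OF q])

lemma vt_zero': "e = q^2 * ga ==> ga ~= 0 ==> vt q ga [n0,n1,n2,n3,e,f] x 0 = 0"
proof -
 assume "e = q^2 * ga" "ga ~= 0"
 then have h: "q * ga / e = 1 / q" using q by (simp add: sqr_eq)
 have "qp q (1 / q) = 0" using q by (auto simp: qp_eq_0_iff[OF q] intro: exI[of _ 1])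
 then show ?thesis by (simp add: vt_def vw_def h)
qed

text \<open>For \<open>e = q * ga\<close> the factor \<open>qp q (q * ga / e)\<close> of the term
  \<open>k = 0\<close> is \<open>qp q 1 = 0\<close>. The series starts at \<open>k = 1\<close>, and
  after re-indexing its base is \<open>q^2 * ga\<close>. The relations for the solution
  \<open>S\<close> take this form.\<close>

lemma shifted_sums:
 assumes "Wok q (q^2*ga) [q*n0,q*n1,q*n2,q*n3,q*f] x" "norm x < 1" "e = q * ga" "ga ~= 0"
 shows "vt q ga [n0,n1,n2,n3,e,f] x sums (x * Wh q (q^2*ga) [q*n0,q*n1,q*n2,q*n3,q*f] x)"
proof -
 have "(%k. x * vt q (q^2*ga) [q^2*ga,q*n0,q*n1,q*n2,q*n3,q*f] x k) sums (x * Wh q (q^2*ga) [q*n0,q*n1,q*n2,q*n3,q*f] x)"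
 by (intro sums_mult vt_sums assms(1,2))
 moreover have "vt q ga [n0,n1,n2,n3,e,f] x (Suc k) = x * vt q (q^2*ga) [q^2*ga,q*n0,q*n1,q*n2,q*n3,q*f] x k" for k
 unfolding vt_Suc by (simp add: vt_perm assms(3) sqr_eq mult.assoc)
 ultimately show ?thesis using vt_zero[OF assms(3,4)] sums_Suc_iff[of "vt q ga [n0,n1,n2,n3,e,f] x"] by simp
qed

text \<open>The boundary term vanishes because \<open>ga = n0\<close> or \<open>ga = e\<close> puts
  the factor \<open>qp q 1\<close> into \<open>u 0\<close>. The first alternative serves
  \<open>R\<close>, the second \<open>S\<close>.\<close>

lemma gamma_sums:
 assumes nz: "ga ~= 0" "n0 ~= 0" "n1 ~= 0" "n2 ~= 0" "n3 ~= 0" "e ~= 0" "f ~= 0"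
 and p: "qp q n0 ~= 0" "qp q n1 ~= 0" "qp q n2 ~= 0" "qp q n3 ~= 0" "qp q e ~= 0" "qp q (f / q^2) ~= 0"
 and x: "x * (n0*n1*n2*n3*e*f) = q^2 * ga^3" "norm x < 1"
 and am: "am * ((1 - f/(q*e)) * (1 - f/(q^2*e)) * (1 - q*ga/(e*f))) =
 - ((1 - ga/(e*n0)) * (1 - ga/(e*n1)) * (1 - ga/(e*n2)) * (1 - ga/(e*n3)))"
 and ap: "ap * ((1 - q^3*e/f) * (1 - q^2*e/f) * (1 - q*ga/(e*f))) =
 - ((1 - q^2*ga/(f*n0)) * (1 - q^2*ga/(f*n1)) * (1 - q^2*ga/(f*n2)) * (1 - q^2*ga/(f*n3)))"
 and bb: "bb = x - 1 - am - ap"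
 and ne: "f ~= q*e" "f ~= q^2*e" "e*f ~= q*ga" "f ~= q^3*e"
 and bd: "ga = n0 | ga = e"
 shows "(%k. am * vt q ga [n0,n1,n2,n3,e,f] x k + bb * vt q ga [n0,n1,n2,n3,q*e,f/q] x k +
 ap * vt q ga [n0,n1,n2,n3,q^2*e,f/q^2] x k) sums 0"
proof -
 define u where "u k = qp q (ga/n0*q^k) / qp q (n0*q^k) * (qp q (ga/n1*q^k) / qp q (n1*q^k)) * (qp q (ga/n2*q^k) / qp q (n2*q^k)) *
 (qp q (ga/n3*q^k) / qp q (n3*q^k)) * (qp q (ga/e*q^k) / qp q (e*q^k)) * (qp q (q^2*ga/f*q^k) / qp q (f/q^2*q^k))" for k
 have tele: "am * vt q ga [n0,n1,n2,n3,e,f] x k + bb * vt q ga [n0,n1,n2,n3,q*e,f/q] x k +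
 ap * vt q ga [n0,n1,n2,n3,q^2*e,f/q^2] x k = x ^ k * (x * u (Suc k) - u k)" for k
 proof -
 define s where "s = q ^ k"
 have s0: "s ~= 0" using q by (simp add: s_def)
 have inv: "ga * s^2/(y * s*(z * s)) = ga/(y*z)" "C*(ga * s^2)/(y * s*(z * s)) = C*ga/(y*z)" "y * s/(C*(z * s)) = y/(C*z)" "C*(y * s)/(z * s) = C*y/z"
 for C y z using s0 by (simp_all add: sqr_eq)
 have ps: "qp q (y * s) ~= 0" if "qp q y ~= 0" for y unfolding s_def by (rule qp_scale_nz[OF q that])
 have "am * vw q (ga * s^2) [n0 * s,n1 * s,n2 * s,n3 * s,e * s,f * s] + bb * vw q (ga * s^2) [n0 * s,n1 * s,n2 * s,n3 * s,q*(e * s),f * s/q] +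
 ap * vw q (ga * s^2) [n0 * s,n1 * s,n2 * s,n3 * s,q^2*(e * s),f * s/q^2] = x * u (Suc k) - u k"
 proof (subst gamma_pointwise[OF q, where S = "ga * s^2" and ?n0.0 = "n0 * s" and ?n1.0 = "n1 * s" and ?n2.0 = "n2 * s" and ?n3.0 = "n3 * s" and e = "e * s" and f = "f * s" and x = x])
 show "qp q (f * s / q^2) ~= 0" using ps[OF p(6)] by simp
 show "x * (n0 * s*(n1 * s)*(n2 * s)*(n3 * s)*(e * s)*(f * s)) = q^2 * (ga * s^2)^3" using x(1) by algebra
 show "am * ((1 - f * s/(q*(e * s))) * (1 - f * s/(q^2*(e * s))) * (1 - q*(ga * s^2)/(e * s*(f * s)))) =
 - ((1 - ga * s^2/(e * s*(n0 * s))) * (1 - ga * s^2/(e * s*(n1 * s))) * (1 - ga * s^2/(e * s*(n2 * s))) * (1 - ga * s^2/(e * s*(n3 * s))))"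
 unfolding inv by (rule am)
 show "ap * ((1 - q^3*(e * s)/(f * s)) * (1 - q^2*(e * s)/(f * s)) * (1 - q*(ga * s^2)/(e * s*(f * s)))) =
 - ((1 - q^2*(ga * s^2)/(f * s*(n0 * s))) * (1 - q^2*(ga * s^2)/(f * s*(n1 * s))) * (1 - q^2*(ga * s^2)/(f * s*(n2 * s))) * (1 - q^2*(ga * s^2)/(f * s*(n3 * s))))"
 unfolding inv by (rule ap)
 show "bb = x - 1 - am - ap" by (rule bb)
 show "e * s*(f * s) ~= q*(ga * s^2)" "f * s ~= q*(e * s)" "f * s ~= q^2*(e * s)" "f * s ~= q^3*(e * s)"
 using ne s0 by (auto simp: sqr_eq)
 have 1: "q^2*(ga * s^2)/(q*(y * s)) = ga/y*q^Suc k" "ga * s^2/(y * s) = ga/y*q^k"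
 "q^2*(q^2*(ga * s^2))/(q*(y * s)) = q^2*ga/y*q^Suc k" "q*(y * s)/q^2 = y/q^2*q^Suc k"
 "q^2*(ga * s^2)/(y * s) = q^2*ga/y*q^k" "y * s/q^2 = y/q^2*q^k" for y
 using q s0 by (simp_all add: s_def sqr_eq)
 have 3: "q*(y * s) = y*q^Suc k" for y by (simp add: s_def)
 show "x * (qp q (q\<^sup>2 * (ga * s\<^sup>2) / (q * (n0 * s))) / qp q (q * (n0 * s)) *
 (qp q (q\<^sup>2 * (ga * s\<^sup>2) / (q * (n1 * s))) / qp q (q * (n1 * s))) *
 (qp q (q\<^sup>2 * (ga * s\<^sup>2) / (q * (n2 * s))) / qp q (q * (n2 * s))) *
 (qp q (q\<^sup>2 * (ga * s\<^sup>2) / (q * (n3 * s))) / qp q (q * (n3 * s))) *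
 (qp q (q\<^sup>2 * (ga * s\<^sup>2) / (q * (e * s))) / qp q (q * (e * s))) *
 (qp q (q\<^sup>2 * (q\<^sup>2 * (ga * s\<^sup>2)) / (q * (f * s))) / qp q (q * (f * s) / q\<^sup>2))) -
 qp q (ga * s\<^sup>2 / (n0 * s)) / qp q (n0 * s) * (qp q (ga * s\<^sup>2 / (n1 * s)) / qp q (n1 * s)) *
 (qp q (ga * s\<^sup>2 / (n2 * s)) / qp q (n2 * s)) * (qp q (ga * s\<^sup>2 / (n3 * s)) / qp q (n3 * s)) *
 (qp q (ga * s\<^sup>2 / (e * s)) / qp q (e * s)) * (qp q (q\<^sup>2 * (ga * s\<^sup>2) / (f * s)) / qp q (f * s / q\<^sup>2)) =
 x * u (Suc k) - u k"
 unfolding 1 unfolding 3 u_def unfolding s_def ..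
 qed (use nz s0 ps p in auto)
 moreover have "vt q ga [n0,n1,n2,n3,e,f] x k = vw q (ga * s^2) [n0 * s,n1 * s,n2 * s,n3 * s,e * s,f * s] * x ^ k"
 "vt q ga [n0,n1,n2,n3,q*e,f/q] x k = vw q (ga * s^2) [n0 * s,n1 * s,n2 * s,n3 * s,q*(e * s),f * s/q] * x^k"
 "vt q ga [n0,n1,n2,n3,q^2*e,f/q^2] x k = vw q (ga * s^2) [n0 * s,n1 * s,n2 * s,n3 * s,q^2*(e * s),f * s/q^2] * x^k"
 by (simp_all add: vt_def s_def mult.assoc)
 ultimately show ?thesis by (rule scaled_combination(1))
 qed
 have "u \<longlonglongrightarrow> 1 / 1 * (1 / 1) * (1 / 1) * (1 / 1) * (1 / 1) * (1 / 1)"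
 unfolding u_def by (intro tendsto_intros qp_tendsto[OF q]) simp_all
 from telescoping_sums[OF q this x(2)] have "(%k. x ^ k * (x * u (Suc k) - u k)) sums (- u 0)" .
 moreover have "u 0 = 0" using bd nz by (auto simp: u_def qp_1[OF q])
 ultimately show ?thesis unfolding tele by simp
qed

lemma raise_sums:
 assumes nz: "ga ~= 0" "n0 ~= 0" "n1 ~= 0" "n2 ~= 0" "n3 ~= 0" "e ~= 0" "f ~= 0"
 and p: "qp q n0 ~= 0" "qp q n1 ~= 0" "qp q n2 ~= 0" "qp q n3 ~= 0" "qp q e ~= 0" "qp q f ~= 0"
 and x: "x = q^2 * ga^3 / (n0*n1*n2*n3*e*f)" "norm (x/q) < 1"
 and c0: "c0 = (ga^2 / (n0*n1*n2*n3) - 1) * (n1 + ga / n1) - ga^2 * (n0+n1+n2+n3) / (n0*n1*n2*n3) + ga * (1/n0+1/n1+1/n2+1/n3)"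
 and c1: "c1 = x/q - ga^2 / (n0*n1*n2*n3)"
 and c2: "c2 = ga^2 / (n0*n1*n2*n3) - 1"
 and bd: "ga = n0 | e = q * ga"
 shows "(%k. c0 * vt q ga [n0,n1,n2,n3,e,f] x k + c1 * vt q (q*ga) [q*n0,q*n1,q*n2,q*n3,e,f] (x/q) k +
 c2 * vt q ga [n0,q*n1,n2,n3,e,f] (x/q) k) sums 0"
proof -
 define u where "u k = qp q (ga/n0*q^k) / qp q (n0*q^k) * (qp q (ga/n1*q^k) / qp q (n1*q^k)) * (qp q (ga/n2*q^k) / qp q (n2*q^k)) *
 (qp q (ga/n3*q^k) / qp q (n3*q^k)) * (qp q (q*ga/e*q^k) / qp q (e*q^k)) * (qp q (q*ga/f*q^k) / qp q (f*q^k))" for k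
 have tele: "c0 * vt q ga [n0,n1,n2,n3,e,f] x k + c1 * vt q (q*ga) [q*n0,q*n1,q*n2,q*n3,e,f] (x/q) k +
 c2 * vt q ga [n0,q*n1,n2,n3,e,f] (x/q) k = (x/q) ^ k * (x/q * u (Suc k) - u k)" for k
 proof -
 define s where "s = q ^ k"
 have s0: "s ~= 0" using q by (simp add: s_def)
 have ps: "qp q (y * s) ~= 0" if "qp q y ~= 0" for y unfolding s_def by (rule qp_scale_nz[OF q that])
 have M: "n0 * s*(n1 * s)*(n2 * s)*(n3 * s) = n0*n1*n2*n3 * s^4" "(ga * s^2)^2 = ga^2 * s^4" by algebra+
 have inv: "(ga * s^2)^2 / (n0 * s*(n1 * s)*(n2 * s)*(n3 * s)) = ga^2 / (n0*n1*n2*n3)" unfolding M using s0 by simp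
 have inv': "(ga * s^2)^2 * X / (n0 * s*(n1 * s)*(n2 * s)*(n3 * s)) = ga^2 * X / (n0*n1*n2*n3)" for X unfolding M using s0 by simp
 have "c0 * s * vw q (ga * s^2) [n0 * s,n1 * s,n2 * s,n3 * s,e * s,f * s] + c1 * vw q (q*(ga * s^2)) [q*(n0 * s),q*(n1 * s),q*(n2 * s),q*(n3 * s),e * s,f * s] +
 c2 * vw q (ga * s^2) [n0 * s,q*(n1 * s),n2 * s,n3 * s,e * s,f * s] = x/q * u (Suc k) - u k"
 proof (subst raise_pointwise[OF q, where S = "ga * s^2" and ?n0.0 = "n0 * s" and ?n1.0 = "n1 * s" and ?n2.0 = "n2 * s" and ?n3.0 = "n3 * s" and e = "e * s" and f = "f * s" and x = x])
 show "x = q^2 * (ga * s^2)^3 / (n0 * s*(n1 * s)*(n2 * s)*(n3 * s)*(e * s)*(f * s))"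
 proof -
 have h: "(ga * s^2)^3 = ga^3 * s^6" "n0 * s*(n1 * s)*(n2 * s)*(n3 * s)*(e * s)*(f * s) = n0*n1*n2*n3*e*f * s^6" by algebra+
 show ?thesis unfolding h x(1) using s0 by simp
 qed
 have "1/(n * s) = 1/n/s" for n by simp
 then have h: "ga * s^2*(1/(n0 * s)+1/(n1 * s)+1/(n2 * s)+1/(n3 * s)) = ga*(1/n0+1/n1+1/n2+1/n3) * s" "ga * s^2/(n1 * s) = ga/n1 * s"
 using s0 by (simp_all add: sqr_eq distrib_left distrib_right add_divide_distrib)
 show "c0 * s = ((ga * s^2)^2 / (n0 * s*(n1 * s)*(n2 * s)*(n3 * s)) - 1) * (n1 * s + ga * s^2 / (n1 * s)) -
 (ga * s^2)^2 * (n0 * s+n1 * s+n2 * s+n3 * s) / (n0 * s*(n1 * s)*(n2 * s)*(n3 * s)) + ga * s^2 * (1/(n0 * s)+1/(n1 * s)+1/(n2 * s)+1/(n3 * s))"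
 unfolding inv inv' h c0 by (simp add: algebra_simps add_divide_distrib)
 show "c1 = x/q - (ga * s^2)^2 / (n0 * s*(n1 * s)*(n2 * s)*(n3 * s))" "c2 = (ga * s^2)^2 / (n0 * s*(n1 * s)*(n2 * s)*(n3 * s)) - 1"
 unfolding inv by (rule c1 c2)+
 have 1: "q^2*(ga * s^2)/(q*(y * s)) = ga/y*q^Suc k" "ga * s^2/(y * s) = ga/y*q^k"
 "q*(q^2*(ga * s^2))/(q*(y * s)) = q*ga/y*q^Suc k" "q*(ga * s^2)/(y * s) = q*ga/y*q^k" for y
 using q s0 by (simp_all add: s_def sqr_eq)
 have 3: "q*(y * s) = y*q^Suc k" for y by (simp add: s_def)
 show "x / q * (qp q (q\<^sup>2 * (ga * s\<^sup>2) / (q * (n0 * s))) / qp q (q * (n0 * s)) *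
 (qp q (q\<^sup>2 * (ga * s\<^sup>2) / (q * (n1 * s))) / qp q (q * (n1 * s))) *
 (qp q (q\<^sup>2 * (ga * s\<^sup>2) / (q * (n2 * s))) / qp q (q * (n2 * s))) *
 (qp q (q\<^sup>2 * (ga * s\<^sup>2) / (q * (n3 * s))) / qp q (q * (n3 * s))) *
 (qp q (q * (q\<^sup>2 * (ga * s\<^sup>2)) / (q * (e * s))) / qp q (q * (e * s))) *
 (qp q (q * (q\<^sup>2 * (ga * s\<^sup>2)) / (q * (f * s))) / qp q (q * (f * s)))) -
 qp q (ga * s\<^sup>2 / (n0 * s)) / qp q (n0 * s) * (qp q (ga * s\<^sup>2 / (n1 * s)) / qp q (n1 * s)) *
 (qp q (ga * s\<^sup>2 / (n2 * s)) / qp q (n2 * s)) * (qp q (ga * s\<^sup>2 / (n3 * s)) / qp q (n3 * s)) *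
 (qp q (q * (ga * s\<^sup>2) / (e * s)) / qp q (e * s)) * (qp q (q * (ga * s\<^sup>2) / (f * s)) / qp q (f * s)) =
 x / q * u (Suc k) - u k"
 unfolding 1 unfolding 3 u_def unfolding s_def ..
 qed (use nz s0 ps p in auto)
 moreover have "x ^ k = s * (x/q)^k" using q by (simp add: s_def power_divide)
 moreover have "vt q ga [n0,n1,n2,n3,e,f] x k = vw q (ga * s^2) [n0 * s,n1 * s,n2 * s,n3 * s,e * s,f * s] * x ^ k"
 "vt q (q*ga) [q*n0,q*n1,q*n2,q*n3,e,f] (x/q) k = vw q (q*(ga * s^2)) [q*(n0 * s),q*(n1 * s),q*(n2 * s),q*(n3 * s),e * s,f * s] * (x/q)^k"
 "vt q ga [n0,q*n1,n2,n3,e,f] (x/q) k = vw q (ga * s^2) [n0 * s,q*(n1 * s),n2 * s,n3 * s,e * s,f * s] * (x/q)^k"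
 by (simp_all add: vt_def s_def mult.assoc)
 ultimately show ?thesis by (rule scaled_combination(2))
 qed
 have "u \<longlonglongrightarrow> 1 / 1 * (1 / 1) * (1 / 1) * (1 / 1) * (1 / 1) * (1 / 1)"
 unfolding u_def by (intro tendsto_intros qp_tendsto[OF q]) simp_all
 from telescoping_sums[OF q this x(2)] have "(%k. (x/q) ^ k * (x/q * u (Suc k) - u k)) sums (- u 0)" .
 moreover have "u 0 = 0" using bd nz q by (auto simp: u_def qp_1[OF q])
 ultimately show ?thesis unfolding tele by simp
qed

lemma lower_sums:
 assumes nz: "ga ~= 0" "n0 ~= 0" "n1 ~= 0" "n2 ~= 0" "n3 ~= 0" "e ~= 0" "f ~= 0"
 and p: "qp q n0 ~= 0" "qp q n1 ~= 0" "qp q n2 ~= 0" "qp q n3 ~= 0" "qp q e ~= 0" "qp q f ~= 0"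
 and g: "g = n0*n2*n3/ga" and ka: "ka = ga / (g * n1)"
 and x: "x = q^2 * ga^2 / (g * n1 * e * f)" "norm (x/q) < 1" "norm x < 1"
 and c0: "c0 = g - (n0+n2+n3) + ga * (1/n0+1/n2+1/n3) - ga / g"
 and c1: "c1 = x/q - 1"
 and c2: "c2 = - ((ka - 1) * q * ga * (1/e + 1/f)) + (x/q - 1) * (n1 + q*ga/n1) - (x/q - ka) * (n1 + q*g)"
 and bd: "ga = n0 | e = q * ga"
 shows "(%k. c0 * vt q ga [n0,n1,n2,n3,e,f] x k + c1 * vt q (q*ga) [q*n0,q*n1,q*n2,q*n3,e,f] (x/q) k +
 c2 * vt q (q*ga) [q*n0,n1,q*n2,q*n3,e,f] x k) sums 0"
proof -
 define u where "u k = qp q (ga/n0*q^k) / qp q (n0*q^k) * (qp q (q*ga/n1*q^k) / qp q (n1*q^k)) * (qp q (ga/n2*q^k) / qp q (n2*q^k)) *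
 (qp q (ga/n3*q^k) / qp q (n3*q^k)) * (qp q (q*ga/e*q^k) / qp q (e*q^k)) * (qp q (q*ga/f*q^k) / qp q (f*q^k)) * (1 - g*q^k)" for k
 have tele: "c0 * vt q ga [n0,n1,n2,n3,e,f] x k + c1 * vt q (q*ga) [q*n0,q*n1,q*n2,q*n3,e,f] (x/q) k +
 c2 * vt q (q*ga) [q*n0,n1,q*n2,q*n3,e,f] x k = (x/q) ^ k * (x/q * u (Suc k) - u k)" for k
 proof -
 define s where "s = q ^ k"
 have s0: "s ~= 0" using q by (simp add: s_def)
 have ps: "qp q (y * s) ~= 0" if "qp q y ~= 0" for y unfolding s_def by (rule qp_scale_nz[OF q that])
 have g0: "g ~= 0" using nz by (simp add: g)
 have "c0 * s * vw q (ga * s^2) [n0 * s,n1 * s,n2 * s,n3 * s,e * s,f * s] + c1 * vw q (q*(ga * s^2)) [q*(n0 * s),q*(n1 * s),q*(n2 * s),q*(n3 * s),e * s,f * s] +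
 c2 * s * vw q (q*(ga * s^2)) [q*(n0 * s),n1 * s,q*(n2 * s),q*(n3 * s),e * s,f * s] = x/q * u (Suc k) - u k"
 proof (subst lower_pointwise[OF q, where S = "ga * s^2" and ?n0.0 = "n0 * s" and ?n1.0 = "n1 * s" and ?n2.0 = "n2 * s" and ?n3.0 = "n3 * s" and e = "e * s" and f = "f * s" and x = x and g = "g * s" and ka = ka])
 show "g * s = n0 * s*(n2 * s)*(n3 * s)/(ga * s^2)" using s0 by (simp add: g sqr_eq)
 show "ka = ga * s^2 / (g * s*(n1 * s))" using s0 by (simp add: ka sqr_eq)
 show "x = q^2 * (ga * s^2)^2 / (g * s*(n1 * s)*(e * s)*(f * s))"
 proof -
 have h: "(ga * s^2)^2 = ga^2 * s^4" "g * s*(n1 * s)*(e * s)*(f * s) = g*n1*e*f * s^4" by algebra+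
 show ?thesis unfolding h x(1) using s0 by simp
 qed
 have d: "1/(n * s) = 1/n/s" for n by simp
 have h: "ga * s^2*(1/(n0 * s)+1/(n2 * s)+1/(n3 * s)) = ga*(1/n0+1/n2+1/n3) * s" "ga * s^2/(g * s) = ga/g * s"
 using s0 by (simp_all add: sqr_eq distrib_left distrib_right add_divide_distrib)
 show "c0 * s = g * s - (n0 * s+n2 * s+n3 * s) + ga * s^2 * (1/(n0 * s)+1/(n2 * s)+1/(n3 * s)) - ga * s^2 / (g * s)"
 unfolding h c0 by (simp add: algebra_simps)
 show "c1 = x/q - 1" by (rule c1)
 have h': "(ka - 1) * q * (ga * s^2) * (1/(e * s) + 1/(f * s)) = (ka - 1) * q * ga * (1/e + 1/f) * s"
 "q*(ga * s^2)/(n1 * s) = q*ga/n1 * s" "q*(g * s) = q*g * s"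
 using s0 by (simp_all add: sqr_eq distrib_left distrib_right add_divide_distrib mult.assoc)
 show "c2 * s = - ((ka - 1) * q * (ga * s^2) * (1/(e * s) + 1/(f * s))) + (x/q - 1) * (n1 * s + q*(ga * s^2)/(n1 * s)) - (x/q - ka) * (n1 * s + q*(g * s))"
 unfolding h' c2 by (simp only: distrib_right left_diff_distrib distrib_left minus_mult_left[symmetric] mult.assoc)
 have 1: "q^2*(ga * s^2)/(q*(y * s)) = ga/y*q^Suc k" "ga * s^2/(y * s) = ga/y*q^k"
 "q*(q^2*(ga * s^2))/(q*(y * s)) = q*ga/y*q^Suc k" "q*(ga * s^2)/(y * s) = q*ga/y*q^k" for y
 using q s0 by (simp_all add: s_def sqr_eq)
 have 2: "q*(n0 * s)*(q*(n2 * s))*(q*(n3 * s))/(q^2*(ga * s^2)) = g*q^Suc k" "n0 * s*(n2 * s)*(n3 * s)/(ga * s^2) = g*q^k"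
 using q s0 by (simp_all add: g s_def sqr_eq)
 have 3: "q*(y * s) = y*q^Suc k" for y by (simp add: s_def)
 show "x / q * (qp q (q\<^sup>2 * (ga * s\<^sup>2) / (q * (n0 * s))) / qp q (q * (n0 * s)) *
 (qp q (q * (q\<^sup>2 * (ga * s\<^sup>2)) / (q * (n1 * s))) / qp q (q * (n1 * s))) *
 (qp q (q\<^sup>2 * (ga * s\<^sup>2) / (q * (n2 * s))) / qp q (q * (n2 * s))) *
 (qp q (q\<^sup>2 * (ga * s\<^sup>2) / (q * (n3 * s))) / qp q (q * (n3 * s))) *
 (qp q (q * (q\<^sup>2 * (ga * s\<^sup>2)) / (q * (e * s))) / qp q (q * (e * s))) *
 (qp q (q * (q\<^sup>2 * (ga * s\<^sup>2)) / (q * (f * s))) / qp q (q * (f * s))) *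
 (1 - q*(n0 * s)*(q*(n2 * s))*(q*(n3 * s))/(q\<^sup>2*(ga * s\<^sup>2)))) -
 qp q (ga * s\<^sup>2 / (n0 * s)) / qp q (n0 * s) * (qp q (q * (ga * s\<^sup>2) / (n1 * s)) / qp q (n1 * s)) *
 (qp q (ga * s\<^sup>2 / (n2 * s)) / qp q (n2 * s)) * (qp q (ga * s\<^sup>2 / (n3 * s)) / qp q (n3 * s)) *
 (qp q (q * (ga * s\<^sup>2) / (e * s)) / qp q (e * s)) * (qp q (q * (ga * s\<^sup>2) / (f * s)) / qp q (f * s)) *
 (1 - n0 * s*(n2 * s)*(n3 * s)/(ga * s\<^sup>2)) =
 x / q * u (Suc k) - u k"
 unfolding 2 unfolding 1 unfolding 3 u_def unfolding s_def ..
 qed (use nz s0 ps p in auto)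
 moreover have "x ^ k = s * (x/q)^k" using q by (simp add: s_def power_divide)
 moreover have "vt q ga [n0,n1,n2,n3,e,f] x k = vw q (ga * s^2) [n0 * s,n1 * s,n2 * s,n3 * s,e * s,f * s] * x ^ k"
 "vt q (q*ga) [q*n0,q*n1,q*n2,q*n3,e,f] (x/q) k = vw q (q*(ga * s^2)) [q*(n0 * s),q*(n1 * s),q*(n2 * s),q*(n3 * s),e * s,f * s] * (x/q)^k"
 "vt q (q*ga) [q*n0,n1,q*n2,q*n3,e,f] x k = vw q (q*(ga * s^2)) [q*(n0 * s),n1 * s,q*(n2 * s),q*(n3 * s),e * s,f * s] * x^k"
 by (simp_all add: vt_def s_def mult.assoc)
 ultimately show ?thesis by (rule scaled_combination(3))
 qed
 have "(%k. g * q ^ k) \<longlonglongrightarrow> g * 0" by (intro tendsto_intros LIMSEQ_power_zero q(2))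
 then have "u \<longlonglongrightarrow> 1 / 1 * (1 / 1) * (1 / 1) * (1 / 1) * (1 / 1) * (1 / 1) * (1 - g * 0)"
 unfolding u_def by (intro tendsto_intros qp_tendsto[OF q]) (use q in simp_all)
 from telescoping_sums[OF q this x(2)] have "(%k. (x/q) ^ k * (x/q * u (Suc k) - u k)) sums (- u 0)" .
 moreover have "u 0 = 0" using bd nz q by (auto simp: u_def qp_1[OF q])
 ultimately show ?thesis unfolding tele by simp
qed

end

lemma generic_qp:
 assumes q: "q ~= 0" "norm q < 1"
 shows "generic (%z. qp q (c * z) ~= 0)" "generic (%z. qp q (c / z) ~= 0)"
proof -
 have 1: "generic (%z. c * z * q ^ i ~= 1)" for i
 proof (rule generic_mono[OF generic_neq[of "1 / (c * q ^ i)"]], rule notI)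
 fix z assume "z ~= 1 / (c * q ^ i)" and h: "c * z * q ^ i = 1"
 moreover have "c * q ^ i ~= 0" using h q by auto
 ultimately show False using q by (simp add: eq_divide_eq mult_ac)
 qed
 have 2: "generic (%z. c / z * q ^ i ~= 1)" for i
 by (rule generic_mono[OF generic_neq[of "c * q ^ i"]]) (auto simp: field_simps)
 show "generic (%z. qp q (c * z) ~= 0)"
 by (rule generic_mono[OF generic_all[OF 1]]) (simp add: qp_eq_0_iff[OF q])
 show "generic (%z. qp q (c / z) ~= 0)"
 by (rule generic_mono[OF generic_all[OF 2]]) (simp add: qp_eq_0_iff[OF q])
qed

section \<open>First-order relations for R and S\<close>

locale aw_params =
 fixes q a b c d :: complex
 assumes q: "q ~= 0" "norm q < 1" and abcd: "a ~= 0" "b ~= 0" "c ~= 0" "d ~= 0"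
 and const: "qp q (c*d) ~= 0" "qp q (b*d) ~= 0" "qp q (b*c) ~= 0" "qp q (c*d/q) ~= 0"
begin

abbreviation "P \<equiv> a*b*c*d"

text \<open>\<open>tok\<close> and \<open>zgood\<close> keep the infinite products that occur away
  from zero. The first condition follows from non-resonance on the lattice, the second is generic in
  \<open>z\<close>.\<close>

definition tok :: "complex => bool" where
 "tok t \<longleftrightarrow> t ~= 0 & qp q (P*t/q) ~= 0 & qp q (1/t) ~= 0 & qp q (a*b*t) ~= 0 & qp q (a*c*t) ~= 0 & qp q (a*d*t) ~= 0 &
 qp q (b*c*t) ~= 0 & qp q (b*d*t) ~= 0 & qp q (c*d*t) ~= 0 & qp q (c*d*t/q) ~= 0 & qp q (q*t) ~= 0 &
 qp q t ~= 0 & qp q (b*c*t/q) ~= 0 & qp q (b*d*t/q) ~= 0 & qp q (c*d*t/q^2) ~= 0 &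
 (ALL k. P*t^2 ~= q powi k) & qp q (P*t^2) ~= 0"

definition WR where "WR t z = Wh q (b*c*d/(q*z)) [b/z, c/z, d/z, P*t/q, 1/t] (q*z/a)"
text \<open>\<open>TR\<close> and \<open>TS\<close> are auxiliary series with one parameter moved by
  \<open>q\<close>. They split the second-order equation in \<open>z\<close> into relations that
  involve only two neighbouring points.\<close>

definition TR where "TR t z = Wh q (b*c*d/(q*z)) [q*(b/z), c/z, d/z, P*t/q, 1/t] (z/a)"
definition WS where "WS t z = Wh q (b*c*d*t^2*z) [q*t, c*d*t, b*c*t, b*d*t, q/a*z] (a*z)"
definition TS where "TS t z = Wh q (b*c*d*t^2/q*z) [q*t, c*d*t/q, b*c*t, b*d*t, 1/a*z] (a*z)"

definition zgood :: "complex => complex => bool" where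
 "zgood t z \<longleftrightarrow> z ~= 0 & z ~= q/a & qp q (b/z) ~= 0 & qp q (c/z) ~= 0 & qp q (d/z) ~= 0 & qp q (b*c*d/q/z) ~= 0 &
 qp q (b*c*d*t/z) ~= 0 & qp q (q/(a*t)/z) ~= 0 & qp q (a*t*z) ~= 0 &
 qp q (a*z) ~= 0 & qp q (q/a*z) ~= 0 & qp q (1/a*z) ~= 0 & qp q (1/(a*q)*z) ~= 0 & qp q (q/b*z) ~= 0 & qp q (q/c*z) ~= 0 & qp q (q/d*z) ~= 0 &
 qp q (b*c*d*t^2*z) ~= 0 & qp q (b*c*d*t^2/q*z) ~= 0 &
 qp q (b*t*z) ~= 0 & qp q (c*t*z) ~= 0 & qp q (d*t*z) ~= 0 & qp q (b*c*d*t*z) ~= 0 & qp q (b*c*d*t/q*z) ~= 0"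

lemma generic_zgood: "generic (zgood t)"
 unfolding zgood_def by (intro generic_conj generic_neq generic_qp[OF q])

lemma vt_perm': "vt q ga [n0,n1,n2,n3,e,f] x = vt q ga [e,n0,n1,n2,n3,f] x"
 by (rule ext) (rule vt_perm)

lemma qp_q: "qp q q ~= 0"
proof
 assume "qp q q = 0"
 then obtain i where "norm (q * q ^ i) = 1" unfolding qp_eq_0_iff[OF q] by (metis norm_one)
 moreover have "norm (q * q ^ i) <= norm q * 1"
 unfolding norm_mult norm_power using q by (intro mult_left_mono power_le_one) auto
 ultimately show False using q by simp
qed

lemma qp_up: "qp q y ~= 0 ==> qp q (q * y) ~= 0"
 using qp_scale_nz[OF q, of y 1] by (simp add: mult.commute)

lemma WokI:
 assumes "ga ~= 0" "qp q ga ~= 0" "norm x < 1"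
 "!!a. a \<in> set as ==> a ~= 0 & qp q a ~= 0 & qp q (q * ga / a) ~= 0"
 shows "Wok q ga as x"
proof -
 have "poly (pW q ga as) (q ^ Suc k) ~= 0" for k
 proof -
 have "q ^ Suc k ~= 1" using qp_q unfolding qp_eq_0_iff[OF q] by simp
 moreover have "ga / q^2 * (q ^ Suc k)^2 ~= 1"
 proof -
 have "ga / q^2 * (q ^ Suc k)^2 = ga * q ^ (2 * k)"
 using q by (simp add: power_mult_distrib mult.commute flip: power_mult)
 then show ?thesis using assms(2) by (simp add: qp_eq_0_iff[OF q])
 qed
 moreover have "(\<Prod>a\<leftarrow>as. 1 - ga / a * q ^ Suc k) ~= 0"
 proof
 assume "(\<Prod>a\<leftarrow>as. 1 - ga / a * q ^ Suc k) = 0"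
 then obtain a where "a \<in> set as" "1 = ga / a * q ^ Suc k" unfolding prod_list_zero_iff by auto
 moreover from this(2) have "q * ga / a * q ^ k = 1" by (simp add: mult_ac)
 ultimately show False using assms(4)[of a] unfolding qp_eq_0_iff[OF q] by blast
 qed
 ultimately show ?thesis unfolding poly_pW by simp
 qed
 then show ?thesis using assms small_not_pole[OF q assms(3)]
 by (auto simp: Wok_def W87_regular_iff[OF q] qreg_def[OF q])
qed

text \<open>Each parameter of a very-well-poised series has a partner with product
  \<open>q * ga\<close>. With both in closed form, regularity reduces to the nonvanishing of
  infinite products.\<close>

lemma WokI5:
 assumes "ga ~= 0" "qp q ga ~= 0" "norm x < 1"
 "q * ga = a1 * b1" "q * ga = a2 * b2" "q * ga = a3 * b3" "q * ga = a4 * b4" "q * ga = a5 * b5"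
 "qp q a1 ~= 0" "qp q a2 ~= 0" "qp q a3 ~= 0" "qp q a4 ~= 0" "qp q a5 ~= 0"
 "qp q b1 ~= 0" "qp q b2 ~= 0" "qp q b3 ~= 0" "qp q b4 ~= 0" "qp q b5 ~= 0"
 shows "Wok q ga [a1, a2, a3, a4, a5] x"
proof (rule WokI)
 have *: "y ~= 0 & q * ga / y = w" if "q * ga = y * w" for y w using that assms(1) q by auto
 show "y ~= 0 & qp q y ~= 0 & qp q (q * ga / y) ~= 0" if "y \<in> set [a1, a2, a3, a4, a5]" for y
 using that *[OF assms(4)] *[OF assms(5)] *[OF assms(6)] *[OF assms(7)] *[OF assms(8)] assms(9-) by auto
qed (rule assms)+

lemma Wok_R:
 assumes t: "tok t" and z: "zgood t z" and x: "norm (q*z/a) < 1"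
 shows "Wok q (b*c*d/(q*z)) [b/z, c/z, d/z, P*t/q, 1/t] (q*z/a)"
proof (rule WokI5)
 show "q * (b*c*d/(q*z)) = b/z * (c*d)" using z t q abcd by (simp add: zgood_def tok_def field_simps sqr_eq)
 show "q * (b*c*d/(q*z)) = c/z * (b*d)" using z t q abcd by (simp add: zgood_def tok_def field_simps sqr_eq)
 show "q * (b*c*d/(q*z)) = d/z * (b*c)" using z t q abcd by (simp add: zgood_def tok_def field_simps sqr_eq)
 show "q * (b*c*d/(q*z)) = (P*t/q) * (q/(a*t)/z)" using z t q abcd by (simp add: zgood_def tok_def field_simps sqr_eq)
 show "q * (b*c*d/(q*z)) = 1/t * (b*c*d*t/z)" using z t q abcd by (simp add: zgood_def tok_def field_simps sqr_eq)
qed (use z t const q abcd x qp_up[of "b/z"] qp_up[of "b*t*z"] qp_up[of "c*t*z"] qp_up[of "d*t*z"] in \<open>simp_all add: zgood_def tok_def\<close>)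

lemma Wok_TR:
 assumes t: "tok t" and z: "zgood t z" and x: "norm (z/a) < 1"
 shows "Wok q (b*c*d/(q*z)) [q*(b/z), c/z, d/z, P*t/q, 1/t] (z/a)"
proof (rule WokI5)
 show "q * (b*c*d/(q*z)) = q*(b/z) * (c*d/q)" using z t q abcd by (simp add: zgood_def tok_def field_simps sqr_eq)
 show "q * (b*c*d/(q*z)) = c/z * (b*d)" using z t q abcd by (simp add: zgood_def tok_def field_simps sqr_eq)
 show "q * (b*c*d/(q*z)) = d/z * (b*c)" using z t q abcd by (simp add: zgood_def tok_def field_simps sqr_eq)
 show "q * (b*c*d/(q*z)) = (P*t/q) * (q/(a*t)/z)" using z t q abcd by (simp add: zgood_def tok_def field_simps sqr_eq)
 show "q * (b*c*d/(q*z)) = 1/t * (b*c*d*t/z)" using z t q abcd by (simp add: zgood_def tok_def field_simps sqr_eq)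
qed (use z t const q abcd x qp_up[of "b/z"] qp_up[of "b*t*z"] qp_up[of "c*t*z"] qp_up[of "d*t*z"] in \<open>simp_all add: zgood_def tok_def\<close>)

lemma Wok_S:
 assumes t: "tok t" and z: "zgood t z" and x: "norm (a*z) < 1"
 shows "Wok q (b*c*d*t^2*z) [q*t, c*d*t, b*c*t, b*d*t, q/a*z] (a*z)"
proof (rule WokI5)
 show "q * (b*c*d*t^2*z) = q*t * (b*c*d*t*z)" using z t q abcd by (simp add: zgood_def tok_def field_simps sqr_eq)
 show "q * (b*c*d*t^2*z) = c*d*t * (q*(b*t*z))" using z t q abcd by (simp add: zgood_def tok_def field_simps sqr_eq)
 show "q * (b*c*d*t^2*z) = b*c*t * (q*(d*t*z))" using z t q abcd by (simp add: zgood_def tok_def field_simps sqr_eq)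
 show "q * (b*c*d*t^2*z) = b*d*t * (q*(c*t*z))" using z t q abcd by (simp add: zgood_def tok_def field_simps sqr_eq)
 show "q * (b*c*d*t^2*z) = q/a*z * (P*t^2)" using z t q abcd by (simp add: zgood_def tok_def field_simps sqr_eq)
qed (use z t const q abcd x qp_up[of "b/z"] qp_up[of "b*t*z"] qp_up[of "c*t*z"] qp_up[of "d*t*z"] in \<open>simp_all add: zgood_def tok_def\<close>)

lemma Wok_TS:
 assumes t: "tok t" and z: "zgood t z" and x: "norm (a*z) < 1"
 shows "Wok q (b*c*d*t^2/q*z) [q*t, c*d*t/q, b*c*t, b*d*t, 1/a*z] (a*z)"
proof (rule WokI5)
 show "q * (b*c*d*t^2/q*z) = q*t * (b*c*d*t/q*z)" using z t q abcd by (simp add: zgood_def tok_def field_simps sqr_eq)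
 show "q * (b*c*d*t^2/q*z) = c*d*t/q * (q*(b*t*z))" using z t q abcd by (simp add: zgood_def tok_def field_simps sqr_eq)
 show "q * (b*c*d*t^2/q*z) = b*c*t * (d*t*z)" using z t q abcd by (simp add: zgood_def tok_def field_simps sqr_eq)
 show "q * (b*c*d*t^2/q*z) = b*d*t * (c*t*z)" using z t q abcd by (simp add: zgood_def tok_def field_simps sqr_eq)
 show "q * (b*c*d*t^2/q*z) = 1/a*z * (P*t^2)" using z t q abcd by (simp add: zgood_def tok_def field_simps sqr_eq)
qed (use z t const q abcd x qp_up[of "b/z"] qp_up[of "b*t*z"] qp_up[of "c*t*z"] qp_up[of "d*t*z"] in \<open>simp_all add: zgood_def tok_def\<close>)

text \<open>Multiplying the base and the parameters \<open>b / z\<close>, \<open>c / z\<close>,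
  \<open>d / z\<close> by \<open>q\<close> replaces \<open>z\<close> by \<open>z / q\<close>, so the
  middle series of \<open>raise_sums\<close> is again \<open>WR\<close>.\<close>

lemma R_raise:
 assumes t: "tok t" and z: "zgood t z" "zgood t (z/q)" and x: "norm (z/a) < 1"
 shows "(1-b/z)*(1-c*z/q)*(1-d*z/q) * WR t z + (z/a)*(1-a*z/q) * WR t (z/q) - (1-z^2/q) * TR t z = 0"
proof -
 have z0: "z ~= 0" "t ~= 0" using z t by (auto simp: zgood_def tok_def)
 define ga where "ga = b*c*d/(q*z)"
 have nx: "norm (q*z/a) < 1"
 proof -
 have "norm q * norm (z/a) <= 1 * norm (z/a)" using q by (intro mult_right_mono) auto
 then show ?thesis using x by (simp add: norm_mult norm_divide)
 qed
 have s: "(%k. (1-b/z)*(1-c*z/q)*(1-d*z/q) * vt q ga [ga,b/z,c/z,d/z,P*t/q,1/t] (q*z/a) k +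
 (z/a)*(1-a*z/q) * vt q (q*ga) [q*ga,q*(b/z),q*(c/z),q*(d/z),P*t/q,1/t] (q*z/a/q) k +
 (- (1-z^2/q)) * vt q ga [ga,q*(b/z),c/z,d/z,P*t/q,1/t] (q*z/a/q) k) sums 0"
 proof (rule raise_sums[OF q])
 have M: "ga*(b/z)*(c/z)*(d/z) = ga^2*q/z^2" using q abcd z0 by (simp add: ga_def field_simps sqr_eq)
 have Q: "ga^2 / (ga^2*q/z^2) = z^2/q" "ga^2*X/(ga^2*q/z^2) = z^2/q*X" for X using q abcd z0 by (simp_all add: ga_def)
 show "q*z/a = q^2*ga^3/(ga*(b/z)*(c/z)*(d/z)*(P*t/q)*(1/t))"
 unfolding M unfolding ga_def using q abcd z0 by (simp add: sqr_eq power3_eq_cube)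
 show "- (1-z^2/q) = ga^2/(ga*(b/z)*(c/z)*(d/z)) - 1" "(z/a)*(1-a*z/q) = q*z/a/q - ga^2/(ga*(b/z)*(c/z)*(d/z))"
 unfolding M Q using q abcd by (simp_all add: field_simps sqr_eq)
 show "(1-b/z)*(1-c*z/q)*(1-d*z/q) = (ga^2 / (ga*(b/z)*(c/z)*(d/z)) - 1) * (b/z + ga / (b/z)) -
 ga^2 * (ga+b/z+c/z+d/z) / (ga*(b/z)*(c/z)*(d/z)) + ga * (1/ga+1/(b/z)+1/(c/z)+1/(d/z))"
 unfolding M Q unfolding ga_def using q abcd z0 by (simp add: field_simps sqr_eq)
 qed (use z t x q abcd z0 in \<open>auto simp: zgood_def tok_def ga_def\<close>)
 have e: "q*ga = b*c*d/(q*(z/q))" "q*(b/z) = b/(z/q)" "q*(c/z) = c/(z/q)" "q*(d/z) = d/(z/q)" "q*z/a/q = q*(z/q)/a"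
 using q by (simp_all add: ga_def)
 have 1: "vt q ga [ga,b/z,c/z,d/z,P*t/q,1/t] (q*z/a) sums WR t z"
 unfolding WR_def ga_def by (rule vt_sums[OF q Wok_R[OF t z(1) nx] nx])
 have nx': "norm (q*(z/q)/a) < 1" using x q by simp
 have 2: "vt q (q*ga) [q*ga,q*(b/z),q*(c/z),q*(d/z),P*t/q,1/t] (q*z/a/q) sums WR t (z/q)"
 unfolding WR_def e by (rule vt_sums[OF q Wok_R[OF t z(2) nx'] nx'])
 have 3: "vt q ga [ga,q*(b/z),c/z,d/z,P*t/q,1/t] (q*z/a/q) sums TR t z"
 proof -
 have h: "q*z/a/q = z/a" using q by simp
 show ?thesis unfolding TR_def ga_def h by (rule vt_sums[OF q Wok_TR[OF t z(1) x] x])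
 qed
 show ?thesis
 using sums_unique2[OF s sums_add[OF sums_add[OF sums_mult[OF 1] sums_mult[OF 2]] sums_mult[OF 3]], symmetric]
 by (simp only: diff_conv_add_uminus mult_minus_left)
qed

lemma R_lower:
 assumes t: "tok t" and z: "zgood t z" "zgood t (q*z)" and x: "norm (z/a) < 1"
 shows "(1-b*z)*(1-c/(q*z))*(1-d/(q*z)) * TR t (q*z) - (1-z/a) * TR t z +
 (1-z^2)*(1-a*b*t)*(1-c*d*t/q)/(a*z*t) * WR t z = 0"
proof -
 have z0: "z ~= 0" "t ~= 0" using z t by (auto simp: zgood_def tok_def)
 define ga where "ga = b*c*d/(q*(q*z))"
 have nx: "norm (q*z/a) < 1"
 proof -
 have "norm q * norm (z/a) <= 1 * norm (z/a)" using q by (intro mult_right_mono) auto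
 then show ?thesis using x by (simp add: norm_mult norm_divide)
 qed
 define g where "g = c*d/(q^2*z^2)"
 have ka: "z^2 = ga/(g*(b/z))" using q abcd z0 by (simp add: ga_def g_def sqr_eq)
 have s: "(%k. (1-b*z)*(1-c/(q*z))*(1-d/(q*z)) * vt q ga [ga,b/z,c/(q*z),d/(q*z),P*t/q,1/t] (q*z/a) k +
 (- (1-z/a)) * vt q (q*ga) [q*ga,q*(b/z),q*(c/(q*z)),q*(d/(q*z)),P*t/q,1/t] (q*z/a/q) k +
 ((1-z^2)*(1-a*b*t)*(1-c*d*t/q)/(a*z*t)) * vt q (q*ga) [q*ga,b/z,q*(c/(q*z)),q*(d/(q*z)),P*t/q,1/t] (q*z/a) k) sums 0"
 proof (rule lower_sums[OF q, where g = g and ka = "z^2"])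
 show "g = ga*(c/(q*z))*(d/(q*z))/ga" using q abcd z0 by (simp add: ga_def g_def sqr_eq)
 show "z^2 = ga/(g*(b/z))" by (rule ka)
 show "q*z/a = q^2*ga^2/(g*(b/z)*(P*t/q)*(1/t))"
 unfolding ga_def g_def using q abcd z0 by (simp add: field_simps sqr_eq power3_eq_cube)
 show "- (1-z/a) = q*z/a/q - 1" using q by simp
 show "(1-b*z)*(1-c/(q*z))*(1-d/(q*z)) = g - (ga+c/(q*z)+d/(q*z)) + ga*(1/ga+1/(c/(q*z))+1/(d/(q*z))) - ga/g"
 unfolding ga_def g_def using q abcd z0 by (simp add: field_simps sqr_eq)
 show "(1-z^2)*(1-a*b*t)*(1-c*d*t/q)/(a*z*t) = - ((z^2 - 1)*q*ga*(1/(P*t/q)+1/(1/t))) + (q*z/a/q - 1)*(b/z + q*ga/(b/z)) -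
 (q*z/a/q - z^2)*(b/z + q*g)"
 unfolding ga_def g_def using q abcd z0 by (simp add: field_simps sqr_eq)
 qed (use z t x nx q abcd z0 in \<open>auto simp: zgood_def tok_def ga_def\<close>)
 have e: "q*(c/(q*z)) = c/z" "q*(d/(q*z)) = d/z" "q*z/a/q = z/a" "q*ga = b*c*d/(q*z)" using q by (simp_all add: ga_def)
 have 1: "vt q ga [ga,b/z,c/(q*z),d/(q*z),P*t/q,1/t] (q*z/a) sums TR t (q*z)"
 proof -
 have h: "b/z = q*(b/(q*z))" using q by simp
 show ?thesis unfolding TR_def ga_def h by (rule vt_sums[OF q Wok_TR[OF t z(2) nx] nx])
 qed
 have 2: "vt q (q*ga) [q*ga,q*(b/z),q*(c/(q*z)),q*(d/(q*z)),P*t/q,1/t] (q*z/a/q) sums TR t z"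
 unfolding TR_def e by (rule vt_sums[OF q Wok_TR[OF t z(1) x] x])
 have 3: "vt q (q*ga) [q*ga,b/z,q*(c/(q*z)),q*(d/(q*z)),P*t/q,1/t] (q*z/a) sums WR t z"
 unfolding WR_def e by (rule vt_sums[OF q Wok_R[OF t z(1) nx] nx])
 show ?thesis
 using sums_unique2[OF s sums_add[OF sums_add[OF sums_mult[OF 1] sums_mult[OF 2]] sums_mult[OF 3]], symmetric]
 by (simp only: diff_conv_add_uminus mult_minus_left)
qed

text \<open>The choice \<open>e = q * ga\<close> makes the first series lose its initial term, so
  that it equals \<open>a * z * WS t z\<close> by \<open>shifted_sums\<close>.\<close>

lemma S_lower:
 assumes t: "tok t" and z: "zgood t z" "zgood t (z/q)" and x: "norm (a*z/q) < 1" "norm (a*z) < 1"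
 shows "- (t*(1-b/z)*(1-c*z/q)*(1-d*z/q)) * (a*z * WS t z) - (1-a*z/q) * WS t (z/q) +
 (1-z^2/q)*(1-a*b*t)*(1-c*d*t/q) * TS t z = 0"
proof -
 have z0: "z ~= 0" "t ~= 0" using z t by (auto simp: zgood_def tok_def)
 define ga where "ga = b*c*d*z*t^2/q^2"
 define g where "g = b*t/z"
 have s: "(%k. (- (t*(1-b/z)*(1-c*z/q)*(1-d*z/q))) * vt q ga [t,c*d*t/q,b*c*t/q,b*d*t/q,q*ga,z/a] (a*z) k +
 (- (1-a*z/q)) * vt q (q*ga) [q*t,q*(c*d*t/q),q*(b*c*t/q),q*(b*d*t/q),q*ga,z/a] (a*z/q) k +
 ((1-z^2/q)*(1-a*b*t)*(1-c*d*t/q)) * vt q (q*ga) [q*t,c*d*t/q,q*(b*c*t/q),q*(b*d*t/q),q*ga,z/a] (a*z) k) sums 0"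
 proof (rule lower_sums[OF q, where g = g and ka = "z^2/q"])
 show "g = t*(b*c*t/q)*(b*d*t/q)/ga" using q abcd z0 by (simp add: ga_def g_def sqr_eq)
 show "z^2/q = ga/(g*(c*d*t/q))" using q abcd z0 by (simp add: ga_def g_def sqr_eq)
 show "a*z = q^2*ga^2/(g*(c*d*t/q)*(q*ga)*(z/a))"
 unfolding ga_def g_def using q abcd z0 by (simp add: field_simps sqr_eq power3_eq_cube)
 show "- (1-a*z/q) = a*z/q - 1" by simp
 show "- (t*(1-b/z)*(1-c*z/q)*(1-d*z/q)) = g - (t+b*c*t/q+b*d*t/q) + ga*(1/t+1/(b*c*t/q)+1/(b*d*t/q)) - ga/g"
 unfolding ga_def g_def using q abcd z0 by (simp add: field_simps sqr_eq)
 show "(1-z^2/q)*(1-a*b*t)*(1-c*d*t/q) = - ((z^2/q - 1)*q*ga*(1/(q*ga)+1/(z/a))) + (a*z/q - 1)*(c*d*t/q + q*ga/(c*d*t/q)) -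
 (a*z/q - z^2/q)*(c*d*t/q + q*g)"
 unfolding ga_def g_def using q abcd z0 by (simp add: field_simps sqr_eq)
 qed (use z t x q abcd z0 in \<open>auto simp: zgood_def tok_def ga_def sqr_eq mult_ac\<close>)
 have e: "q*(c*d*t/q) = c*d*t" "q*(b*c*t/q) = b*c*t" "q*(b*d*t/q) = b*d*t" "q*(z/a) = q/a*z" "q^2*ga = b*c*d*t^2*z"
 using q by (simp_all add: ga_def sqr_eq)
 have ga0: "ga ~= 0" using q abcd z0 by (simp add: ga_def)
 have 1: "vt q ga [t,c*d*t/q,b*c*t/q,b*d*t/q,q*ga,z/a] (a*z) sums (a*z * WS t z)"
 proof -
 have "Wok q (q^2*ga) [q*t,q*(c*d*t/q),q*(b*c*t/q),q*(b*d*t/q),q*(z/a)] (a*z)"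
 unfolding e by (rule Wok_S[OF t z(1) x(2)])
 from shifted_sums[OF q this x(2) refl ga0] show ?thesis unfolding WS_def e .
 qed
 have 2: "vt q (q*ga) [q*t,q*(c*d*t/q),q*(b*c*t/q),q*(b*d*t/q),q*ga,z/a] (a*z/q) sums WS t (z/q)"
 proof -
 have h: "q*ga = b*c*d*t^2*(z/q)" "z/a = q/a*(z/q)" "a*z/q = a*(z/q)" using q by (simp_all add: ga_def sqr_eq)
 have x': "norm (a*(z/q)) < 1" using x(1) by simp
 show ?thesis unfolding e(1-3) h WS_def by (subst vt_perm') (rule vt_sums[OF q Wok_S[OF t z(2) x'] x'])
 qed
 have 3: "vt q (q*ga) [q*t,c*d*t/q,q*(b*c*t/q),q*(b*d*t/q),q*ga,z/a] (a*z) sums TS t z"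
 proof -
 have h: "q*ga = b*c*d*t^2/q*z" "z/a = 1/a*z" using q by (simp_all add: ga_def sqr_eq)
 show ?thesis unfolding e(2,3) h TS_def by (subst vt_perm') (rule vt_sums[OF q Wok_TS[OF t z(1) x(2)] x(2)])
 qed
 show ?thesis
 using sums_unique2[OF s sums_add[OF sums_add[OF sums_mult[OF 1] sums_mult[OF 2]] sums_mult[OF 3]], symmetric]
 by (simp only: diff_conv_add_uminus mult_minus_left)
qed

lemma S_raise:
 assumes t: "tok t" and z: "zgood t z" "zgood t (q*z)" and x: "norm (a*z) < 1"
 shows "- (z^2*t*(1-b*z)*(1-c/(q*z))*(1-d/(q*z))) * (a*q*z * TS t (q*z)) + z*(a-z) * TS t z +
 (- (1-z^2)) * (a*q*z/q * WS t z) = 0"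
proof -
 have z0: "z ~= 0" "t ~= 0" using z t by (auto simp: zgood_def tok_def)
 define ga where "ga = b*c*d*z*t^2/q^2"
 have nx: "norm (a*q*z) < 1"
 proof -
 have "norm q * norm (a*z) <= 1 * norm (a*z)" using q by (intro mult_right_mono) auto
 then show ?thesis using x by (simp add: norm_mult mult_ac)
 qed
 have nx': "norm (a*q*z/q) < 1" using x q by simp
 have s: "(%k. (- (z^2*t*(1-b*z)*(1-c/(q*z))*(1-d/(q*z)))) * vt q ga [t,c*d*t/q^2,b*c*t/q,b*d*t/q,q*ga,z/a] (a*q*z) k +
 z*(a-z) * vt q (q*ga) [q*t,q*(c*d*t/q^2),q*(b*c*t/q),q*(b*d*t/q),q*ga,z/a] (a*q*z/q) k +
 (- (1-z^2)) * vt q ga [t,q*(c*d*t/q^2),b*c*t/q,b*d*t/q,q*ga,z/a] (a*q*z/q) k) sums 0"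
 proof (rule raise_sums[OF q])
 have M: "t*(c*d*t/q^2)*(b*c*t/q)*(b*d*t/q) = ga^2/z^2" using q abcd z0 by (simp add: ga_def field_simps sqr_eq)
 have Q: "ga^2 / (ga^2/z^2) = z^2" "ga^2*X/(ga^2/z^2) = z^2*X" for X using q abcd z0 by (simp_all add: ga_def)
 show "a*q*z = q^2*ga^3/(t*(c*d*t/q^2)*(b*c*t/q)*(b*d*t/q)*(q*ga)*(z/a))"
 unfolding M unfolding ga_def using q abcd z0 by (simp add: field_simps sqr_eq power3_eq_cube)
 show "- (1-z^2) = ga^2/(t*(c*d*t/q^2)*(b*c*t/q)*(b*d*t/q)) - 1" "z*(a-z) = a*q*z/q - ga^2/(t*(c*d*t/q^2)*(b*c*t/q)*(b*d*t/q))"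
 unfolding M Q using q abcd by (simp_all add: field_simps sqr_eq)
 show "- (z^2*t*(1-b*z)*(1-c/(q*z))*(1-d/(q*z))) = (ga^2 / (t*(c*d*t/q^2)*(b*c*t/q)*(b*d*t/q)) - 1) * (c*d*t/q^2 + ga / (c*d*t/q^2)) -
 ga^2 * (t+c*d*t/q^2+b*c*t/q+b*d*t/q) / (t*(c*d*t/q^2)*(b*c*t/q)*(b*d*t/q)) + ga * (1/t+1/(c*d*t/q^2)+1/(b*c*t/q)+1/(b*d*t/q))"
 unfolding M Q unfolding ga_def using q abcd z0 by (simp add: field_simps sqr_eq)
 have "q*ga = b*c*d*t^2/q*z" using q by (simp add: ga_def sqr_eq)
 then show "qp q (q*ga) ~= 0" using z by (simp add: zgood_def)
 qed (use z t nx' q abcd z0 in \<open>simp_all add: zgood_def tok_def ga_def\<close>)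
 have e: "q*(c*d*t/q^2) = c*d*t/q" "q*(b*c*t/q) = b*c*t" "q*(b*d*t/q) = b*d*t" "q*(c*d*t/q) = c*d*t"
 using q by (simp_all add: sqr_eq)
 have ga0: "ga ~= 0" using q abcd z0 by (simp add: ga_def)
 have 1: "vt q ga [t,c*d*t/q^2,b*c*t/q,b*d*t/q,q*ga,z/a] (a*q*z) sums (a*q*z * TS t (q*z))"
 proof -
 have h: "q^2*ga = b*c*d*t^2/q*(q*z)" "q*(z/a) = 1/a*(q*z)" "a*q*z = a*(q*z)" using q by (simp_all add: ga_def)
 have x': "norm (a*(q*z)) < 1" using nx by (simp add: mult.assoc)
 have "Wok q (q^2*ga) [q*t,q*(c*d*t/q^2),q*(b*c*t/q),q*(b*d*t/q),q*(z/a)] (a*q*z)"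
 unfolding e h by (rule Wok_TS[OF t z(2) x'])
 from shifted_sums[OF q this nx refl ga0] show ?thesis unfolding TS_def e h .
 qed
 have 2: "vt q (q*ga) [q*t,q*(c*d*t/q^2),q*(b*c*t/q),q*(b*d*t/q),q*ga,z/a] (a*q*z/q) sums TS t z"
 proof -
 have h: "q*ga = b*c*d*t^2/q*z" "z/a = 1/a*z" "a*q*z/q = a*z" using q by (simp_all add: ga_def sqr_eq)
 show ?thesis unfolding e(1-3) h TS_def by (subst vt_perm') (rule vt_sums[OF q Wok_TS[OF t z(1) x] x])
 qed
 have 3: "vt q ga [t,q*(c*d*t/q^2),b*c*t/q,b*d*t/q,q*ga,z/a] (a*q*z/q) sums (a*q*z/q * WS t z)"
 proof -
 have h: "q^2*ga = b*c*d*t^2*z" "q*(z/a) = q/a*z" "a*q*z/q = a*z" using q by (simp_all add: ga_def)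
 have "Wok q (q^2*ga) [q*t,q*(c*d*t/q),q*(b*c*t/q),q*(b*d*t/q),q*(z/a)] (a*z)"
 unfolding e h by (rule Wok_S[OF t z(1) x])
 from shifted_sums[OF q this x refl ga0] show ?thesis unfolding WS_def e h .
 qed
 show ?thesis
 by (rule sums_unique2[OF s sums_add[OF sums_add[OF sums_mult[OF 1] sums_mult[OF 2]] sums_mult[OF 3]], symmetric])
qed

definition Gm :: "complex => complex" where
 "Gm t = (a/q)*((1-q/(P*t))*(1-1/(a*b*t))*(1-1/(a*c*t))*(1-1/(a*d*t)))/((1-1/(P*t^2))*(1-1/(q*P*t^2)))"

definition Hm :: "complex => complex" where
 "Hm t = (a/q)*((1-q^2*t)*(1-q*c*d*t)*(1-q*b*d*t)*(1-q*b*c*t))/((1-q^2*P*t^2)*(1-q*P*t^2))"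

lemma tok_P: assumes "tok t" shows "P*t^2 ~= 1" "q*P*t^2 ~= 1" "q^2*P*t^2 ~= 1"
proof -
 have h: "ALL k. P*t^2 ~= q powi k" using assms by (simp add: tok_def)
 show "P*t^2 ~= 1" using h[THEN spec, of 0] by simp
 show "q*P*t^2 ~= 1" using h[THEN spec, of "-1"] q by (auto simp: power_int_minus field_simps)
 show "q^2*P*t^2 ~= 1" using h[THEN spec, of "-2"] q by (auto simp: power_int_minus field_simps)
qed

text \<open>\<open>Gm\<close> and \<open>Hm\<close> are the outer coefficients that
  \<open>gamma_sums\<close> dictates for the normalised series of \<open>R\<close>. The identity
  says that the middle coefficient is the diagonal one of the Askey-Wilson operator.\<close>

lemma Gm_Hm:
 assumes t: "tok t"
 shows "Gm t + Hm t - AWA q a b c d (q*t) - AWC q a b c d (q*t) = q/a + a/q - a - 1/a"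
proof -
 have t0: "t ~= 0" using t by (simp add: tok_def)
 define u where "u = P*t^2"
 have nz: "1 - u ~= 0" "1 - q*u ~= 0" "1 - q^2*u ~= 0" "u ~= 0" using tok_P[OF t] abcd t0 by (simp_all add: u_def mult.assoc)
 have 1: "Gm t = (P*t-q)*(a*b*t-1)*(a*c*t-1)*(a*d*t-1)/(a*((1-u)*(1-q*u)))"
 proof -
 have r: "1-q/(P*t) = (P*t-q)/(P*t)" "1-1/(a*b*t) = (a*b*t-1)/(a*b*t)" "1-1/(a*c*t) = (a*c*t-1)/(a*c*t)" "1-1/(a*d*t) = (a*d*t-1)/(a*d*t)"
 "1-1/(P*t^2) = (u-1)/u" "1-1/(q*P*t^2) = (q*u-1)/(q*u)" using abcd t0 q by (simp_all add: u_def diff_divide_distrib mult.assoc)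
 have pr: "(u-1)*(q*u-1) = (1-u)*(1-q*u)" by algebra
 have den: "P*t*(a*b*t)*(a*c*t)*(a*d*t) = a^2*u^2" unfolding u_def by algebra
 have "Gm t = (a/q)*(((P*t-q)*(a*b*t-1)*(a*c*t-1)*(a*d*t-1))/(P*t*(a*b*t)*(a*c*t)*(a*d*t)))/(((u-1)*(q*u-1))/(q*u^2))"
 unfolding Gm_def r by (simp add: sqr_eq mult_ac)
 then show ?thesis unfolding den pr using nz q abcd(1) by (simp add: sqr_eq)
 qed
 have 2: "Hm t = a*(1-q^2*t)*(1-q*c*d*t)*(1-q*b*d*t)*(1-q*b*c*t)/(q*((1-q^2*u)*(1-q*u)))"
 by (simp add: Hm_def u_def mult.assoc)
 have 3: "AWA q a b c d (q*t) = (1-a*b*(q*t))*(1-a*c*(q*t))*(1-a*d*(q*t))*(1-P*t)/(a*((1-q*u)*(1-q^2*u)))"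
 proof -
 have "q - P*(q*t) = q*(1-P*t)" "q - P*(q*t)^2 = q*(1-q*u)" "1 - P*(q*t)^2 = 1-q^2*u" by (simp_all add: u_def algebra_simps sqr_eq)
 then show ?thesis using q by (simp add: AWA_def mult_ac)
 qed
 have 4: "AWC q a b c d (q*t) = a*(1-q*t)*(1-b*c*t)*(1-b*d*t)*(1-c*d*t)/((1-u)*(1-q*u))"
 proof -
 have "q - b*c*(q*t) = q*(1-b*c*t)" "q - b*d*(q*t) = q*(1-b*d*t)" "q - c*d*(q*t) = q*(1-c*d*t)"
 "q^2 - P*(q*t)^2 = q^2*(1-u)" "q - P*(q*t)^2 = q*(1-q*u)" by (simp_all add: u_def algebra_simps sqr_eq)
 then show ?thesis using q by (simp add: AWC_def sqr_eq)
 qed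
 have "q*a*((1-u)*(1-q*u)*(1-q^2*u)) * (Gm t + Hm t - AWA q a b c d (q*t) - AWC q a b c d (q*t)) =
 q*((P*t-q)*(a*b*t-1)*(a*c*t-1)*(a*d*t-1))*(1-q^2*u) + a^2*(1-q^2*t)*(1-q*c*d*t)*(1-q*b*d*t)*(1-q*b*c*t)*(1-u) -
 q*((1-a*b*(q*t))*(1-a*c*(q*t))*(1-a*d*(q*t))*(1-P*t))*(1-u) - q*a^2*((1-q*t)*(1-b*c*t)*(1-b*d*t)*(1-c*d*t))*(1-q^2*u)"
 unfolding 1 2 3 4 using nz(1-3) q abcd(1) by (simp add: divide_simps) algebra
 also have "... = (q^2 + a^2 - q*a^2 - q)*((1-u)*(1-q*u)*(1-q^2*u))" unfolding u_def by algebra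
 also have "... = q*a*((1-u)*(1-q*u)*(1-q^2*u)) * (q/a + a/q - a - 1/a)"
 using q abcd(1) by (simp add: field_simps sqr_eq)
 finally show ?thesis using nz q abcd(1) by simp
qed

end

section \<open>Second-order equations in z and in t\<close>

lemma eliminate_intermediate:
 fixes W1 :: "'a::comm_ring_1"
 assumes "p0 * W0 + p1 * Wm + p2 * T0 = 0" "p0' * W1 + p1' * W0 + p2' * T1 = 0" "r0 * T1 + r1 * T0 + r2 * W0 = 0"
 shows "- (r0 * p2 * p0') * W1 + (- (r0 * p2 * p1') - r1 * p2' * p0 + p2 * p2' * r2) * W0 - r1 * p2' * p1 * Wm = 0"
proof -
 have "- (r0 * p2 * p0') * W1 + (- (r0 * p2 * p1') - r1 * p2' * p0 + p2 * p2' * r2) * W0 - r1 * p2' * p1 * Wm =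
 p2 * p2' * (r0 * T1 + r1 * T0 + r2 * W0) - r1 * p2' * (p0 * W0 + p1 * Wm + p2 * T0) - r0 * p2 * (p0' * W1 + p1' * W0 + p2' * T1)"
 by (simp add: algebra_simps)
 then show ?thesis using assms by simp
qed

lemma scale_three:
 fixes M :: "'a::comm_ring_1"
 assumes "M * c1 = - D1" "M * c2 = - D2" "M * (- c3) = - D3"
 shows "M * (c1 * W1 + c2 * W0 - c3 * Wm) = - D1 * W1 - D2 * W0 - D3 * Wm"
proof -
 have "M * (c1 * W1 + c2 * W0 - c3 * Wm) = (M * c1) * W1 + (M * c2) * W0 + (M * (- c3)) * Wm" by (simp add: algebra_simps)
 then show ?thesis unfolding assms by simp
qed

context aw_params
begin

text \<open>The unshifted coefficient of the \<open>q\<close>-difference equation, cleared of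
  denominators. It contains \<open>t\<close> only through
  \<open>(1/t - 1) * (1 - P * t / q)\<close>, which is affine in \<open>t + q / P / t\<close>: this
  is bispectrality before any Darboux step.\<close>

definition A0 :: "complex => complex => complex" where
 "A0 t z = (q-z^2)*((1-a*z)*(1-b*z)*(1-c*z)*(1-d*z)) + (1-q*z^2)*((z-a)*(z-b)*(z-c)*(z-d)) +
 (1-z^2)*(q-z^2)*(1-q*z^2)*((1/t-1)*(1-P*t/q))"

lemma A0_eq:
 assumes "t ~= 0" "z ~= 0"
 shows "A0 t z = q*z^2*((1-b*z)*(1-c/(q*z))*(1-d/(q*z)))*(1-a*z)*(q-z^2) -
 z*q*(a-z)*(1-q*z^2)*((1-b/z)*(1-c*z/q)*(1-d*z/q)) + (q-z^2)*(1-q*z^2)*(1-z^2)*((1-a*b*t)*(1-c*d*t/q))/t"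
proof -
 have id: "t*(q*(q-z^2)*((1-a*z)*(1-b*z)*(1-c*z)*(1-d*z)) + q*(1-q*z^2)*((z-a)*(z-b)*(z-c)*(z-d))) +
 (1-z^2)*(q-z^2)*(1-q*z^2)*((1-t)*(q-P*t)) =
 t*((1-a*z)*(1-b*z)*(q*z-c)*(q*z-d)*(q-z^2) - (a-z)*(z-b)*(q-c*z)*(q-d*z)*(1-q*z^2)) +
 (1-z^2)*(q-z^2)*(1-q*z^2)*((1-a*b*t)*(q-c*d*t))" by algebra
 have r: "1/t-1 = (1-t)/t" "1-P*t/q = (q-P*t)/q" "1-c/(q*z) = (q*z-c)/(q*z)" "1-d/(q*z) = (q*z-d)/(q*z)"
 "1-b/z = (z-b)/z" "1-c*z/q = (q-c*z)/q" "1-d*z/q = (q-d*z)/q" "1-c*d*t/q = (q-c*d*t)/q"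
 using assms q by (simp_all add: diff_divide_distrib)
 have 1: "q*t * A0 t z = t*(q*(q-z^2)*((1-a*z)*(1-b*z)*(1-c*z)*(1-d*z)) + q*(1-q*z^2)*((z-a)*(z-b)*(z-c)*(z-d))) +
 (1-z^2)*(q-z^2)*(1-q*z^2)*((1-t)*(q-P*t))"
 unfolding A0_def r distrib_left using assms q by simp
 have s: "q*t*(q*z^2*((1-b*z)*((q*z-c)/(q*z))*((q*z-d)/(q*z)))*(1-a*z)*(q-z^2)) = t*((1-a*z)*(1-b*z)*(q*z-c)*(q*z-d)*(q-z^2))"
 "q*t*(z*q*(a-z)*(1-q*z^2)*((z-b)/z*((q-c*z)/q)*((q-d*z)/q))) = t*((a-z)*(z-b)*(q-c*z)*(q-d*z)*(1-q*z^2))"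
 "q*t*((q-z^2)*(1-q*z^2)*(1-z^2)*((1-a*b*t)*((q-c*d*t)/q))/t) = (1-z^2)*(q-z^2)*(1-q*z^2)*((1-a*b*t)*(q-c*d*t))"
 using assms q by (simp_all add: sqr_eq mult_ac)
 have "q*t * A0 t z = q*t*(q*z^2*((1-b*z)*(1-c/(q*z))*(1-d/(q*z)))*(1-a*z)*(q-z^2) -
 z*q*(a-z)*(1-q*z^2)*((1-b/z)*(1-c*z/q)*(1-d*z/q)) + (q-z^2)*(1-q*z^2)*(1-z^2)*((1-a*b*t)*(1-c*d*t/q))/t)"
 unfolding 1 id unfolding r unfolding distrib_left right_diff_distrib[of "q*t"] s by (simp only: right_diff_distrib)
 then show ?thesis using assms q by simp
qed

text \<open>\<open>TR\<close> is eliminated from \<open>R_raise\<close> at \<open>z\<close> and at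
  \<open>q * z\<close> together with \<open>R_lower\<close>.\<close>

lemma R_three_term:
 assumes t: "tok t" and z: "zgood t z" "zgood t (z/q)" "zgood t (q*z)" and x: "norm (z/a) < 1" "norm (q*z/a) < 1"
 shows "- (a*z*(q-z^2)*((1-b*z)*(1-c*z)*(1-d*z))*((1-b/(q*z))*(1-c/(q*z))*(1-d/(q*z)))) * WR t (q*z) - A0 t z * WR t z
 - q*z^2/a*(1-a*z/q)*(z-a)*(1-q*z^2) * WR t (z/q) = 0"
proof -
 have z0: "z ~= 0" "t ~= 0" using z t by (auto simp: zgood_def tok_def)
 define p where "p = (1-b/z)*(1-c*z/q)*(1-d*z/q)"
 define r where "r = (1-b*z)*(1-c/(q*z))*(1-d/(q*z))"
 define K where "K = (1-a*b*t)*(1-c*d*t/q)"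
 define p' where "p' = (1-b/(q*z))*(1-c*z)*(1-d*z)"
 have q1: "1 - z^2/q = (q-z^2)/q" using q by (simp add: diff_divide_distrib)
 have E1: "p * WR t z + (z/a)*(1-a*z/q) * WR t (z/q) + (-((q-z^2)/q)) * TR t z = 0"
 using R_raise[OF t z(1,2) x(1)] unfolding p_def q1 by (simp only: diff_conv_add_uminus mult_minus_left)
 have qz: "q*z/q = z" "c*(q*z)/q = c*z" "d*(q*z)/q = d*z" "a*(q*z)/q = a*z" "(q*z)^2/q = q*z^2" using q by (simp_all add: sqr_eq)
 have E1': "p' * WR t (q*z) + (q*z/a)*(1-a*z) * WR t z + (-(1-q*z^2)) * TR t (q*z) = 0"
 using R_raise[OF t z(3), unfolded qz, OF z(1) x(2)] unfolding p'_def by (simp only: diff_conv_add_uminus mult_minus_left)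
 have E2: "r * TR t (q*z) + (-(1-z/a)) * TR t z + (1-z^2)*K/(a*z*t) * WR t z = 0"
 using R_lower[OF t z(1,3) x(1)] unfolding r_def K_def by (simp only: diff_conv_add_uminus mult_minus_left mult.assoc)
 have M: "- (a*z*q) * (- (r * (-((q-z^2)/q)) * p') * W1 + (- (r * (-((q-z^2)/q)) * ((q*z/a)*(1-a*z))) - (-(1-z/a)) * (-(1-q*z^2)) * p + (-((q-z^2)/q)) * (-(1-q*z^2)) * ((1-z^2)*K/(a*z*t))) * W0 - (-(1-z/a)) * (-(1-q*z^2)) * ((z/a)*(1-a*z/q)) * Wm)
 = - (a*z*(q-z^2)*((1-b*z)*(1-c*z)*(1-d*z))*((1-b/(q*z))*(1-c/(q*z))*(1-d/(q*z)))) * W1 - A0 t z * W0 - q*z^2/a*(1-a*z/q)*(z-a)*(1-q*z^2) * Wm"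
 for W1 W0 Wm
 proof -
 have 1: "- (a*z*q) * (- (r * (-((q-z^2)/q)) * p')) = - (a*z*(q-z^2)*((1-b*z)*(1-c*z)*(1-d*z))*((1-b/(q*z))*(1-c/(q*z))*(1-d/(q*z))))"
 unfolding r_def p'_def using q by (simp add: mult_ac)
 have 2: "- (a*z*q) * (- (r * (-((q-z^2)/q)) * ((q*z/a)*(1-a*z))) - (-(1-z/a)) * (-(1-q*z^2)) * p + (-((q-z^2)/q)) * (-(1-q*z^2)) * ((1-z^2)*K/(a*z*t))) = - A0 t z"
 proof -
 define X where "X = q - z^2"
 define Y where "Y = 1 - q*z^2"
 define y where "y = 1 - a*z"
 define Z where "Z = 1 - z^2"
 have "1 - z/a = (a-z)/a" using abcd by (simp add: diff_divide_distrib)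
 then show ?thesis unfolding A0_eq[OF z0(2,1)] r_def[symmetric] p_def[symmetric] K_def[symmetric] X_def[symmetric] Y_def[symmetric] y_def[symmetric] Z_def[symmetric]
 using q abcd(1) z0 by (simp add: field_simps sqr_eq)
 qed
 have 3: "- (a*z*q) * (- ((-(1-z/a)) * (-(1-q*z^2)) * ((z/a)*(1-a*z/q)))) = - (q*z^2/a*(1-a*z/q)*(z-a)*(1-q*z^2))"
 proof -
 define v where "v = z - a"
 define Y where "Y = 1 - q*z^2"
 have h: "1 - z/a = - (v/a)" using abcd by (simp add: v_def diff_divide_distrib)
 show ?thesis unfolding h v_def[symmetric] Y_def[symmetric] using abcd(1) by (simp add: sqr_eq mult_ac)
 qed
 show ?thesis by (rule scale_three[OF 1 2 3])
 qed
 show ?thesis using M eliminate_intermediate[OF E1 E1' E2] by (metis mult_zero_right)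
qed

lemma S_three_term:
 assumes t: "tok t" and z: "zgood t z" "zgood t (z/q)" "zgood t (q*z)" and x: "norm (a*z/q) < 1" "norm (a*z) < 1" "norm (a*(q*z)) < 1"
 shows "- (a*t*q^2*z^3*(q-z^2)*((1-b*z)*(1-c*z)*(1-d*z))*((1-b/(q*z))*(1-c/(q*z))*(1-d/(q*z)))) * WS t (q*z) - A0 t z * WS t z
 - q/(a*t)*(1-a*z/q)*(z-a)*(1-q*z^2) * WS t (z/q) = 0"
proof -
 have z0: "z ~= 0" "t ~= 0" using z t by (auto simp: zgood_def tok_def)
 define p where "p = (1-b/z)*(1-c*z/q)*(1-d*z/q)"
 define r where "r = (1-b*z)*(1-c/(q*z))*(1-d/(q*z))"
 define K where "K = (1-a*b*t)*(1-c*d*t/q)"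
 define p' where "p' = (1-b/(q*z))*(1-c*z)*(1-d*z)"
 have K0: "K ~= 0"
 using t qp_shift[OF q, of "a*b*t"] qp_shift[OF q, of "c*d*t/q"] by (auto simp: K_def tok_def)
 have q1: "1 - z^2/q = (q-z^2)/q" using q by (simp add: diff_divide_distrib)
 define y where "y = 1-a*z/q"
 define y' where "y' = 1-a*z"
 define yz where "yz = 1-z^2"
 have E1: "- (a*z*t*p) * WS t z + (-(1-a*z/q)) * WS t (z/q) + ((q-z^2)/q*K) * TS t z = 0"
 using S_lower[OF t z(1,2) x(1,2)] unfolding p_def K_def q1 unfolding y_def[symmetric] by (simp add: mult_ac)
 have qz: "q*z/q = z" "c*(q*z)/q = c*z" "d*(q*z)/q = d*z" "a*(q*z)/q = a*z" "(q*z)^2/q = q*z^2" using q by (simp_all add: sqr_eq)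
 have E1': "- (a*q*z*t*p') * WS t (q*z) + (-(1-a*z)) * WS t z + ((1-q*z^2)*K) * TS t (q*z) = 0"
 using S_lower[OF t z(3), unfolded qz, OF z(1) x(2,3)] unfolding p'_def K_def y'_def[symmetric] by (simp add: mult_ac)
 have E2: "- (z^2*t*r*(a*q*z)) * TS t (q*z) + z*(a-z) * TS t z + (- ((1-z^2)*(a*z))) * WS t z = 0"
 using S_raise[OF t z(1,3) x(2)] q unfolding r_def yz_def[symmetric] by (simp add: mult_ac)
 have M: "q/(a*t*z*K) * (- (- (z^2*t*r*(a*q*z)) * ((q-z^2)/q*K) * (- (a*q*z*t*p'))) * W1 + (- (- (z^2*t*r*(a*q*z)) * ((q-z^2)/q*K) * (-(1-a*z))) - z*(a-z) * ((1-q*z^2)*K) * (- (a*z*t*p)) + ((q-z^2)/q*K) * ((1-q*z^2)*K) * (- ((1-z^2)*(a*z)))) * W0 - z*(a-z) * ((1-q*z^2)*K) * (-(1-a*z/q)) * Wm)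
 = - (a*t*q^2*z^3*(q-z^2)*((1-b*z)*(1-c*z)*(1-d*z))*((1-b/(q*z))*(1-c/(q*z))*(1-d/(q*z)))) * W1 - A0 t z * W0 - q/(a*t)*(1-a*z/q)*(z-a)*(1-q*z^2) * Wm"
 for W1 W0 Wm
 proof -
 have 1: "q/(a*t*z*K) * (- (- (z^2*t*r*(a*q*z)) * ((q-z^2)/q*K) * (- (a*q*z*t*p')))) = - (a*t*q^2*z^3*(q-z^2)*((1-b*z)*(1-c*z)*(1-d*z))*((1-b/(q*z))*(1-c/(q*z))*(1-d/(q*z))))"
 unfolding r_def p'_def using q K0 z0 abcd(1) by (simp add: mult_ac sqr_eq power3_eq_cube)
 have 2: "q/(a*t*z*K) * (- (- (z^2*t*r*(a*q*z)) * ((q-z^2)/q*K) * (-(1-a*z))) - z*(a-z) * ((1-q*z^2)*K) * (- (a*z*t*p)) + ((q-z^2)/q*K) * ((1-q*z^2)*K) * (- ((1-z^2)*(a*z)))) = - A0 t z"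
 proof -
 define X where "X = q - z^2"
 define Y where "Y = 1 - q*z^2"
 define y where "y = 1 - a*z"
 define Z where "Z = 1 - z^2"
 show ?thesis unfolding A0_eq[OF z0(2,1)] r_def[symmetric] p_def[symmetric] K_def[symmetric] X_def[symmetric] Y_def[symmetric] y_def[symmetric] Z_def[symmetric]
 using q abcd(1) z0 K0 by (simp add: field_simps sqr_eq)
 qed
 have 3: "q/(a*t*z*K) * (- (z*(a-z) * ((1-q*z^2)*K) * (-(1-a*z/q)))) = - (q/(a*t)*(1-a*z/q)*(z-a)*(1-q*z^2))"
 proof -
 have "a - z = - (z - a)" by simp
 then show ?thesis using K0 z0 abcd(1) by (simp only: mult_minus_left mult_minus_right minus_minus) (simp add: mult_ac)
 qed
 show ?thesis by (rule scale_three[OF 1 2 3])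
 qed
 show ?thesis using M eliminate_intermediate[OF E1 E1' E2] by (metis mult_zero_right)
qed

text \<open>With \<open>e = P * t / q\<close> and \<open>f = 1 / t\<close>, the move
  \<open>e \<mapsto> q * e\<close>, \<open>f \<mapsto> f / q\<close> is
  \<open>t \<mapsto> q * t\<close>. Dividing the coefficients by \<open>cc\<close> adapts them to
  the normalisation of \<open>gamma_sums\<close>.\<close>

lemma R_gamma:
 assumes t: "tok t" "tok (q*t)" "tok (q^2*t)" and z: "zgood t z" "zgood (q*t) z" "zgood (q^2*t) z" and x: "norm (q*z/a) < 1"
 shows "Gm t * WR t z + (AWB q a b c d (q*t) - (z+1/z)) * WR (q*t) z + Hm t * WR (q^2*t) z = 0"
proof -
 have z0: "z ~= 0" "t ~= 0" "z ~= q/a" using z t by (auto simp: zgood_def tok_def)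
 define ga where "ga = b*c*d/(q*z)"
 define cc where "cc = 1/z - a/q"
 have cc: "cc ~= 0" "cc = - (a/q)*(1 - q/(a*z))" using z0 q abcd by (auto simp: cc_def field_simps)
 note tP = tok_P[OF t(1)]
 have s: "(%k. Gm t/cc * vt q ga [ga,b/z,c/z,d/z,P*t/q,1/t] (q*z/a) k +
 (AWB q a b c d (q*t) - (z+1/z))/cc * vt q ga [ga,b/z,c/z,d/z,q*(P*t/q),1/t/q] (q*z/a) k +
 Hm t/cc * vt q ga [ga,b/z,c/z,d/z,q^2*(P*t/q),1/t/q^2] (q*z/a) k) sums 0"
 proof (rule gamma_sums[OF q])
 show "q*z/a*(ga*(b/z)*(c/z)*(d/z)*(P*t/q)*(1/t)) = q^2*ga^3"
 unfolding ga_def using q abcd z0 by (simp add: sqr_eq power3_eq_cube)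
 have r: "1/t/(q*(P*t/q)) = 1/(P*t^2)" "1/t/(q^2*(P*t/q)) = 1/(q*P*t^2)" "q*ga/(P*t/q*(1/t)) = q/(a*z)"
 "ga/(P*t/q*ga) = q/(P*t)" "ga/(P*t/q*(b/z)) = 1/(a*b*t)" "ga/(P*t/q*(c/z)) = 1/(a*c*t)" "ga/(P*t/q*(d/z)) = 1/(a*d*t)"
 "q^3*(P*t/q)/(1/t) = q^2*P*t^2" "q^2*(P*t/q)/(1/t) = q*P*t^2" "q^2*ga/(1/t*ga) = q^2*t" "q^2*ga/(1/t*(b/z)) = q*c*d*t"
 "q^2*ga/(1/t*(c/z)) = q*b*d*t" "q^2*ga/(1/t*(d/z)) = q*b*c*t"
 unfolding ga_def using q abcd z0 by (simp_all add: sqr_eq power3_eq_cube)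
 have u: "1-1/(P*t^2) ~= 0" "1-1/(q*P*t^2) ~= 0" using tP abcd z0 q by auto
 have c1: "1 - q/(a*z) ~= 0" using cc by auto
 have gen: "X1 ~= 0 ==> X2 ~= 0 ==> X3 ~= 0 ==> (a/q)*X/(X1*X2)/(-(a/q)*X3)*(X1*X2*X3) = -X" for X X1 X2 X3
 using q abcd(1) by simp
 show "Gm t/cc * ((1 - 1/t/(q*(P*t/q))) * (1 - 1/t/(q^2*(P*t/q))) * (1 - q*ga/(P*t/q*(1/t)))) =
 - ((1-ga/(P*t/q*ga))*(1-ga/(P*t/q*(b/z)))*(1-ga/(P*t/q*(c/z)))*(1-ga/(P*t/q*(d/z))))"
 unfolding r Gm_def cc(2) by (rule gen[OF u c1])
 show "Hm t/cc * ((1 - q^3*(P*t/q)/(1/t)) * (1 - q^2*(P*t/q)/(1/t)) * (1 - q*ga/(P*t/q*(1/t)))) =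
 - ((1-q^2*ga/(1/t*ga))*(1-q^2*ga/(1/t*(b/z)))*(1-q^2*ga/(1/t*(c/z)))*(1-q^2*ga/(1/t*(d/z))))"
 unfolding r Hm_def cc(2) by (rule gen[OF _ _ c1]) (use tP in auto)
 have "cc*(q*z/a - 1) = q/a + a/q - 1/z - z" using q abcd(1) z0 by (simp add: cc_def field_simps)
 then have "AWB q a b c d (q*t) - (z+1/z) = cc*(q*z/a - 1) - Gm t - Hm t"
 using Gm_Hm[OF t(1)] by (simp add: AWB_def algebra_simps)
 then show "(AWB q a b c d (q*t) - (z+1/z))/cc = q*z/a - 1 - Gm t/cc - Hm t/cc" using cc(1) by (simp add: diff_divide_distrib)
 show "1/t ~= q*(P*t/q)" "1/t ~= q^2*(P*t/q)" "1/t ~= q^3*(P*t/q)"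
 using tP q z0 by (auto simp: field_simps sqr_eq power3_eq_cube)
 show "P*t/q*(1/t) ~= q*ga" using z0 q abcd by (auto simp: ga_def field_simps)
 have h: "1/t/q^2 = 1/(q^2*t)" by simp
 show "qp q (1/t/q^2) ~= 0" unfolding h using t(3)[unfolded tok_def] by blast
 qed (use z t x q abcd z0 in \<open>simp_all add: zgood_def tok_def ga_def\<close>)
 have e: "q*(P*t/q) = P*(q*t)/q" "1/t/q = 1/(q*t)" "q^2*(P*t/q) = P*(q^2*t)/q" "1/t/q^2 = 1/(q^2*t)"
 using q by (simp_all add: sqr_eq)
 have v: "vt q ga [ga,b/z,c/z,d/z,P*t'/q,1/t'] (q*z/a) sums WR t' z" if "tok t'" "zgood t' z" for t'
 unfolding WR_def ga_def by (rule vt_sums[OF q Wok_R[OF that x] x])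
 have "0 = Gm t/cc * WR t z + (AWB q a b c d (q*t) - (z+1/z))/cc * WR (q*t) z + Hm t/cc * WR (q^2*t) z"
 by (rule sums_unique2[OF s[unfolded e] sums_add[OF sums_add[OF sums_mult[OF v[OF t(1) z(1)]] sums_mult[OF v[OF t(2) z(2)]]] sums_mult[OF v[OF t(3) z(3)]]]])
 also have "... = (Gm t * WR t z + (AWB q a b c d (q*t) - (z+1/z)) * WR (q*t) z + Hm t * WR (q^2*t) z)/cc"
 by (simp add: add_divide_distrib)
 finally show ?thesis using cc(1) by (metis divide_eq_0_iff)
qed

lemma AWA_qt: "AWA q a b c d (q*t) = (1-q*a*b*t)*(1-q*a*c*t)*(1-q*a*d*t)*(1-P*t)/(a*((1-q*P*t^2)*(1-q^2*P*t^2)))"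
proof -
 have "q - P*(q*t) = q*(1-P*t)" "q - P*(q*t)^2 = q*(1-q*P*t^2)" "1 - P*(q*t)^2 = 1-q^2*P*t^2" by (simp_all add: algebra_simps sqr_eq)
 then show ?thesis using q by (simp add: AWA_def mult_ac)
qed

lemma AWC_qt: "AWC q a b c d (q*t) = a*(1-q*t)*(1-b*c*t)*(1-b*d*t)*(1-c*d*t)/((1-P*t^2)*(1-q*P*t^2))"
proof -
 have "q - b*c*(q*t) = q*(1-b*c*t)" "q - b*d*(q*t) = q*(1-b*d*t)" "q - c*d*(q*t) = q*(1-c*d*t)"
 "q^2 - P*(q*t)^2 = q^2*(1-P*t^2)" "q - P*(q*t)^2 = q*(1-q*P*t^2)" by (simp_all add: algebra_simps sqr_eq)
 then show ?thesis using q by (simp add: AWC_def sqr_eq)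
qed

text \<open>Each step in \<open>t\<close> moves the base of \<open>WS\<close> by \<open>q^2\<close>.
  \<open>shifted_sums\<close> brings the three series to a common base at the price of factors
  \<open>a * z\<close>.\<close>

lemma S_gamma:
 assumes t: "tok t" "tok (q*t)" "tok (q^2*t)" and z: "zgood t z" "zgood (q*t) z" "zgood (q^2*t) z" and x: "norm (a*z) < 1"
 shows "AWC q a b c d (q*t) * WS t z + (AWB q a b c d (q*t) - (z+1/z)) * (a*z * WS (q*t) z) +
 AWA q a b c d (q*t) * (a*z * (a*z * WS (q^2*t) z)) = 0"
proof -
 have z0: "z ~= 0" "t ~= 0" using z t by (auto simp: zgood_def tok_def)
 have za: "z ~= a" using z(1) qp_1[OF q] abcd by (auto simp: zgood_def)
 define ga where "ga = b*c*d*t^2*z"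
 have ga0: "ga ~= 0" using abcd z0 by (simp add: ga_def)
 define cc where "cc = 1/z - 1/a"
 have cc: "cc ~= 0" "cc = - (1/a)*(1 - a/z)" using z0 za abcd by (auto simp: cc_def field_simps)
 note tP = tok_P[OF t(1)]
 have s: "(%k. AWC q a b c d (q*t)/cc * vt q ga [q*t,c*d*t,b*c*t,b*d*t,ga,q/a*z] (a*z) k +
 (AWB q a b c d (q*t) - (z+1/z))/cc * vt q ga [q*t,c*d*t,b*c*t,b*d*t,q*ga,q/a*z/q] (a*z) k +
 AWA q a b c d (q*t)/cc * vt q ga [q*t,c*d*t,b*c*t,b*d*t,q^2*ga,q/a*z/q^2] (a*z) k) sums 0"
 proof (rule gamma_sums[OF q])
 show "a*z*(q*t*(c*d*t)*(b*c*t)*(b*d*t)*ga*(q/a*z)) = q^2*ga^3"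
 unfolding ga_def using abcd(1) by (simp add: sqr_eq power3_eq_cube)
 have r: "q/a*z/(q*ga) = 1/(P*t^2)" "q/a*z/(q^2*ga) = 1/(q*P*t^2)" "q*ga/(ga*(q/a*z)) = a/z" "ga/(ga*n) = 1/n"
 "q^3*ga/(q/a*z) = q^2*P*t^2" "q^2*ga/(q/a*z) = q*P*t^2" "q^2*ga/(q/a*z*(q*t)) = P*t" "q^2*ga/(q/a*z*(c*d*t)) = q*a*b*t"
 "q^2*ga/(q/a*z*(b*c*t)) = q*a*d*t" "q^2*ga/(q/a*z*(b*d*t)) = q*a*c*t" for n
 unfolding ga_def using q abcd z0 by (simp_all add: sqr_eq power3_eq_cube)
 have u: "P*t^2 ~= 0" "1-P*t^2 ~= 0" "1-q*P*t^2 ~= 0" "1-q^2*P*t^2 ~= 0" using tP abcd z0 by auto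
 have c1: "1 - a/z ~= 0" using cc by auto
 show "AWC q a b c d (q*t)/cc * ((1 - q/a*z/(q*ga)) * (1 - q/a*z/(q^2*ga)) * (1 - q*ga/(ga*(q/a*z)))) =
 - ((1-ga/(ga*(q*t)))*(1-ga/(ga*(c*d*t)))*(1-ga/(ga*(b*c*t)))*(1-ga/(ga*(b*d*t))))"
 proof -
 have f: "1-1/n = - (1-n)/n" if "n ~= 0" for n :: complex using that by (simp add: diff_divide_distrib)
 have nn: "q*P*t^2 ~= 0" "q*t ~= 0" "c*d*t ~= 0" "b*c*t ~= 0" "b*d*t ~= 0" using q abcd z0 by auto
 define y1 y2 y3 y4 v1 v2 where "y1 = 1-q*t" "y2 = 1-c*d*t" "y3 = 1-b*c*t" "y4 = 1-b*d*t" "v1 = 1-P*t^2" "v2 = 1-q*P*t^2"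
 have "v1 ~= 0" "v2 ~= 0" using u by (simp_all add: y1_y2_y3_y4_v1_v2_def)
 then show ?thesis unfolding r AWC_qt cc(2) f[OF u(1)] f[OF nn(1)] f[OF nn(2)] f[OF nn(3)] f[OF nn(4)] f[OF nn(5)]
 unfolding y1_y2_y3_y4_v1_v2_def[symmetric] using c1 q abcd z0 by (simp add: sqr_eq mult_ac)
 qed
 show "AWA q a b c d (q*t)/cc * ((1 - q^3*ga/(q/a*z)) * (1 - q^2*ga/(q/a*z)) * (1 - q*ga/(ga*(q/a*z)))) =
 - ((1-q^2*ga/(q/a*z*(q*t)))*(1-q^2*ga/(q/a*z*(c*d*t)))*(1-q^2*ga/(q/a*z*(b*c*t)))*(1-q^2*ga/(q/a*z*(b*d*t))))"
 proof -
 have gen: "X1 ~= 0 ==> X2 ~= 0 ==> X3 ~= 0 ==> X/(a*(X2*X1))/(-(1/a)*X3)*(X1*X2*X3) = -X" for X X1 X2 X3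
 using abcd(1) by simp
 show ?thesis unfolding r AWA_qt cc(2) gen[OF u(4) u(3) c1] by (simp only: mult_ac)
 qed
 have "cc*(a*z - 1) = a + 1/a - 1/z - z" using abcd(1) z0 by (simp add: cc_def field_simps)
 then have "AWB q a b c d (q*t) - (z+1/z) = cc*(a*z - 1) - AWC q a b c d (q*t) - AWA q a b c d (q*t)"
 by (simp add: AWB_def algebra_simps)
 then show "(AWB q a b c d (q*t) - (z+1/z))/cc = a*z - 1 - AWC q a b c d (q*t)/cc - AWA q a b c d (q*t)/cc"
 using cc(1) by (simp add: diff_divide_distrib)
 show "q/a*z ~= q*ga" "q/a*z ~= q^2*ga" "q/a*z ~= q^3*ga"
 using tP q z0 abcd by (auto simp: ga_def field_simps sqr_eq power3_eq_cube)
 show "ga*(q/a*z) ~= q*ga" using za q abcd ga0 by (auto simp: field_simps)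
 have h: "q/a*z/q^2 = 1/(a*q)*z" using q by (simp add: sqr_eq)
 show "qp q (q/a*z/q^2) ~= 0" using z(1) unfolding h by (simp add: zgood_def)
 show "qp q ga ~= 0" using z(1) by (simp add: zgood_def ga_def)
 qed (use z t x q abcd z0 ga0 in \<open>simp_all add: zgood_def tok_def\<close>)
 have 1: "vt q ga [q*t,c*d*t,b*c*t,b*d*t,ga,q/a*z] (a*z) sums WS t z"
 unfolding WS_def ga_def by (subst vt_perm') (rule vt_sums[OF q Wok_S[OF t(1) z(1) x] x])
 have 2: "vt q ga [q*t,c*d*t,b*c*t,b*d*t,q*ga,q/a*z/q] (a*z) sums (a*z * WS (q*t) z)"
 proof -
 have h: "q^2*ga = b*c*d*(q*t)^2*z" "q*(c*d*t) = c*d*(q*t)" "q*(b*c*t) = b*c*(q*t)" "q*(b*d*t) = b*d*(q*t)" "q*(q/a*z/q) = q/a*z"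
 using q by (simp_all add: ga_def power_mult_distrib)
 have "Wok q (q^2*ga) [q*(q*t),q*(c*d*t),q*(b*c*t),q*(b*d*t),q*(q/a*z/q)] (a*z)"
 unfolding h by (rule Wok_S[OF t(2) z(2) x])
 from shifted_sums[OF q this x refl ga0] show ?thesis unfolding WS_def h .
 qed
 have 3: "vt q ga [q*t,c*d*t,b*c*t,b*d*t,q^2*ga,q/a*z/q^2] (a*z) sums (a*z * (a*z * WS (q^2*t) z))"
 proof -
 define ga' where "ga' = q^2*ga"
 have h: "q^2*ga' = b*c*d*(q^2*t)^2*z" "q*(q*(c*d*t)) = c*d*(q^2*t)" "q*(q*(b*c*t)) = b*c*(q^2*t)" "q*(q*(b*d*t)) = b*d*(q^2*t)"
 "q*(q/a*z/q) = q/a*z" "q*(q*(q*t)) = q*(q^2*t)"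
 using q by (simp_all add: ga'_def ga_def sqr_eq)
 have ga'0: "ga' ~= 0" using ga0 q by (simp add: ga'_def)
 have "Wok q (q^2*ga') [q*(q*(q*t)),q*(q*(c*d*t)),q*(q*(b*c*t)),q*(q*(b*d*t)),q*(q/a*z/q)] (a*z)"
 unfolding h by (rule Wok_S[OF t(3) z(3) x])
 from shifted_sums[OF q this x refl ga'0]
 have v: "vt q ga' [q*(q*t),q*(c*d*t),q*(b*c*t),q*(b*d*t),q*ga',q/a*z/q] (a*z) sums (a*z * WS (q^2*t) z)" unfolding WS_def h .
 have "vt q ga [q*t,c*d*t,b*c*t,b*d*t,q^2*ga,q/a*z/q^2] (a*z) (Suc k) =
 a*z * vt q ga' [q*(q*t),q*(c*d*t),q*(b*c*t),q*(b*d*t),q*ga',q/a*z/q] (a*z) k" for k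
 unfolding vt_Suc ga'_def using q by (simp add: sqr_eq)
 then show ?thesis
 using sums_mult[OF v, of "a*z"] vt_zero'[OF q refl ga0] sums_Suc_iff[of "vt q ga [q*t,c*d*t,b*c*t,b*d*t,q^2*ga,q/a*z/q^2] (a*z)"] by simp
 qed
 have "0 = AWC q a b c d (q*t)/cc * WS t z + (AWB q a b c d (q*t) - (z+1/z))/cc * (a*z * WS (q*t) z) + AWA q a b c d (q*t)/cc * (a*z * (a*z * WS (q^2*t) z))"
 by (rule sums_unique2[OF s sums_add[OF sums_add[OF sums_mult[OF 1] sums_mult[OF 2]] sums_mult[OF 3]]])
 also have "... = (AWC q a b c d (q*t) * WS t z + (AWB q a b c d (q*t) - (z+1/z)) * (a*z * WS (q*t) z) +
 AWA q a b c d (q*t) * (a*z * (a*z * WS (q^2*t) z)))/cc" by (simp add: add_divide_distrib)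
 finally show ?thesis using cc(1) by (metis divide_eq_0_iff)
qed

section \<open>The solutions without their power factors\<close>

definition RR where
 "RR t z = qp q (a*z) / qp q (b*c*d/z) * ((qp q (a*b*t) * (qp q (a*c*t) * (qp q (a*d*t) * qp q (b*c*d*t/z)))) /
 (qp q (b*c*t) * (qp q (b*d*t) * (qp q (c*d*t) * qp q (a*z*t))))) *
 W87 (b*c*d/(q*z)) [b/z, c/z, d/z, P*t/q, 1/t] q (q*z/a)"

definition SS where
 "SS t z = qp q (a*z) / (qp q (z*q/a) * (qp q (z*q/b) * (qp q (z*q/c) * qp q (z*q/d)))) *
 ((qp q (P*t^2) * (qp q (b*z*t*q) * (qp q (c*z*t*q) * (qp q (d*z*t*q) * qp q (b*c*d*z*t))))) /
 (qp q (b*c*t) * (qp q (b*d*t) * (qp q (c*d*t) * (qp q (t*q) * qp q (b*c*d*z*t^2*q)))))) *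
 W87 (b*c*d*z*t^2) [b*c*t, b*d*t, c*d*t, t*q, z*q/a] q (a*z)"

text \<open>Quotient of \<open>RR\<close> by the normalised series. The pair of products at
  \<open>q/(a*t)/z\<close> and \<open>a*t*z\<close> is a theta function, so by \<open>atz\<close> it
  changes only by an elementary factor under shifts of \<open>t\<close> and
  \<open>z\<close>.\<close>

definition KR where
 "KR t z = qp q (a*z) * (qp q (b/z) * qp q (c/z) * qp q (d/z)) * (qp q (a*b*t) * qp q (a*c*t) * qp q (a*d*t) * qp q (P*t/q) * qp q (1/t)) /
 (qp q (b*c*t) * qp q (b*d*t) * qp q (c*d*t) * (qp q (q/(a*t)/z) * qp q (a*t*z)) * (qp q q * qp q (c*d) * qp q (b*d) * qp q (b*c)))"

definition KS where "KS z = qp q (a*z) / (qp q q * (qp q (q/b*z) * qp q (q/c*z) * qp q (q/d*z)))"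

lemma RR_eq: assumes t: "tok t" and z: "zgood t z" shows "RR t z = KR t z * WR t z"
proof -
 have z0: "z ~= 0" "t ~= 0" using z t by (auto simp: zgood_def tok_def)
 define ga where "ga = b*c*d/(q*z)"
 have r: "q*ga/ga = q" "q*ga/(b/z) = c*d" "q*ga/(c/z) = b*d" "q*ga/(d/z) = b*c" "q*ga/(P*t/q) = q/(a*t)/z" "q*ga/(1/t) = b*c*d*t/z"
 using z0 q abcd by (simp_all add: ga_def)
 have s: "qp q ga = (1-ga) * qp q (b*c*d/z)" using qp_shift[OF q, of ga] q by (simp add: ga_def)
 have "qp q ga ~= 0" using z by (simp add: zgood_def ga_def)
 then have s0: "1-ga ~= 0" "qp q (b*c*d/z) ~= 0" using s by auto
 have e: "a*z*t = a*t*z" by (simp add: mult_ac)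
 note nz = z[unfolded zgood_def] t[unfolded tok_def]
 show ?thesis unfolding RR_def KR_def WR_def Wh_def ga_def[symmetric] vw_def list.map prod_list.Cons prod_list.Nil r s e
 using nz const s0 qp_q by (simp add: mult_ac)
qed

lemma SS_eq: assumes t: "tok t" and z: "zgood t z" shows "SS t z = KS z * WS t z"
proof -
 have z0: "z ~= 0" "t ~= 0" using z t by (auto simp: zgood_def tok_def)
 define ga where "ga = b*c*d*t^2*z"
 have r: "q*ga/ga = q" "q*ga/(q*t) = b*c*d*z*t" "q*ga/(c*d*t) = b*z*t*q" "q*ga/(b*c*t) = d*z*t*q" "q*ga/(b*d*t) = c*z*t*q" "q*ga/(q/a*z) = P*t^2"
 using z0 q abcd by (simp_all add: ga_def sqr_eq)
 have s: "qp q ga = (1-ga) * qp q (b*c*d*z*t^2*q)" using qp_shift[OF q, of ga] by (simp add: ga_def mult_ac)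
 have "qp q ga ~= 0" using z by (simp add: zgood_def ga_def)
 then have s0: "1-ga ~= 0" "qp q (b*c*d*z*t^2*q) ~= 0" using s by auto
 have e: "z*q/u = q/u*z" for u by simp
 have e': "t*q = q*t" "b*c*d*z*t^2 = ga" by (simp_all add: ga_def)
 have W: "W87 ga [b*c*t, b*d*t, c*d*t, q*t, y] q x = W87 ga [q*t, c*d*t, b*c*t, b*d*t, y] q x" for y x
 unfolding W87_def W87_coeff_def W87_den_def by (simp add: qpoch_def mult_ac)
 note nz = z[unfolded zgood_def] t[unfolded tok_def]
 have nn: "qp q (b*c*t) ~= 0" "qp q (b*d*t) ~= 0" "qp q (c*d*t) ~= 0" "qp q (q*t) ~= 0" "qp q (q/a*z) ~= 0" using nz by auto
 show ?thesis unfolding SS_def KS_def WS_def e e'(1) Wh_def ga_def[symmetric] vw_def list.map prod_list.Cons prod_list.Nil r s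
 unfolding e'(2) W using nn s0 qp_q by (simp add: e'(2) mult_ac)
qed

end

lemma shuffle_t:
 fixes n :: "'a::field"
 shows "n * n2 * (A1/y1 * (A2/y2) * (A3/y3) * (A4/y4) * (g*A5)) / ((B1/w1) * (B2/w2) * (B3/w3) * ((k*C1) * (C2/m)) * D0) =
 n * n2 * (A1 * A2 * A3 * A4 * A5) / (B1 * B2 * B3 * (C1 * C2) * D0) * ((w1*w2*w3*g)/(y1*y2*y3*y4) * (m/k))"
 by (simp add: mult_ac)

lemma shuffle_z:
 fixes A :: "'a::field"
 shows "A/y * ((k1*B1) * (k2*B2) * (k3*B3)) * T0 / (U0 * ((k*C1) * (C2/m)) * D0) =
 A * (B1*B2*B3) * T0 / (U0 * (C1*C2) * D0) * (k1*k2*k3/y * (m/k))"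
 by (simp add: mult_ac)

lemma analytic_scale: "f analytic_on {c * z0} ==> (%z. f (c * z)) analytic_on {z0}" for f :: "complex => complex"
 using analytic_on_compose_gen[of "%z. c * z" "{z0}" f "{c * z0}"] by (auto simp: comp_def intro!: analytic_intros)

context aw_params
begin

lemma qp_q_mult: "qp q w ~= 0 ==> qp q (q*w) = qp q w / (1-w)"
 using qp_shift[OF q, of w] by auto

lemma minus_ratio: "y ~= 0 ==> y ~= 1 ==> (1-y)/(1-1/y) = -y" for y :: complex
 by (simp add: field_simps)

definition rho where "rho t z = (1-b*c*t)*(1-b*d*t)*(1-c*d*t)*(1-1/(q*t))/((1-a*b*t)*(1-a*c*t)*(1-a*d*t)*(1-P*t/q)) * (-(a*t*z))"

lemma atz: "tok t ==> zgood t z ==> (1-a*t*z)/(1-1/(a*t*z)) = -(a*t*z)"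
 by (rule minus_ratio) (use abcd qp_1[OF q] in \<open>auto simp: tok_def zgood_def\<close>)

lemma KR_qt: assumes t: "tok t" and z: "zgood t z" shows "KR (q*t) z = KR t z * rho t z"
proof -
 note nz = t[unfolded tok_def] z[unfolded zgood_def]
 have m: "a*b*(q*t) = q*(a*b*t)" "a*c*(q*t) = q*(a*c*t)" "a*d*(q*t) = q*(a*d*t)" "b*c*(q*t) = q*(b*c*t)" "b*d*(q*t) = q*(b*d*t)" "c*d*(q*t) = q*(c*d*t)" "P*(q*t)/q = q*(P*t/q)" "a*(q*t)*z = q*(a*t*z)" by simp_all
 have g: "qp q (1/(q*t)) = (1-1/(q*t)) * qp q (1/t)" using qp_shift[OF q, of "1/(q*t)"] q by simp
 have k: "qp q (q/(a*(q*t))/z) = (1-1/(a*t*z)) * qp q (q/(a*t)/z)" using qp_shift[OF q, of "1/(a*t*z)"] q by simp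
 have f: "qp q (q*(a*b*t)) = qp q (a*b*t)/(1-a*b*t)" "qp q (q*(a*c*t)) = qp q (a*c*t)/(1-a*c*t)" "qp q (q*(a*d*t)) = qp q (a*d*t)/(1-a*d*t)"
 "qp q (q*(P*t/q)) = qp q (P*t/q)/(1-P*t/q)" "qp q (q*(b*c*t)) = qp q (b*c*t)/(1-b*c*t)" "qp q (q*(b*d*t)) = qp q (b*d*t)/(1-b*d*t)"
 "qp q (q*(c*d*t)) = qp q (c*d*t)/(1-c*d*t)" "qp q (q*(a*t*z)) = qp q (a*t*z)/(1-a*t*z)"
 by (rule qp_q_mult; use nz in blast)+
 show ?thesis unfolding rho_def atz[OF t z, symmetric] KR_def m f g k by (rule shuffle_t)
qed

lemma KR_qz:
 assumes t: "tok t" and z: "zgood t z"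
 shows "KR t (q*z) = KR t z * ((1-b/(q*z))*(1-c/(q*z))*(1-d/(q*z))/(1-a*z) * (-(a*t*z)))"
proof -
 note nz = t[unfolded tok_def] z[unfolded zgood_def]
 have m: "a*(q*z) = q*(a*z)" "a*t*(q*z) = q*(a*t*z)" by simp_all
 have k: "qp q (q/(a*t)/(q*z)) = (1-1/(a*t*z)) * qp q (q/(a*t)/z)" using qp_shift[OF q, of "1/(a*t*z)"] q by (simp add: mult.assoc)
 have l: "qp q (u/(q*z)) = (1-u/(q*z)) * qp q (u/z)" for u using qp_shift[OF q, of "u/(q*z)"] q by simp
 have f: "qp q (q*(a*z)) = qp q (a*z)/(1-a*z)" "qp q (q*(a*t*z)) = qp q (a*t*z)/(1-a*t*z)"
 by (rule qp_q_mult; use nz in blast)+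
 show ?thesis unfolding atz[OF t z, symmetric] KR_def m f unfolding k unfolding l by (rule shuffle_z)
qed

lemma KS_qz:
 assumes z: "zgood t z"
 shows "KS (q*z) = KS z * ((1-q/b*z)*(1-q/c*z)*(1-q/d*z)/(1-a*z))"
proof -
 note nz = z[unfolded zgood_def]
 have m: "a*(q*z) = q*(a*z)" "q/u*(q*z) = q*(q/u*z)" for u by simp_all
 have f: "qp q (q*(a*z)) = qp q (a*z)/(1-a*z)" "qp q (q*(q/b*z)) = qp q (q/b*z)/(1-q/b*z)" "qp q (q*(q/c*z)) = qp q (q/c*z)/(1-q/c*z)"
 "qp q (q*(q/d*z)) = qp q (q/d*z)/(1-q/d*z)" by (rule qp_q_mult; use nz in blast)+
 show ?thesis unfolding KS_def m f by (simp add: mult_ac)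
qed

lemma one_minus: "qp q w ~= 0 ==> 1 - w ~= 0"
 using qp_shift[OF q, of w] by auto

lemma tok_ne: assumes "tok t"
 shows "1-a*b*t ~= 0" "1-a*c*t ~= 0" "1-a*d*t ~= 0" "1-P*t/q ~= 0" "t ~= 0" "1-P*t^2 ~= 0" "1-q*P*t^2 ~= 0" "1-q^2*P*t^2 ~= 0"
 using assms one_minus[of "a*b*t"] one_minus[of "a*c*t"] one_minus[of "a*d*t"] one_minus[of "P*t/q"] tok_P[OF assms]
 by (auto simp: tok_def)

lemma Gm_rho: assumes t: "tok t" shows "Gm t * rho t z = AWC q a b c d (q*t) * (z/a)"
proof -
 note n = tok_ne[OF t]
 define y1 y2 y3 y4 w1 w2 w3 u v1 v2 w4 where "y1 = 1-a*b*t" "y2 = 1-a*c*t" "y3 = 1-a*d*t" "y4 = 1-P*t/q" "w1 = 1-b*c*t" "w2 = 1-b*d*t" "w3 = 1-c*d*t" "u = P*t^2"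
 "v1 = 1-P*t^2" "v2 = 1-q*P*t^2" "w4 = 1-q*t"
 note df = y1_y2_y3_y4_w1_w2_w3_u_v1_v2_w4_def
 have r: "1-q/(P*t) = -(q*y4)/(P*t)" "1-1/(a*b*t) = -y1/(a*b*t)" "1-1/(a*c*t) = -y2/(a*c*t)" "1-1/(a*d*t) = -y3/(a*d*t)"
 "1-1/(P*t^2) = -v1/u" "1-1/(q*P*t^2) = -v2/(q*u)" "1-1/(q*t) = -w4/(q*t)"
 using abcd n q by (simp_all add: df diff_divide_distrib right_diff_distrib mult.assoc)
 have nz: "y1 ~= 0" "y2 ~= 0" "y3 ~= 0" "y4 ~= 0" "v1 ~= 0" "v2 ~= 0" "u ~= 0" using n abcd by (simp_all add: df mult.assoc)
 have den: "(P*t)*(a*b*t)*(a*c*t)*(a*d*t) = a^2*u^2" unfolding df by algebra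
 have "Gm t * rho t z = (a/q)*((q*y4*y1*y2*y3)/((P*t)*(a*b*t)*(a*c*t)*(a*d*t)))/(v1* v2/(q*u^2)) * (w1*w2*w3*(-w4/(q*t))/(y1*y2*y3*y4) * (-(a*t*z)))"
 unfolding Gm_def rho_def r unfolding df(1-7)[symmetric] by (simp add: sqr_eq mult_ac)
 also have "... = a*w4*w1*w2*w3/(v1* v2) * (z/a)"
 unfolding den using nz q abcd(1) n(5) by (simp add: sqr_eq)
 finally show ?thesis unfolding AWC_qt by (simp add: df mult.assoc)
qed

lemma Hm_rho: assumes t: "tok t" "tok (q*t)" and that: "z ~= 0" shows "Hm t = AWA q a b c d (q*t) * (a/z) * rho (q*t) z"
proof -
 note n = tok_ne[OF t(1)] tok_ne[OF t(2)]
 have e: "a*b*(q*t) = q*a*b*t" "a*c*(q*t) = q*a*c*t" "a*d*(q*t) = q*a*d*t" "b*c*(q*t) = q*b*c*t" "b*d*(q*t) = q*b*d*t" "c*d*(q*t) = q*c*d*t" "P*(q*t)/q = P*t" "q*(q*t) = q^2*t" using q by (simp_all add: sqr_eq)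
 define y1 y2 y3 y4 w1 w2 w3 v1 v2 w4 where "y1 = 1-q*a*b*t" "y2 = 1-q*a*c*t" "y3 = 1-q*a*d*t" "y4 = 1-P*t" "w1 = 1-q*b*c*t" "w2 = 1-q*b*d*t" "w3 = 1-q*c*d*t" "v1 = 1-q*P*t^2" "v2 = 1-q^2*P*t^2" "w4 = 1-q^2*t"
 note df = y1_y2_y3_y4_w1_w2_w3_v1_v2_w4_def
 have nz: "y1 ~= 0" "y2 ~= 0" "y3 ~= 0" "y4 ~= 0" "v1 ~= 0" "v2 ~= 0" using n(9-12)[unfolded e] n(7,8) by (simp_all add: df)
 have r: "1-1/(q^2*t) = -w4/(q^2*t)" using q n(5) by (simp add: df diff_divide_distrib)
 show ?thesis unfolding Hm_def AWA_qt rho_def e r unfolding df[symmetric]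
 using nz q abcd(1) n(5) that by (simp add: sqr_eq mult_ac)
qed

text \<open>The recurrence for \<open>F\<close> times the \<open>\<gamma>\<close>-th power of
  \<open>s\<close>, with this power divided out; no branch has to be chosen.\<close>

definition Lrel where "Lrel t s F z \<longleftrightarrow> AWC q a b c d (q*t) * (1/s z) * F t z + (AWB q a b c d (q*t) - (z+1/z)) * F (q*t) z + AWA q a b c d (q*t) * s z * F (q^2*t) z = (0::complex)"

text \<open>\<open>m\<close> is the multiplier that the removed power factors acquire under
  \<open>z \<mapsto> q * z\<close>.\<close>

definition Zrel where "Zrel t m F z \<longleftrightarrow> (q-z^2)*((1-a*z)*(1-b*z)*(1-c*z)*(1-d*z)) * (m * F t (q*z)) - A0 t z * F t z +
 (1-q*z^2)*((z-a)*(z-b)*(z-c)*(z-d)) * (1/m * F t (1/q*z)) = (0::complex)"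

lemma RR_L_small:
 assumes t: "tok t" "tok (q*t)" "tok (q^2*t)" and z: "zgood t z" "zgood (q*t) z" "zgood (q^2*t) z" and x: "norm (q*z/a) < 1"
 shows "Lrel t (%z. a/z) RR z"
proof -
 have z0: "z ~= 0" using z by (simp add: zgood_def)
 have k: "KR (q^2*t) z = KR t z * rho t z * rho (q*t) z"
 using KR_qt[OF t(2) z(2)] KR_qt[OF t(1) z(1)] by (simp add: sqr_eq mult.assoc)
 have "AWC q a b c d (q*t) * (1/(a/z)) * RR t z + (AWB q a b c d (q*t) - (z+1/z)) * RR (q*t) z + AWA q a b c d (q*t) * (a/z) * RR (q^2*t) z =
 KR t z * (AWC q a b c d (q*t) * (z/a) * WR t z + (AWB q a b c d (q*t) - (z+1/z)) * (rho t z * WR (q*t) z) +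
 rho t z * (AWA q a b c d (q*t) * (a/z) * rho (q*t) z) * WR (q^2*t) z)"
 unfolding RR_eq[OF t(1) z(1)] RR_eq[OF t(2) z(2)] RR_eq[OF t(3) z(3)] KR_qt[OF t(1) z(1)] k by (simp add: algebra_simps)
 also have "... = KR t z * rho t z * (Gm t * WR t z + (AWB q a b c d (q*t) - (z+1/z)) * WR (q*t) z + Hm t * WR (q^2*t) z)"
 unfolding Hm_rho[OF t(1,2) z0] Gm_rho[OF t(1), symmetric] by (simp only: distrib_left mult_ac)
 finally show ?thesis using R_gamma[OF t z x] by (simp add: Lrel_def)
qed

lemma SS_L_small:
 assumes t: "tok t" "tok (q*t)" "tok (q^2*t)" and z: "zgood t z" "zgood (q*t) z" "zgood (q^2*t) z" and x: "norm (a*z) < 1"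
 shows "Lrel t (%z. a*z) SS z"
proof -
 have z0: "z ~= 0" using z by (simp add: zgood_def)
 define s where "s = a*z"
 have s0: "s ~= 0" using z0 abcd by (simp add: s_def)
 have "AWC q a b c d (q*t) * (1/s) * SS t z + (AWB q a b c d (q*t) - (z+1/z)) * SS (q*t) z + AWA q a b c d (q*t) * s * SS (q^2*t) z =
 KS z/s * (AWC q a b c d (q*t) * WS t z + (AWB q a b c d (q*t) - (z+1/z)) * (s * WS (q*t) z) + AWA q a b c d (q*t) * (s * (s * WS (q^2*t) z)))"
 unfolding SS_eq[OF t(1) z(1)] SS_eq[OF t(2) z(2)] SS_eq[OF t(3) z(3)] distrib_left using s0 by (simp add: mult_ac)
 then show ?thesis using S_gamma[OF t z x] by (simp add: Lrel_def s_def)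
qed

lemma RR_Z_small:
 assumes t: "tok t" and z: "zgood t z" "zgood t (z/q)" "zgood t (q*z)" and x: "norm (z/a) < 1" "norm (q*z/a) < 1"
 shows "Zrel t (1/t) RR z"
proof -
 have z0: "z ~= 0" "t ~= 0" using z t by (auto simp: zgood_def tok_def)
 have e: "q*(z/q) = z" "1/q*z = z/q" using q by simp_all
 have 1: "1-a*z ~= 0" "1-a*(z/q) ~= 0" using one_minus[of "a*z"] one_minus[of "a*(z/q)"] z by (simp_all add: zgood_def)
 define X where "X = q-z^2"
 define Y where "Y = 1-q*z^2"
 define b1 b2 b3 where "b1 = 1-b*z" "b2 = 1-c*z" "b3 = 1-d*z"
 define c1 c2 c3 where "c1 = 1-b/(q*z)" "c2 = 1-c/(q*z)" "c3 = 1-d/(q*z)"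
 define d1 d2 d3 where "d1 = 1-b/z" "d2 = 1-c/z" "d3 = 1-d/z"
 define y1 y2 v where "y1 = 1-a*z" "y2 = 1-a*(z/q)" "v = z-a"
 note df = X_def Y_def b1_b2_b3_def c1_c2_c3_def d1_d2_d3_def y1_y2_v_def
 have k1: "KR t (q*z) = KR t z * (c1*c2*c3/y1 * (-(a*t*z)))" using KR_qz[OF t z(1)] by (simp add: df)
 have k2: "KR t z = KR t (z/q) * (d1*d2*d3/y2 * (-(a*t*(z/q))))" using KR_qz[OF t z(2)] unfolding e by (simp add: df)
 have zu: "z - b = z*d1" "z - c = z*d2" "z - d = z*d3" using z0 by (simp_all add: df right_diff_distrib)
 have E: "- (a*z*X*(b1*b2*b3)*(c1*c2*c3)) * WR t (q*z) - A0 t z * WR t z - q*z^2/a*y2* v * Y * WR t (z/q) = 0"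
 using R_three_term[OF t z x] by (simp add: df)
 have A: "X*(y1*b1*b2*b3)*(1/t * RR t (q*z)) = KR t z * (- (a*z*X*(b1*b2*b3)*(c1*c2*c3)) * WR t (q*z))"
 unfolding RR_eq[OF t z(3)] k1 using z0 1 by (simp add: df(6)[symmetric] y1_y2_v_def(1)[symmetric] mult_ac)
 have B: "Y*(v * (z-b)*(z-c)*(z-d))*(t * RR t (z/q)) = KR t z * (- (q*z^2/a*y2* v * Y) * WR t (z/q))"
 unfolding RR_eq[OF t z(2)] k2 zu using z0 1 q abcd(1) y1_y2_v_def(2) by (simp add: sqr_eq mult_ac)
 have "X*(y1*b1*b2*b3)*(1/t * RR t (q*z)) - A0 t z * RR t z + Y*(v * (z-b)*(z-c)*(z-d))*(t * RR t (z/q)) =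
 KR t z * (- (a*z*X*(b1*b2*b3)*(c1*c2*c3)) * WR t (q*z) - A0 t z * WR t z - q*z^2/a*y2* v * Y * WR t (z/q))"
 unfolding A B unfolding RR_eq[OF t z(1)] by (simp add: right_diff_distrib mult_ac)
 then show ?thesis unfolding E Zrel_def e by (simp add: df)
qed

lemma SS_Z_small:
 assumes t: "tok t" and z: "zgood t z" "zgood t (z/q)" "zgood t (q*z)" and x: "norm (a*z/q) < 1" "norm (a*z) < 1" "norm (a*(q*z)) < 1"
 shows "Zrel t (P*t/q) SS z"
proof -
 have z0: "z ~= 0" "t ~= 0" using z t by (auto simp: zgood_def tok_def)
 have e: "q*(z/q) = z" "1/q*z = z/q" "q/u*(z/q) = z/u" for u using q by simp_all
 have 1: "1-a*z ~= 0" "1-a*(z/q) ~= 0" using one_minus[of "a*z"] one_minus[of "a*(z/q)"] z by (simp_all add: zgood_def)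
 define X where "X = q-z^2"
 define Y where "Y = 1-q*z^2"
 define b1 b2 b3 where "b1 = 1-b*z" "b2 = 1-c*z" "b3 = 1-d*z"
 define c1 c2 c3 where "c1 = 1-b/(q*z)" "c2 = 1-c/(q*z)" "c3 = 1-d/(q*z)"
 define d1 d2 d3 where "d1 = 1-z/b" "d2 = 1-z/c" "d3 = 1-z/d"
 define y1 y2 v where "y1 = 1-a*z" "y2 = 1-a*(z/q)" "v = z-a"
 note df = X_def Y_def b1_b2_b3_def c1_c2_c3_def d1_d2_d3_def y1_y2_v_def
 have cu: "1-q/b*z = -(q*z/b)*c1" "1-q/c*z = -(q*z/c)*c2" "1-q/d*z = -(q*z/d)*c3"
 using z0 q abcd by (simp_all add: df right_diff_distrib)
 have k1: "KS (q*z) = KS z * ((-(q*z/b)*c1)*(-(q*z/c)*c2)*(-(q*z/d)*c3)/y1)" using KS_qz[OF z(1)] unfolding cu by (simp add: df)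
 have k2: "KS z = KS (z/q) * (d1*d2*d3/y2)" using KS_qz[OF z(2)] unfolding e by (simp add: df)
 have zu: "z - b = -b*d1" "z - c = -c*d2" "z - d = -d*d3" using abcd by (simp_all add: df right_diff_distrib)
 have E: "- (a*t*q^2*z^3*X*(b1*b2*b3)*(c1*c2*c3)) * WS t (q*z) - A0 t z * WS t z - q/(a*t)*y2* v * Y * WS t (z/q) = 0"
 using S_three_term[OF t z x] by (simp add: df)
 have A: "X*(y1*b1*b2*b3)*(P*t/q * SS t (q*z)) = KS z * (- (a*t*q^2*z^3*X*(b1*b2*b3)*(c1*c2*c3)) * WS t (q*z))"
 unfolding SS_eq[OF t z(3)] k1 using z0 1 q abcd y1_y2_v_def(1) by (simp add: sqr_eq power3_eq_cube mult_ac)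
 have B: "Y*(v * (z-b)*(z-c)*(z-d))*(q/(P*t) * SS t (z/q)) = KS z * (- (q/(a*t)*y2* v * Y) * WS t (z/q))"
 unfolding SS_eq[OF t z(2)] k2 zu using z0 1 q abcd y1_y2_v_def(2) by (simp add: mult_ac)
 have "X*(y1*b1*b2*b3)*(P*t/q * SS t (q*z)) - A0 t z * SS t z + Y*(v * (z-b)*(z-c)*(z-d))*(q/(P*t) * SS t (z/q)) =
 KS z * (- (a*t*q^2*z^3*X*(b1*b2*b3)*(c1*c2*c3)) * WS t (q*z) - A0 t z * WS t z - q/(a*t)*y2* v * Y * WS t (z/q))"
 unfolding A B unfolding SS_eq[OF t z(1)] by (simp add: right_diff_distrib mult_ac)
 then show ?thesis unfolding E Zrel_def e by (simp add: df)
qed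

lemma RR_analytic:
 assumes "z0 ~= 0" "t ~= 0" "qp q (b*c*d/z0) ~= 0" "qp q (b*c*t) ~= 0" "qp q (b*d*t) ~= 0" "qp q (c*d*t) ~= 0" "qp q (a*z0*t) ~= 0"
 and reg: "W87_regular (b*c*d/(q*z0)) [b/z0, c/z0, d/z0, P*t/q, 1/t] q (q*z0/a)"
 shows "RR t analytic_on {z0}"
proof -
 have "(%z. W87 (b*c*d/(q*z)) (map (%f. f z) [%z. b/z, %z. c/z, %z. d/z, %z. P*t/q, %z. 1/t]) q (q*z/a)) analytic_on {z0}"
 by (rule W87_analytic[OF q]) (use assms q abcd in \<open>auto intro!: analytic_intros\<close>)
 then have W: "(%z. W87 (b*c*d/(q*z)) [b/z, c/z, d/z, P*t/q, 1/t] q (q*z/a)) analytic_on {z0}" by simp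
 show ?thesis unfolding RR_def[abs_def] by (intro analytic_intros W qp_analytic[OF q]) (use assms abcd in auto)
qed

lemma SS_analytic:
 assumes "z0 ~= 0" "t ~= 0" "qp q (z0*q/a) ~= 0" "qp q (z0*q/b) ~= 0" "qp q (z0*q/c) ~= 0" "qp q (z0*q/d) ~= 0"
 "qp q (b*c*t) ~= 0" "qp q (b*d*t) ~= 0" "qp q (c*d*t) ~= 0" "qp q (t*q) ~= 0" "qp q (b*c*d*z0*t^2*q) ~= 0"
 and reg: "W87_regular (b*c*d*z0*t^2) [b*c*t, b*d*t, c*d*t, t*q, z0*q/a] q (a*z0)"
 shows "SS t analytic_on {z0}"
proof -
 have "(%z. W87 (b*c*d*z*t^2) (map (%f. f z) [%z. b*c*t, %z. b*d*t, %z. c*d*t, %z. t*q, %z. z*q/a]) q (a*z)) analytic_on {z0}"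
 by (rule W87_analytic[OF q]) (use assms q abcd in \<open>auto intro!: analytic_intros\<close>)
 then have W: "(%z. W87 (b*c*d*z*t^2) [b*c*t, b*d*t, c*d*t, t*q, z*q/a] q (a*z)) analytic_on {z0}" by simp
 show ?thesis unfolding SS_def[abs_def] by (intro analytic_intros W qp_analytic[OF q]) (use assms abcd in auto)
qed

lemma zgood_nz: "zgood t z ==> z ~= 0"
 by (simp add: zgood_def)

lemma regular_of_Wok: assumes "Wok q ga as 0" "qp q x ~= 0" shows "W87_regular ga as q x"
 using assms by (auto simp: Wok_def W87_regular_iff[OF q] poles_iff[OF q])

lemma R_regular_good:
 assumes t: "tok t" and z: "zgood t z"
 shows "W87_regular (b*c*d/(q*z)) [b/z, c/z, d/z, P*t/q, 1/t] q (q*z/a)"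
proof (rule regular_of_Wok)
 show "Wok q (b*c*d/(q*z)) [b/z, c/z, d/z, P*t/q, 1/t] 0"
 proof (rule WokI5)
 show "q * (b*c*d/(q*z)) = b/z * (c*d)" "q * (b*c*d/(q*z)) = c/z * (b*d)" "q * (b*c*d/(q*z)) = d/z * (b*c)"
 "q * (b*c*d/(q*z)) = P*t/q * (q/(a*t)/z)" "q * (b*c*d/(q*z)) = 1/t * (b*c*d*t/z)"
 using z t q abcd by (simp_all add: zgood_def tok_def field_simps)
 qed (use z t const q abcd in \<open>simp_all add: zgood_def tok_def\<close>)
qed (use z in \<open>simp add: zgood_def\<close>)

lemma S_regular_good:
 assumes t: "tok t" and z: "zgood t z"
 shows "W87_regular (b*c*d*z*t^2) [b*c*t, b*d*t, c*d*t, t*q, z*q/a] q (a*z)"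
proof (rule regular_of_Wok)
 have e: "b*c*d*z*t^2 = b*c*d*t^2*z" "t*q = q*t" "z*q/a = q/a*z" by simp_all
 show "Wok q (b*c*d*z*t^2) [b*c*t, b*d*t, c*d*t, t*q, z*q/a] 0" unfolding e
 proof (rule WokI5)
 show "q * (b*c*d*t^2*z) = b*c*t * (q*(d*t*z))" "q * (b*c*d*t^2*z) = b*d*t * (q*(c*t*z))" "q * (b*c*d*t^2*z) = c*d*t * (q*(b*t*z))"
 "q * (b*c*d*t^2*z) = q*t * (b*c*d*t*z)" "q * (b*c*d*t^2*z) = q/a*z * (P*t^2)"
 using z t q abcd by (simp_all add: zgood_def tok_def field_simps sqr_eq)
 qed (use z t const q abcd qp_up[of "b*t*z"] qp_up[of "c*t*z"] qp_up[of "d*t*z"] in \<open>simp_all add: zgood_def tok_def\<close>)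
qed (use z in \<open>simp add: zgood_def\<close>)

lemma RR_good: assumes t: "tok t" and z: "zgood t z" shows "RR t analytic_on {z}"
proof (rule RR_analytic)
 have "q*(b*c*d/q/z) = b*c*d/z" using q by simp
 then show "qp q (b*c*d/z) ~= 0" using qp_up[of "b*c*d/q/z"] z by (simp add: zgood_def)
 have e: "a*z*t = a*t*z" by simp
 show "qp q (a*z*t) ~= 0" unfolding e using z by (simp add: zgood_def)
qed (use t z R_regular_good[OF t z] in \<open>auto simp: zgood_def tok_def\<close>)

lemma SS_good: assumes t: "tok t" and z: "zgood t z" shows "SS t analytic_on {z}"
proof (rule SS_analytic)
 have e: "z*q/u = q/u*z" "t*q = q*t" "b*c*d*z*t^2*q = q*(b*c*d*t^2*z)" for u by simp_all
 show "qp q (z*q/a) ~= 0" "qp q (z*q/b) ~= 0" "qp q (z*q/c) ~= 0" "qp q (z*q/d) ~= 0" "qp q (t*q) ~= 0"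
 unfolding e using t z by (auto simp: zgood_def tok_def)
 show "qp q (b*c*d*z*t^2*q) ~= 0" unfolding e using z by (intro qp_up) (simp add: zgood_def)
qed (use t z S_regular_good[OF t z] in \<open>auto simp: zgood_def tok_def\<close>)

lemma small_extend:
 assumes "generic (%z. H analytic_on {z})" "generic Q" "!!z. Q z ==> norm z < ro ==> H z = (0::complex)" "ro > 0" "H analytic_on {z}"
 shows "H z = 0"
 by (rule generic_continuation[OF assms(1,2) open_ball[of 0 ro] _ _ assms(5), where u = 0]) (use assms in auto)

text \<open>The recurrence is required at every point where the functions are analytic, not merely
  at generic ones, because the eigenvalue equation is claimed at all regular points.\<close>

lemma Lrel_extend:
 assumes F: "!!t z. tok t ==> zgood t z ==> F t analytic_on {z}"
 and s: "!!z. z ~= 0 ==> s analytic_on {z} & s z ~= 0"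
 and small: "!!z. zgood t z ==> zgood (q*t) z ==> zgood (q^2*t) z ==> norm z < ro ==> Lrel t s F z" "ro > 0"
 and t: "tok t" "tok (q*t)" "tok (q^2*t)"
 and z: "z ~= 0" "F t analytic_on {z}" "F (q*t) analytic_on {z}" "F (q^2*t) analytic_on {z}"
 shows "Lrel t s F z"
proof -
 define H where "H z = AWC q a b c d (q*t) * (1/s z) * F t z + (AWB q a b c d (q*t) - (z+1/z)) * F (q*t) z + AWA q a b c d (q*t) * s z * F (q^2*t) z" for z
 have an: "H analytic_on {z}" if "z ~= 0" "F t analytic_on {z}" "F (q*t) analytic_on {z}" "F (q^2*t) analytic_on {z}" for z
 unfolding H_def using that s[OF that(1)] by (intro analytic_intros) auto
 define Q where "Q z \<longleftrightarrow> zgood t z & zgood (q*t) z & zgood (q^2*t) z" for z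
 have Q: "generic Q" unfolding Q_def by (intro generic_conj generic_zgood)
 have "H z = 0"
 proof (rule small_extend[OF _ Q _ small(2) an[OF z]])
 show "generic (%z. H analytic_on {z})"
 by (rule generic_mono[OF Q], rule an) (use t F in \<open>auto simp: Q_def dest: zgood_nz\<close>)
 show "H z = 0" if "Q z" "norm z < ro" for z using small(1)[of z] that by (simp add: Q_def Lrel_def H_def)
 qed
 then show ?thesis by (simp add: Lrel_def H_def)
qed

text \<open>Validity for generic \<open>z\<close> suffices here, since operators in \<open>z\<close>
  are compared only off countable sets.\<close>

lemma Zrel_extend:
 assumes F: "!!z. zgood t z ==> F t analytic_on {z}"
 and small: "!!z. zgood t z ==> zgood t (z/q) ==> zgood t (q*z) ==> norm z < ro ==> Zrel t m F z" "ro > 0"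
 shows "generic (Zrel t m F)"
proof -
 define H where "H z = (q-z^2)*((1-a*z)*(1-b*z)*(1-c*z)*(1-d*z)) * (m * F t (q*z)) - A0 t z * F t z +
 (1-q*z^2)*((z-a)*(z-b)*(z-c)*(z-d)) * (1/m * F t (1/q*z))" for z
 define Q where "Q z \<longleftrightarrow> zgood t z & zgood t (1/q*z) & zgood t (q*z)" for z
 have Q: "generic Q" unfolding Q_def
 by (intro generic_conj generic_zgood generic_scale[OF _ generic_zgood]) (use q in auto)
 have an: "H analytic_on {z}" if "Q z" for z
 unfolding H_def A0_def using that F[of z] analytic_scale[of "F t" q z] analytic_scale[of "F t" "1/q" z] F[of "q*z"] F[of "1/q*z"]
 by (intro analytic_intros) (auto simp: Q_def)
 have gen: "generic (%z. H analytic_on {z})" by (rule generic_mono[OF Q an])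
 have "H z = 0" if "H analytic_on {z}" for z
 proof (rule small_extend[OF gen Q _ small(2) that])
 show "H z = 0" if "Q z" "norm z < ro" for z using small(1)[of z] that by (simp add: Q_def Zrel_def H_def)
 qed
 from generic_mono[OF gen this] have g: "generic (%z. H z = 0)" .
 have e: "Zrel t m F = (%z. H z = 0)" unfolding H_def by (rule ext) (rule Zrel_def)
 show ?thesis unfolding e by (rule g)
qed

lemma Lrel_RR:
 assumes t: "tok t" "tok (q*t)" "tok (q^2*t)"
 and z: "z ~= 0" "RR t analytic_on {z}" "RR (q*t) analytic_on {z}" "RR (q^2*t) analytic_on {z}"
 shows "Lrel t (%z. a/z) RR z"
proof (rule Lrel_extend[OF RR_good _ _ _ t z, where ro = "norm (a/q)"])
 show "Lrel t (%z. a/z) RR z" if "zgood t z" "zgood (q*t) z" "zgood (q^2*t) z" "norm z < norm (a/q)" for z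
 proof (rule RR_L_small[OF t that(1-3)])
 have "norm z * norm q < norm a" using that(4) q by (simp add: norm_divide field_simps)
 then show "norm (q*z/a) < 1" using abcd by (simp add: norm_divide norm_mult mult.commute)
 qed
qed (use abcd q in \<open>auto intro!: analytic_intros\<close>)

lemma Lrel_SS:
 assumes t: "tok t" "tok (q*t)" "tok (q^2*t)"
 and z: "z ~= 0" "SS t analytic_on {z}" "SS (q*t) analytic_on {z}" "SS (q^2*t) analytic_on {z}"
 shows "Lrel t (%z. a*z) SS z"
proof (rule Lrel_extend[OF SS_good _ _ _ t z, where ro = "1 / norm a"])
 show "Lrel t (%z. a*z) SS z" if "zgood t z" "zgood (q*t) z" "zgood (q^2*t) z" "norm z < 1 / norm a" for z
 by (rule SS_L_small[OF t that(1-3)]) (use that(4) abcd in \<open>simp add: norm_mult field_simps\<close>)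
qed (use abcd q in \<open>auto intro!: analytic_intros\<close>)

lemma Zrel_RR: assumes t: "tok t" shows "generic (Zrel t (1/t) RR)"
proof (rule Zrel_extend[where F = RR and t = t and ro = "norm a"])
 show "RR t analytic_on {z}" if "zgood t z" for z by (rule RR_good[OF t that])
 show "Zrel t (1/t) RR z" if "zgood t z" "zgood t (z/q)" "zgood t (q*z)" "norm z < norm a" for z
 proof (rule RR_Z_small[OF t that(1-3)])
 show x: "norm (z/a) < 1" using that(4) abcd by (simp add: norm_divide)
 have "norm q * norm (z/a) <= 1 * norm (z/a)" using q by (intro mult_right_mono) auto
 then show "norm (q*z/a) < 1" using x by (simp add: norm_mult norm_divide)
 qed
qed (use abcd in auto)

lemma Zrel_SS: assumes t: "tok t" shows "generic (Zrel t (P*t/q) SS)"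
proof (rule Zrel_extend[where F = SS and t = t and ro = "norm (q/a)"])
 show "SS t analytic_on {z}" if "zgood t z" for z by (rule SS_good[OF t that])
 show "Zrel t (P*t/q) SS z" if "zgood t z" "zgood t (z/q)" "zgood t (q*z)" "norm z < norm (q/a)" for z
 proof (rule SS_Z_small[OF t that(1-3)])
 have x: "norm (a*z) < norm q" using that(4) abcd by (simp add: norm_divide norm_mult field_simps)
 then show "norm (a*z/q) < 1" using q by (simp add: norm_divide)
 show y: "norm (a*z) < 1" using x q by simp
 have "norm q * norm (a*z) <= 1 * norm (a*z)" using q by (intro mult_right_mono) auto
 then show "norm (a*(q*z)) < 1" using y by (simp add: norm_mult mult_ac)
 qed
qed (use abcd q in auto)

text \<open>A numerator parameter \<open>1\<close> kills all terms but the first. This evaluates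
  \<open>R\<close> at \<open>z = b\<close>, where \<open>b / z = 1\<close>.\<close>

lemma W87_unit_parameter:
 assumes reg: "W87_regular ga (1 # as) q x"
 shows "W87 ga (1 # as) q x = 1"
proof -
 define r p N where "r = rW q ga (1 # as)" and "p = pW q ga (1 # as)" and "N = length as + 1"
 have pair: "ratio_pair (N + 3) r p" unfolding r_def p_def N_def by (rule ratio_pair_W) simp
 have qr: "qreg q p" and xp: "x \<notin> W87_poles q" using reg by (auto simp: W87_regular_iff[OF q] p_def)
 define H where "H y = qcont q (N + 3) r p y - 1" for y
 have an: "H analytic_on {y}" if "qp q y ~= 0" for y
 unfolding H_def using qcont_analytic[OF q apoly_const apoly_const, of "%y. y" y "N + 3" r p] pair qr that
 by (intro analytic_intros) (auto simp: poles_iff[OF q])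
 have gen: "generic (%y. qp q y ~= 0)" using generic_qp(1)[OF q, of 1] by simp
 have "H x = 0"
 proof (rule small_extend[OF generic_mono[OF gen an] gen _ zero_less_one])
 show "H y = 0" if "norm y < 1" for y
 proof -
 have z: "qc q r p (Suc k) = 0" for k
 unfolding qc_def[OF q] by (rule prod_zero[OF _ bexI[of _ 0]]) (auto simp: r_def poly_rW)
 have one: "qc q r p 0 = 1" by (simp add: qc_def[OF q])
 have e: "qc q r p k * y ^ k = (if k = 0 then 1 else 0)" for k by (cases k) (simp_all only: z one, simp_all)
 have "(%k. if k = 0 then 1 else 0) sums qcont q (N + 3) r p y" using qcont_sums[OF q pair qr that] unfolding e .
 moreover have "(%k. if k = 0 then 1 else (0::complex)) sums 1" using sums_single[of 0 "%_. 1::complex"] by (simp add: eq_commute)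
 ultimately show ?thesis using sums_unique2 by (force simp: H_def)
 qed
 show "H analytic_on {x}" by (rule an) (use xp in \<open>simp add: poles_iff[OF q]\<close>)
 qed
 then show ?thesis using W87_eq[OF q reg refl] by (simp add: H_def r_def p_def N_def)
qed

end

section \<open>Powers, and the separation of the two shifts in z\<close>

lemma powr_shift:
 fixes w g :: complex
 assumes "w ~= 0"
 shows "w powr (g - 1) = w powr g / w" "w powr (g + 1) = w powr g * w" "w powr (2 * g) = (w powr g)^2" "w powr (- g) = 1 / w powr g"
 "w powr (2 * g - 1) = (w powr g)^2 / w" "w powr (2 * g - 2) = (w powr g)^2 / w^2" "w powr (2 * g + 1) = (w powr g)^2 * w"
proof -
 have e: "exp (ln w) = w" using assms by simp
 have d: "exp (2 * g * ln w) = (exp (g * ln w))^2" "exp (2 * ln w) = w^2"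
 using exp_double[of "g * ln w"] exp_double[of "ln w"] e by (simp_all add: mult.assoc)
 show "w powr (g - 1) = w powr g / w" "w powr (g + 1) = w powr g * w" "w powr (2 * g) = (w powr g)^2" "w powr (- g) = 1 / w powr g"
 "w powr (2 * g - 1) = (w powr g)^2 / w" "w powr (2 * g - 2) = (w powr g)^2 / w^2" "w powr (2 * g + 1) = (w powr g)^2 * w"
 using assms d e by (simp_all add: powr_def ring_distribs exp_diff exp_add exp_minus inverse_eq_divide)
qed

lemma powr_int_add:
 fixes w e :: complex assumes "w ~= 0" shows "w powr (of_int n + e) = w powr e * w powi n"
proof -
 have "exp (ln w) powi n = exp (of_int n * ln w)" by (rule exp_power_int)
 then have "w powi n = exp (of_int n * ln w)" using assms by simp
 then show ?thesis using assms by (simp add: powr_def ring_distribs exp_add)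
qed

text \<open>A positive factor leaves the argument of \<open>z\<close> alone, so the principal branch
  is respected; this is where it matters that \<open>q\<close> is real.\<close>

lemma powr_scale_real:
 fixes z s :: complex
 assumes "0 < x" shows "(of_real x * z) powr s = of_real x powr s * z powr s"
proof (cases "z = 0")
 case False
 then have "ln (of_real x * z) = of_real (ln x) + ln z" using assms by (simp add: Ln_times_of_real Ln_of_real)
 with False assms show ?thesis by (simp add: powr_def ring_distribs exp_add Ln_of_real)
qed simp

lemma cancel_nested1: "q ~= 0 ==> X * (y / q) / (a * (z / q) * w) = X * y / (a * z * w)" for q :: "'a::field"
 by (cases "a = 0 | z = 0 | w = 0") (auto simp: field_simps)

lemma cancel_nested3: "q ~= 0 ==> X * (u / q) * (v / q) * (w / q) / ((y / q^2) * (z / q)) = X * u * v * w / (y * z)" for q :: "'a::field"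
 by (cases "y = 0 | z = 0") (auto simp: field_simps sqr_eq)

lemma AW_A_eq: "q ~= 0 ==> AW_A q a b c d g = AWA q a b c d (q powr g)"
proof -
 assume q: "q ~= 0"
 have e: "1 - a*b*c*d * (q powr g / q) = (q - a*b*c*d * q powr g) / q" "1 - a*b*c*d * ((q powr g)^2 / q) = (q - a*b*c*d * (q powr g)^2) / q"
 using q by (simp_all add: diff_divide_distrib)
 show ?thesis unfolding AW_A_def AWA_def powr_shift[OF q] e by (rule cancel_nested1[OF q])
qed

lemma AW_C_eq: "q ~= 0 ==> AW_C q a b c d g = AWC q a b c d (q powr g)"
proof -
 assume q: "q ~= 0"
 have e: "1 - x * (q powr g / q) = (q - x * q powr g) / q" "1 - x * ((q powr g)^2 / q) = (q - x * (q powr g)^2) / q"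
 "1 - x * ((q powr g)^2 / q^2) = (q^2 - x * (q powr g)^2) / q^2" for x
 using q by (simp_all add: diff_divide_distrib)
 show ?thesis unfolding AW_C_def AWC_def powr_shift[OF q] e by (rule cancel_nested3[OF q])
qed

lemma AW_B_eq: "q ~= 0 ==> AW_B q a b c d g = AWB q a b c d (q powr g)"
 by (simp add: AW_B_def AWB_def AW_A_eq AW_C_eq)

text \<open>The equation in \<open>z\<close> contains both shifts at once. Applying the recurrence
  in \<open>n\<close> to it, with the eigenvalues at \<open>q * z\<close>, \<open>z / q\<close> and
  \<open>z\<close>, gives a second linear relation between them, and the shifts separate.\<close>

lemma spectral_shift_identity:
 fixes A :: "'a::comm_ring_1"
 assumes "A*y1 + B*y0 + C*ym = xp*y0" "A*w1 + B*w0 + C*wm = xm*w0" "A*p1 + B*p0 + C*pm = x*p0"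
 "X*y0 + Y*w0 = M0*p0" "X*y1 + Y*w1 = M1*p1" "X*ym + Y*wm = Mm*pm"
 shows "X*(xp-xm)*y0 = (B*M0 + (x-B)*Mm - xm*M0)*p0 + A*(M1-Mm)*p1"
 and "Y*(xm-xp)*w0 = (B*M0 + (x-B)*Mm - xp*M0)*p0 + A*(M1-Mm)*p1"
proof -
 have "X*(xp*y0) + Y*(xm*w0) = A*(X*y1 + Y*w1) + B*(X*y0 + Y*w0) + C*(X*ym + Y*wm)"
 unfolding assms(1,2)[symmetric] by (simp add: algebra_simps)
 also have "... = A*(M1*p1) + B*(M0*p0) + Mm*(C*pm)" unfolding assms(4-6) by (simp add: mult_ac)
 also have "C*pm = x*p0 - A*p1 - B*p0" unfolding assms(3)[symmetric] by simp
 finally have e: "X*(xp*y0) + Y*(xm*w0) = A*(M1*p1) + B*(M0*p0) + Mm*(x*p0 - A*p1 - B*p0)" .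
 have "X*(xp-xm)*y0 = (X*(xp*y0) + Y*(xm*w0)) - xm*(X*y0 + Y*w0)" by (simp add: algebra_simps)
 then show "X*(xp-xm)*y0 = (B*M0 + (x-B)*Mm - xm*M0)*p0 + A*(M1-Mm)*p1" unfolding e assms(4) by (simp add: algebra_simps)
 have "Y*(xm-xp)*w0 = (X*(xp*y0) + Y*(xm*w0)) - xp*(X*y0 + Y*w0)" by (simp add: algebra_simps)
 then show "Y*(xm-xp)*w0 = (B*M0 + (x-B)*Mm - xp*M0)*p0 + A*(M1-Mm)*p1" unfolding e assms(4) by (simp add: algebra_simps)
qed

lemma q_power_ne_1: fixes q :: complex assumes "norm q < 1" shows "q ^ Suc k ~= 1"
proof
 assume "q ^ Suc k = 1"
 then have "norm q ^ Suc k = 1" by (metis norm_one norm_power)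
 moreover have "norm q ^ Suc k < 1" using assms mult_left_le[of "norm q ^ k" "norm q"] power_le_one[of "norm q" k] by simp
 ultimately show False by simp
qed

lemma qp_ne: assumes "q ~= 0" "norm q < 1" "qp q w ~= 0" shows "w * q ^ i ~= 1"
 using assms qp_eq_0_iff[OF assms(1,2), of w] by auto

lemma W87_regularI:
 assumes q: "q ~= 0" "norm q < 1" and s: "qp q ga ~= 0" and as: "!!a. a \<in> set as ==> qp q (q * (ga / a)) ~= 0" and x: "qp q x ~= 0"
 shows "W87_regular ga as q x"
proof -
 have "poly (pW q ga as) (q ^ Suc k) ~= 0" for k
 proof -
 have 1: "1 - q ^ Suc k ~= 0" using q_power_ne_1[OF q(2), of k] by simp
 have "ga / q^2 * (q ^ Suc k)^2 = ga * q ^ (k * 2)" using q by (simp add: power_mult_distrib power_mult)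
 then have 2: "1 - ga / q^2 * (q ^ Suc k)^2 ~= 0" using qp_ne[OF q s, of "k * 2"] by simp
 have "1 - ga / a * q ^ Suc k ~= 0" if "a \<in> set as" for a
 proof -
 have e: "ga / a * q ^ Suc k = q * (ga / a) * q ^ k" by simp
 show ?thesis unfolding e using qp_ne[OF q as[OF that], of k] by simp
 qed
 note n = this
 have 3: "(\<Prod>a\<leftarrow>as. 1 - ga / a * q ^ Suc k) ~= 0"
 proof
 assume "(\<Prod>a\<leftarrow>as. 1 - ga / a * q ^ Suc k) = 0"
 then have "0 \<in> (%a. 1 - ga / a * q ^ Suc k) ` set as" by (simp only: prod_list_zero_iff set_map)
 then obtain a where "a \<in> set as" "0 = 1 - ga / a * q ^ Suc k" by blast
 with n show False by metis
 qed
 show ?thesis unfolding poly_pW using 1 2 3 by simp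
 qed
 then show ?thesis using x by (simp add: W87_regular_iff[OF q] qreg_def[OF q] poles_iff[OF q])
qed

text \<open>This is the \<open>q\<close>-binomial series. By its functional equation a zero at
  \<open>x\<close> would propagate along \<open>x * q ^ n\<close> to the limit \<open>0\<close>,
  where the value is \<open>1\<close>.\<close>

lemma q_binomial_nonzero:
 assumes q: "q ~= 0" "norm q < 1" and x: "norm x < 1" "!!i. e * x * q ^ i ~= 1"
 shows "(\<Sum>k. qc q [:1, - e:] [:1, - 1:] k * x ^ k) ~= 0"
proof
 define F where "F x = (\<Sum>k. qc q [:1, - e:] [:1, - 1:] k * x ^ k)" for x
 assume "(\<Sum>k. qc q [:1, - e:] [:1, - 1:] k * x ^ k) = 0"
 then have F0: "F x = 0" by (simp add: F_def)
 have rp: "ratio_pair 1 [:1, - e:] [:1, - 1:]" by (simp add: ratio_pair_def)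
 have qr: "qreg q [:1, - 1:]" using q_power_ne_1[OF q(2)] by (simp add: qreg_def[OF q])
 have small: "norm (x * q ^ n) < 1" for n
 proof -
 have "norm x * norm q ^ n <= norm x * 1" using q by (intro mult_left_mono power_le_one) auto
 then show ?thesis using x by (simp add: norm_mult norm_power)
 qed
 have z: "F (x * q ^ n) = 0" for n
 proof (induction n)
 case (Suc n)
 define y where "y = x * q ^ n"
 have "(1 - y) * F y = (\<Sum>j=1..1. (y * coeff [:1, - e:] j - coeff [:1, - 1:] j) * F (q ^ j * y))"
 unfolding F_def by (rule qser_functional[OF q rp qr]) (use small[of n] in \<open>simp add: y_def\<close>)
 then have "(1 - y) * F y = (1 - e * y) * F (q * y)" by (simp add: mult.commute)
 moreover have "1 - e * y ~= 0" using x(2)[of n] by (simp add: y_def mult.assoc)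
 ultimately have "F (q * y) = 0" using Suc by (simp add: y_def)
 moreover have "q * y = x * q ^ Suc n" by (simp add: y_def)
 ultimately show ?case by simp
 qed (use F0 in simp)
 have "F analytic_on {0}" unfolding F_def
 by (rule qser_analytic[OF q apoly_const apoly_const _ _ rp qr]) (auto intro: analytic_intros)
 then have c: "isCont F 0" by (rule analytic_at_imp_isCont)
 have "(%n. x * q ^ n) \<longlonglongrightarrow> x * 0" by (intro tendsto_intros LIMSEQ_power_zero q)
 then have "(%n. F (x * q ^ n)) \<longlonglongrightarrow> F 0" by (intro isCont_tendsto_compose[OF c]) simp
 then have "F 0 = 0" unfolding z using LIMSEQ_unique tendsto_const by blast
 moreover have "F 0 = 1" unfolding F_def powser_zero by (simp add: qc_def[OF q])
 ultimately show False by simp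
qed

section \<open>Independence of the two solutions\<close>

locale aw_half = aw_params +
 assumes sq: "\<exists>k::int. a^2 = q powi k" "\<exists>k::int. b^2 = q powi k" "\<exists>k::int. c^2 = q powi k" "\<exists>k::int. d^2 = q powi k"
 and Pint: "\<exists>k::int. a*b*c*d = q powi k"
 and bz: "b^2 ~= 1" "norm (a*b) < 1" "qp q (b*q/a) ~= 0" "qp q (b*q/c) ~= 0" "qp q (b*q/d) ~= 0" "qp q (b^2*q) ~= 0" "qp q (a*b) ~= 0"
begin

text \<open>Up to sign, the half-integral powers of \<open>q\<close>. They form a group, and a
  non-resonant \<open>t\<close> times one of them is never a power of \<open>q\<close>, so infinite
  products with such arguments do not vanish.\<close>

definition hv where "hv v \<longleftrightarrow> v ~= 0 & (\<exists>k::int. v^2 = q powi k)"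
definition nonres where "nonres t \<longleftrightarrow> t ~= 0 & (\<forall>k::int. t^2 ~= q powi k)"

lemma hv_mult: assumes "hv u" "hv v" shows "hv (u * v)"
proof -
 from assms obtain k j :: int where "u^2 = q powi k" "v^2 = q powi j" by (auto simp: hv_def)
 then have "(u * v)^2 = q powi (k + j)" using q by (simp add: power_mult_distrib power_int_add)
 then show ?thesis using assms by (auto simp: hv_def)
qed

lemma hv_inv: assumes "hv u" shows "hv (1 / u)"
proof -
 from assms obtain k :: int where "u^2 = q powi k" by (auto simp: hv_def)
 then have "(1 / u)^2 = q powi (- k)" by (simp add: power_one_over power_int_minus inverse_eq_divide)
 then show ?thesis using assms unfolding hv_def by (intro conjI exI[of _ "- k"]) auto
qed

lemma hv_div: "hv u ==> hv v ==> hv (u / v)"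
 using hv_mult[OF _ hv_inv, of u v] by simp

lemma hv_powi: "hv (q powi n)"
 using q power_int_add[of q n n] by (auto simp: hv_def sqr_eq intro!: exI[of _ "n + n"])

lemma hv_q: "hv q" and hv_1: "hv 1" and hv_pow: "hv (q ^ n)"
 using hv_powi[of 1] hv_powi[of 0] hv_powi[of "int n"] by simp_all

lemma hv_abcd: "hv a" "hv b" "hv c" "hv d"
 using sq abcd by (auto simp: hv_def)

lemmas hv_intros = hv_mult hv_div hv_powi hv_q hv_1 hv_pow hv_abcd

lemma nonres_ne: assumes "nonres t" "hv v" shows "v * t ~= 1"
proof
 assume "v * t = 1"
 then have "t = 1 / v" using assms by (auto simp: hv_def field_simps)
 then show False using hv_inv[OF assms(2)] assms(1) by (auto simp: hv_def nonres_def)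
qed

lemma nonres_qp: assumes "nonres t" "hv v" shows "qp q (v * t) ~= 0"
proof
 assume "qp q (v * t) = 0"
 then obtain i where "v * t * q ^ i = 1" by (auto simp: qp_eq_0_iff[OF q])
 then have "(v * q ^ i) * t = 1" by (simp add: mult_ac)
 then show False using nonres_ne[OF assms(1) hv_mult[OF assms(2) hv_pow]] by simp
qed

lemma nonres_mult: assumes "nonres t" "hv v" shows "nonres (v * t)"
proof -
 have "(v * t)^2 ~= q powi k" for k :: int
 proof
 assume e: "(v * t)^2 = q powi k"
 from hv_inv[OF assms(2)] obtain j :: int where j: "(1 / v)^2 = q powi j" by (auto simp: hv_def)
 have "t = 1 / v * (v * t)" using assms by (simp add: hv_def)
 then have "t^2 = (1 / v)^2 * (v * t)^2" by (metis power_mult_distrib)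
 then have "t^2 = q powi (j + k)" using q by (simp add: e j power_int_add)
 then show False using assms by (auto simp: nonres_def)
 qed
 then show ?thesis using assms by (auto simp: nonres_def hv_def)
qed

lemma nonres_inv: assumes "nonres t" shows "nonres (1 / t)"
proof -
 have "(1 / t)^2 ~= q powi k" for k :: int
 proof
 assume e: "(1 / t)^2 = q powi k"
 have "t^2 = 1 / (1 / t)^2" by (simp add: power_one_over)
 then have "t^2 = q powi (- k)" unfolding e by (simp add: power_int_minus inverse_eq_divide)
 then show False using assms by (auto simp: nonres_def)
 qed
 then show ?thesis using assms by (auto simp: nonres_def)
qed

lemma nonres_P: assumes "nonres t" shows "P*t^2 ~= q powi k"
proof
 assume e: "P*t^2 = q powi k"
 obtain j :: int where j: "P = q powi j" using Pint by auto
 have "t^2 = q powi (k - j)" using e abcd q unfolding j by (simp add: power_int_diff field_simps)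
 then show False using assms by (auto simp: nonres_def)
qed

lemma tok_nonres: assumes t: "nonres t" shows "tok t"
proof -
 have h: "hv (P/q)" "hv (a*b)" "hv (a*c)" "hv (a*d)" "hv (b*c)" "hv (b*d)" "hv (c*d)" "hv (c*d/q)" "hv (b*c/q)" "hv (b*d/q)" "hv (c*d/q^2)"
 by (intro hv_intros)+
 have "qp q (P*t^2) ~= 0"
 proof
 assume "qp q (P*t^2) = 0"
 then obtain i where "P*t^2 * q ^ i = 1" by (auto simp: qp_eq_0_iff[OF q])
 then have "P*t^2 = q powi (- int i)" using q by (simp add: power_int_minus field_simps)
 then show False using nonres_P[OF t] by blast
 qed
 then show ?thesis
 using nonres_qp[OF t h(1)] nonres_qp[OF t h(2)] nonres_qp[OF t h(3)] nonres_qp[OF t h(4)] nonres_qp[OF t h(5)] nonres_qp[OF t h(6)]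
 nonres_qp[OF t h(7)] nonres_qp[OF t h(8)] nonres_qp[OF t h(9)] nonres_qp[OF t h(10)] nonres_qp[OF t h(11)]
 nonres_qp[OF t hv_q] nonres_qp[OF t hv_1] nonres_qp[OF nonres_inv[OF t] hv_1] nonres_P[OF t] t
 by (simp add: tok_def nonres_def)
qed

lemma P_resonance: assumes t: "nonres t" shows "q - P*t^2 ~= 0" "1 - P*t^2 ~= 0" "q^2 - P*t^2 ~= 0"
 using nonres_P[OF t, of 1] nonres_P[OF t, of 0] nonres_P[OF t, of 2] by auto

lemma AWA_nonzero: assumes t: "nonres t" shows "AWA q a b c d t ~= 0"
proof -
 have h: "hv (P/q)" "hv (a*b)" "hv (a*c)" "hv (a*d)" by (intro hv_intros)+
 have "q - P*t ~= 0" using nonres_ne[OF t h(1)] q by (auto simp: field_simps)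
 then show ?thesis unfolding AWA_def using P_resonance[OF t] abcd nonres_ne[OF t h(2)] nonres_ne[OF t h(3)] nonres_ne[OF t h(4)] by simp
qed

lemma AWC_nonzero: assumes t: "nonres t" shows "AWC q a b c d t ~= 0"
proof -
 have h: "hv (b*c/q)" "hv (b*d/q)" "hv (c*d/q)" by (intro hv_intros)+
 have "q - b*c*t ~= 0" "q - b*d*t ~= 0" "q - c*d*t ~= 0"
 using nonres_ne[OF t h(1)] nonres_ne[OF t h(2)] nonres_ne[OF t h(3)] q by (auto simp: field_simps)
 then show ?thesis unfolding AWC_def using P_resonance[OF t] abcd nonres_ne[OF t hv_1] by simp
qed

text \<open>At \<open>z = b\<close> the series has a parameter \<open>1\<close> and collapses, which
  leaves a closed form whose behaviour for small \<open>t\<close> is visible.\<close>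

lemma RR_at_b:
 assumes t: "nonres t"
 shows "RR t b = qp q (a*b) / qp q (c*d) * ((qp q (a*c*t) * qp q (a*d*t)) / (qp q (b*c*t) * qp q (b*d*t)))" "RR t analytic_on {b}"
proof -
 have t0: "t ~= 0" using t by (simp add: nonres_def)
 have h: "hv (a*b)" "hv (b*c)" "hv (b*d)" "hv (c*d)" "hv (q/(a*b))" by (intro hv_intros)+
 have reg: "W87_regular (b*c*d/(q*b)) [1, c/b, d/b, P*t/q, 1/t] q (q*b/a)"
 proof (rule W87_regularI[OF q])
 have e: "b*c*d/(q*b) = c*d/q" using abcd by simp
 show "qp q (b*c*d/(q*b)) ~= 0" unfolding e by (rule const)
 have e: "q * (b*c*d/(q*b) / 1) = c*d" "q * (b*c*d/(q*b) / (c/b)) = b*d" "q * (b*c*d/(q*b) / (d/b)) = b*c"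
 "q * (b*c*d/(q*b) / (P*t/q)) = q/(a*b) * (1/t)" "q * (b*c*d/(q*b) / (1/t)) = c*d*t"
 using abcd q t0 by (simp_all add: field_simps)
 fix v assume "v \<in> set [1, c/b, d/b, P*t/q, 1/t]"
 then have "v = 1 | v = c/b | v = d/b | v = P*t/q | v = 1/t" by (simp only: list.set insert_iff empty_iff simp_thms)
 then show "qp q (q * (b*c*d/(q*b) / v)) ~= 0"
 by (elim disjE; hypsubst; simp only: e const nonres_qp[OF nonres_inv[OF t] h(5)] nonres_qp[OF t h(4)] not_False_eq_True simp_thms)
 qed (use bz in \<open>simp add: mult.commute\<close>)
 have nz: "qp q (a*b*t) ~= 0" "qp q (b*c*t) ~= 0" "qp q (b*d*t) ~= 0" "qp q (c*d*t) ~= 0"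
 using nonres_qp[OF t h(1)] nonres_qp[OF t h(2)] nonres_qp[OF t h(3)] nonres_qp[OF t h(4)] .
 have e: "b/b = 1" "b*c*d/b = c*d" "b*c*d*t/b = c*d*t" using abcd by simp_all
 show "RR t b = qp q (a*b) / qp q (c*d) * ((qp q (a*c*t) * qp q (a*d*t)) / (qp q (b*c*t) * qp q (b*d*t)))"
 unfolding RR_def e W87_unit_parameter[OF reg] using nz by simp
 show "RR t analytic_on {b}"
 by (rule RR_analytic) (use abcd t0 nz const reg e in simp_all)
qed

lemma qp_q: "qp q q ~= 0"
 using q_power_ne_1[OF q(2)] by (auto simp: qp_eq_0_iff[OF q])

lemma SS_at_b:
 assumes t: "nonres t" and s: "qp q (b*c*d*b*t^2) ~= 0"
 shows "SS t analytic_on {b}"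
proof (rule SS_analytic)
 have t0: "t ~= 0" using t by (simp add: nonres_def)
 have h: "hv (b*c)" "hv (b*d)" "hv (c*d)" "hv (q*d*b)" "hv (q*c*b)" "hv (q*b*b)" "hv (b*c*d*b)"
 by (intro hv_intros)+
 have h': "hv (b*c*b*d)" "hv (b*c*d)" by (intro hv_intros)+
 show "qp q (b*c*t) ~= 0" "qp q (b*d*t) ~= 0" "qp q (c*d*t) ~= 0" "qp q (t*q) ~= 0"
 using nonres_qp[OF t h(1)] nonres_qp[OF t h(2)] nonres_qp[OF t h(3)] nonres_qp[OF t hv_q] by (simp_all add: mult.commute)
 show "qp q (b*c*d*b*t^2*q) ~= 0" using qp_up[OF s] by (simp add: mult_ac)
 show "qp q (b*q/b) ~= 0" using qp_q abcd by simp
 show "W87_regular (b*c*d*b*t^2) [b*c*t, b*d*t, c*d*t, t*q, b*q/a] q (a*b)"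
 proof (rule W87_regularI[OF q s])
 have e: "q * (b*c*d*b*t^2 / (b*c*t)) = q*d*b*t" "q * (b*c*d*b*t^2 / (b*d*t)) = q*c*b*t" "q * (b*c*d*b*t^2 / (c*d*t)) = q*b*b*t"
 "q * (b*c*d*b*t^2 / (t*q)) = b*c*d*b*t" "q * (b*c*d*b*t^2 / (b*q/a)) = P*t^2"
 using abcd q t0 by (simp_all add: field_simps sqr_eq)
 have P: "qp q (P*t^2) ~= 0" using tok_nonres[OF t] unfolding tok_def by blast
 fix v assume "v \<in> set [b*c*t, b*d*t, c*d*t, t*q, b*q/a]"
 then have "v = b*c*t | v = b*d*t | v = c*d*t | v = t*q | v = b*q/a" by (simp only: list.set insert_iff empty_iff simp_thms)
 then show "qp q (q * (b*c*d*b*t^2 / v)) ~= 0"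
 by (elim disjE; hypsubst; simp only: e P nonres_qp[OF t h(4)] nonres_qp[OF t h(5)] nonres_qp[OF t h(6)] nonres_qp[OF t h(7)] not_False_eq_True simp_thms)
 qed (rule bz)
qed (use abcd bz t in \<open>auto simp: nonres_def\<close>)

text \<open>At \<open>t = 0\<close> the series degenerates to the \<open>q\<close>-binomial series
  with parameter \<open>b * q / a\<close> and argument \<open>a * b\<close>. Analyticity in
  \<open>t\<close> makes its value the limit along the lattice.\<close>

lemma SS_b_limit: "isCont (%t. SS t b) 0" "SS 0 b ~= 0"
proof -
 have reg0: "W87_regular 0 [0, 0, 0, 0, b*q/a] q (a*b)"
 by (rule W87_regularI[OF q]) (use bz in auto)
 have "(%t. W87 (b*c*d*b*t^2) (map (%f. f t) [%t. b*c*t, %t. b*d*t, %t. c*d*t, %t. t*q, %t. b*q/a]) q (a*b)) analytic_on {0}"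
 proof (rule W87_analytic[OF q])
 \<comment> \<open>At \<open>t = 0\<close> both sides are \<open>0\<close> by the convention
   \<open>x / 0 = 0\<close>, so these quotients are analytic there as well.\<close>
 have key: "x*t^2 / (y*t) = x/y*t" "x*t^2 / (t*y) = x/y*t" for x y t :: complex
 by (cases "t = 0"; simp add: sqr_eq)+
 have nz: "b*q/a ~= 0" using abcd q by simp
 fix f assume "f \<in> set [%t. b*c*t, %t. b*d*t, %t. c*d*t, %t. t*q, %t. b*q/a]"
 then have "f = (%t. b*c*t) | f = (%t. b*d*t) | f = (%t. c*d*t) | f = (%t. t*q) | f = (%t. b*q/a)"
 by (simp only: list.set insert_iff empty_iff simp_thms)
 then show "f analytic_on {0} & (%t. b*c*d*b*t^2 / f t) analytic_on {0}"
 by (elim disjE; hypsubst; (simp only: key)?; intro conjI analytic_intros nz)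
 qed (use reg0 in \<open>auto intro!: analytic_intros\<close>)
 then have W: "(%t. W87 (b*c*d*b*t^2) [b*c*t, b*d*t, c*d*t, t*q, b*q/a] q (a*b)) analytic_on {0}" by simp
 have "(%t. SS t b) analytic_on {0}"
 unfolding SS_def by (intro analytic_intros W qp_analytic[OF q]) (use bz qp_q abcd in auto)
 then show "isCont (%t. SS t b) 0" by (rule analytic_at_imp_isCont)
 have r: "rW q 0 [0, 0, 0, 0, b*q/a] = [:1, - (b*q/a):]" "pW q 0 [0, 0, 0, 0, b*q/a] = [:1, - 1:]"
 by (simp_all add: rW_def pW_def)
 have rp: "ratio_pair (5 + 3) [:1, - (b*q/a):] [:1, - 1:]" unfolding r[symmetric] by (rule ratio_pair_W) simp
 have qr: "qreg q [:1, - 1:]" using q_power_ne_1[OF q(2)] by (simp add: qreg_def[OF q])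
 have "W87 0 [0, 0, 0, 0, b*q/a] q (a*b) = qcont q (5 + 3) [:1, - (b*q/a):] [:1, - 1:] (a*b)"
 unfolding r[symmetric] by (rule W87_eq[OF q reg0]) simp
 also have "... = (\<Sum>k. qc q [:1, - (b*q/a):] [:1, - 1:] k * (a*b) ^ k)"
 by (rule sums_unique[OF qcont_sums[OF q rp qr bz(2)]])
 also have "... ~= 0"
 proof (rule q_binomial_nonzero[OF q bz(2)])
 have "b*q/a * (a*b) = b^2*q" using abcd by (simp add: sqr_eq)
 then show "b*q/a * (a*b) * q ^ i ~= 1" for i using qp_ne[OF q bz(6), of i] by simp
 qed
 finally show "SS 0 b ~= 0" using bz qp_q abcd by (simp add: SS_def)
qed

text \<open>The Casoratian of the two solutions, freed of their power factors.\<close>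

definition DD where "DD t z = a*z * RR t z * SS (q*t) z - a/z * RR (q*t) z * SS t z"

lemma nonres_q: "nonres t ==> nonres (q * t)"
 by (rule nonres_mult[OF _ hv_q])

lemma DD_eventually:
 assumes t: "nonres t0"
 shows "\<forall>\<^sub>F n in sequentially. DD (t0 * q ^ n) b ~= 0 & DD (t0 * q ^ n) analytic_on {b}"
proof -
 have tn: "nonres (t0 * q ^ n)" for n using nonres_mult[OF t hv_pow, of n] by (simp add: mult.commute)
 have x: "(%n. t0 * q ^ n) \<longlonglongrightarrow> 0" using tendsto_mult[OF tendsto_const[of t0] LIMSEQ_power_zero[OF q(2)]] by simp
 have x': "(%n. q * (t0 * q ^ n)) \<longlonglongrightarrow> 0" using tendsto_mult[OF tendsto_const[of q] x] by simp
 define rb where "rb t = qp q (a*b) / qp q (c*d) * ((qp q (a*c*t) * qp q (a*d*t)) / (qp q (b*c*t) * qp q (b*d*t)))" for t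
 have "rb analytic_on {0}" unfolding rb_def by (intro analytic_intros qp_analytic[OF q]) (use const in auto)
 then have rc: "isCont rb 0" by (rule analytic_at_imp_isCont)
 have rb0: "rb 0 ~= 0" using bz const by (simp add: rb_def)
 have DDe: "DD (t0 * q ^ n) b = a*b * rb (t0 * q ^ n) * SS (q*(t0 * q ^ n)) b - a/b * rb (q*(t0 * q ^ n)) * SS (t0 * q ^ n) b" for n
 unfolding DD_def RR_at_b(1)[OF tn] RR_at_b(1)[OF nonres_q[OF tn]] rb_def ..
 have "(%n. DD (t0 * q ^ n) b) \<longlonglongrightarrow> a*b * rb 0 * SS 0 b - a/b * rb 0 * SS 0 b"
 unfolding DDe by (intro tendsto_intros isCont_tendsto_compose[OF rc] isCont_tendsto_compose[OF SS_b_limit(1)] x x')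
 \<comment> \<open>The weights \<open>a * b\<close> and \<open>a / b\<close> of the two products do
   not cancel because \<open>b^2 ~= 1\<close>.\<close>
 moreover have "a*b * rb 0 * SS 0 b - a/b * rb 0 * SS 0 b = a/b*(b^2-1) * rb 0 * SS 0 b"
 using abcd by (simp add: field_simps sqr_eq)
 moreover have "a/b*(b^2-1) * rb 0 * SS 0 b ~= 0" using abcd bz(1) rb0 SS_b_limit(2) by simp
 ultimately have 1: "\<forall>\<^sub>F n in sequentially. DD (t0 * q ^ n) b ~= 0" using tendsto_imp_eventually_ne by metis
 have c: "isCont (%t. qp q (b*c*d*b*t^2)) 0"
 by (rule analytic_at_imp_isCont) (intro qp_analytic[OF q] analytic_intros)
 have "\<forall>\<^sub>F n in sequentially. qp q (b*c*d*b*(t0 * q ^ n)^2) ~= 0" "\<forall>\<^sub>F n in sequentially. qp q (b*c*d*b*(q*(t0 * q ^ n))^2) ~= 0"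
 by (rule tendsto_imp_eventually_ne[OF isCont_tendsto_compose[OF c x]], simp, rule tendsto_imp_eventually_ne[OF isCont_tendsto_compose[OF c x']], simp)
 with 1 show ?thesis
 proof eventually_elim
 case (elim n)
 have "DD (t0 * q ^ n) analytic_on {b}" unfolding DD_def[abs_def]
 by (intro analytic_intros RR_at_b(2) SS_at_b tn nonres_q) (use elim abcd in auto)
 then show ?case using elim by simp
 qed
qed

lemma DD_good:
 assumes "nonres t" "zgood t z" "zgood (q*t) z" shows "DD t analytic_on {z}"
 unfolding DD_def[abs_def] by (intro analytic_intros RR_good SS_good tok_nonres nonres_q) (use assms zgood_nz in auto)

text \<open>The two recurrences give \<open>AWA * DD (q * t) = AWC / a^2 * DD t\<close>, with
  coefficients taken at \<open>q * t\<close>, so nonvanishing passes from \<open>q * t\<close> down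
  to \<open>t\<close>.\<close>

lemma DD_step:
 assumes t: "nonres t" and z: "zgood t z" "zgood (q*t) z" "zgood (q^2*t) z" and D: "DD (q*t) z ~= 0"
 shows "DD t z ~= 0"
proof
 assume D0: "DD t z = 0"
 have z0: "z ~= 0" using zgood_nz[OF z(1)] .
 have tk: "tok t" "tok (q*t)" "tok (q^2*t)"
 using tok_nonres[OF t] tok_nonres[OF nonres_q[OF t]] tok_nonres[OF nonres_mult[OF t hv_pow[of 2]]] by simp_all
 define A B C where "A = AWA q a b c d (q*t)" and "B = AWB q a b c d (q*t) - (z+1/z)" and "C = AWC q a b c d (q*t)"
 define r0 r1 r2 s0 s1 s2 where "r0 = RR t z" and "r1 = RR (q*t) z" and "r2 = RR (q^2*t) z" and "s0 = SS t z" and "s1 = SS (q*t) z" and "s2 = SS (q^2*t) z"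
 have R: "C * (1/(a/z)) * r0 + B * r1 + A * (a/z) * r2 = 0"
 using Lrel_RR[OF tk z0 RR_good[OF tk(1) z(1)] RR_good[OF tk(2) z(2)] RR_good[OF tk(3) z(3)]]
 by (simp only: Lrel_def A_def B_def C_def r0_def r1_def r2_def)
 have S: "C * (1/(a*z)) * s0 + B * s1 + A * (a*z) * s2 = 0"
 using Lrel_SS[OF tk z0 SS_good[OF tk(1) z(1)] SS_good[OF tk(2) z(2)] SS_good[OF tk(3) z(3)]]
 by (simp only: Lrel_def A_def B_def C_def s0_def s1_def s2_def)
 have d0: "a*z * r0 * s1 - a/z * r1 * s0 = 0" using D0 by (simp add: DD_def r0_def r1_def s0_def s1_def)
 have "(C * (1/(a/z)) * r0 + B * r1 + A * (a/z) * r2) * s1 - (C * (1/(a*z)) * s0 + B * s1 + A * (a*z) * s2) * r1 =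
 C/a^2 * (a*z * r0 * s1 - a/z * r1 * s0) - A * (a*z * r1 * s2 - a/z * r2 * s1)"
 using z0 abcd by (simp add: field_simps sqr_eq)
 then have "A * (a*z * r1 * s2 - a/z * r2 * s1) = 0" unfolding R S d0 by simp
 moreover have "DD (q*t) z = a*z * r1 * s2 - a/z * r2 * s1"
 by (simp add: DD_def r1_def r2_def s1_def s2_def sqr_eq mult.assoc)
 moreover have "A ~= 0" unfolding A_def by (rule AWA_nonzero[OF nonres_q[OF t]])
 ultimately show False using D by simp
qed

text \<open>For large \<open>n\<close> a nonzero value at \<open>b\<close> spreads to generic
  \<open>z\<close>. Smaller \<open>n\<close>, about which the limit says nothing, follow by
  \<open>DD_step\<close> at the same \<open>z\<close>.\<close>

lemma generic_DD:
 assumes t: "nonres t0"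
 shows "generic (%z. \<forall>n::int. DD (t0 * q powi n) z ~= 0)"
proof -
 have tn: "nonres (t0 * q powi n)" for n using nonres_mult[OF t hv_powi, of n] by (simp add: mult.commute)
 have shift: "q * (t0 * q powi n) = t0 * q powi (n + 1)" "q^2 * (t0 * q powi n) = t0 * q powi (n + 2)" for n
 using q by (simp_all add: power_int_add mult_ac)
 obtain N where N: "!!n. n >= N ==> DD (t0 * q ^ n) b ~= 0 & DD (t0 * q ^ n) analytic_on {b}"
 using DD_eventually[OF t] by (auto simp: eventually_sequentially)
 have zg: "generic (%z. \<forall>n::int. zgood (t0 * q powi n) z)" by (rule generic_all[OF generic_zgood])
 have "generic (%z. DD (t0 * q ^ (N + m)) z ~= 0)" for m
 proof (rule generic_nonzero)
 show "generic (%z. DD (t0 * q ^ (N + m)) analytic_on {z})"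
 proof (rule generic_mono[OF zg])
 fix z assume z: "\<forall>n::int. zgood (t0 * q powi n) z"
 have "zgood (q * (t0 * q powi int (N + m))) z" unfolding shift using z by blast
 then have "DD (t0 * q powi int (N + m)) analytic_on {z}" by (rule DD_good[OF tn z[THEN spec]])
 then show "DD (t0 * q ^ (N + m)) analytic_on {z}" by (simp only: power_int_of_nat)
 qed
 qed (use N[of "N + m"] in auto)
 then have "generic (%z. (\<forall>n::int. zgood (t0 * q powi n) z) & (ALL m. DD (t0 * q ^ (N + m)) z ~= 0))"
 by (intro generic_conj zg generic_all)
 then show ?thesis
 proof (rule generic_mono)
 fix z assume z: "(\<forall>n::int. zgood (t0 * q powi n) z) & (ALL m. DD (t0 * q ^ (N + m)) z ~= 0)"
 have down: "DD (t0 * q powi (int N - int k)) z ~= 0" for k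
 proof (induction k)
 case 0
 show ?case using z[THEN conjunct2, THEN spec, of 0] by simp
 next
 case (Suc k)
 have e: "int N - int (Suc k) + 1 = int N - int k" by simp
 have 1: "DD (q * (t0 * q powi (int N - int (Suc k)))) z ~= 0" unfolding shift e by (rule Suc.IH)
 have 2: "zgood (t0 * q powi (int N - int (Suc k))) z" "zgood (q * (t0 * q powi (int N - int (Suc k)))) z"
 "zgood (q^2 * (t0 * q powi (int N - int (Suc k)))) z" unfolding shift using z by blast+
 show ?case by (rule DD_step[OF tn 2 1])
 qed
 show "\<forall>n::int. DD (t0 * q powi n) z ~= 0"
 proof
 fix n :: int
 show "DD (t0 * q powi n) z ~= 0"
 proof (cases "n <= int N")
 case True
 then have "n = int N - int (nat (int N - n))" by simp
 then show ?thesis using down by metis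
 next
 case False
 then have "n = int (N + nat (n - int N))" by simp
 then show ?thesis using z[THEN conjunct2, THEN spec, of "nat (n - int N)"] by (metis power_int_of_nat)
 qed
 qed
 qed
qed

end

section \<open>The solutions on the lattice\<close>

locale aw_lattice = aw_half +
 fixes \<epsilon> :: complex and x0 :: real
 assumes x0: "0 < x0" "q = complex_of_real x0" and eps: "nonres (q powr \<epsilon>)"
begin

definition tt :: "int => complex" where "tt n = q powr \<epsilon> * q powi n"

lemma tt_nonres: "nonres (tt n)"
 using nonres_mult[OF eps hv_powi, of n] by (simp add: tt_def mult.commute)

lemma tt_nz: "tt n ~= 0"
 using tt_nonres[of n] by (simp add: nonres_def)

lemma tt_powr: "q powr (of_int n + \<epsilon>) = tt n"
 unfolding tt_def by (rule powr_int_add[OF q(1)])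

lemma tt_shift: "q * tt n = tt (n + 1)" "q^2 * tt n = tt (n + 2)" "tt n / q = tt (n - 1)"
 using q by (simp_all add: tt_def power_int_add power_int_diff mult_ac)

text \<open>\<open>gR\<close> and \<open>gS\<close> carry the branches of the powers and do not
  depend on \<open>n\<close>; what is left in \<open>fR\<close> and \<open>fS\<close> is analytic at
  regular points.\<close>

definition gR where "gR z = (a/z) powr \<epsilon>"
definition gS where "gS z = z powr (- 1 + ln (a*b*c*d) / ln q) * (a*z) powr \<epsilon>"
definition fR where "fR n z = (a/z) powi n * RR (tt n) z"
definition fS where "fS n z = (a*z) powi n * SS (tt n) z"

lemma R_fun_lattice: assumes "z ~= 0" shows "R_fun q a b c d (of_int n + \<epsilon>) z = gR z * fR n z"
proof -
 have az: "a/z ~= 0" using assms abcd by simp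
 show ?thesis unfolding R_fun_def r_fun_def RR_def gR_def fR_def powr_shift[OF q(1)] tt_powr powr_int_add[OF az]
 by (simp add: mult_ac)
qed

lemma S_fun_lattice: assumes "z ~= 0" shows "S_fun q a b c d (of_int n + \<epsilon>) z = gS z * fS n z"
proof -
 have az: "a*z ~= 0" using assms abcd by simp
 show ?thesis unfolding S_fun_def s_fun_def SS_def gS_def fS_def powr_shift[OF q(1)] tt_powr powr_int_add[OF az]
 by (simp add: mult_ac)
qed

lemma R_regular_iff: "R_regular q a b c d (of_int n + \<epsilon>) z \<longleftrightarrow> z ~= 0 & qp q (b*c*d/z) ~= 0 & (qp q (b*c*tt n) ~= 0 & qp q (b*d*tt n) ~= 0 &
 qp q (c*d*tt n) ~= 0 & qp q (a*z*tt n) ~= 0) & W87_regular (b*c*d/(q*z)) [b/z, c/z, d/z, P*tt n/q, 1/tt n] q (q*z/a)"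
 unfolding R_regular_def powr_shift[OF q(1)] tt_powr by simp

lemma S_regular_iff: "S_regular q a b c d (of_int n + \<epsilon>) z \<longleftrightarrow> z ~= 0 & (qp q (z*q/a) ~= 0 & qp q (z*q/b) ~= 0 & qp q (z*q/c) ~= 0 & qp q (z*q/d) ~= 0) &
 (qp q (b*c*tt n) ~= 0 & qp q (b*d*tt n) ~= 0 & qp q (c*d*tt n) ~= 0 & qp q (tt n*q) ~= 0 & qp q (b*c*d*z*(tt n)^2*q) ~= 0) &
 W87_regular (b*c*d*z*(tt n)^2) [b*c*tt n, b*d*tt n, c*d*tt n, tt n*q, z*q/a] q (a*z)"
 unfolding S_regular_def powr_shift[OF q(1)] tt_powr by (simp add: mult.assoc)

lemma regular_analytic:
 assumes "regular_point q a b c d \<epsilon> z"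
 shows "z ~= 0" "RR (tt n) analytic_on {z}" "SS (tt n) analytic_on {z}"
proof -
 have R: "R_regular q a b c d (of_int n + \<epsilon>) z" and S: "S_regular q a b c d (of_int n + \<epsilon>) z"
 using assms by (auto simp: regular_point_def)
 show "z ~= 0" using R by (simp add: R_regular_iff)
 show "RR (tt n) analytic_on {z}" by (rule RR_analytic) (use R[unfolded R_regular_iff] tt_nz in blast)+
 show "SS (tt n) analytic_on {z}" by (rule SS_analytic) (use S[unfolded S_regular_iff] tt_nz in blast)+
qed

lemma regular_zgood:
 assumes z: "!!n. zgood (tt n) z"
 shows "regular_point q a b c d \<epsilon> z"
 unfolding regular_point_def
proof (intro allI conjI)
 fix n
 note t = tok_nonres[OF tt_nonres[of n]]
 have "q*(b*c*d/q/z) = b*c*d/z" using q by simp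
 then have 1: "qp q (b*c*d/z) ~= 0" using qp_up[of "b*c*d/q/z"] z[of n] by (simp add: zgood_def)
 have e: "a*z*tt n = a*tt n*z" "z*q/u = q/u*z" "tt n*q = q*tt n" "b*c*d*z*(tt n)^2*q = q*(b*c*d*(tt n)^2*z)" for u by simp_all
 have 2: "qp q (a*z*tt n) ~= 0" "qp q (z*q/a) ~= 0" "qp q (z*q/b) ~= 0" "qp q (z*q/c) ~= 0" "qp q (z*q/d) ~= 0" "qp q (tt n*q) ~= 0"
 unfolding e using t z[of n] by (auto simp: zgood_def tok_def)
 have 3: "qp q (b*c*d*z*(tt n)^2*q) ~= 0" unfolding e(4) using z[of n] by (intro qp_up) (simp add: zgood_def)
 have 4: "qp q (b*c*tt n) ~= 0" "qp q (b*d*tt n) ~= 0" "qp q (c*d*tt n) ~= 0" using t by (simp_all add: tok_def)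
 show "R_regular q a b c d (of_int n + \<epsilon>) z" unfolding R_regular_iff
 using 1 2 4 R_regular_good[OF t z] zgood_nz[OF z] by blast
 show "S_regular q a b c d (of_int n + \<epsilon>) z" unfolding S_regular_iff
 using 2 3 4 S_regular_good[OF t z] zgood_nz[OF z] by blast
qed

text \<open>The restriction to regular points excludes only countably many \<open>z\<close>, so the
  claims at such points are not vacuous.\<close>

lemma generic_regular: "generic (regular_point q a b c d \<epsilon>)"
 by (rule generic_mono[OF generic_all[of "%n. zgood (tt n)"]]) (auto intro: generic_zgood regular_zgood)

lemma lattice_recurrence:
 assumes "s z ~= 0" "Lrel (tt (n - 1)) s F z"
 shows "AWA q a b c d (tt n) * (s z powi (n + 1) * F (tt (n + 1)) z) + AWB q a b c d (tt n) * (s z powi n * F (tt n) z) +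
 AWC q a b c d (tt n) * (s z powi (n - 1) * F (tt (n - 1)) z) = (z + 1/z) * (s z powi n * F (tt n) z)"
proof -
 have i: "n - 1 + 1 = n" "n - 1 + 2 = n + 1" by simp_all
 have e: "q * tt (n - 1) = tt n" "q^2 * tt (n - 1) = tt (n + 1)" using tt_shift(1,2)[of "n - 1"] unfolding i by blast+
 have p: "s z powi (n + 1) = s z powi n * s z" "s z powi (n - 1) = s z powi n / s z"
 using assms(1) by (simp_all add: power_int_add power_int_diff)
 have "s z powi n * (AWC q a b c d (tt n) * (1 / s z) * F (tt (n - 1)) z + (AWB q a b c d (tt n) - (z+1/z)) * F (tt n) z +
 AWA q a b c d (tt n) * s z * F (tt (n + 1)) z) = 0"
 using assms(2)[unfolded Lrel_def e] by simp
 then show ?thesis unfolding p by (simp add: algebra_simps)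
qed

lemma AW_op_eq: "AW_op q a b c d \<epsilon> h n = AWA q a b c d (tt n) * h (n + 1) + AWB q a b c d (tt n) * h n + AWC q a b c d (tt n) * h (n - 1)"
 unfolding AW_op_def AW_A_eq[OF q(1)] AW_B_eq[OF q(1)] AW_C_eq[OF q(1)] tt_powr ..

lemma AW_eigen:
 assumes z: "regular_point q a b c d \<epsilon> z"
 shows "AW_op q a b c d \<epsilon> (%n. fR n z) n = (z + 1/z) * fR n z" "AW_op q a b c d \<epsilon> (%n. fS n z) n = (z + 1/z) * fS n z"
proof -
 note r = regular_analytic[OF z]
 have i: "n - 1 + 1 = n" "n - 1 + 2 = n + 1" by simp_all
 have e: "q * tt (n - 1) = tt n" "q^2 * tt (n - 1) = tt (n + 1)" using tt_shift(1,2)[of "n - 1"] unfolding i by blast+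
 note tk = tok_nonres[OF tt_nonres]
 have "Lrel (tt (n - 1)) (%z. a/z) RR z" by (rule Lrel_RR) (simp_all only: e tk r not_False_eq_True)
 then show "AW_op q a b c d \<epsilon> (%n. fR n z) n = (z + 1/z) * fR n z"
 unfolding AW_op_eq fR_def using lattice_recurrence[of "%z. a/z" z n RR] r(1) abcd by simp
 have "Lrel (tt (n - 1)) (%z. a*z) SS z" by (rule Lrel_SS) (simp_all only: e tk r not_False_eq_True)
 then show "AW_op q a b c d \<epsilon> (%n. fS n z) n = (z + 1/z) * fS n z"
 unfolding AW_op_eq fS_def using lattice_recurrence[of "%z. a*z" z n SS] r(1) abcd by simp
qed

definition PP :: "bool => int => complex => complex" where
 "PP j n z = (if j then R_fun q a b c d (of_int n + \<epsilon>) z else S_fun q a b c d (of_int n + \<epsilon>) z)"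
definition gg where "gg j z = (if j then gR z else gS z)"
definition ff where "ff j n z = (if j then fR n z else fS n z)"

lemma PP_eq: "z ~= 0 ==> PP j n z = gg j z * ff j n z"
 by (simp add: PP_def gg_def ff_def R_fun_lattice S_fun_lattice)

lemma gg_nz: "z ~= 0 ==> gg j z ~= 0"
 using abcd by (simp add: gg_def gR_def gS_def)

lemma ff_eigen: "regular_point q a b c d \<epsilon> z ==> AW_op q a b c d \<epsilon> (%n. ff j n z) n = (z + 1/z) * ff j n z"
 using AW_eigen[of z n] by (cases j) (simp_all add: ff_def)

lemma PP_eigen:
 assumes z: "regular_point q a b c d \<epsilon> z"
 shows "AW_op q a b c d \<epsilon> (%n. PP j n z) n = (z + 1/z) * PP j n z"
proof -
 have e: "PP j m z = gg j z * ff j m z" for m using PP_eq regular_analytic(1)[OF z] .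
 have "AW_op q a b c d \<epsilon> (%n. PP j n z) n = gg j z * AW_op q a b c d \<epsilon> (%n. ff j n z) n"
 unfolding AW_op_eq e by (simp add: algebra_simps)
 then show ?thesis unfolding ff_eigen[OF z] e by simp
qed

lemma gR_scale: assumes "0 < x" shows "gR z = of_real x powr \<epsilon> * gR (of_real x * z)"
proof -
 have "a/z = of_real x * (a / (of_real x * z))" using assms by simp
 then show ?thesis unfolding gR_def by (metis powr_scale_real[OF assms])
qed

lemma gS_scale: assumes "0 < x"
 shows "gS (of_real x * z) = of_real x powr (- 1 + ln (a*b*c*d) / ln q) * of_real x powr \<epsilon> * gS z"
proof -
 have e: "a * (of_real x * z) = of_real x * (a * z)" by simp
 show ?thesis unfolding gS_def e powr_scale_real[OF assms] by (simp add: mult_ac)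
qed

text \<open>A dilation by a power of the positive number \<open>q\<close> changes the branch factor
  by a constant, so the factor can be divided out of any \<open>q\<close>-difference
  equation.\<close>

lemma gg_scale: "EX k. ALL z. z ~= 0 --> gg j (q powi i * z) = k * gg j z"
proof -
 obtain y where y: "0 < y" "q powi i = of_real y" using x0 by (intro that[of "x0 powi i"]) simp_all
 define ka where "ka = complex_of_real y powr \<epsilon>"
 have k: "ka ~= 0" using y by (simp add: ka_def)
 show ?thesis
 proof (cases j)
 case True
 have "gR (q powi i * z) = 1/ka * gR z" for z
 proof -
 have "gR z = ka * gR (q powi i * z)" unfolding ka_def y(2) by (rule gR_scale[OF y(1)])
 then show ?thesis using k by simp
 qed
 with True show ?thesis unfolding gg_def by (intro exI[of _ "1/ka"]) simp
 next
 case False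
 have "EX k. ALL z. z ~= 0 --> gS (q powi i * z) = k * gS z"
 unfolding y(2) by (intro exI allI impI, rule gS_scale[OF y(1)])
 with False show ?thesis by (simp only: gg_def if_False)
 qed
qed

lemma q_powr_exponent: "q powr (- 1 + ln (a*b*c*d) / ln q) = P/q"
proof -
 have "ln q ~= 0"
 proof
 assume "ln q = 0"
 then have "exp (ln q) = 1" by simp
 with q show False by simp
 qed
 then have "(- 1 + ln (a*b*c*d) / ln q) * ln q = ln (a*b*c*d) - ln q" by (simp add: field_simps)
 then have "q powr (- 1 + ln (a*b*c*d) / ln q) = exp (ln (a*b*c*d) - ln q)" using q by (simp add: powr_def)
 then show ?thesis using q abcd by (simp add: exp_diff)
qed

text \<open>The complete power factor in front of \<open>RR\<close> or \<open>SS\<close>;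
  \<open>mm\<close> is its multiplier under \<open>z \<mapsto> q * z\<close> and is the number used
  in \<open>Zrel\<close>.\<close>

definition hh where "hh j n z = gg j z * (if j then (a/z) powi n else (a*z) powi n)"
definition mm where "mm j n = (if j then 1 / tt n else P * tt n / q)"
definition FF where "FF j = (if j then RR else SS)"

lemma PP_hh: "z ~= 0 ==> PP j n z = hh j n z * FF j (tt n) z"
 by (simp add: PP_eq hh_def FF_def ff_def fR_def fS_def)

lemma mm_nz: "mm j n ~= 0"
 using tt_nz abcd q by (simp add: mm_def)

lemma hh_scale: "hh j n (q * z) = mm j n * hh j n z"
proof (cases j)
 case True
 have "gR z = q powr \<epsilon> * gR (q * z)" using gR_scale[OF x0(1), of z] by (simp only: x0(2))
 moreover have "(a/(q*z)) powi n = (a/z) powi n / q powi n" by (simp add: power_int_divide_distrib power_int_mult_distrib)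
 ultimately show ?thesis using True tt_nz[of n] q by (simp add: hh_def gg_def mm_def tt_def)
next
 case False
 have "gS (q * z) = P/q * q powr \<epsilon> * gS z" using gS_scale[OF x0(1), of z] q_powr_exponent by (simp only: x0(2))
 moreover have "(a*(q*z)) powi n = (a*z) powi n * q powi n" by (simp add: power_int_mult_distrib)
 ultimately show ?thesis using False by (simp add: hh_def gg_def mm_def tt_def)
qed

definition XX where "XX z = (q-z^2)*((1-a*z)*(1-b*z)*(1-c*z)*(1-d*z))"
definition YY where "YY z = (1-q*z^2)*((z-a)*(z-b)*(z-c)*(z-d))"
definition EE where "EE z = (1-z^2)*(q-z^2)*(1-q*z^2)"

lemma generic_PP_z: "generic (%z. ALL j n. XX z * PP j n (q*z) + YY z * PP j n (z/q) = A0 (tt n) z * PP j n z)"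
proof -
 have "generic (Zrel (tt n) (mm j n) (FF j))" for j n
 using Zrel_RR[OF tok_nonres[OF tt_nonres[of n]]] Zrel_SS[OF tok_nonres[OF tt_nonres[of n]]] by (cases j) (simp_all add: mm_def FF_def)
 then have "generic (%z. z ~= 0 & (ALL j n. Zrel (tt n) (mm j n) (FF j) z))"
 by (intro generic_conj generic_neq generic_all)
 then show ?thesis
 proof (rule generic_mono, intro allI)
 fix z j n assume z: "z ~= 0 & (ALL j n. Zrel (tt n) (mm j n) (FF j) z)"
 then have nz: "q*z ~= 0" "z/q ~= 0" "z ~= 0" using q by simp_all
 have "q * (z/q) = z" using q by simp
 then have h: "hh j n (z/q) = 1 / mm j n * hh j n z" using hh_scale[of j n "z/q"] mm_nz[of j n] by simp
 have e: "1/q*z = z/q" by simp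
 have "XX z * (mm j n * FF j (tt n) (q*z)) - A0 (tt n) z * FF j (tt n) z + YY z * (1 / mm j n * FF j (tt n) (z/q)) = 0"
 using z unfolding Zrel_def e XX_def YY_def by blast
 then have "hh j n z * (XX z * (mm j n * FF j (tt n) (q*z)) - A0 (tt n) z * FF j (tt n) z + YY z * (1 / mm j n * FF j (tt n) (z/q))) = 0"
 by simp
 then have "XX z * (mm j n * hh j n z * FF j (tt n) (q*z)) + YY z * (1 / mm j n * hh j n z * FF j (tt n) (z/q)) = A0 (tt n) z * (hh j n z * FF j (tt n) z)"
 by (simp add: algebra_simps)
 then show "XX z * PP j n (q*z) + YY z * PP j n (z/q) = A0 (tt n) z * PP j n z"
 unfolding PP_hh[OF nz(1)] PP_hh[OF nz(2)] PP_hh[OF nz(3)] hh_scale h .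
 qed
qed

lemma A0_lambda: "t ~= 0 ==> A0 t z = XX z + YY z + EE z * (P/q*(t + q/P/t) - 1 - P/q)"
proof -
 assume "t ~= 0"
 then have "(1/t-1)*(1-P*t/q) = P/q*(t + q/P/t) - 1 - P/q" using q abcd by (simp add: field_simps)
 then show ?thesis unfolding A0_def XX_def YY_def EE_def by simp
qed

lemma zact_lambda: "zact q PP (%j n z. (tt n + q/P/tt n) * PP j n z)"
proof -
 \<comment> \<open>\<open>A0_lambda\<close> solved for the eigenvalue: \<open>EE\<close> is the
   coefficient standing in front of it, and the coefficient of the identity compensates the
   constants \<open>1\<close> and \<open>P / q\<close>.\<close>
 define B :: "int => complex => complex" where "B i z = (if i = 1 then q/P * XX z / EE z else if i = - 1 then q/P * YY z / EE z
 else if i = 0 then 1 + q/P - q/P * (XX z + YY z) / EE z else 0)" for i z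
 have supp: "qdiff_supp B \<subseteq> {- 1, 0, 1}" by (auto simp: qdiff_supp_def B_def split: if_splits)
 have mer: "XX meromorphic_on UNIV" "YY meromorphic_on UNIV" "EE meromorphic_on UNIV"
 unfolding XX_def[abs_def] YY_def[abs_def] EE_def[abs_def] by (intro analytic_on_imp_meromorphic_on analytic_intros)+
 have "B i meromorphic_on UNIV" for i
 proof -
 consider "i = 1" | "i = - 1" | "i = 0" | "i ~= 1" "i ~= - 1" "i ~= 0" by blast
 then show ?thesis
 by cases (simp_all add: B_def[abs_def], (intro meromorphic_intros mer)+)
 qed
 then have B: "qdiff_operator B" using finite_subset[OF supp] by (simp add: qdiff_operator_def)
 have gE: "generic (%z. EE z ~= 0)"
 proof (rule generic_nonzero)
 have an: "EE analytic_on {z}" for z unfolding EE_def[abs_def] by (intro analytic_intros)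
 show "generic (%z. EE analytic_on {z})" by (rule generic_True) (rule an)
 show "EE analytic_on {0}" by (rule an)
 show "EE 0 ~= 0" using q by (simp add: EE_def)
 qed
 have "zrel q B PP (%j n z. (tt n + q/P/tt n) * PP j n z)"
 proof (rule zrelI[OF B generic_conj[OF generic_PP_z gE]])
 fix z j n assume "(ALL j n. XX z * PP j n (q*z) + YY z * PP j n (z/q) = A0 (tt n) z * PP j n z) & EE z ~= 0"
 then have z: "XX z * PP j n (q*z) + YY z * PP j n (z/q) = A0 (tt n) z * PP j n z" and E: "EE z ~= 0" by blast+
 define l where "l = tt n + q/P/tt n"
 have gen: "k/e*(y + e*w) = k*y/e + k*w" if "e ~= 0" for k e y w :: complex using that by (simp add: field_simps)
 have i: "q powi (- 1) * z = z/q" "q powi 0 * z = z" "q powi 1 * z = q*z" by (simp_all add: power_int_minus field_simps)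
 have i': "inverse q * z = z/q" by (simp add: field_simps)
 have "qdiff_apply q B (PP j n) z = B (- 1) z * PP j n (z/q) + (B 0 z * PP j n z + B 1 z * PP j n (q*z))"
 unfolding qdiff_apply_superset[of "{- 1, 0, 1}", OF _ supp, simplified] by (simp add: i i')
 also have "... = q/P / EE z * (XX z * PP j n (q*z) + YY z * PP j n (z/q)) + (1 + q/P - q/P * (XX z + YY z) / EE z) * PP j n z"
 by (simp add: B_def algebra_simps add_divide_distrib)
 also have "... = (q/P / EE z * (XX z + YY z + EE z * (P/q*l - 1 - P/q)) + 1 + q/P - q/P * (XX z + YY z) / EE z) * PP j n z"
 unfolding z A0_lambda[OF tt_nz] l_def by (simp add: algebra_simps)
 also have "q/P / EE z * (XX z + YY z + EE z * (P/q*l - 1 - P/q)) = q/P * (XX z + YY z) / EE z + q/P * (P/q*l - 1 - P/q)"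
 by (rule gen[OF E])
 also have "q/P * (P/q*l - 1 - P/q) = l - q/P - 1" using q abcd by (simp add: right_diff_distrib)
 finally show "qdiff_apply q B (PP j n) z = (tt n + q/P/tt n) * PP j n z" by (simp add: l_def)
 qed
 then show ?thesis by (auto simp: zact_def)
qed

definition TT where "TT = {q powr \<epsilon> * q powi n |n. True} \<union> {q/P / (q powr \<epsilon> * q powi n) |n. True}"

lemma TT_nonres: assumes "t \<in> TT" shows "nonres t"
proof -
 have h: "hv (q/P)" by (intro hv_intros)
 from assms obtain n where "t = tt n | t = q/P * (1/tt n)" by (auto simp: TT_def tt_def)
 then show ?thesis using tt_nonres nonres_mult[OF nonres_inv[OF tt_nonres] h] by auto
qed

lemma TT_rfun: "rfun TT (AWA q a b c d)" "rfun TT (AWB q a b c d)" "rfun TT (AWC q a b c d)"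
proof -
 show A: "rfun TT (AWA q a b c d)" unfolding AWA_def[abs_def]
 by (intro rfun_divide rfun_mult rfun_diff rfun_power rfun_const rfun_id) (use P_resonance TT_nonres abcd in auto)
 show C: "rfun TT (AWC q a b c d)" unfolding AWC_def[abs_def]
 by (intro rfun_divide rfun_mult rfun_diff rfun_power rfun_const rfun_id) (use P_resonance TT_nonres abcd in auto)
 show "rfun TT (AWB q a b c d)" unfolding AWB_def[abs_def]
 by (intro rfun_diff rfun_add rfun_const A C)
qed

lemma A0_rfun: "rfun TT (%t. A0 t z)" "rfun TT (%t. A0 (q*t) z)" "rfun TT (%t. A0 (t/q) z)"
 unfolding A0_def by (intro rfun_add rfun_divide rfun_mult rfun_diff rfun_const rfun_id; use q TT_nonres in \<open>auto simp: nonres_def\<close>)+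

lemma generic_shift:
 "generic (%z. EX u v. rfun TT u & rfun TT v & (ALL j n. PP j n (q*z) = u (tt n) * PP j n z + v (tt n) * PP j (n + 1) z))" (is ?U)
 "generic (%z. EX u v. rfun TT u & rfun TT v & (ALL j n. PP j n (z/q) = u (tt n) * PP j n z + v (tt n) * PP j (n + 1) z))" (is ?D)
proof -
 let ?reg = "regular_point q a b c d \<epsilon>"
 \<comment> \<open>The eigenvalues at \<open>q * z\<close> and \<open>z / q\<close>. Their
   difference is nonzero for generic \<open>z\<close>, which is what separates the two
   shifts.\<close>
 define xp xm where "xp z = q*z + 1/(q*z)" and "xm z = z/q + 1/(z/q)" for z
 define K where "K z = z * XX z * YY z * (z^2 - 1) * (q^2 - 1)" for z
 have gK: "generic (%z. K z ~= 0)"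
 proof -
 define p where "p = [:0, 1:] * ([:q, 0, - 1:] * ([:1, - a:] * [:1, - b:] * [:1, - c:] * [:1, - d:])) *
 ([:1, 0, - q:] * ([:- a, 1:] * [:- b, 1:] * [:- c, 1:] * [:- d, 1:])) * [:- 1, 0, 1:]"
 have f: "poly [:1, - x:] z = 1-x*z" "poly [:- x, 1:] z = z-x" "poly [:q, 0, - 1:] z = q-z^2" "poly [:1, 0, - q:] z = 1-q*z^2"
 "poly [:- 1, 0, 1:] z = z^2-1" "poly [:0, 1:] z = z" for x z by (simp_all add: sqr_eq mult.commute mult.left_commute)
 have K: "K z = poly p z * (q^2 - 1)" for z unfolding K_def p_def poly_mult f XX_def YY_def by (simp only: mult_ac)
 have "p ~= 0" unfolding p_def mult_eq_0_iff pCons_eq_0_iff by simp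
 then have "finite {z. poly p z = 0}" by (rule poly_roots_finite)
 moreover have "q^2 - 1 ~= 0" using q_power_ne_1[OF q(2), of 1] by (simp add: numeral_2_eq_2)
 ultimately show ?thesis by (intro generic_finite) (simp add: K)
 qed
 define W where "W z \<longleftrightarrow> ?reg z & ?reg (q*z) & ?reg (1/q*z) & K z ~= 0 &
 (ALL j n. XX z * PP j n (q*z) + YY z * PP j n (z/q) = A0 (tt n) z * PP j n z)" for z
 have gW: "generic W" unfolding W_def
 by (intro generic_conj generic_regular gK generic_PP_z generic_scale[OF _ generic_regular]) (use q in auto)
 define U where "U z x t = AWB q a b c d t * A0 t z + (z + 1/z - AWB q a b c d t) * A0 (t/q) z - x * A0 t z" for z x t
 define V where "V z t = AWA q a b c d t * (A0 (q * t) z - A0 (t/q) z)" for z t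
 have main: "XX z * (xp z - xm z) * PP j n (q*z) = U z (xm z) (tt n) * PP j n z + V z (tt n) * PP j (n + 1) z"
 "YY z * (xm z - xp z) * PP j n (z/q) = U z (xp z) (tt n) * PP j n z + V z (tt n) * PP j (n + 1) z" if W: "W z" for z j n
 proof -
 have e: "1/q*z = z/q" by simp
 have r: "?reg z" "?reg (q*z)" "?reg (z/q)" using W unfolding W_def e by blast+
 have Z: "XX z * PP j n (q*z) + YY z * PP j n (z/q) = A0 (tt n) z * PP j n z" for n using W unfolding W_def by blast
 note E = PP_eigen[of _ j n, unfolded AW_op_eq]
 show "XX z * (xp z - xm z) * PP j n (q*z) = U z (xm z) (tt n) * PP j n z + V z (tt n) * PP j (n + 1) z"
 "YY z * (xm z - xp z) * PP j n (z/q) = U z (xp z) (tt n) * PP j n z + V z (tt n) * PP j (n + 1) z"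
 unfolding U_def V_def tt_shift xp_def xm_def
 using spectral_shift_identity[OF E[OF r(2)] E[OF r(3)] E[OF r(1)] Z Z Z] by blast+
 qed
 have nz: "XX z * (xp z - xm z) ~= 0" "YY z * (xm z - xp z) ~= 0" if "W z" for z
 proof -
 have K: "z ~= 0" "XX z ~= 0" "YY z ~= 0" "z^2 - 1 ~= 0" "q^2 - 1 ~= 0" using that by (auto simp: W_def K_def)
 have "q*z * (xp z - xm z) = (z^2 - 1) * (q^2 - 1)" using K(1) q by (simp add: xp_def xm_def field_simps sqr_eq)
 with K(4,5) have "xp z - xm z ~= 0" by (metis mult_eq_0_iff)
 with K show "XX z * (xp z - xm z) ~= 0" "YY z * (xm z - xp z) ~= 0" by auto
 qed
 have rf: "rfun TT (%t. k * U z x t)" "rfun TT (%t. k * V z t)" for k x z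
 unfolding U_def V_def by (intro rfun_mult rfun_add rfun_diff rfun_const TT_rfun A0_rfun)+
 have div: "y = 1/k * u * p + 1/k * v * p'" if "k * y = u * p + v * p'" "k ~= 0" for y k u v p p' :: complex
 using that by (simp add: field_simps)
 show ?U
 proof (rule generic_mono[OF gW])
 fix z assume W: "W z"
 show "EX u v. rfun TT u & rfun TT v & (ALL j n. PP j n (q*z) = u (tt n) * PP j n z + v (tt n) * PP j (n + 1) z)"
 by (rule exI[of _ "%t. 1/(XX z * (xp z - xm z)) * U z (xm z) t"], rule exI[of _ "%t. 1/(XX z * (xp z - xm z)) * V z t"])
 (intro conjI allI rf div[OF main(1)[OF W] nz(1)[OF W]])
 qed
 show ?D
 proof (rule generic_mono[OF gW])
 fix z assume W: "W z"
 show "EX u v. rfun TT u & rfun TT v & (ALL j n. PP j n (z/q) = u (tt n) * PP j n z + v (tt n) * PP j (n + 1) z)"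
 by (rule exI[of _ "%t. 1/(YY z * (xm z - xp z)) * U z (xp z) t"], rule exI[of _ "%t. 1/(YY z * (xm z - xp z)) * V z t"])
 (intro conjI allI rf div[OF main(2)[OF W] nz(2)[OF W]])
 qed
qed

lemma PP_casoratian:
 assumes z: "z ~= 0"
 shows "PP True n z * PP False (n + 1) z - PP True (n + 1) z * PP False n z =
 gR z * gS z * ((a/z) powi n * (a*z) powi n) * DD (tt n) z"
proof -
 have p: "(a/z) powi (n + 1) = (a/z) powi n * (a/z)" "(a*z) powi (n + 1) = (a*z) powi n * (a*z)"
 using z abcd by (simp_all add: power_int_add)
 show ?thesis unfolding PP_eq[OF z] gg_def ff_def fR_def fS_def DD_def p tt_shift by (simp add: algebra_simps)
qed

lemma generic_indep: "generic (%z. ALL n. PP True n z * PP False (n + 1) z ~= PP True (n + 1) z * PP False n z)"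
proof (rule generic_mono[OF generic_conj[OF generic_neq[of 0] generic_DD[OF eps]]], intro allI)
 fix z n assume z: "z ~= 0 & (ALL n. DD (q powr \<epsilon> * q powi n) z ~= 0)"
 then have "DD (tt n) z ~= 0" by (simp add: tt_def)
 then have "gR z * gS z * ((a/z) powi n * (a*z) powi n) * DD (tt n) z ~= 0"
 using z abcd gg_nz[of z True] gg_nz[of z False] by (simp add: gg_def)
 then show "PP True n z * PP False (n + 1) z ~= PP True (n + 1) z * PP False n z"
 using PP_casoratian[of z n] z by auto
qed

lemma AW_limits:
 "(%n. AWA q a b c d (q powr \<epsilon> * q ^ n)) \<longlonglongrightarrow> 1/a" "(%n. AWB q a b c d (q powr \<epsilon> * q ^ n)) \<longlonglongrightarrow> 0"
 "(%n. AWC q a b c d (q powr \<epsilon> * q ^ n)) \<longlonglongrightarrow> a"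
proof -
 have x: "(%n. q powr \<epsilon> * q ^ n) \<longlonglongrightarrow> 0" using tendsto_mult[OF tendsto_const[of "q powr \<epsilon>"] LIMSEQ_power_zero[OF q(2)]] by simp
 have c: "isCont (AWA q a b c d) 0" "isCont (AWC q a b c d) 0"
 unfolding AWA_def[abs_def] AWC_def[abs_def] by (intro continuous_intros; use q abcd in simp)+
 have v: "AWA q a b c d 0 = 1/a" "AWC q a b c d 0 = a" using q abcd by (simp_all add: AWA_def AWC_def sqr_eq)
 show A: "(%n. AWA q a b c d (q powr \<epsilon> * q ^ n)) \<longlonglongrightarrow> 1/a" using isCont_tendsto_compose[OF c(1) x] by (simp add: v)
 show C: "(%n. AWC q a b c d (q powr \<epsilon> * q ^ n)) \<longlonglongrightarrow> a" using isCont_tendsto_compose[OF c(2) x] by (simp add: v)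
 have "(%n. a + 1/a - (AWA q a b c d (q powr \<epsilon> * q ^ n) + AWC q a b c d (q powr \<epsilon> * q ^ n))) \<longlonglongrightarrow> a + 1/a - (1/a + a)"
 by (intro tendsto_intros A C)
 then show "(%n. AWB q a b c d (q powr \<epsilon> * q ^ n)) \<longlonglongrightarrow> 0" by (simp add: AWB_def)
qed

lemma aw_pair_PP: "aw_pair q (q powr \<epsilon>) (q/P) a b c d PP TT"
proof (intro aw_pair.intro bispectral_pair.intro aw_pair_axioms.intro)
 show "generic (%z. ALL j n. AWA q a b c d (q powr \<epsilon> * q powi n) * PP j (n + 1) z + AWB q a b c d (q powr \<epsilon> * q powi n) * PP j n z
 + AWC q a b c d (q powr \<epsilon> * q powi n) * PP j (n - 1) z = (z + 1 / z) * PP j n z)"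
 by (rule generic_mono[OF generic_regular]) (use PP_eigen[unfolded AW_op_eq tt_def] in blast)
 show "generic (%z. EX u v. rfun TT u & rfun TT v & (ALL j n. PP j n (q * z) = u (q powr \<epsilon> * q powi n) * PP j n z + v (q powr \<epsilon> * q powi n) * PP j (n + 1) z))"
 "generic (%z. EX u v. rfun TT u & rfun TT v & (ALL j n. PP j n (z / q) = u (q powr \<epsilon> * q powi n) * PP j n z + v (q powr \<epsilon> * q powi n) * PP j (n + 1) z))"
 using generic_shift unfolding tt_def by blast+
 show "t \<in> TT ==> t ^ 2 ~= q powi k" for t k using TT_nonres[of t] by (simp add: nonres_def)
qed (use q abcd TT_rfun AWA_nonzero[OF TT_nonres] AWC_nonzero[OF TT_nonres] AW_limits generic_indep Pint eps in \<open>simp_all add: TT_def nonres_def\<close>)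

lemma chain_bispectral_AW:
 assumes chain: "darboux_chain xs (AW_op q a b c d \<epsilon>) Q L" and xs: "distinct xs"
 and ad: "a = d * q ^ \<alpha>" "a * d = q ^ m" "\<alpha> < m" and bc: "b = c * q ^ \<beta>" "b * c = q ^ m'" "\<beta> < m'"
 and X: "!!x. x \<in> set xs ==> (\<exists>k<\<alpha>. x = d * q^k + 1 / (d * q^k)) | (\<exists>k<\<beta>. x = c * q^k + 1 / (c * q^k))"
 obtains Z \<Lambda> where "zrel q Z (%j n z. Q (%k. PP j k z) n) (%j n z. \<Lambda> n * Q (%k. PP j k z) n)" "EX n n'. \<Lambda> n ~= \<Lambda> n'"
proof -
 interpret ap: aw_pair q "q powr \<epsilon>" "q/P" a b c d PP TT by (rule aw_pair_PP)
 have tn: "ap.tn n = tt n" for n by (simp add: ap.tn_def tt_def)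
 have hi: "ap.halfint v" if "hv v" for v using that by (auto simp: ap.halfint_def hv_def)
 have ext: "ap.eigen_ext (q/P) (AWA q a b c d) (AWB q a b c d) x" if "x \<in> set xs" for x
 using X[OF that]
 proof (elim disjE exE conjE)
 fix k assume "k < \<alpha>" "x = d * q^k + 1 / (d * q^k)"
 then show ?thesis using ap.eigen_ext_ad[OF ad] by (simp add: hi hv_intros)
 next
 fix k assume "k < \<beta>" "x = c * q^k + 1 / (c * q^k)"
 then show ?thesis using ap.eigen_ext_bc[OF bc] by (simp add: hi hv_intros)
 qed
 have "ap.stage (q/P) (AWA q a b c d) (AWB q a b c d) PP (set xs)"
 by (rule ap.base_stage[OF _ ext]) (use zact_lambda in \<open>simp only: tn\<close>)
 note stage = this
 have w: "AWA q a b c d (q/P/tt n) = AWC q a b c d (tt n)" for n using ap.AWA_w0[OF ap.tn_T, of n] unfolding tn .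
 have "AW_op q a b c d \<epsilon> h n = ap.second_order (q/P) (AWA q a b c d) (AWB q a b c d) h n" for h n
 unfolding ap.second_order_def AW_op_eq tn w ..
 note L = this
 show thesis using ap.chain_bispectral[OF chain stage subset_refl xs L] that by blast
qed

lemma chain_scale:
 assumes "darboux_chain xs L Q L'" shows "Q (%k. s * h k) n = s * Q h n"
 using chain_lincomb[OF assms, of s h 0 "%_. 0" n] by simp

lemma ff_isCont: "regular_point q a b c d \<epsilon> z ==> isCont (ff j n) z"
proof -
 assume z: "regular_point q a b c d \<epsilon> z"
 have "ff j n analytic_on {z}"
 using regular_analytic[OF z] abcd by (cases j) (auto simp: ff_def[abs_def] fR_def[abs_def] fS_def[abs_def] intro!: analytic_intros)
 then show ?thesis by (rule analytic_at_imp_isCont)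
qed

text \<open>The equation holds off a countable set and is carried to the remaining regular points by
  continuity. The branch factor \<open>gg\<close> may jump, so it is divided out first.\<close>

lemma bispectral_at_regular:
 assumes chain: "darboux_chain xs L Q L'"
 and Z: "zrel q Z (%j n z. Q (%k. PP j k z) n) (%j n z. \<Lambda> n * Q (%k. PP j k z) n)"
 and z: "regular_point q a b c d \<epsilon> z" "!!i. i \<in> qdiff_supp Z ==> regular_point q a b c d \<epsilon> (q powi i * z) & Z i analytic_on {z}"
 shows "qdiff_apply q Z (%z. Q (%k. PP j k z) n) z = \<Lambda> n * Q (%k. PP j k z) n"
proof -
 obtain ka where ka: "!!i z. z ~= 0 ==> gg j (q powi i * z) = ka i * gg j z" using gg_scale[of j] by metis
 define f where "f y = Q (%k. ff j k y) n" for y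
 define H where "H y = (\<Sum>i\<in>qdiff_supp Z. Z i y * (ka i * f (q powi i * y))) - \<Lambda> n * f y" for y
 have PPf: "Q (%k. PP j k y) n = gg j y * f y" if "y ~= 0" for y
 unfolding PP_eq[OF that] f_def by (rule chain_scale[OF chain])
 have Hg: "qdiff_apply q Z (%z. Q (%k. PP j k z) n) y - \<Lambda> n * Q (%k. PP j k y) n = gg j y * H y" if y: "y ~= 0" for y
 proof -
 have "q powi i * y ~= 0" for i using y q by simp
 then have tm: "Z i y * Q (%k. PP j k (q powi i * y)) n = gg j y * (Z i y * (ka i * f (q powi i * y)))" for i
 unfolding PPf[OF \<open>!!i. q powi i * y ~= 0\<close>] ka[OF y] by (simp only: mult.assoc mult.left_commute)
 have "qdiff_apply q Z (%z. Q (%k. PP j k z) n) y = (\<Sum>i\<in>qdiff_supp Z. gg j y * (Z i y * (ka i * f (q powi i * y))))"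
 unfolding qdiff_apply_def tm ..
 then show ?thesis unfolding H_def PPf[OF y] sum_distrib_left[symmetric] by (simp add: right_diff_distrib mult_ac)
 qed
 have "generic (%y. y ~= 0 & (ALL j n. qdiff_apply q Z (%z. Q (%k. PP j k z) n) y = \<Lambda> n * Q (%k. PP j k y) n))"
 using Z unfolding zrel_def by (intro generic_conj generic_neq) blast
 then have "generic (%y. H y = 0)"
 proof (rule generic_mono)
 fix y assume y: "y ~= 0 & (ALL j n. qdiff_apply q Z (%z. Q (%k. PP j k z) n) y = \<Lambda> n * Q (%k. PP j k y) n)"
 then have "gg j y * H y = 0" using Hg[of y] by simp
 then show "H y = 0" using gg_nz[of y j] y by simp
 qed
 then have freq: "frequently (%y. H y = 0) (at z)" by (rule generic_at)
 have lim: "((%y. f (r * y)) \<longlongrightarrow> f (r * z)) (at z)" if "regular_point q a b c d \<epsilon> (r * z)" for r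
 unfolding f_def
 proof (rule chain_tendsto[OF chain])
 fix m
 have "isCont (%y. ff j m (r * y)) z"
 by (rule isCont_o2[where g = "ff j m"]) (intro continuous_intros, rule ff_isCont[OF that])
 then show "((%y. ff j m (r * y)) \<longlongrightarrow> ff j m (r * z)) (at z)" by (simp add: isCont_def)
 qed
 have "(Z i \<longlongrightarrow> Z i z) (at z)" if "i \<in> qdiff_supp Z" for i
 using analytic_at_imp_isCont[of "Z i" z] z(2)[OF that] by (simp add: isCont_def)
 then have "(H \<longlongrightarrow> H z) (at z)"
 unfolding H_def using lim[of 1] z by (intro tendsto_intros lim) auto
 then have "H z = 0"
 using freq tendsto_imp_eventually_ne[of H "H z" "at z" 0] by (auto simp: frequently_def)
 then show ?thesis using Hg[OF regular_analytic(1)[OF z(1)]] by simp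
qed

text \<open>At a point where \<open>z + 1 / z\<close> is none of the added values the intertwining
  operator is injective on eigenfunctions, so independence of the original pair is
  inherited.\<close>

lemma bispectral_independent:
 assumes chain: "darboux_chain xs (AW_op q a b c d \<epsilon>) Q L"
 and 0: "!!n z. regular_point q a b c d \<epsilon> z ==> c1 * Q (%k. PP True k z) n + c2 * Q (%k. PP False k z) n = 0"
 shows "c1 = 0 & c2 = 0"
proof -
 have "generic (%z. z ~= 0 & (\<forall>x\<in>set xs. z + 1/z ~= x))"
 proof -
 have "finite ({0} \<union> (\<Union>x\<in>set xs. {z. poly [:1, - x, 1:] z = 0}))"
 by (intro finite_UnI finite_UN_I poly_roots_finite) auto
 moreover have "{z. ~ (z ~= 0 & (\<forall>x\<in>set xs. z + 1/z ~= x))} \<subseteq> {0} \<union> (\<Union>x\<in>set xs. {z. poly [:1, - x, 1:] z = 0})"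
 proof
 fix z assume z: "z \<in> {z. ~ (z ~= 0 & (\<forall>x\<in>set xs. z + 1/z ~= x))}"
 show "z \<in> {0} \<union> (\<Union>x\<in>set xs. {z. poly [:1, - x, 1:] z = 0})"
 proof (cases "z = 0")
 case False
 with z obtain x where x: "x \<in> set xs" "x = z + 1/z" by auto
 have "poly [:1, - x, 1:] z = 0" unfolding x(2) using False by (simp add: field_simps)
 with x(1) show ?thesis by blast
 qed simp
 qed
 ultimately have "finite {z. ~ (z ~= 0 & (\<forall>x\<in>set xs. z + 1/z ~= x))}" by (rule rev_finite_subset)
 then show ?thesis by (rule generic_finite)
 qed
 from generic_dense[OF generic_conj[OF generic_conj[OF this generic_regular] generic_indep] open_UNIV UNIV_I]
 obtain z where z: "\<forall>x\<in>set xs. z + 1/z ~= x" "regular_point q a b c d \<epsilon> z"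
 "PP True 0 z * PP False (0 + 1) z ~= PP True (0 + 1) z * PP False 0 z" by blast
 define h where "h n = c1 * PP True n z + c2 * PP False n z" for n
 have L: "AW_op q a b c d \<epsilon> h n = (z + 1/z) * h n" for n
 proof -
 have "AW_op q a b c d \<epsilon> h n = c1 * AW_op q a b c d \<epsilon> (%n. PP True n z) n + c2 * AW_op q a b c d \<epsilon> (%n. PP False n z) n"
 unfolding AW_op_eq h_def by (simp add: algebra_simps)
 then show ?thesis unfolding PP_eigen[OF z(2)] h_def by (simp add: algebra_simps)
 qed
 have "Q h n = 0" for n
 using chain_lincomb[OF chain, of c1 "%k. PP True k z" c2 "%k. PP False k z" n] 0[OF z(2), of n] by (simp add: h_def[abs_def])
 then have "h n = 0" for n using chain_injective[OF chain L] z(1) by blast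
 then have e: "c1 * PP True 0 z + c2 * PP False 0 z = 0" "c1 * PP True (0 + 1) z + c2 * PP False (0 + 1) z = 0"
 unfolding h_def by blast+
 define p0 p1 s0 s1 where "p0 = PP True 0 z" and "p1 = PP True (0 + 1) z" and "s0 = PP False 0 z" and "s1 = PP False (0 + 1) z"
 note df = p0_def[symmetric] p1_def[symmetric] s0_def[symmetric] s1_def[symmetric]
 have w: "p0 * s1 - p1 * s0 ~= 0" using z(3) unfolding df by simp
 have "c1 * (p0 * s1 - p1 * s0) = (c1*p0 + c2* s0) * s1 - (c1*p1 + c2* s1) * s0"
 "c2 * (p0 * s1 - p1 * s0) = (c1*p1 + c2* s1) * p0 - (c1*p0 + c2* s0) * p1" by (simp_all add: algebra_simps)
 then have "c1 * (p0 * s1 - p1 * s0) = 0" "c2 * (p0 * s1 - p1 * s0) = 0" unfolding e[unfolded df] by simp_all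
 with w show ?thesis by simp
qed

end

section \<open>The parameters of the theorem\<close>

lemma qp_real_nonzero:
 fixes q r :: real assumes "0 < q" "q < 1" "r < 1" shows "qp (of_real q) (of_real r) ~= 0"
proof
 assume "qp (of_real q) (of_real r) = 0"
 then obtain i where "complex_of_real r * of_real q ^ i = 1" using assms by (auto simp: qp_eq_0_iff)
 then have e: "r * q ^ i = 1" by (metis of_real_eq_1_iff of_real_mult of_real_power)
 have "q ^ i <= 1" "0 <= q ^ i" using assms by (auto intro: power_le_one)
 then have "r * q ^ i < 1" using assms(3) mult_left_le[of "q ^ i" r] mult_nonpos_nonneg[of r "q ^ i"] by (cases "r >= 0") auto
 then show False using e by simp
qed

theorem corollary6p6:
  fixes q :: real and l1 l2 \<alpha> \<beta> :: nat and a b c d \<epsilon> :: complex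
    and J K X :: "complex set" and xs :: "complex list" and Lhat \<Q> :: lop
    and \<Psi>hat :: "complex \<Rightarrow> complex \<Rightarrow> int \<Rightarrow> complex \<Rightarrow> complex"
  assumes q: "0 < q" "q < 1"
    and pos: "\<alpha> > 0" "\<beta> > 0" "l1 > 0" "l2 > 0"
    and a: "a = complex_of_real (q powr (real l1 / 2 + real \<alpha>))"
    and b: "b = - complex_of_real (q powr (real l2 / 2 + real \<beta>))"
    and c: "c = - complex_of_real (q powr (real l2 / 2))"
    and d: "d = complex_of_real (q powr (real l1 / 2))"
    and \<epsilon>: "\<forall>k::int. complex_of_real q powr (2 * \<epsilon>) \<noteq> complex_of_real q powi k"
    and J: "J = {complex_of_real (q powr (real l1 / 2 + real k) + q powr (- (real l1 / 2) - real k))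
                 |k. k \<le> \<alpha> - 1}"
    and K: "K = {complex_of_real (- (q powr (real l2 / 2 + real k) + q powr (- (real l2 / 2) - real k)))
                 |k. k \<le> \<beta> - 1}"
    and X: "X \<subseteq> J \<union> K" "set xs = X" "distinct xs"
    and Lhat: "darboux_chain xs (AW_op q a b c d \<epsilon>) \<Q> Lhat"
    and \<Psi>hat: "\<And>c1 c2 n z. \<Psi>hat c1 c2 n z =
                 \<Q> (\<lambda>k. c1 * R_fun q a b c d (of_int k + \<epsilon>) z
                         + c2 * S_fun q a b c d (of_int k + \<epsilon>) z) n"
  shows "\<exists>(Bhat :: int \<Rightarrow> complex \<Rightarrow> complex) (\<Lambda>hat :: int \<Rightarrow> complex).
      qdiff_operator Bhat \<and>
      (\<exists>n n'. \<Lambda>hat n \<noteq> \<Lambda>hat n') \<and>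
      (\<forall>c1 c2. (\<forall>n z. regular_point q a b c d \<epsilon> z \<longrightarrow> \<Psi>hat c1 c2 n z = 0) \<longrightarrow> c1 = 0 \<and> c2 = 0) \<and>
      (\<forall>c1 c2 n z. regular_point q a b c d \<epsilon> z \<longrightarrow>
         Lhat (\<lambda>k. \<Psi>hat c1 c2 k z) n = (z + 1 / z) * \<Psi>hat c1 c2 n z) \<and>
      (\<forall>c1 c2 n z. regular_point q a b c d \<epsilon> z \<and>
           (\<forall>i\<in>qdiff_supp Bhat. regular_point q a b c d \<epsilon> (of_real q powi i * z) \<and>
                                 Bhat i analytic_on {z}) \<longrightarrow>
         qdiff_apply q Bhat (\<Psi>hat c1 c2 n) z = \<Lambda>hat n * \<Psi>hat c1 c2 n z)"
proof -
 define u v where "u = q powr (real l1 / 2)" and "v = q powr (real l2 / 2)"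
 have u2: "u * u = q ^ l1" and v2: "v * v = q ^ l2"
 using q by (simp_all add: u_def v_def powr_add[symmetric] powr_realpow[symmetric])
 have "q powr s < 1" if "0 < s" for s using that q by (simp add: powr_def mult_less_0_iff)
 then have uv: "0 < u" "0 < v" "u < 1" "v < 1"
 using q pos by (simp_all add: u_def v_def)
 have sh: "q powr (s + real k) = q powr s * q ^ k" "q powr (- s - real k) = 1 / (q powr s * q ^ k)" for s k
 using q by (simp_all add: powr_add powr_realpow powr_diff powr_minus_divide)
 have prm: "a = of_real (u * q ^ \<alpha>)" "b = of_real (- (v * q ^ \<beta>))" "c = of_real (- v)" "d = of_real u"
 unfolding a b c d sh u_def v_def by simp_all
 have qk: "0 < q ^ k" "q ^ k <= 1" for k using q by (auto intro: power_le_one)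
 have q\<beta>: "q ^ \<beta> < 1" using q pos by (simp add: power_less_one_iff)
 have lt: "x * q ^ k < 1" if "0 < x" "x < 1" for x k using that qk[of k] mult_left_le[of "q ^ k" x] by linarith
 have q0: "complex_of_real q ~= 0" using q by simp
 have pw: "\<exists>k::int. complex_of_real (q ^ n) = complex_of_real q powi k" for n
 by (rule exI[of _ "int n"]) simp
 have sqs: "a^2 = of_real (q ^ (l1 + 2*\<alpha>))" "b^2 = of_real (q ^ (l2 + 2*\<beta>))" "c^2 = of_real (q ^ l2)" "d^2 = of_real (q ^ l1)"
 unfolding prm by (simp_all add: u2[symmetric] v2[symmetric] sqr_eq power_add power_mult power_mult_distrib flip: of_real_mult of_real_power)
 have Pq: "a*b*c*d = of_real (q ^ (l1 + \<alpha> + l2 + \<beta>))"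
 proof -
 have "(u * q ^ \<alpha>) * (- (v * q ^ \<beta>)) * (- v) * u = (u * u) * q ^ \<alpha> * (v * v) * q ^ \<beta>" by simp
 also have "... = q ^ (l1 + \<alpha> + l2 + \<beta>)" unfolding u2 v2 by (simp add: power_add)
 finally have r: "(u * q ^ \<alpha>) * (- (v * q ^ \<beta>)) * (- v) * u = q ^ (l1 + \<alpha> + l2 + \<beta>)" .
 have "a*b*c*d = of_real ((u * q ^ \<alpha>) * (- (v * q ^ \<beta>)) * (- v) * u)" unfolding prm by simp
 then show ?thesis unfolding r .
 qed
 note qp0 = qp_real_nonzero[OF q]
 \<comment> \<open>\<open>a\<close>, \<open>d\<close> are positive and \<open>b\<close>,
   \<open>c\<close> negative, so products and quotients that mix the two pairs have negative
   arguments and cannot meet a zero of \<open>qp\<close>. The remaining arguments are positive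
   products of numbers below \<open>1\<close>.\<close>
 interpret aw_half "complex_of_real q" a b c d
 proof (unfold_locales)
 show "complex_of_real q ~= 0" by (rule q0)
 show "cmod (complex_of_real q) < 1" using q by simp
 show "a ~= 0" "b ~= 0" "c ~= 0" "d ~= 0" unfolding prm using uv q by simp_all
 have e: "c*d = of_real (- (v * u))" "b*d = of_real (- (v * q ^ \<beta> * u))" "b*c = of_real (v * (v * q ^ \<beta>))" "c*d/of_real q = of_real (- (v * u / q))"
 "b* of_real q/a = of_real (- (v * q ^ \<beta> * q / (u * q ^ \<alpha>)))" "b* of_real q/c = of_real (v * q ^ \<beta> * q / v)" "b* of_real q/d = of_real (- (v * q ^ \<beta> * q / u))"
 "b^2* of_real q = of_real ((v * q ^ \<beta>) * (v * q ^ \<beta>) * q)" "a*b = of_real (- (u * q ^ \<alpha> * (v * q ^ \<beta>)))"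
 unfolding prm by (simp_all add: sqr_eq)
 have vq: "0 < v * q ^ \<beta>" "v * q ^ \<beta> < 1" "0 < u * q ^ \<alpha>" "u * q ^ \<alpha> < 1" using uv q lt by simp_all
 have m1: "x * y < 1" if "0 < x" "x < 1" "0 < y" "y < 1" for x y :: real
 using that mult_strict_mono[of x 1 y 1] by simp
 have pos': "0 < v * u" "0 < v * q ^ \<beta> * u" "0 < v * u / q" "0 < v * q ^ \<beta> * q / (u * q ^ \<alpha>)" "0 < v * q ^ \<beta> * q / u" "0 < u * q ^ \<alpha> * (v * q ^ \<beta>)"
 using uv q by simp_all
 have ng: "qp (of_real q) (of_real (- x)) ~= 0" if "0 < x" for x :: real by (rule qp0) (use that in simp)
 show "qp (of_real q) (c*d) ~= 0" unfolding e(1) by (rule ng[OF pos'(1)])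
 show "qp (of_real q) (b*d) ~= 0" unfolding e(2) by (rule ng[OF pos'(2)])
 show "qp (of_real q) (c*d/of_real q) ~= 0" unfolding e(4) by (rule ng[OF pos'(3)])
 show "qp (of_real q) (b* of_real q/a) ~= 0" unfolding e(5) by (rule ng[OF pos'(4)])
 show "qp (of_real q) (b* of_real q/d) ~= 0" unfolding e(7) by (rule ng[OF pos'(5)])
 show "qp (of_real q) (a*b) ~= 0" unfolding e(9) by (rule ng[OF pos'(6)])
 show "qp (of_real q) (b*c) ~= 0" unfolding e by (rule qp0, rule m1) (use uv vq in auto)
 have "v * q ^ \<beta> * q / v = q ^ \<beta> * q" using uv by simp
 then show "qp (of_real q) (b* of_real q/c) ~= 0" unfolding e by (intro qp0) (use m1[of "q ^ \<beta>" q] q\<beta> qk q in simp)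
 show "qp (of_real q) (b^2* of_real q) ~= 0" unfolding e by (rule qp0) (intro m1 mult_pos_pos vq q)
 show "b^2 ~= 1"
 proof -
 have "b^2 = of_real ((v * q ^ \<beta>) * (v * q ^ \<beta>))" unfolding prm by (simp add: sqr_eq)
 moreover have "(v * q ^ \<beta>) * (v * q ^ \<beta>) < 1" by (intro m1 vq)
 ultimately show ?thesis by (metis less_irrefl of_real_eq_1_iff)
 qed
 show "cmod (a*b) < 1" unfolding e norm_of_real using m1[OF vq(3,4,1,2)] pos'(6) by simp
 show "\<exists>k::int. a^2 = of_real q powi k" "\<exists>k::int. b^2 = of_real q powi k" "\<exists>k::int. c^2 = of_real q powi k" "\<exists>k::int. d^2 = of_real q powi k"
 "\<exists>k::int. a*b*c*d = of_real q powi k" unfolding sqs Pq by (rule pw)+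
 qed
 \<comment> \<open>The hypothesis on \<open>\<epsilon>\<close> is non-resonance of
   \<open>q powr \<epsilon>\<close>, whose square is \<open>q powr (2 * \<epsilon>)\<close>.\<close>
 interpret aw_lattice "complex_of_real q" a b c d \<epsilon> q
 proof (unfold_locales)
 have "(complex_of_real q powr \<epsilon>)^2 ~= of_real q powi k" for k using \<epsilon> unfolding powr_shift(3)[OF q0] by blast
 then show "nonres (complex_of_real q powr \<epsilon>)" using q0 by (simp add: nonres_def)
 qed (use assms(1,2) in simp_all)
 have x: "(\<exists>k<\<alpha>. x = d * of_real q ^ k + 1 / (d * of_real q ^ k)) | (\<exists>k<\<beta>. x = c * of_real q ^ k + 1 / (c * of_real q ^ k))" if "x \<in> set xs" for x
 proof -
 from that X consider k where "k <= \<alpha> - 1" "x = complex_of_real (q powr (real l1 / 2 + real k) + q powr (- (real l1 / 2) - real k))"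
 | k where "k <= \<beta> - 1" "x = complex_of_real (- (q powr (real l2 / 2 + real k) + q powr (- (real l2 / 2) - real k)))"
 unfolding J K by blast
 then show ?thesis
 proof cases
 case (1 k)
 have "x = d * of_real q ^ k + 1 / (d * of_real q ^ k)" unfolding 1(2) prm sh u_def[symmetric] by simp
 with 1(1) pos show ?thesis by (intro disjI1 exI[of _ k]) simp
 next
 case (2 k)
 have "x = c * of_real q ^ k + 1 / (c * of_real q ^ k)" unfolding 2(2) prm sh v_def[symmetric] by simp
 with 2(1) pos show ?thesis by (intro disjI2 exI[of _ k]) simp
 qed
 qed
 \<comment> \<open>\<open>l1 + \<alpha>\<close> and \<open>l2 + \<beta>\<close> are the exponents
   \<open>m\<close> and \<open>m'\<close>; positivity of \<open>l1\<close> and \<open>l2\<close> is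
   what makes them exceed \<open>\<alpha>\<close> and \<open>\<beta>\<close>.\<close>
 have r1: "u * q ^ \<alpha> * u = q ^ (l1 + \<alpha>)" "v * q ^ \<beta> * v = q ^ (l2 + \<beta>)"
 unfolding power_add u2[symmetric] v2[symmetric] by (simp_all only: mult_ac)
 have "a * d = of_real (u * q ^ \<alpha> * u)" "b * c = of_real (v * q ^ \<beta> * v)" unfolding prm by simp_all
 then have r2: "a * d = of_real q ^ (l1 + \<alpha>)" "b * c = of_real q ^ (l2 + \<beta>)" unfolding r1 by simp_all
 have r3: "a = d * of_real q ^ \<alpha>" "b = c * of_real q ^ \<beta>" unfolding prm by simp_all
 have r4: "\<alpha> < l1 + \<alpha>" "\<beta> < l2 + \<beta>" using pos by simp_all
 obtain Z \<Lambda> where Z: "zrel (of_real q) Z (%j n z. \<Q> (%k. PP j k z) n) (%j n z. \<Lambda> n * \<Q> (%k. PP j k z) n)" and \<Lambda>: "EX n n'. \<Lambda> n ~= \<Lambda> n'"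
 using chain_bispectral_AW[OF Lhat X(3) r3(1) r2(1) r4(1) r3(2) r2(2) r4(2) x] by blast
 have \<Psi>: "\<Psi>hat c1 c2 n z = c1 * \<Q> (%k. PP True k z) n + c2 * \<Q> (%k. PP False k z) n" for c1 c2 n z
 unfolding \<Psi>hat PP_def if_True if_False by (rule chain_lincomb[OF Lhat])
 show ?thesis
 proof (intro exI[of _ Z] exI[of _ \<Lambda>] conjI allI impI)
 show "qdiff_operator Z" using Z by (simp add: zrel_def)
 show "EX n n'. \<Lambda> n ~= \<Lambda> n'" by (rule \<Lambda>)
 show "c1 = 0" "c2 = 0" if t: "ALL n z. regular_point q a b c d \<epsilon> z --> \<Psi>hat c1 c2 n z = 0" for c1 c2
 proof -
 have "c1 = 0 & c2 = 0" by (rule bispectral_independent[OF Lhat]) (use t[unfolded \<Psi>] in blast)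
 then show "c1 = 0" "c2 = 0" by blast+
 qed
 show "Lhat (%k. \<Psi>hat c1 c2 k z) n = (z + 1 / z) * \<Psi>hat c1 c2 n z" if z: "regular_point q a b c d \<epsilon> z" for c1 c2 n z
 proof -
 define h where "h k = c1 * PP True k z + c2 * PP False k z" for k
 have "AW_op q a b c d \<epsilon> h n = c1 * AW_op q a b c d \<epsilon> (%n. PP True n z) n + c2 * AW_op q a b c d \<epsilon> (%n. PP False n z) n" for n
 unfolding AW_op_eq h_def by (simp add: algebra_simps)
 then have L: "AW_op q a b c d \<epsilon> h n = (z + 1/z) * h n" for n
 unfolding PP_eigen[OF z] h_def by (simp add: algebra_simps)
 have e: "\<Psi>hat c1 c2 k z = \<Q> h k" for k unfolding \<Psi>hat h_def[abs_def] PP_def if_True if_False ..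
 have "Lhat (\<Q> h) n = (z + 1/z) * \<Q> h n" by (rule chain_intertwines[OF Lhat L])
 then show ?thesis unfolding e .
 qed
 show "qdiff_apply q Z (\<Psi>hat c1 c2 n) z = \<Lambda> n * \<Psi>hat c1 c2 n z"
 if z: "regular_point q a b c d \<epsilon> z & (\<forall>i\<in>qdiff_supp Z. regular_point q a b c d \<epsilon> (of_real q powi i * z) & Z i analytic_on {z})" for c1 c2 n z
 proof -
 have e: "qdiff_apply q Z (%z. \<Q> (%k. PP j k z) n) z = \<Lambda> n * \<Q> (%k. PP j k z) n" for j
 by (rule bispectral_at_regular[OF Lhat Z]) (use z in blast)+
 have "qdiff_apply q Z (\<Psi>hat c1 c2 n) z = c1 * qdiff_apply q Z (%z. \<Q> (%k. PP True k z) n) z + c2 * qdiff_apply q Z (%z. \<Q> (%k. PP False k z) n) z"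
 unfolding qdiff_apply_def \<Psi> by (simp add: distrib_left sum.distrib sum_distrib_left mult.left_commute)
 then show ?thesis unfolding e \<Psi> by (simp add: algebra_simps)
 qed
 qed
qed

end
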